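(* ($E$-expansion formulas) Let $\lambda\in\mathbb Z^n$ with $\lambda_1\ge\cdots\ge\lambda_n\ge0$. Then \begin{align*} P_\lambda&=\sum_{\mu\in W_{\mathrm{fin}}\lambda}\mathrm{ev}^t_\mu(\kappa^+_{v_\mu})E_\mu, & A^\pm_{\lambda+\omega}&=\sum_{\mu\in W_{\mathrm{fin}}(\lambda+\omega)}(-1)^{\ell_d(v_\mu)}\mathrm{ev}^t_\mu(\kappa^\pm_{v_\mu})E_\mu,\\ A_{\lambda+\rho}&=\sum_{\mu\in W_{\mathrm{fin}}(\lambda+\rho)}(-1)^{\ell(v_\mu)}\mathrm{ev}^t_\mu(\kappa^-_{v_\mu})E_\mu, & A^\mp_{\lambda+\pi}&=\sum_{\mu\in W_{\mathrm{fin}}(\lambda+\pi)}(-1)^{\ell_s(v_\mu)}\mathrm{ev}^t_\mu(\kappa^\mp_{v_\mu})E_\mu, \end{align*} where the sums are over $W_{\mathrm{fin}}$-orbits in $\mathbb Z^n$.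
   Context: Let $n\ge1$, $\mathbb K=\mathbb C(q^{1/2},t^{1/2},t_0^{1/2},u_0^{1/2},t_n^{1/2},u_n^{1/2})$ (independent parameters), $\mathbb K[x]=\mathbb K[x_1^{\pm1},\dots,x_n^{\pm1}]$, $x^\mu=x_1^{\mu_1}\cdots x_n^{\mu_n}$, $\rho=(n,n-1,\dots,1)$, $\omega=(1,\dots,1)$, $\pi=(n-1,\dots,1,0)$. $W_{\mathrm{fin}}$ is the group of signed permutations acting on $\mathbb Z^n$, generated by $s_i$ ($i<n$, swapping entries $i,i+1$) and $s_n$ (negating the last entry); it acts on $\mathbb K[x]$ by $wx^\mu=x^{w\mu}$. For $w\in W_{\mathrm{fin}}$, $w(j)\in\{\pm1,\dots,\pm n\}$ is defined by $w\varepsilon_j^\vee=\varepsilon_{w(j)}^\vee$, where $\varepsilon_j^\vee$ is the $j$th unit vector and $\varepsilon_{-k}^\vee=-\varepsilon_k^\vee$. $w_0$ is the longest element; $\ell_s(w)$, $\ell_d(w)$ are the numbers of factors $s_i$ ($i<n$), resp. $s_n$, in a reduced word of $w$, and $\ell=\ell_s+\ell_d$. **Operators on $\mathbb K[x]$.** $(\xi_{s_0}f)(x)=f(qx_1^{-1},x_2,\dots,x_n)$, and $\xi_{s_i}=s_i$ for $1\le i\le n$. Define $T_0,\dots,T_n$ by $$t_0^{1/2}T_0=t_0-\frac{(x_1+q^{1/2}t_0^{1/2}u_0^{-1/2})(x_1-q^{1/2}t_0^{1/2}u_0^{1/2})}{x_1^2-q}(1-\xi_{s_0}),$$ $$t_n^{1/2}T_n=t_n-\frac{(1+t_n^{1/2}u_n^{-1/2}x_n)(1-t_n^{1/2}u_n^{1/2}x_n)}{1-x_n^2}(1-\xi_{s_n}),\qquad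 t^{1/2}T_i=t-\frac{x_{i+1}-tx_i}{x_{i+1}-x_i}(1-\xi_{s_i})\ (1\le i<n),$$ and $Y_j=T_{j-1}^{-1}\cdots T_1^{-1}T_0T_1\cdots T_{n-1}T_nT_{n-1}\cdots T_j$ for $1\le j\le n$. $T_w=T_{i_1}\cdots T_{i_k}$ for a reduced word $w=s_{i_1}\cdots s_{i_k}$ in $W_{\mathrm{fin}}$. **Electronic polynomials and evaluations.** For $\mu\in\mathbb Z^n$ let $v_\mu\in W_{\mathrm{fin}}$ be the minimal length element such that $v_\mu\mu$ is weakly increasing with all entries $\le0$. Let $\mathrm{ev}^t_\mu$ be the evaluation homomorphism $\mathrm{ev}^t_\mu(Y_j)=q^{-\mu_j}t^{-v_\mu(j)}(t_0^{1/2}t_n^{1/2}t^n)^{\mathrm{sgn}(v_\mu(j))}\in\mathbb K$, extended to rational functions in the commuting variables $Y_1,\dots,Y_n$ with nonzero evaluated denominator. $E_\mu\in\mathbb K[x]$ is the unique Laurent polynomial with coefficient of $x^\mu$ equal to $1$ and $Y_jE_\mu=\mathrm{ev}^t_\mu(Y_j)E_\mu$ for $1\le j\le n$. **Symmetrized polynomials.** Multiplicative characters: for $i<n$, $\chi^+(T_i)=\chi^\pm(T_i)=t^{1/2}$, $\chi^\mp(T_i)=\chi^-(T_i)=-t^{-1/2}$; $\chi^+(T_n)=\chi^\mp(T_n)=t_n^{1/2}$, $\chi^\pm(T_n)=\chi^-(T_n)=-t_n^{-1/2}$. Put $\varepsilon_\Xi=\frac1{\chi^\Xi(T_{w_0})}\sum_{w\in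 W_{\mathrm{fin}}}\chi^\Xi(T_w)T_w$ for $\Xi\in\{+,\pm,\mp,-\}$. For $\nu\in\mathbb Z^n$ with $\nu_1\ge\cdots\ge\nu_n\ge0$ let $W_\nu$ be its stabilizer in $W_{\mathrm{fin}}$ and $W_\nu(t,t_n)=\sum_{w\in W_\nu}t^{\ell_s(w)}t_n^{\ell_d(w)}$. Then $$P_\lambda=\tfrac{\chi^+(T_{w_0})}{W_\lambda(t,t_n)}\varepsilon_+E_\lambda,\quad A_{\lambda+\rho}=\tfrac{\chi^+(T_{w_0})}{W_{\lambda+\rho}(t,t_n)}\varepsilon_-E_{\lambda+\rho},\quad A^\pm_{\lambda+\omega}=\tfrac{\chi^+(T_{w_0})}{W_{\lambda+\omega}(t,t_n)}\varepsilon_\pm E_{\lambda+\omega},\quad A^\mp_{\lambda+\pi}=\tfrac{\chi^+(T_{w_0})}{W_{\lambda+\pi}(t,t_n)}\varepsilon_\mp E_{\lambda+\pi}.$$ **$\kappa$-functions.** For $w\in W_{\mathrm{fin}}$, $\mathrm{Inv}(w)$ is the set of $\beta\in\{\varepsilon_i^\vee\}\cup\{\varepsilon_i^\vee\pm\varepsilon_j^\vee\mid i<j\}$ such that $-w\beta$ also lies in this set; $\mathrm{Inv}_d(w)=\mathrm{Inv}(w)\cap\{\varepsilon_i^\vee\}$ and $\mathrm{Inv}_s(w)=\mathrm{Inv}(w)\cap\{\varepsilon_i^\vee\pm\varepsilon_j^\vee\}$. With $Y^{\varepsilon_i^\vee}=Y_i$ set $$\kappa^Y_{\varepsilon_i^\vee}=\frac{(1-t_n^{1/2}t_0^{1/2}Y_i)(1+t_n^{1/2}t_0^{-1/2}Y_i)}{1-Y_i^2},\qquad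 \kappa^Y_\beta=\frac{1-tY^\beta}{1-Y^\beta}\ \text{ for }\beta=\varepsilon_i^\vee\pm\varepsilon_j^\vee,$$ let $\kappa^{Y^{-1}}_\beta$ be obtained by replacing all $Y_i$ by $Y_i^{-1}$, and \begin{align*} \kappa^+_w&=\prod_{\mathrm{Inv}_s(w)}\kappa^Y_\beta\prod_{\mathrm{Inv}_d(w)}\kappa^Y_\beta, & \kappa^\pm_w&=\prod_{\mathrm{Inv}_s(w)}\kappa^Y_\beta\prod_{\mathrm{Inv}_d(w)}\kappa^{Y^{-1}}_\beta,\\ \kappa^-_w&=\prod_{\mathrm{Inv}_s(w)}\kappa^{Y^{-1}}_\beta\prod_{\mathrm{Inv}_d(w)}\kappa^{Y^{-1}}_\beta, & \kappa^\mp_w&=\prod_{\mathrm{Inv}_s(w)}\kappa^{Y^{-1}}_\beta\prod_{\mathrm{Inv}_d(w)}\kappa^{Y}_\beta. \end{align*} *)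

theory Defs
  imports Complex_Main
    "HOL-Library.Poly_Mapping"
    "HOL-Library.Numeral_Type"
    "HOL-Computational_Algebra.Fraction_Field"
begin

section \<open>Coefficient field and Laurent polynomials\<close>

text \<open>The rational function field over the complex numbers in six independent variables, namely
  the square roots of the parameters. A monomial in the six variables is an element of
  \<open>6 \<Rightarrow>\<^sub>0 nat\<close>.\<close>

type_synonym coeff = "((6 \<Rightarrow>\<^sub>0 nat) \<Rightarrow>\<^sub>0 complex) fract"

definition generator :: "6 \<Rightarrow> coeff" where
  "generator p = Fract (Poly_Mapping.single (Poly_Mapping.single p 1) 1) 1"

definition q_half :: coeff where "q_half = generator 0"
definition t_half :: coeff where "t_half = generator 1"
definition t0_half :: coeff where "t0_half = generator 2"
definition u0_half :: coeff where "u0_half = generator 3"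
definition tn_half :: coeff where "tn_half = generator 4"
definition un_half :: coeff where "un_half = generator 5"

abbreviation q_par :: coeff where "q_par \<equiv> q_half ^ 2"
abbreviation t_par :: coeff where "t_par \<equiv> t_half ^ 2"
abbreviation t0_par :: coeff where "t0_par \<equiv> t0_half ^ 2"
abbreviation tn_par :: coeff where "tn_par \<equiv> tn_half ^ 2"

text \<open>Exponent vectors are finitely supported functions on all of \<open>nat\<close>; the lattice of
  rank \<open>n\<close> consists of those supported in \<open>{1..n}\<close>. Accordingly \<open>laurent\<close> has variables
  indexed by \<open>nat\<close>, and \<open>laurent_ring n\<close> is the Laurent polynomial ring in
  \<open>x\<^sub>1, \<dots>, x\<^sub>n\<close>.\<close>

type_synonym vec = "nat \<Rightarrow>\<^sub>0 int"
type_synonym laurent = "vec \<Rightarrow>\<^sub>0 coeff"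

definition lattice :: "nat \<Rightarrow> vec set" where
  "lattice n = {\<mu>. Poly_Mapping.keys \<mu> \<subseteq> {1..n}}"

definition laurent_ring :: "nat \<Rightarrow> laurent set" where
  "laurent_ring n = {f. Poly_Mapping.keys f \<subseteq> lattice n}"

definition cst :: "coeff \<Rightarrow> laurent" where
  "cst c = Poly_Mapping.single 0 c"

definition var :: "nat \<Rightarrow> laurent" where
  "var i = Poly_Mapping.single (Poly_Mapping.single i 1) 1"

definition rho :: "nat \<Rightarrow> vec" where
  "rho n = (\<Sum>i\<in>{1..n}. Poly_Mapping.single i (int n - int i + 1))"

definition omega :: "nat \<Rightarrow> vec" where
  "omega n = (\<Sum>i\<in>{1..n}. Poly_Mapping.single i 1)"

definition pi_vec :: "nat \<Rightarrow> vec" where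
  "pi_vec n = (\<Sum>i\<in>{1..n}. Poly_Mapping.single i (int n - int i))"

section \<open>The finite Weyl group\<close>

definition simple_refl :: "nat \<Rightarrow> nat \<Rightarrow> vec \<Rightarrow> vec" where
  "simple_refl n i \<mu> =
     (if i < n
      then Poly_Mapping.update i (Poly_Mapping.lookup \<mu> (Suc i))
             (Poly_Mapping.update (Suc i) (Poly_Mapping.lookup \<mu> i) \<mu>)
      else Poly_Mapping.update n (- Poly_Mapping.lookup \<mu> n) \<mu>)"

definition word_prod :: "nat \<Rightarrow> nat list \<Rightarrow> vec \<Rightarrow> vec" where
  "word_prod n is = foldr (\<lambda>i w. simple_refl n i \<circ> w) is id"

text \<open>The generators are involutions, so the group they generate is the set of products of
  generators.\<close>

definition W_fin :: "nat \<Rightarrow> (vec \<Rightarrow> vec) set" where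
  "W_fin n = {word_prod n is | is. set is \<subseteq> {1..n}}"

definition is_reduced_word :: "nat \<Rightarrow> (vec \<Rightarrow> vec) \<Rightarrow> nat list \<Rightarrow> bool" where
  "is_reduced_word n w is \<longleftrightarrow>
     set is \<subseteq> {1..n} \<and> word_prod n is = w \<and>
     (\<forall>js. set js \<subseteq> {1..n} \<and> word_prod n js = w \<longrightarrow> length is \<le> length js)"

text \<open>An arbitrary but fixed reduced word. Everything defined from it below is independent of the
  choice, because reduced words of the same element are related by braid moves.\<close>

definition reduced_word :: "nat \<Rightarrow> (vec \<Rightarrow> vec) \<Rightarrow> nat list" where
  "reduced_word n w = (SOME is. is_reduced_word n w is)"

definition len :: "nat \<Rightarrow> (vec \<Rightarrow> vec) \<Rightarrow> nat" where
  "len n w = length (reduced_word n w)"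

definition len_s :: "nat \<Rightarrow> (vec \<Rightarrow> vec) \<Rightarrow> nat" where
  "len_s n w = length (filter (\<lambda>i. i < n) (reduced_word n w))"

definition len_d :: "nat \<Rightarrow> (vec \<Rightarrow> vec) \<Rightarrow> nat" where
  "len_d n w = length (filter (\<lambda>i. i = n) (reduced_word n w))"

definition longest :: "nat \<Rightarrow> vec \<Rightarrow> vec" where
  "longest n = (THE w. w \<in> W_fin n \<and> (\<forall>v\<in>W_fin n. len n v \<le> len n w))"

text \<open>Unit vectors with signed indices: \<open>eps (- k) = - eps k\<close>.\<close>

definition eps :: "int \<Rightarrow> vec" where
  "eps k = Poly_Mapping.single (nat \<bar>k\<bar>) (sgn k)"

definition signed_image :: "nat \<Rightarrow> (vec \<Rightarrow> vec) \<Rightarrow> nat \<Rightarrow> int" where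
  "signed_image n w j = (THE k. k \<noteq> 0 \<and> \<bar>k\<bar> \<le> int n \<and> w (eps (int j)) = eps k)"

definition antidominant :: "nat \<Rightarrow> vec \<Rightarrow> bool" where
  "antidominant n \<mu> \<longleftrightarrow>
     (\<forall>i\<in>{1..n}. \<forall>j\<in>{1..n}. i \<le> j \<longrightarrow> Poly_Mapping.lookup \<mu> i \<le> Poly_Mapping.lookup \<mu> j) \<and>
     (\<forall>i\<in>{1..n}. Poly_Mapping.lookup \<mu> i \<le> 0)"

definition v_min :: "nat \<Rightarrow> vec \<Rightarrow> vec \<Rightarrow> vec" where
  "v_min n \<mu> = (THE v. v \<in> W_fin n \<and> antidominant n (v \<mu>) \<and>
     (\<forall>u\<in>W_fin n. antidominant n (u \<mu>) \<longrightarrow> len n v \<le> len n u))"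

definition orbit :: "nat \<Rightarrow> vec \<Rightarrow> vec set" where
  "orbit n \<mu> = (\<lambda>w. w \<mu>) ` W_fin n"

definition dominant :: "nat \<Rightarrow> vec \<Rightarrow> bool" where
  "dominant n \<mu> \<longleftrightarrow>
     (\<forall>i\<in>{1..n}. \<forall>j\<in>{1..n}. i \<le> j \<longrightarrow> Poly_Mapping.lookup \<mu> j \<le> Poly_Mapping.lookup \<mu> i) \<and>
     (\<forall>i\<in>{1..n}. 0 \<le> Poly_Mapping.lookup \<mu> i)"

section \<open>Operators on Laurent polynomials\<close>

definition xi :: "nat \<Rightarrow> nat \<Rightarrow> laurent \<Rightarrow> laurent" where
  "xi n i f =
     (if i = 0
      then (\<Sum>\<nu>\<in>Poly_Mapping.keys f.
              Poly_Mapping.single (Poly_Mapping.update 1 (- Poly_Mapping.lookup \<nu> 1) \<nu>)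
                (q_par powi Poly_Mapping.lookup \<nu> 1 * Poly_Mapping.lookup f \<nu>))
      else (\<Sum>\<nu>\<in>Poly_Mapping.keys f.
              Poly_Mapping.single (simple_refl n i \<nu>) (Poly_Mapping.lookup f \<nu>)))"

text \<open>Exact division in the integral domain of Laurent polynomials. In \<open>T_op\<close> the divisor divides
  \<open>f - xi n i f\<close>.\<close>

definition exact_quot :: "laurent \<Rightarrow> laurent \<Rightarrow> laurent" where
  "exact_quot a b = (THE c. c * b = a)"

definition T_op :: "nat \<Rightarrow> nat \<Rightarrow> laurent \<Rightarrow> laurent" where
  "T_op n i f =
     (if i = 0 then
        cst (inverse t0_half) *
          (cst t0_par * f -
           exact_quot
             ((var 1 + cst (q_half * t0_half * inverse u0_half)) *
              (var 1 - cst (q_half * t0_half * u0_half)) * (f - xi n 0 f))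
             (var 1 ^ 2 - cst q_par))
      else if i = n then
        cst (inverse tn_half) *
          (cst tn_par * f -
           exact_quot
             ((1 + cst (tn_half * inverse un_half) * var n) *
              (1 - cst (tn_half * un_half) * var n) * (f - xi n n f))
             (1 - var n ^ 2))
      else
        cst (inverse t_half) *
          (cst t_par * f -
           exact_quot
             ((var (Suc i) - cst t_par * var i) * (f - xi n i f))
             (var (Suc i) - var i)))"

definition T_word :: "nat \<Rightarrow> nat list \<Rightarrow> laurent \<Rightarrow> laurent" where
  "T_word n is = foldr (\<lambda>i g. T_op n i \<circ> g) is id"

definition Y_op :: "nat \<Rightarrow> nat \<Rightarrow> laurent \<Rightarrow> laurent" where
  "Y_op n j =
     foldr (\<lambda>i g. inv (T_op n i) \<circ> g) (rev [1..<j]) id \<circ>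
     T_word n ([0..<n] @ [n] @ rev [j..<n])"

definition T_w :: "nat \<Rightarrow> (vec \<Rightarrow> vec) \<Rightarrow> laurent \<Rightarrow> laurent" where
  "T_w n w = T_word n (reduced_word n w)"

section \<open>Evaluations and electronic polynomials\<close>

definition ev_Y :: "nat \<Rightarrow> vec \<Rightarrow> nat \<Rightarrow> coeff" where
  "ev_Y n \<mu> j =
     (let k = signed_image n (v_min n \<mu>) j in
      q_par powi (- Poly_Mapping.lookup \<mu> j) * t_par powi (- k) *
      (t0_half * tn_half * t_par ^ n) powi (sgn k))"

text \<open>The type \<open>laurent\<close> is reused for Laurent polynomials in the commuting variables
  \<open>Y\<^sub>1, \<dots>, Y\<^sub>n\<close>, and \<open>laurent fract\<close> for rational functions in them.\<close>

definition ev_laurent :: "nat \<Rightarrow> vec \<Rightarrow> laurent \<Rightarrow> coeff" where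
  "ev_laurent n \<mu> p =
     (\<Sum>\<nu>\<in>Poly_Mapping.keys p. Poly_Mapping.lookup p \<nu> *
        (\<Prod>j\<in>{1..n}. ev_Y n \<mu> j powi Poly_Mapping.lookup \<nu> j))"

text \<open>Extension to the fractions that have a representation with nonzero evaluated
  denominator; the value does not depend on that representation.\<close>

definition ev :: "nat \<Rightarrow> vec \<Rightarrow> laurent fract \<Rightarrow> coeff" where
  "ev n \<mu> r = (THE c. \<exists>a b. r = Fract a b \<and> ev_laurent n \<mu> b \<noteq> 0 \<and>
     c = ev_laurent n \<mu> a / ev_laurent n \<mu> b)"

definition E_poly :: "nat \<Rightarrow> vec \<Rightarrow> laurent" where
  "E_poly n \<mu> = (THE f. f \<in> laurent_ring n \<and> Poly_Mapping.lookup f \<mu> = 1 \<and>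
     (\<forall>j\<in>{1..n}. Y_op n j f = cst (ev_Y n \<mu> j) * f))"

section \<open>Symmetrized polynomials\<close>

text \<open>The four characters \<open>+\<close>, \<open>\<plusminus>\<close>, \<open>\<mp>\<close>, \<open>-\<close>; the first sign concerns
  the generators \<open>T\<^sub>i\<close> with \<open>i < n\<close>, the second one \<open>T\<^sub>n\<close>.\<close>

datatype symm_type = Plus | PlusMinus | MinusPlus | Minus

fun chi_s :: "symm_type \<Rightarrow> coeff" where
  "chi_s Plus = t_half"
| "chi_s PlusMinus = t_half"
| "chi_s MinusPlus = - inverse t_half"
| "chi_s Minus = - inverse t_half"

fun chi_d :: "symm_type \<Rightarrow> coeff" where
  "chi_d Plus = tn_half"
| "chi_d MinusPlus = tn_half"
| "chi_d PlusMinus = - inverse tn_half"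
| "chi_d Minus = - inverse tn_half"

definition chi :: "symm_type \<Rightarrow> nat \<Rightarrow> (vec \<Rightarrow> vec) \<Rightarrow> coeff" where
  "chi X n w = prod_list (map (\<lambda>i. if i < n then chi_s X else chi_d X) (reduced_word n w))"

definition symmetrizer :: "symm_type \<Rightarrow> nat \<Rightarrow> laurent \<Rightarrow> laurent" where
  "symmetrizer X n f =
     cst (1 / chi X n (longest n)) * (\<Sum>w\<in>W_fin n. cst (chi X n w) * T_w n w f)"

definition stabilizer :: "nat \<Rightarrow> vec \<Rightarrow> (vec \<Rightarrow> vec) set" where
  "stabilizer n \<nu> = {w \<in> W_fin n. w \<nu> = \<nu>}"

definition poincare :: "nat \<Rightarrow> vec \<Rightarrow> coeff" where
  "poincare n \<nu> = (\<Sum>w\<in>stabilizer n \<nu>. t_par ^ len_s n w * tn_par ^ len_d n w)"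

text \<open>The character in the normalizing factor is the trivial one \<open>chi Plus\<close> in all four
  cases.\<close>

definition symm_E :: "symm_type \<Rightarrow> nat \<Rightarrow> vec \<Rightarrow> laurent" where
  "symm_E X n \<nu> = cst (chi Plus n (longest n) / poincare n \<nu>) * symmetrizer X n (E_poly n \<nu>)"

definition P_poly :: "nat \<Rightarrow> vec \<Rightarrow> laurent" where
  "P_poly n \<nu> = symm_E Plus n \<nu>"

definition A_poly :: "nat \<Rightarrow> vec \<Rightarrow> laurent" where
  "A_poly n \<nu> = symm_E Minus n \<nu>"

definition A_pm_poly :: "nat \<Rightarrow> vec \<Rightarrow> laurent" where
  "A_pm_poly n \<nu> = symm_E PlusMinus n \<nu>"

definition A_mp_poly :: "nat \<Rightarrow> vec \<Rightarrow> laurent" where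
  "A_mp_poly n \<nu> = symm_E MinusPlus n \<nu>"

section \<open>Kappa functions\<close>

definition roots_d :: "nat \<Rightarrow> vec set" where
  "roots_d n = {eps (int i) | i. 1 \<le> i \<and> i \<le> n}"

definition roots_s :: "nat \<Rightarrow> vec set" where
  "roots_s n = {eps (int i) + eps (int j) | i j. 1 \<le> i \<and> i < j \<and> j \<le> n} \<union>
               {eps (int i) - eps (int j) | i j. 1 \<le> i \<and> i < j \<and> j \<le> n}"

definition Inv :: "nat \<Rightarrow> (vec \<Rightarrow> vec) \<Rightarrow> vec set" where
  "Inv n w = {\<beta> \<in> roots_d n \<union> roots_s n. - w \<beta> \<in> roots_d n \<union> roots_s n}"

definition Inv_d :: "nat \<Rightarrow> (vec \<Rightarrow> vec) \<Rightarrow> vec set" where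
  "Inv_d n w = Inv n w \<inter> roots_d n"

definition Inv_s :: "nat \<Rightarrow> (vec \<Rightarrow> vec) \<Rightarrow> vec set" where
  "Inv_s n w = Inv n w \<inter> roots_s n"

definition Y_mon :: "vec \<Rightarrow> laurent fract" where
  "Y_mon \<beta> = Fract (Poly_Mapping.single \<beta> 1) 1"

definition cst_Y :: "coeff \<Rightarrow> laurent fract" where
  "cst_Y c = Fract (cst c) 1"

text \<open>The kappa functions of a root \<open>\<beta>\<close> as functions of \<open>y = Y\<^sup>\<beta>\<close>; inverting all
  variables \<open>Y\<^sub>i\<close> amounts to replacing \<open>y\<close> by its inverse.\<close>

definition kappa_root_d :: "laurent fract \<Rightarrow> laurent fract" where
  "kappa_root_d y =
     (1 - cst_Y (tn_half * t0_half) * y) * (1 + cst_Y (tn_half * inverse t0_half) * y) / (1 - y ^ 2)"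

definition kappa_root_s :: "laurent fract \<Rightarrow> laurent fract" where
  "kappa_root_s y = (1 - cst_Y t_par * y) / (1 - y)"

fun kappa :: "symm_type \<Rightarrow> nat \<Rightarrow> (vec \<Rightarrow> vec) \<Rightarrow> laurent fract" where
  "kappa Plus n w = (\<Prod>\<beta>\<in>Inv_s n w. kappa_root_s (Y_mon \<beta>)) *
                    (\<Prod>\<beta>\<in>Inv_d n w. kappa_root_d (Y_mon \<beta>))"
| "kappa PlusMinus n w = (\<Prod>\<beta>\<in>Inv_s n w. kappa_root_s (Y_mon \<beta>)) *
                         (\<Prod>\<beta>\<in>Inv_d n w. kappa_root_d (inverse (Y_mon \<beta>)))"
| "kappa Minus n w = (\<Prod>\<beta>\<in>Inv_s n w. kappa_root_s (inverse (Y_mon \<beta>))) *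
                     (\<Prod>\<beta>\<in>Inv_d n w. kappa_root_d (inverse (Y_mon \<beta>)))"
| "kappa MinusPlus n w = (\<Prod>\<beta>\<in>Inv_s n w. kappa_root_s (inverse (Y_mon \<beta>))) *
                         (\<Prod>\<beta>\<in>Inv_d n w. kappa_root_d (Y_mon \<beta>))"

end

theory Submission
  imports Defs "HOL-Library.Product_Lexorder" "HOL-Library.FuncSet"
begin

text \<open>
  The operators \<open>T\<^sub>i\<close> have the form \<open>f \<mapsto> \<tau> f - c (f - s f)\<close> over the field of rational functions, where
  the Hecke relations are rational identities in the coefficients \<open>c\<close>; hence the \<open>Y\<^sub>j\<close> commute and
  satisfy the cross relations with \<open>T\<^sub>i\<close>. With respect to an order on exponents that compares first
  the Euclidean norm and then lexicographically, twisted by a Weyl group element after each factor, every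
  \<open>T\<^sub>i\<close> and its inverse is triangular. So \<open>Y\<^sub>j\<close> is triangular with the eigenvalues \<open>ev_Y n \<mu> j\<close>, and these are
  pairwise distinct because their degree in \<open>q\<close> determines \<open>\<mu>\<close>. This makes the \<open>E_poly n \<mu>\<close> a basis and
  turns the cross relations into the two-term formula for \<open>T\<^sub>i E\<^sub>\<mu>\<close> in terms of \<open>E\<^sub>\<mu>\<close> and
  \<open>E\<^bsub>s\<^sub>i\<mu>\<^esub>\<close>.

  The symmetrizer satisfies \<open>T\<^sub>i \<epsilon> = \<chi>(T\<^sub>i) \<epsilon>\<close>, so the coefficients of a symmetrized \<open>E\<close> along an orbit
  obey a recursion \<open>c\<^sub>\<mu> = \<plusminus>\<kappa>(Y\<^sup>\<alpha>) c\<^bsub>s\<mu>\<^esub>\<close> towards the antidominant weight, one factor for each element of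
  \<open>Inv(v\<^sub>\<mu>) = {\<beta> > 0. \<langle>\<mu>, \<beta>\<rangle> > 0}\<close>. Modulo lower exponents, only \<open>T\<^sub>w\<close> with \<open>w\<close> in the coset
  \<open>v\<^sub>\<lambda> W\<^sub>\<lambda>\<close> contribute to the antidominant monomial, and the sum over the coset is the Poincare
  polynomial, which the normalization cancels.
\<close>

section \<open>Demazure--Lusztig operators on a field\<close>

text \<open>The delicate case is a weight fixed by a simple reflection. There the spectral vector is
  not permuted, the intertwiner yields no new eigenvector, and the two eigenvalues involved must be
  shown to differ although their degrees in q agree. This is done without computing them: if they
  coincided, T_i E would be a proper generalized eigenvector, which a basis of eigenvectors excludes
  as long as the parameters are independent. The exact quotient in the operators is a definite
  description. The Hecke relations are therefore proved in the field of fractions, where division is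
  ordinary, and pulled back along the injective embedding. The four characters are treated at once.
  The sum over the stabilizer of the weight gives the Poincare polynomial in t and t_n only if the
  character takes the trivial values on the positive roots orthogonal to the weight; the shifts by
  omega, rho and pi make all other roots nonorthogonal. The inverted Y and the signs in the formulas
  have one common source: the eigenvalue -1/tau of T_i in place of tau in the recursion.\<close>

definition endo :: "('f::field \<Rightarrow> 'f) \<Rightarrow> bool" where
  "endo s \<longleftrightarrow> s 1 = 1 \<and> (\<forall>a b. s (a + b) = s a + s b) \<and> (\<forall>a b. s (a * b) = s a * s b)"

lemma endoD:
  assumes "endo s"
  shows "s 1 = 1" "s (a + b) = s a + s b" "s (a * b) = s a * s b" "s 0 = 0" "s (- a) = - s a"
    "s (a - b) = s a - s b" "s (inverse a) = inverse (s a)" "s (a / b) = s a / s b"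
    "s (a ^ k) = s a ^ k"
proof -
  show 1: "s 1 = 1" and 2: "\<And>a b. s (a + b) = s a + s b" and 3: "\<And>a b. s (a * b) = s a * s b"
    using assms by (auto simp: endo_def)
  have "s 0 + s 0 = s 0 + 0" using 2[of 0 0] by simp
  then show 4: "s 0 = 0" by (metis add_left_cancel)
  show 5: "s (- a) = - s a" for a using 2[of a "- a"] 4 by (simp add: eq_neg_iff_add_eq_0 add.commute)
  show "s (a - b) = s a - s b" using 2[of a "- b"] 5 by simp
  show 6: "s (inverse a) = inverse (s a)" for a
  proof (cases "a = 0")
    case False
    then have "s a * s (inverse a) = 1" using 3[of a "inverse a"] 1 by simp
    then show ?thesis by (metis inverse_unique)
  qed (simp add: 4)
  show "s (a / b) = s a / s b" using 3[of a "inverse b"] 6 by (simp add: divide_inverse)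
  show "s (a ^ k) = s a ^ k" by (induction k) (simp_all add: 1 3)
qed

definition dl :: "'f::field \<Rightarrow> 'f \<Rightarrow> ('f \<Rightarrow> 'f) \<Rightarrow> 'f \<Rightarrow> 'f" where
  "dl \<tau> c s f = \<tau> * f - c * (f - s f)"

text \<open>In the form \<open>dl_alt\<close> the square has c (2 \<tau> - c - s c) as coefficient
  of s f, which the hypothesis on \<open>c + s c\<close> turns into c (\<tau> - 1/\<tau>); the
  coefficient of f then matches as well.\<close>

lemma dl_quadratic:
  fixes \<tau> :: "'f::field"
  assumes s: "endo s" "\<And>f. s (s f) = f" "s \<tau> = \<tau>" and c: "c + s c = \<tau> + 1 / \<tau>" and "\<tau> \<noteq> 0"
  shows "dl \<tau> c s (dl \<tau> c s f) = (\<tau> - 1 / \<tau>) * dl \<tau> c s f + f"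
proof -
  have c': "s c = \<tau> + 1 / \<tau> - c" using c by (simp add: algebra_simps)
  show ?thesis
    unfolding dl_def endoD[OF s(1)] s c' using \<open>\<tau> \<noteq> 0\<close> by (simp add: field_simps)
qed

lemma dl_commute:
  fixes \<tau> :: "'f::field"
  assumes s: "endo s" "s \<sigma> = \<sigma>" "s d = d" and r: "endo r" "r \<tau> = \<tau>" "r c = c"
    and sr: "\<And>f. s (r f) = r (s f)"
  shows "dl \<tau> c s (dl \<sigma> d r f) = dl \<sigma> d r (dl \<tau> c s f)"
  unfolding dl_def endoD[OF s(1)] endoD[OF r(1)] s r sr by (simp add: algebra_simps)

lemma dl_alt: "dl \<tau> c s f = (\<tau> - c) * f + c * s f"
  by (simp add: dl_def algebra_simps)

text \<open>The coefficients \<open>c\<close> of \<open>T\<^sub>i\<close> for \<open>0 < i < n\<close> with \<open>a = x\<^bsub>i+1\<^esub>/x\<^sub>i\<close>, and of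
  \<open>T\<^sub>n\<close>, \<open>T\<^sub>0\<close> with \<open>y = x\<^sub>n\<close>, \<open>y = q\<^bsup>1/2\<^esup>/x\<^sub>1\<close>.\<close>

definition coef_s :: "'f::field \<Rightarrow> 'f \<Rightarrow> 'f" where
  "coef_s \<tau> a = (\<tau>\<^sup>2 - a) / (\<tau> * (1 - a))"

definition coef_d :: "'f::field \<Rightarrow> 'f \<Rightarrow> 'f \<Rightarrow> 'f" where
  "coef_d \<tau> v y = (1 + \<tau> / v * y) * (1 - \<tau> * v * y) / (\<tau> * (1 - y\<^sup>2))"

text \<open>The reflection inverts \<open>a\<close>, so this supplies the hypothesis of
  \<open>dl_quadratic\<close> for \<open>coef_s\<close>.\<close>

lemma coef_s_sum: "\<tau> \<noteq> 0 \<Longrightarrow> a \<noteq> 0 \<Longrightarrow> a \<noteq> 1 \<Longrightarrow> coef_s \<tau> a + coef_s \<tau> (1 / a) = \<tau> + 1 / (\<tau>::'f::field)"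
proof -
  assume "\<tau> \<noteq> 0" "a \<noteq> 0" "a \<noteq> 1"
  then have "1 - a \<noteq> 0" "a - 1 \<noteq> 0" "1 - 1 / a = (a - 1) / a" by (auto simp: field_simps)
  then show ?thesis unfolding coef_s_def using \<open>\<tau> \<noteq> 0\<close> \<open>a \<noteq> 0\<close>
    by (simp add: divide_simps) algebra
qed

lemma coef_d_sum:
  assumes "\<tau> \<noteq> 0" "v \<noteq> 0" "y \<noteq> 0" "y\<^sup>2 \<noteq> 1"
  shows "coef_d \<tau> v y + coef_d \<tau> v (1 / y) = \<tau> + 1 / (\<tau>::'f::field)"
proof -
  have "1 - y\<^sup>2 \<noteq> 0" "y\<^sup>2 - 1 \<noteq> 0" "1 - (1 / y)\<^sup>2 = (y\<^sup>2 - 1) / y\<^sup>2" using assms by (auto simp: field_simps)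
  then show ?thesis unfolding coef_d_def using assms
    by (simp add: divide_simps) algebra
qed

text \<open>Rank two of type A: \<open>a\<close> and \<open>b\<close> belong to the simple roots and
  \<open>a * b\<close> to the third positive root. Both sides are expanded over the six elements of
  the dihedral group generated by s and r.\<close>

lemma dl_braid3:
  fixes \<tau> :: "'f::field"
  assumes s: "endo s" "\<And>f. s (s f) = f" "s \<tau> = \<tau>" and r: "endo r" "\<And>f. r (r f) = f" "r \<tau> = \<tau>"
    and sr: "\<And>f. s (r (s f)) = r (s (r f))"
    and ab: "s a = 1 / a" "s b = a * b" "r b = 1 / b" "r a = a * b"
    and nz: "\<tau> \<noteq> 0" "a \<noteq> 0" "b \<noteq> 0" "a \<noteq> 1" "b \<noteq> 1" "a * b \<noteq> 1"
  defines "c \<equiv> coef_s \<tau> a" and "d \<equiv> coef_s \<tau> b"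
  shows "dl \<tau> c s (dl \<tau> d r (dl \<tau> c s f)) = dl \<tau> d r (dl \<tau> c s (dl \<tau> d r f))"
proof -
  define e where "e = coef_s \<tau> (a * b)"
  have sd: "s d = e" and rc: "r c = e" and se: "s e = d" and re: "r e = c"
    unfolding c_def d_def e_def coef_s_def using nz
    by (simp_all add: endoD[OF s(1)] endoD[OF r(1)] s r ab)
  have sc: "s c = \<tau> + 1 / \<tau> - c" and rd: "r d = \<tau> + 1 / \<tau> - d"
    using coef_s_sum[of \<tau> a] coef_s_sum[of \<tau> b] nz unfolding c_def d_def
    by (simp_all add: coef_s_def endoD[OF s(1)] endoD[OF r(1)] s r ab algebra_simps)
  have n: "1 - a \<noteq> 0" "1 - b \<noteq> 0" "1 - a * b \<noteq> 0" using nz by auto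
  have p: "\<tau> - c = (1 - \<tau>\<^sup>2) * a / (\<tau> * (1 - a))" "\<tau> - d = (1 - \<tau>\<^sup>2) * b / (\<tau> * (1 - b))"
     "\<tau> - e = (1 - \<tau>\<^sup>2) * (a * b) / (\<tau> * (1 - a * b))"
    unfolding c_def d_def e_def coef_s_def using nz n by (simp_all add: field_simps power2_eq_square)
  \<comment> \<open>\<open>I\<close> and \<open>J\<close> relate the coefficients at the three
    positive roots. Once all automorphisms are pushed inwards, the braid relation follows from them
    by polynomial algebra.\<close>
  have I: "(\<tau> - c) * (\<tau> - d) + (\<tau> - e) * (c - 1 / \<tau>) = (\<tau> - d) * (\<tau> - e)"
  proof -
    have "c - 1 / \<tau> = (\<tau>\<^sup>2 - 1) / (\<tau> * (1 - a))"
      unfolding c_def coef_s_def using nz n by (simp add: field_simps)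
    then show ?thesis unfolding p using nz n by (simp add: divide_simps) algebra
  qed
  have J: "(\<tau> - d) * (\<tau> - c) + (\<tau> - e) * (d - 1 / \<tau>) = (\<tau> - c) * (\<tau> - e)"
  proof -
    have "d - 1 / \<tau> = (\<tau>\<^sup>2 - 1) / (\<tau> * (1 - b))"
      unfolding d_def coef_s_def using nz n by (simp add: field_simps)
    then show ?thesis unfolding p using nz n by (simp add: divide_simps) algebra
  qed
  define k where "k = 1 / \<tau>"
  have tk: "\<tau> * k = 1" using nz by (simp add: k_def)
  have sk: "s k = k" "r k = k" by (simp_all add: k_def endoD[OF s(1)] endoD[OF r(1)] s r)
  note I = I[folded k_def] and J = J[folded k_def] and sc = sc[folded k_def] and rd = rd[folded k_def]
  show ?thesis
    unfolding dl_alt endoD[OF s(1)] endoD[OF r(1)] s r sd rc sc rd se re sk sr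
    using I J tk by algebra
qed

text \<open>Rank two of type B: the positive roots correspond to \<open>a\<close>, \<open>y\<close>,
  \<open>a / y\<^sup>2\<close> and \<open>y / a\<close>, with \<open>c2\<close> and
  \<open>d2\<close> the coefficients at the last two. Apart from inverting its own root, s swaps
  \<open>d\<close> with \<open>d2\<close> and fixes \<open>c2\<close>, while r swaps
  \<open>c\<close> with \<open>c2\<close> and fixes \<open>d2\<close>.\<close>

lemma dl_braid4:
  fixes \<tau> :: "'f::field"
  assumes s: "endo s" "\<And>f. s (s f) = f" "s \<tau> = \<tau>" "s \<sigma> = \<sigma>" "s v = v"
    and r: "endo r" "\<And>f. r (r f) = f" "r \<tau> = \<tau>" "r \<sigma> = \<sigma>" "r v = v"
    and sr: "\<And>f. s (r (s (r f))) = r (s (r (s f)))"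
    and ay: "s a = 1 / a" "s y = y / a" "r y = 1 / y" "r a = a / y\<^sup>2"
    and nz: "\<tau> \<noteq> 0" "\<sigma> \<noteq> 0" "v \<noteq> 0" "a \<noteq> 0" "y \<noteq> 0" "a \<noteq> 1" "y\<^sup>2 \<noteq> 1" "y\<^sup>2 \<noteq> a" "y\<^sup>2 \<noteq> a\<^sup>2"
  defines "c \<equiv> coef_s \<tau> a" and "d \<equiv> coef_d \<sigma> v y"
  shows "dl \<tau> c s (dl \<sigma> d r (dl \<tau> c s (dl \<sigma> d r f))) = dl \<sigma> d r (dl \<tau> c s (dl \<sigma> d r (dl \<tau> c s f)))"
proof -
  define c2 d2 where "c2 = coef_s \<tau> (a / y\<^sup>2)" and "d2 = coef_d \<sigma> v (y / a)"
  have n: "1 - a \<noteq> 0" "1 - y\<^sup>2 \<noteq> 0" "y\<^sup>2 - a \<noteq> 0" "a\<^sup>2 - y\<^sup>2 \<noteq> 0"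
    "1 - a / y\<^sup>2 = (y\<^sup>2 - a) / y\<^sup>2" "1 - (y / a)\<^sup>2 = (a\<^sup>2 - y\<^sup>2) / a\<^sup>2"
    using nz by (auto simp: field_simps)
  have sd: "s d = d2" and rc: "r c = c2" and sd2: "s d2 = d" and rc2: "r c2 = c" and rd2: "r d2 = d2" and sc2: "s c2 = c2"
    unfolding c_def d_def c2_def d2_def coef_s_def coef_d_def using nz
    by (simp_all add: endoD[OF s(1)] endoD[OF r(1)] s r ay power2_eq_square)
  have sc: "s c = \<tau> + 1 / \<tau> - c" and rd: "r d = \<sigma> + 1 / \<sigma> - d"
    using coef_s_sum[of \<tau> a] coef_d_sum[of \<sigma> v y] nz unfolding c_def d_def
    by (simp_all add: coef_s_def coef_d_def endoD[OF s(1)] endoD[OF r(1)] s r ay algebra_simps)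
  define k l where "k = 1 / \<tau>" and "l = 1 / \<sigma>"
  define a' y' v' where "a' = 1 / a" and "y' = 1 / y" and "v' = 1 / v"
  have kl: "\<tau> * k = 1" "\<sigma> * l = 1" using nz by (simp_all add: k_def l_def)
  have skl: "s k = k" "r k = k" "s l = l" "r l = l"
    by (simp_all add: k_def l_def endoD[OF s(1)] endoD[OF r(1)] s r)
  have C: "c * (1 - a) = (\<tau> - k * a)" "c2 * (y\<^sup>2 - a) = (\<tau> * y\<^sup>2 - k * a)"
    unfolding c_def c2_def coef_s_def n k_def using nz n by (simp_all add: field_simps power2_eq_square)
  have D: "d * (1 - y\<^sup>2) = (l + y / v) * (1 - \<sigma> * v * y)"
    "d2 * (a\<^sup>2 - y\<^sup>2) = (l * a + y / v) * (a - \<sigma> * v * y)"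
    unfolding d_def d2_def coef_d_def n l_def using nz n by (simp_all add: field_simps power2_eq_square)
  define e where "e = 1 / v - v"
  have P: "\<tau> - c = (k - \<tau>) * a / (1 - a)" "c - k = (\<tau> - k) / (1 - a)"
    "\<tau> - c2 = (k - \<tau>) * a / (y\<^sup>2 - a)" "c2 - k = (\<tau> - k) * y\<^sup>2 / (y\<^sup>2 - a)"
    unfolding c_def c2_def coef_s_def n k_def using nz n by (simp_all add: field_simps power2_eq_square)
  have Q: "\<sigma> - d = (\<sigma> - l - e * y) / (1 - y\<^sup>2)" "d - l = (e * y - (\<sigma> - l) * y\<^sup>2) / (1 - y\<^sup>2)"
    unfolding d_def coef_d_def l_def e_def using nz n by (simp_all add: field_simps power2_eq_square)
  have Q2: "\<sigma> - d2 = ((\<sigma> - l) * a\<^sup>2 - e * y * a) / (a\<^sup>2 - y\<^sup>2)"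
    "d2 - l = (e * y * a - (\<sigma> - l) * y\<^sup>2) / (a\<^sup>2 - y\<^sup>2)"
    unfolding d2_def coef_d_def n l_def e_def using nz n by (simp_all add: field_simps power2_eq_square)
  \<comment> \<open>These two identities equate the coefficients of \<open>s (r f)\<close> and of
    \<open>r (s f)\<close> on both sides; those of \<open>s f\<close> and \<open>r f\<close> below
    are polynomial consequences of them.\<close>
  have Isr: "(\<tau> - c2) * (d2 - l) + (\<sigma> - d2) * (c - k) + (\<tau> - c) * (\<sigma> - d) = (\<sigma> - d) * (\<tau> - c2)"
    unfolding P Q Q2 using nz n by (simp add: divide_simps) algebra
  have Irs: "(\<tau> - c) * (\<sigma> - d2) = (\<sigma> - d2) * (c2 - k) + (\<tau> - c2) * (d - l) + (\<tau> - c) * (\<sigma> - d)"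
    unfolding P Q Q2 using nz n by (simp add: divide_simps) algebra
  have Is: "(\<sigma> - d2)\<^sup>2 * (c - k) + (\<tau> - c) * (\<sigma> - d) * (\<sigma> - d2) + d2 * (\<sigma> + l - d2) * (\<tau> - c2)
      = (\<sigma> - d) * (\<sigma> - d2) * (c - k) + (\<tau> - c) * (\<sigma> - d)\<^sup>2 + d * (\<sigma> + l - d) * (\<tau> - c2)"
    using Isr Irs kl by algebra
  have Ir: "(\<tau> - c) * (\<tau> - c2) * (d - l) + (\<tau> - c)\<^sup>2 * (\<sigma> - d) + c * (\<tau> + k - c) * (\<sigma> - d2)
      = (\<tau> - c2)\<^sup>2 * (d - l) + (\<tau> - c) * (\<sigma> - d) * (\<tau> - c2) + c2 * (\<tau> + k - c2) * (\<sigma> - d2)"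
    using Isr Irs kl by algebra
  note sc = sc[folded k_def] and rd = rd[folded l_def]
  note push = dl_alt endoD[OF s(1)] endoD[OF r(1)] s r sd rc sc rd sd2 rc2 rd2 sc2 skl
  define F where "F = s (r (s (r f)))"
  \<comment> \<open>Normal form over the eight elements of the dihedral group. The coefficients at
    the words of length 0, 3 and 4 agree literally on both sides.\<close>
  have L: "dl \<tau> c s (dl \<sigma> d r (dl \<tau> c s (dl \<sigma> d r f))) =
     ((\<tau> - c)\<^sup>2 * (\<sigma> - d)\<^sup>2 + (\<tau> - c) * (\<tau> - c2) * (d * (\<sigma> + l - d)) + (\<sigma> - d) * (\<sigma> - d2) * (c * (\<tau> + k - c))) * f
     + c * ((\<sigma> - d2)\<^sup>2 * (c - k) + (\<tau> - c) * (\<sigma> - d) * (\<sigma> - d2) + d2 * (\<sigma> + l - d2) * (\<tau> - c2)) * s f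
     + d * ((\<tau> - c) * (\<tau> - c2) * (d - l) + (\<tau> - c)\<^sup>2 * (\<sigma> - d) + c * (\<tau> + k - c) * (\<sigma> - d2)) * r f
     + c * d2 * ((\<tau> - c2) * (d2 - l) + (\<sigma> - d2) * (c - k) + (\<tau> - c) * (\<sigma> - d)) * s (r f)
     + d * c2 * ((\<tau> - c) * (\<sigma> - d2)) * r (s f)
     + c * d2 * c2 * (\<sigma> - d) * s (r (s f)) + d * c2 * d2 * (\<tau> - c) * r (s (r f)) + c * d2 * c2 * d * F"
    unfolding push F_def by algebra
  have R: "dl \<sigma> d r (dl \<tau> c s (dl \<sigma> d r (dl \<tau> c s f))) =
     ((\<tau> - c)\<^sup>2 * (\<sigma> - d)\<^sup>2 + (\<tau> - c) * (\<tau> - c2) * (d * (\<sigma> + l - d)) + (\<sigma> - d) * (\<sigma> - d2) * (c * (\<tau> + k - c))) * f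
     + c * ((\<sigma> - d) * (\<sigma> - d2) * (c - k) + (\<tau> - c) * (\<sigma> - d)\<^sup>2 + d * (\<sigma> + l - d) * (\<tau> - c2)) * s f
     + d * ((\<tau> - c2)\<^sup>2 * (d - l) + (\<tau> - c) * (\<sigma> - d) * (\<tau> - c2) + c2 * (\<tau> + k - c2) * (\<sigma> - d2)) * r f
     + c * d2 * ((\<sigma> - d) * (\<tau> - c2)) * s (r f)
     + d * c2 * ((\<sigma> - d2) * (c2 - k) + (\<tau> - c2) * (d - l) + (\<tau> - c) * (\<sigma> - d)) * r (s f)
     + c * d2 * c2 * (\<sigma> - d) * s (r (s f)) + d * c2 * d2 * (\<tau> - c) * r (s (r f)) + c * d2 * c2 * d * F"
    unfolding push F_def sr[of f] by algebra
  show ?thesis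
    unfolding L R Is Ir Isr Irs ..
qed

section \<open>Monomial substitutions\<close>

lemma laurent_expand: "f = (\<Sum>\<nu>\<in>Poly_Mapping.keys f. Poly_Mapping.single \<nu> (Poly_Mapping.lookup f \<nu>))"
  by (rule poly_mapping_eqI)
     (auto simp: lookup_sum lookup_single when_def in_keys_iff)

lemma laurent_induct [case_names single add]:
  assumes "\<And>\<nu> c. P (Poly_Mapping.single \<nu> c)" and "\<And>f g. P f \<Longrightarrow> P g \<Longrightarrow> P (f + g)"
  shows "P (f :: 'a \<Rightarrow>\<^sub>0 'b::comm_monoid_add)"
proof -
  have P0: "P 0" using assms(1)[of undefined 0] by simp
  have "P (\<Sum>\<nu>\<in>A. Poly_Mapping.single \<nu> (Poly_Mapping.lookup f \<nu>))" if "finite A" for A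
    using that by (induction A rule: finite_induct) (auto simp: P0 intro: assms)
  moreover have "f = (\<Sum>\<nu>\<in>Poly_Mapping.keys f. Poly_Mapping.single \<nu> (Poly_Mapping.lookup f \<nu>))"
    by (rule poly_mapping_eqI) (auto simp: lookup_sum lookup_single when_def in_keys_iff)
  ultimately show ?thesis by (metis finite_keys)
qed

lemma cst_simps: "cst 1 = 1" "cst 0 = 0" "cst (a + b) = cst a + cst b" "cst (a * b) = cst a * cst b"
  "cst (- a) = - cst a" "cst (a - b) = cst a - cst b" "cst (a ^ k) = cst a ^ k"
proof -
  show "cst 1 = 1" and "cst 0 = 0" and "cst (a + b) = cst a + cst b" and *: "\<And>a b. cst (a * b) = cst a * cst b"
  "cst (- a) = - cst a" "cst (a - b) = cst a - cst b"
    by (simp_all add: cst_def single_add mult_single single_uminus single_diff)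
  then show "cst (a ^ k) = cst a ^ k" by (induction k) simp_all
qed

lemma cst_inj [simp]: "cst a = cst b \<longleftrightarrow> a = b"
  by (metis cst_def lookup_single_eq)

lemma cst_single: "cst c * Poly_Mapping.single \<nu> d = Poly_Mapping.single \<nu> (c * d)"
  by (simp add: cst_def mult_single)

lemma lookup_cst_mult: "Poly_Mapping.lookup (cst c * f) \<nu> = c * Poly_Mapping.lookup f \<nu>"
  by (induction f rule: laurent_induct)
     (auto simp: cst_single lookup_single when_def algebra_simps lookup_add)

text \<open>Covers all \<open>xi\<close> uniformly: the exponent moves linearly, and
  \<open>\<phi>\<close> carries the power of q that only \<open>xi n 0\<close> produces.\<close>

definition sub_mon :: "(vec \<Rightarrow> vec) \<Rightarrow> (vec \<Rightarrow> coeff) \<Rightarrow> laurent \<Rightarrow> laurent" where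
  "sub_mon \<sigma> \<phi> f = (\<Sum>\<nu>\<in>Poly_Mapping.keys f. Poly_Mapping.single (\<sigma> \<nu>) (\<phi> \<nu> * Poly_Mapping.lookup f \<nu>))"

lemma sub_mon_superset:
  assumes "finite A" "Poly_Mapping.keys f \<subseteq> A"
  shows "sub_mon \<sigma> \<phi> f = (\<Sum>\<nu>\<in>A. Poly_Mapping.single (\<sigma> \<nu>) (\<phi> \<nu> * Poly_Mapping.lookup f \<nu>))"
  unfolding sub_mon_def using assms by (intro sum.mono_neutral_left) (auto simp: in_keys_iff)

lemma sub_mon_add: "sub_mon \<sigma> \<phi> (f + g) = sub_mon \<sigma> \<phi> f + sub_mon \<sigma> \<phi> g"
  using sub_mon_superset[of "Poly_Mapping.keys f \<union> Poly_Mapping.keys g"] keys_add[of f g]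
  by (simp add: lookup_add algebra_simps single_add sum.distrib)

lemma sub_mon_single: "sub_mon \<sigma> \<phi> (Poly_Mapping.single \<nu> c) = Poly_Mapping.single (\<sigma> \<nu>) (\<phi> \<nu> * c)"
  by (simp add: sub_mon_superset[of "{\<nu>}"])

lemma sub_mon_mult:
  assumes "\<And>\<mu> \<nu>. \<sigma> (\<mu> + \<nu>) = \<sigma> \<mu> + \<sigma> \<nu>" "\<And>\<mu> \<nu>. \<phi> (\<mu> + \<nu>) = \<phi> \<mu> * \<phi> \<nu>"
  shows "sub_mon \<sigma> \<phi> (f * g) = sub_mon \<sigma> \<phi> f * sub_mon \<sigma> \<phi> g"
proof (induction f rule: laurent_induct)
  case (single \<mu> c)
  show ?case
    by (induction g rule: laurent_induct)
       (simp_all add: sub_mon_add sub_mon_single mult_single assms algebra_simps)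
qed (simp add: sub_mon_add algebra_simps)

section \<open>Extension of ring endomorphisms to the field of fractions\<close>

text \<open>Injectivity keeps denominators nonzero under the extension to fractions.\<close>

definition ring_inj :: "('a::idom \<Rightarrow> 'a) \<Rightarrow> bool" where
  "ring_inj \<phi> \<longleftrightarrow> \<phi> 1 = 1 \<and> (\<forall>a b. \<phi> (a + b) = \<phi> a + \<phi> b) \<and> (\<forall>a b. \<phi> (a * b) = \<phi> a * \<phi> b) \<and> inj \<phi>"

definition fr_map :: "('a::idom \<Rightarrow> 'a) \<Rightarrow> 'a fract \<Rightarrow> 'a fract" where
  "fr_map \<phi> r = (THE c. \<exists>a b. b \<noteq> 0 \<and> r = Fract a b \<and> c = Fract (\<phi> a) (\<phi> b))"

lemma ring_inj_nz:
  assumes "ring_inj \<phi>" shows "\<phi> a = 0 \<longleftrightarrow> a = 0"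
proof -
  have "\<phi> 0 + \<phi> 0 = \<phi> 0 + 0" using assms unfolding ring_inj_def by (metis add.right_neutral)
  then have "\<phi> 0 = 0" by (metis add_left_cancel)
  then show ?thesis using assms unfolding ring_inj_def inj_def by metis
qed

lemma fr_map_Fract:
  assumes "ring_inj \<phi>" "b \<noteq> 0"
  shows "fr_map \<phi> (Fract a b) = Fract (\<phi> a) (\<phi> b)"
  unfolding fr_map_def
proof (rule the_equality)
  show "\<exists>a' b'. b' \<noteq> 0 \<and> Fract a b = Fract a' b' \<and> Fract (\<phi> a) (\<phi> b) = Fract (\<phi> a') (\<phi> b')"
    using assms by blast
  fix c assume "\<exists>a' b'. b' \<noteq> 0 \<and> Fract a b = Fract a' b' \<and> c = Fract (\<phi> a') (\<phi> b')"
  then obtain a' b' where *: "b' \<noteq> 0" "Fract a b = Fract a' b'" "c = Fract (\<phi> a') (\<phi> b')" by blast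
  then have "a * b' = a' * b" using assms(2) by (simp add: eq_fract)
  then have "\<phi> a * \<phi> b' = \<phi> a' * \<phi> b" using assms(1) unfolding ring_inj_def by metis
  then show "c = Fract (\<phi> a) (\<phi> b)"
    using * assms by (simp add: eq_fract ring_inj_nz)
qed

lemma endo_fr_map:
  assumes "ring_inj \<phi>"
  shows "endo (fr_map \<phi>)"
  unfolding endo_def
proof (intro conjI allI)
  have m: "\<phi> 1 = 1" "\<And>a b. \<phi> (a + b) = \<phi> a + \<phi> b" "\<And>a b. \<phi> (a * b) = \<phi> a * \<phi> b"
    using assms by (auto simp: ring_inj_def)
  show "fr_map \<phi> 1 = 1" using assms by (simp add: One_fract_def fr_map_Fract m)
  fix a b :: "'a fract"
  show "fr_map \<phi> (a + b) = fr_map \<phi> a + fr_map \<phi> b"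
    by (cases a; cases b) (simp add: assms fr_map_Fract m ring_inj_nz)
  show "fr_map \<phi> (a * b) = fr_map \<phi> a * fr_map \<phi> b"
    by (cases a; cases b) (simp add: assms fr_map_Fract m ring_inj_nz)
qed

section \<open>The reflections and their action on monomials\<close>

text \<open>For \<open>i = 0\<close> this is only the linear part of the affine reflection; its
  translation part is the power of q recorded in \<open>qfac\<close>.\<close>

definition srefl :: "nat \<Rightarrow> nat \<Rightarrow> vec \<Rightarrow> vec" where
  "srefl n i \<mu> = (if i = 0 then Poly_Mapping.update 1 (- Poly_Mapping.lookup \<mu> 1) \<mu> else simple_refl n i \<mu>)"

definition qfac :: "nat \<Rightarrow> vec \<Rightarrow> coeff" where
  "qfac i \<mu> = (if i = 0 then q_par powi Poly_Mapping.lookup \<mu> 1 else 1)"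

lemma lookup_simple_refl:
  "Poly_Mapping.lookup (simple_refl n i \<mu>) k = (if i < n then Poly_Mapping.lookup \<mu> (if k = i then Suc i else if k = Suc i then i else k)
     else (if k = n then - Poly_Mapping.lookup \<mu> n else Poly_Mapping.lookup \<mu> k))"
  by (auto simp: simple_refl_def lookup_update)

lemma lookup_srefl:
  "Poly_Mapping.lookup (srefl n i \<mu>) k = (if i = 0 then (if k = 1 then - Poly_Mapping.lookup \<mu> 1 else Poly_Mapping.lookup \<mu> k)
    else if i < n then Poly_Mapping.lookup \<mu> (if k = i then Suc i else if k = Suc i then i else k)
     else (if k = n then - Poly_Mapping.lookup \<mu> n else Poly_Mapping.lookup \<mu> k))"
  by (auto simp: srefl_def lookup_simple_refl lookup_update)

lemma simple_refl_add: "simple_refl n i (\<mu> + \<nu>) = simple_refl n i \<mu> + simple_refl n i \<nu>"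
  by (rule poly_mapping_eqI) (simp add: lookup_simple_refl lookup_add)

lemma srefl_add: "srefl n i (\<mu> + \<nu>) = srefl n i \<mu> + srefl n i \<nu>"
  by (rule poly_mapping_eqI) (simp add: lookup_srefl lookup_add)

lemma simple_refl_simple_refl [simp]: "simple_refl n i (simple_refl n i \<mu>) = \<mu>"
  by (rule poly_mapping_eqI) (simp add: lookup_simple_refl)

lemma srefl_srefl [simp]: "srefl n i (srefl n i \<mu>) = \<mu>"
  by (rule poly_mapping_eqI) (simp add: lookup_srefl)

lemma xi_eq: "xi n i f = sub_mon (srefl n i) (qfac i) f"
  by (auto simp: xi_def sub_mon_def srefl_def[abs_def] qfac_def[abs_def] intro!: sum.cong)

lemma single_eq_0_iff [simp]: "Poly_Mapping.single k v = 0 \<longleftrightarrow> v = 0"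
  by (metis lookup_single_eq lookup_zero single_zero)

lemma generator_nz [simp]: "generator p \<noteq> 0"
  unfolding generator_def Zero_fract_def by (simp add: eq_fract)

lemma par_nz [simp]: "q_half \<noteq> 0" "t_half \<noteq> 0" "t0_half \<noteq> 0" "u0_half \<noteq> 0" "tn_half \<noteq> 0" "un_half \<noteq> 0"
  by (simp_all add: q_half_def t_half_def t0_half_def u0_half_def tn_half_def un_half_def)

lemma qfac_add: "qfac i (\<mu> + \<nu>) = qfac i \<mu> * qfac i \<nu>"
  by (simp add: qfac_def lookup_add power_int_add)

lemma qfac_srefl: "qfac i (srefl n i \<mu>) * qfac i \<mu> = 1"
  by (simp add: qfac_def lookup_srefl flip: power_int_add)

lemma xi_simps: "xi n i (f + g) = xi n i f + xi n i g" "xi n i (f * g) = xi n i f * xi n i g"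
  "xi n i (Poly_Mapping.single \<nu> c) = Poly_Mapping.single (srefl n i \<nu>) (qfac i \<nu> * c)"
  by (simp_all add: xi_eq sub_mon_add sub_mon_mult sub_mon_single srefl_add qfac_add)

lemma srefl_0 [simp]: "srefl n i 0 = 0"
  by (rule poly_mapping_eqI) (simp add: lookup_srefl)

lemma xi_cst: "xi n i (cst c) = cst c"
  by (simp add: cst_def xi_simps qfac_def)

lemma xi_xi [simp]: "xi n i (xi n i f) = f"
  by (induction f rule: laurent_induct) (simp_all add: xi_simps qfac_srefl flip: mult.assoc)

lemma ring_inj_xi: "ring_inj (xi n i)"
  unfolding ring_inj_def using xi_cst[of n i 1]
  by (auto simp: xi_simps cst_simps intro: inj_on_inverseI[of _ "xi n i"])

section \<open>The operators as Demazure--Lusztig operators\<close>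

definition tau :: "nat \<Rightarrow> nat \<Rightarrow> coeff" where
  "tau n i = (if i = 0 then t0_half else if i = n then tn_half else t_half)"

lemma tau_nz [simp]: "tau n i \<noteq> 0"
  by (simp add: tau_def)

definition Tnum :: "nat \<Rightarrow> nat \<Rightarrow> laurent" where
  "Tnum n i = (if i = 0 then (var 1 + cst (q_half * t0_half * inverse u0_half)) *
              (var 1 - cst (q_half * t0_half * u0_half))
     else if i = n then (1 + cst (tn_half * inverse un_half) * var n) *
              (1 - cst (tn_half * un_half) * var n)
     else var (Suc i) - cst t_par * var i)"

definition Tden :: "nat \<Rightarrow> nat \<Rightarrow> laurent" where
  "Tden n i = (if i = 0 then var 1 ^ 2 - cst q_par
     else if i = n then 1 - var n ^ 2
     else var (Suc i) - var i)"

text \<open>The quotient of \<open>xi n i\<close> applied to a monomial by that monomial is an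
  integral power of this unit; up to a unit, \<open>1 - umon n i\<close> is the denominator
  \<open>Tden n i\<close>.\<close>

definition umon :: "nat \<Rightarrow> nat \<Rightarrow> laurent" where
  "umon n i = (if i = 0 then Poly_Mapping.single (Poly_Mapping.single 1 (- 2)) q_par
     else if i = n then Poly_Mapping.single (Poly_Mapping.single n 2) 1
     else Poly_Mapping.single (Poly_Mapping.single (Suc i) 1 - Poly_Mapping.single i 1) 1)"

lemma T_op_eq:
  "T_op n i f = cst (inverse (tau n i)) * (cst ((tau n i)\<^sup>2) * f -
     exact_quot (Tnum n i * (f - xi n i f)) (Tden n i))"
  by (simp add: T_op_def tau_def Tnum_def Tden_def)

lemma single_single_power:
  "Poly_Mapping.single (Poly_Mapping.single j a) c ^ k = Poly_Mapping.single (Poly_Mapping.single j (int k * a)) ((c::'a::comm_semiring_1) ^ k)"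
  by (induction k) (simp_all add: mult_single algebra_simps flip: single_add)

lemma single_diff_power:
  "Poly_Mapping.single (Poly_Mapping.single j 1 - Poly_Mapping.single i 1) 1 ^ k =
   (Poly_Mapping.single (Poly_Mapping.single j (int k) - Poly_Mapping.single i (int k)) 1 :: _ \<Rightarrow>\<^sub>0 'a::comm_semiring_1)"
proof (induction k)
  case (Suc k)
  show ?case unfolding power_Suc Suc.IH mult_single
    by (intro arg_cong2[where f = Poly_Mapping.single] poly_mapping_eqI) (auto simp: lookup_add lookup_minus lookup_single)
qed simp

text \<open>The exponent of \<open>umon n i\<close> is an integer; its two signs give the two
  alternatives, so that only natural powers occur.\<close>

lemma srefl_power:
  assumes "i \<le> n"
  shows "\<exists>k. xi n i (Poly_Mapping.single \<nu> c) = Poly_Mapping.single \<nu> c * umon n i ^ k \<or>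
             Poly_Mapping.single \<nu> c = xi n i (Poly_Mapping.single \<nu> c) * umon n i ^ k"
proof -
  define m where "m = (if i = 0 then Poly_Mapping.lookup \<nu> 1 else if i = n then - Poly_Mapping.lookup \<nu> n
     else Poly_Mapping.lookup \<nu> i - Poly_Mapping.lookup \<nu> (Suc i))"
  obtain k where "m = int k \<or> m = - int k" by (metis int_cases2)
  then show ?thesis
  proof
    assume k: "m = int k"
    have "xi n i (Poly_Mapping.single \<nu> c) = Poly_Mapping.single \<nu> c * umon n i ^ k"
    proof -
      consider "i = 0" | "i \<noteq> 0" "i = n" | "i \<noteq> 0" "i < n" using assms by linarith
      then show ?thesis
      proof cases
        case 1
        then show ?thesis using k
          by (auto simp: m_def umon_def xi_simps single_single_power mult_single qfac_def lookup_srefl lookup_add lookup_single when_def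
            split: if_splits
            intro!: arg_cong2[where f = Poly_Mapping.single] poly_mapping_eqI)
      next
        case 2
        then show ?thesis using k
          by (auto simp: m_def umon_def xi_simps single_single_power mult_single qfac_def lookup_srefl lookup_add lookup_single when_def
            split: if_splits
            intro!: arg_cong2[where f = Poly_Mapping.single] poly_mapping_eqI)
      next
        case 3
        then show ?thesis using k
          by (auto simp: m_def umon_def xi_simps single_diff_power mult_single qfac_def lookup_srefl lookup_add lookup_minus lookup_single when_def
            split: if_splits
            intro!: arg_cong2[where f = Poly_Mapping.single] poly_mapping_eqI)
      qed
    qed
    then show ?thesis by blast
  next
    assume k: "m = - int k"
    have "Poly_Mapping.single \<nu> c = xi n i (Poly_Mapping.single \<nu> c) * umon n i ^ k"
    proof -
      consider "i = 0" | "i \<noteq> 0" "i = n" | "i \<noteq> 0" "i < n" using assms by linarith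
      then show ?thesis
      proof cases
        case 1
        then show ?thesis using k
          by (auto simp: m_def umon_def xi_simps single_single_power mult_single qfac_def lookup_srefl lookup_add lookup_single when_def power_int_minus
            split: if_splits
            intro!: arg_cong2[where f = Poly_Mapping.single] poly_mapping_eqI)
      next
        case 2
        then show ?thesis using k
          by (auto simp: m_def umon_def xi_simps single_single_power mult_single qfac_def lookup_srefl lookup_add lookup_single when_def
            split: if_splits
            intro!: arg_cong2[where f = Poly_Mapping.single] poly_mapping_eqI)
      next
        case 3
        then show ?thesis using k
          by (auto simp: m_def umon_def xi_simps single_diff_power mult_single qfac_def lookup_srefl lookup_add lookup_minus lookup_single when_def
            split: if_splits
            intro!: arg_cong2[where f = Poly_Mapping.single] poly_mapping_eqI)
      qed
    qed
    then show ?thesis by blast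
  qed
qed

text \<open>A factor 1 - u divides every 1 - u^k, so monomial by monomial the quotient in
  \<open>T_op\<close> exists within the Laurent polynomials.\<close>

lemma umon_dvd:
  assumes "i \<le> n"
  shows "(1 - umon n i) dvd (f - xi n i f)"
proof (induction f rule: laurent_induct)
  case (single \<nu> c)
  have dvd: "(1 - umon n i) dvd (1 - umon n i ^ k)" for k
    unfolding one_diff_power_eq by simp
  from srefl_power[OF assms, of \<nu> c] obtain k where
    "xi n i (Poly_Mapping.single \<nu> c) = Poly_Mapping.single \<nu> c * umon n i ^ k \<or>
     Poly_Mapping.single \<nu> c = xi n i (Poly_Mapping.single \<nu> c) * umon n i ^ k" by blast
  then have "Poly_Mapping.single \<nu> c - xi n i (Poly_Mapping.single \<nu> c) = Poly_Mapping.single \<nu> c * (1 - umon n i ^ k) \<or>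
    Poly_Mapping.single \<nu> c - xi n i (Poly_Mapping.single \<nu> c) = - xi n i (Poly_Mapping.single \<nu> c) * (1 - umon n i ^ k)"
    by (metis (no_types, opaque_lifting) mult.right_neutral right_diff_distrib mult_minus_left minus_diff_eq)
  then show ?case using dvd[of k] by (metis dvd_mult)
next
  case (add f g)
  then have "(1 - umon n i) dvd (f - xi n i f) + (g - xi n i g)" by (rule dvd_add)
  then show ?case by (simp add: xi_simps algebra_simps)
qed

lemma Tden_factor:
  assumes "i \<le> n"
  shows "\<exists>w w'. w * w' = 1 \<and> Tden n i = w * (1 - umon n i)"
proof -
  consider "i = 0" | "i \<noteq> 0" "i = n" | "i \<noteq> 0" "i < n" using assms by linarith
  then show ?thesis
  proof cases
    case 1
    have "var 1 ^ 2 * (Poly_Mapping.single (Poly_Mapping.single 1 (- 2)) 1 :: laurent) = 1"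
      "Tden n i = var 1 ^ 2 * (1 - umon n i)"
      using 1 by (simp_all add: Tden_def umon_def var_def single_single_power mult_single cst_def algebra_simps flip: single_add)
    then show ?thesis by blast
  next
    case 2
    have "1 * 1 = (1 :: laurent)" "Tden n i = 1 * (1 - umon n i)"
      using 2 by (simp_all add: Tden_def umon_def var_def single_single_power)
    then show ?thesis by blast
  next
    case 3
    have "(- var i) * (- Poly_Mapping.single (Poly_Mapping.single i (- 1)) 1 :: laurent) = 1"
      by (simp add: var_def mult_single flip: single_add)
    moreover have "Tden n i = (- var i) * (1 - umon n i)" using 3
      by (auto simp: Tden_def umon_def var_def mult_single algebra_simps)
    ultimately show ?thesis by blast
  qed
qed

lemma umon_neq_1:
  assumes "i \<le> n"
  shows "umon n i \<noteq> 1"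
proof
  assume u: "umon n i = 1"
  consider "i = 0" | "i \<noteq> 0" "i = n" | "i \<noteq> 0" "i < n" using assms by linarith
  then show False
  proof cases
    case 1
    then have "Poly_Mapping.lookup (umon n i) (Poly_Mapping.single 1 (- 2)) \<noteq> Poly_Mapping.lookup 1 (Poly_Mapping.single 1 (- 2) :: vec)"
      by (simp add: umon_def lookup_one)
    then show ?thesis using u by simp
  next
    case 2
    then have "Poly_Mapping.lookup (umon n i) (Poly_Mapping.single n 2) \<noteq> Poly_Mapping.lookup 1 (Poly_Mapping.single n 2 :: vec)"
      by (simp add: umon_def lookup_one)
    then show ?thesis using u by simp
  next
    case 3
    define \<delta> :: vec where "\<delta> = Poly_Mapping.single (Suc i) 1 - Poly_Mapping.single i 1"
    have "Poly_Mapping.lookup \<delta> i \<noteq> 0" by (simp add: \<delta>_def lookup_minus lookup_single)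
    then have "\<delta> \<noteq> 0" by (metis lookup_zero)
    then have "Poly_Mapping.lookup (umon n i) \<delta> \<noteq> Poly_Mapping.lookup 1 \<delta>"
      using 3 by (simp add: umon_def lookup_one flip: \<delta>_def)
    then show ?thesis using u by simp
  qed
qed

lemma Tden_nz: "i \<le> n \<Longrightarrow> Tden n i \<noteq> 0"
  using Tden_factor[of i n] umon_neq_1[of i n] by auto

lemma exact_quot_eq: "b \<noteq> 0 \<Longrightarrow> c * b = a \<Longrightarrow> exact_quot a b = c"
  unfolding exact_quot_def by (rule the_equality) auto

text \<open>Replaces the description in \<open>exact_quot\<close> by an explicit quotient
  \<open>h\<close>, which is unique because \<open>Tden n i\<close> is nonzero in an integral
  domain.\<close>

lemma T_op_obtain:
  assumes "i \<le> n"
  obtains h where "h * Tden n i = f - xi n i f"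
    "T_op n i f = cst (inverse (tau n i)) * (cst ((tau n i)\<^sup>2) * f - Tnum n i * h)"
proof -
  obtain w w' where w: "w * w' = 1" "Tden n i = w * (1 - umon n i)" using Tden_factor[OF assms] by blast
  obtain g where g: "f - xi n i f = (1 - umon n i) * g" using umon_dvd[OF assms] by (auto elim: dvdE)
  have h: "(w' * g) * Tden n i = f - xi n i f" unfolding w g using w(1) by algebra
  have "exact_quot (Tnum n i * (f - xi n i f)) (Tden n i) = Tnum n i * (w' * g)"
    using h by (intro exact_quot_eq Tden_nz assms) (simp add: mult.assoc)
  then show ?thesis using that[OF h] by (simp add: T_op_eq)
qed

section \<open>The passage to rational functions\<close>

definition emb :: "laurent \<Rightarrow> laurent fract" where "emb a = Fract a 1"

definition kc :: "coeff \<Rightarrow> laurent fract" where "kc c = emb (cst c)"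

lemma emb_simps: "emb (a + b) = emb a + emb b" "emb (a * b) = emb a * emb b" "emb (a - b) = emb a - emb b"
  "emb 1 = 1" "emb 0 = 0" "emb (a ^ k) = emb a ^ k"
proof -
  show "emb (a + b) = emb a + emb b" and *: "\<And>a b. emb (a * b) = emb a * emb b" and "emb (a - b) = emb a - emb b"
  and "emb 1 = 1" and "emb 0 = 0"
    by (simp_all add: emb_def One_fract_def Zero_fract_def)
  then show "emb (a ^ k) = emb a ^ k" by (induction k) simp_all
qed

lemma emb_inj [simp]: "emb a = emb b \<longleftrightarrow> a = b"
  by (simp add: emb_def eq_fract)

lemma emb_eq_0 [simp]: "emb a = 0 \<longleftrightarrow> a = 0"
  by (metis emb_inj emb_simps(5))

lemma kc_simps: "kc (a + b) = kc a + kc b" "kc (a * b) = kc a * kc b" "kc (a - b) = kc a - kc b"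
  "kc 1 = 1" "kc 0 = 0" "kc (a ^ k) = kc a ^ k" "kc (inverse a) = inverse (kc a)" "kc (a / b) = kc a / kc b"
proof -
  show "kc (a + b) = kc a + kc b" and *: "\<And>a b. kc (a * b) = kc a * kc b" and "kc (a - b) = kc a - kc b"
    and 1: "kc 1 = 1" and 0: "kc 0 = 0" and "kc (a ^ k) = kc a ^ k"
    by (simp_all add: kc_def cst_simps emb_simps)
  show **: "kc (inverse a) = inverse (kc a)" for a
  proof (cases "a = 0")
    case False
    then have "kc a * kc (inverse a) = 1" by (simp flip: * add: 1)
    then show ?thesis by (metis inverse_unique)
  qed (simp add: 0)
  show "kc (a / b) = kc a / kc b" using *[of a "inverse b"] ** by (simp add: divide_inverse)
qed

lemma kc_eq_0 [simp]: "kc c = 0 \<longleftrightarrow> c = 0"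
  by (simp add: kc_def cst_def)

definition Xi :: "nat \<Rightarrow> nat \<Rightarrow> laurent fract \<Rightarrow> laurent fract" where
  "Xi n i = fr_map (xi n i)"

lemma Xi_endo: "endo (Xi n i)"
  unfolding Xi_def by (intro endo_fr_map ring_inj_xi)

lemma xi_0 [simp]: "xi n i 0 = 0" and xi_1 [simp]: "xi n i 1 = 1"
  using xi_cst[of n i 0] xi_cst[of n i 1] by (simp_all add: cst_simps)

lemma Xi_Fract: "b \<noteq> 0 \<Longrightarrow> Xi n i (Fract a b) = Fract (xi n i a) (xi n i b)"
  unfolding Xi_def by (rule fr_map_Fract[OF ring_inj_xi])

lemma Xi_emb: "Xi n i (emb f) = emb (xi n i f)"
  by (simp add: emb_def Xi_Fract)

lemma xi_eq_0 [simp]: "xi n i a = 0 \<longleftrightarrow> a = 0"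
  by (metis xi_xi xi_0)

lemma Xi_Xi [simp]: "Xi n i (Xi n i r) = r"
  by (cases r) (simp add: Xi_Fract)

lemma Xi_kc [simp]: "Xi n i (kc c) = kc c"
  by (simp add: kc_def Xi_emb xi_cst)

definition Tc :: "nat \<Rightarrow> nat \<Rightarrow> laurent fract" where
  "Tc n i = emb (Tnum n i) / (kc (tau n i) * emb (Tden n i))"

text \<open>After the embedding the exact division is a division in the field, so relations between
  the operators become relations between the maps \<open>dl\<close>.\<close>

lemma emb_T_op:
  assumes "i \<le> n"
  shows "emb (T_op n i f) = dl (kc (tau n i)) (Tc n i) (Xi n i) (emb f)"
proof -
  obtain h where h: "h * Tden n i = f - xi n i f"
    "T_op n i f = cst (inverse (tau n i)) * (cst ((tau n i)\<^sup>2) * f - Tnum n i * h)"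
    using T_op_obtain[OF assms] by blast
  have h1: "emb f - Xi n i (emb f) = emb h * emb (Tden n i)"
    unfolding Xi_emb by (simp flip: emb_simps h(1))
  show ?thesis
    unfolding h(2) dl_def h1 Tc_def emb_simps kc_def[symmetric] kc_simps
    using Tden_nz[OF assms] by (simp add: field_simps power2_eq_square)
qed

section \<open>Hecke relations\<close>

definition em :: "vec \<Rightarrow> coeff \<Rightarrow> laurent fract" where
  "em \<nu> c = emb (Poly_Mapping.single \<nu> c)"

lemma em_mult: "em \<nu> c * em \<mu> d = em (\<nu> + \<mu>) (c * d)"
  by (simp add: em_def emb_simps(2)[symmetric] mult_single)

lemma em_power: "em \<nu> c ^ 2 = em (\<nu> + \<nu>) (c ^ 2)"
  by (simp add: power2_eq_square em_mult)

lemma em_eq_0 [simp]: "em \<nu> c = 0 \<longleftrightarrow> c = 0"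
  by (simp add: em_def)

lemma em_1: "em 0 1 = 1" by (simp add: em_def emb_simps)

lemma em_inverse: "c \<noteq> 0 \<Longrightarrow> inverse (em \<nu> c) = em (- \<nu>) (inverse c)"
  by (rule inverse_unique) (simp add: em_mult em_1)

lemma em_divide: "d \<noteq> 0 \<Longrightarrow> em \<nu> c / em \<mu> d = em (\<nu> - \<mu>) (c / d)"
  by (simp add: divide_inverse em_inverse em_mult)

lemma em_eq: "em \<nu> c = em \<mu> d \<Longrightarrow> c \<noteq> 0 \<Longrightarrow> \<nu> = \<mu>"
  unfolding em_def emb_inj by (metis lookup_single_eq lookup_single_not_eq)

lemma Xi_em: "Xi n i (em \<nu> c) = em (srefl n i \<nu>) (qfac i \<nu> * c)"
  by (simp add: em_def Xi_emb xi_simps)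

definition yv :: "nat \<Rightarrow> nat \<Rightarrow> laurent fract" where
  "yv n i = (if i = 0 then em (Poly_Mapping.single 1 (- 1)) q_half else em (Poly_Mapping.single n 1) 1)"

definition av :: "nat \<Rightarrow> laurent fract" where
  "av i = em (Poly_Mapping.single (Suc i) 1 - Poly_Mapping.single i 1) 1"

lemma Tc_s:
  assumes "1 \<le> i" "i < n"
  shows "Tc n i = coef_s (kc t_half) (av i)"
proof -
  have x: "emb (var i) \<noteq> 0" by (simp add: var_def)
  have a: "av i = emb (var (Suc i)) / emb (var i)"
    by (simp add: av_def var_def em_def[symmetric] em_divide)
  have n: "emb (var (Suc i)) - emb (var i) \<noteq> 0" "emb (var i) - emb (var (Suc i)) \<noteq> 0"
    using Tden_nz[of i n] assms by (simp_all add: Tden_def flip: emb_simps)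
  have r: "1 - av i = (emb (var i) - emb (var (Suc i))) / emb (var i)"
    "(kc t_half)\<^sup>2 - av i = ((kc t_half)\<^sup>2 * emb (var i) - emb (var (Suc i))) / emb (var i)"
    unfolding a using x by (simp_all add: field_simps)
  show ?thesis
    unfolding Tc_def coef_s_def r using assms x n
    by (simp add: Tnum_def Tden_def tau_def emb_simps kc_def[symmetric] kc_simps power2_eq_square divide_simps) (simp add: algebra_simps)
qed

lemma Tc_n:
  assumes "1 \<le> n"
  shows "Tc n n = coef_d (kc tn_half) (kc un_half) (yv n n)"
  using assms
  by (simp add: Tc_def coef_d_def yv_def Tnum_def Tden_def tau_def emb_simps kc_def[symmetric] kc_simps
     var_def[symmetric] em_def divide_inverse mult.assoc)

lemma Tc_0:
  shows "Tc n 0 = coef_d (kc t0_half) (kc u0_half) (yv n 0)"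
proof -
  define x where "x = emb (var 1)"
  have x: "x \<noteq> 0" by (simp add: var_def x_def)
  have a: "yv n 0 = kc q_half / x"
    by (simp add: yv_def x_def var_def cst_def kc_def em_def[symmetric] em_divide single_uminus)
  have d: "emb (Tden n 0) = x\<^sup>2 - (kc q_half)\<^sup>2"
    by (simp add: Tden_def x_def emb_simps kc_def cst_simps)
  then have n: "x\<^sup>2 - (kc q_half)\<^sup>2 \<noteq> 0" using Tden_nz[of 0 n] by (metis emb_eq_0 le0)
  have r: "1 - (yv n 0)\<^sup>2 = (x\<^sup>2 - (kc q_half)\<^sup>2) / x\<^sup>2"
    unfolding a using x by (simp_all add: field_simps)
  have m: "emb (Tnum n 0) = (x + kc q_half * kc t0_half / kc u0_half) * (x - kc q_half * kc t0_half * kc u0_half)"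
    unfolding Tnum_def by (simp add: x_def emb_simps kc_def[symmetric] kc_simps divide_inverse mult.assoc)
  have "emb (Tnum n 0) = x\<^sup>2 * ((1 + kc t0_half / kc u0_half * yv n 0) * (1 - kc t0_half * kc u0_half * yv n 0))"
    unfolding m a using x by (simp add: field_simps power2_eq_square)
  then show ?thesis
    unfolding Tc_def coef_d_def r d using x n by (simp add: tau_def)
qed

lemma coef_endo:
  assumes "endo s" "s \<tau> = \<tau>"
  shows "s (coef_s \<tau> a) = coef_s \<tau> (s a)" "s v = v \<Longrightarrow> s (coef_d \<tau> v y) = coef_d \<tau> v (s y)"
  by (simp_all add: coef_s_def coef_d_def endoD[OF assms(1)] assms(2))

lemma em_recip: "c \<noteq> 0 \<Longrightarrow> 1 / em \<nu> c = em (- \<nu>) (1 / c)"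
  by (simp add: em_inverse divide_inverse)

lemma em_neq_1: "Poly_Mapping.lookup \<nu> k \<noteq> 0 \<Longrightarrow> c \<noteq> 0 \<Longrightarrow> em \<nu> c \<noteq> 1"
  using em_eq[of \<nu> c 0 1] by (auto simp: em_1)

lemma em_neq: "Poly_Mapping.lookup \<nu> k \<noteq> Poly_Mapping.lookup \<mu> k \<Longrightarrow> c \<noteq> 0 \<Longrightarrow> em \<nu> c \<noteq> em \<mu> d"
  using em_eq[of \<nu> c \<mu> d] by auto

lemmas em_eqI = arg_cong2[where f = em, OF poly_mapping_eqI]
lemma lookup_double: "Poly_Mapping.lookup (2 * \<nu> :: vec) k = 2 * Poly_Mapping.lookup \<nu> k"
  by (simp only: mult_2 lookup_add)

lemmas lookup_simps = lookup_double lookup_add lookup_minus lookup_uminus lookup_single lookup_srefl when_def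

lemma yv_nz: "yv n i \<noteq> 0" "i = 0 \<or> 1 \<le> n \<Longrightarrow> (yv n i)\<^sup>2 \<noteq> 1"
proof -
  show "yv n i \<noteq> 0" by (simp add: yv_def)
  show "(yv n i)\<^sup>2 \<noteq> 1" if "i = 0 \<or> 1 \<le> n"
  proof (cases "i = 0")
    case True
    show ?thesis unfolding yv_def em_power if_P[OF True] by (rule em_neq_1[of _ 1]) (simp_all add: lookup_simps)
  next
    case False
    show ?thesis unfolding yv_def em_power if_not_P[OF False] by (rule em_neq_1[of _ n]) (simp_all add: lookup_simps)
  qed
qed

lemma av_nz: "av i \<noteq> 0" "av i \<noteq> 1"
proof -
  show "av i \<noteq> 0" by (simp add: av_def)
  show "av i \<noteq> 1" unfolding av_def by (rule em_neq_1[of _ i]) (simp_all add: lookup_simps)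
qed

lemma Xi_yv: "i = 0 \<or> 1 \<le> n \<and> i = n \<Longrightarrow> Xi n i (yv n i) = 1 / yv n i"
proof -
  assume i: "i = 0 \<or> 1 \<le> n \<and> i = n"
  have q: "q_par powi (- 1) * q_half = 1 / q_half"
    by (simp add: power_int_minus power2_eq_square field_simps)
  show ?thesis
  proof (cases "i = 0")
    case True
    show ?thesis unfolding yv_def if_P[OF True] Xi_em em_recip[OF par_nz(1)]
      by (rule em_eqI) (use q in \<open>simp_all add: lookup_simps qfac_def True\<close>)
  next
    case False
    have "em (Poly_Mapping.single n 1) 1 \<noteq> 0" by simp
    show ?thesis unfolding yv_def if_not_P[OF False] Xi_em em_recip[OF one_neq_zero]
      by (rule em_eqI) (use i False in \<open>simp_all add: lookup_simps qfac_def\<close>)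
  qed
qed

lemma Xi_av: "1 \<le> i \<Longrightarrow> i < n \<Longrightarrow> Xi n i (av i) = 1 / av i"
  unfolding av_def Xi_em em_recip[OF one_neq_zero]
  by (rule em_eqI) (auto simp: qfac_def lookup_simps)

lemma Tc_sum:
  assumes "i \<le> n" "1 \<le> n"
  shows "Tc n i + Xi n i (Tc n i) = kc (tau n i) + 1 / kc (tau n i)"
proof -
  consider "i = 0" | "i \<noteq> 0" "i = n" | "i \<noteq> 0" "i < n" using assms by linarith
  then show ?thesis
  proof cases
    case 1
    then show ?thesis using coef_d_sum[of "kc t0_half" "kc u0_half" "yv n 0"]
      by (simp add: Tc_0 tau_def coef_endo Xi_endo yv_nz Xi_yv)
  next
    case 2
    then show ?thesis using coef_d_sum[of "kc tn_half" "kc un_half" "yv n n"] assms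
      by (simp add: Tc_n tau_def coef_endo Xi_endo yv_nz Xi_yv)
  next
    case 3
    then show ?thesis using coef_s_sum[of "kc t_half" "av i"]
      by (simp add: Tc_s tau_def coef_endo Xi_endo av_nz Xi_av)
  qed
qed

lemma emb_cst: "emb (cst c * f) = kc c * emb f"
  by (simp add: emb_simps kc_def)

lemma T_op_quadratic:
  assumes "i \<le> n" "1 \<le> n"
  shows "T_op n i (T_op n i f) = cst (tau n i - inverse (tau n i)) * T_op n i f + f"
proof -
  have "emb (T_op n i (T_op n i f)) = emb (cst (tau n i - inverse (tau n i)) * T_op n i f + f)"
    unfolding emb_T_op[OF assms(1)] emb_simps(1) emb_cst kc_simps inverse_eq_divide
    by (rule dl_quadratic[OF Xi_endo Xi_Xi Xi_kc Tc_sum[OF assms]]) simp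
  then show ?thesis by simp
qed

lemma T_op_linear:
  assumes "i \<le> n"
  shows "T_op n i (f + g) = T_op n i f + T_op n i g" "T_op n i (cst c * f) = cst c * T_op n i f"
proof -
  have "emb (T_op n i (f + g)) = emb (T_op n i f + T_op n i g)"
    unfolding emb_T_op[OF assms] emb_simps by (simp add: dl_def endoD[OF Xi_endo] algebra_simps)
  then show "T_op n i (f + g) = T_op n i f + T_op n i g" by simp
  have "emb (T_op n i (cst c * f)) = emb (cst c * T_op n i f)"
    unfolding emb_T_op[OF assms] emb_cst by (simp add: dl_def endoD[OF Xi_endo] algebra_simps)
  then show "T_op n i (cst c * f) = cst c * T_op n i f" by simp
qed

lemma Xi_commute_of_srefl:
  assumes "\<And>\<nu>. srefl n i (srefl n j \<nu>) = srefl n j (srefl n i \<nu>)"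
     "\<And>\<nu>. qfac i (srefl n j \<nu>) * qfac j \<nu> = qfac j (srefl n i \<nu>) * qfac i \<nu>"
  shows "Xi n i (Xi n j r) = Xi n j (Xi n i r)"
proof -
  have "xi n i (xi n j f) = xi n j (xi n i f)" for f
    by (induction f rule: laurent_induct) (simp_all add: xi_simps assms flip: mult.assoc)
  then show ?thesis by (cases r) (simp add: Xi_Fract)
qed

lemma srefl_commute: "Suc i < j \<Longrightarrow> j \<le> n \<Longrightarrow> srefl n i (srefl n j \<nu>) = srefl n j (srefl n i \<nu>)"
  by (rule poly_mapping_eqI) (auto simp: lookup_srefl)

lemma Xi_commute: "Suc i < j \<Longrightarrow> j \<le> n \<Longrightarrow> Xi n i (Xi n j r) = Xi n j (Xi n i r)"
  by (rule Xi_commute_of_srefl, erule (1) srefl_commute) (auto simp: qfac_def lookup_srefl)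

lemma T_op_commute:
  assumes "Suc i < j" "j \<le> n"
  shows "T_op n i (T_op n j f) = T_op n j (T_op n i f)"
proof -
  have X: "Xi n i (Tc n j) = Tc n j"
  proof (cases "j = n")
    case True
    then have "Xi n i (yv n n) = yv n n" using assms
      by (auto simp: yv_def Xi_em qfac_def lookup_simps intro!: em_eqI)
    with True assms show ?thesis by (simp add: Tc_n coef_endo Xi_endo)
  next
    case False
    then have "Xi n i (av j) = av j" using assms
      by (auto simp: av_def Xi_em qfac_def lookup_simps intro!: em_eqI)
    with False assms show ?thesis by (simp add: Tc_s coef_endo Xi_endo)
  qed
  have Y: "Xi n j (Tc n i) = Tc n i"
  proof (cases "i = 0")
    case True
    then have "Xi n j (yv n 0) = yv n 0" using assms
      by (auto simp: yv_def Xi_em qfac_def lookup_simps intro!: em_eqI)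
    with True assms show ?thesis by (simp add: Tc_0 coef_endo Xi_endo)
  next
    case False
    then have "Xi n j (av i) = av i" using assms
      by (auto simp: av_def Xi_em qfac_def lookup_simps intro!: em_eqI)
    with False assms show ?thesis by (simp add: Tc_s coef_endo Xi_endo)
  qed
  have "emb (T_op n i (T_op n j f)) = emb (T_op n j (T_op n i f))"
    using assms by (simp add: emb_T_op, intro dl_commute Xi_commute) (simp_all add: Xi_endo X Y)
  then show ?thesis by simp
qed

lemma srefl_braid3:
  "1 \<le> i \<Longrightarrow> Suc i < n \<Longrightarrow> srefl n i (srefl n (Suc i) (srefl n i \<nu>)) = srefl n (Suc i) (srefl n i (srefl n (Suc i) \<nu>))"
  by (rule poly_mapping_eqI) (auto simp: lookup_srefl)

lemma srefl_braid4:
  assumes "i = 0 \<and> j = 1 \<or> j = n \<and> Suc i = n" "2 \<le> n"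
  shows "srefl n i (srefl n j (srefl n i (srefl n j \<nu>))) = srefl n j (srefl n i (srefl n j (srefl n i \<nu>)))"
  using assms(1)
proof (elim disjE conjE)
  assume ij: "i = 0" "j = 1"
  have n: "Suc 0 < n" using assms(2) by simp
  show ?thesis
  proof (rule poly_mapping_eqI)
    fix k :: nat
    consider "k = 1" | "k = 2" | "k \<noteq> 1" "k \<noteq> 2" by blast
    then show "Poly_Mapping.lookup (srefl n i (srefl n j (srefl n i (srefl n j \<nu>)))) k =
      Poly_Mapping.lookup (srefl n j (srefl n i (srefl n j (srefl n i \<nu>)))) k"
      by cases (use n ij in \<open>simp_all add: lookup_srefl\<close>)
  qed
next
  assume ij: "j = n" "Suc i = n"
  then have n: "i \<noteq> 0" "i < n" "n \<noteq> 0" "i \<noteq> n" using assms(2) by auto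
  show ?thesis
  proof (rule poly_mapping_eqI)
    fix k
    consider "k = i" | "k = n" | "k \<noteq> i" "k \<noteq> n" by blast
    then show "Poly_Mapping.lookup (srefl n i (srefl n j (srefl n i (srefl n j \<nu>)))) k =
      Poly_Mapping.lookup (srefl n j (srefl n i (srefl n j (srefl n i \<nu>)))) k"
      by cases (use n ij in \<open>simp_all add: lookup_srefl\<close>)
  qed
qed

lemma T_op_braid3:
  assumes "1 \<le> i" "Suc i < n"
  shows "T_op n i (T_op n (Suc i) (T_op n i f)) = T_op n (Suc i) (T_op n i (T_op n (Suc i) f))"
proof -
  have "xi n i (xi n (Suc i) (xi n i f)) = xi n (Suc i) (xi n i (xi n (Suc i) f))" for f
    using assms by (induction f rule: laurent_induct) (simp_all add: xi_simps qfac_def srefl_braid3)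
  then have X: "Xi n i (Xi n (Suc i) (Xi n i r)) = Xi n (Suc i) (Xi n i (Xi n (Suc i) r))" for r
    by (cases r) (simp add: Xi_Fract)
  have ab: "Xi n i (av i) = 1 / av i" "Xi n (Suc i) (av (Suc i)) = 1 / av (Suc i)"
     "Xi n i (av (Suc i)) = av i * av (Suc i)" "Xi n (Suc i) (av i) = av i * av (Suc i)"
    using assms by (auto simp: Xi_av) (auto simp: av_def Xi_em qfac_def em_mult lookup_simps intro!: em_eqI)
  have "av i * av (Suc i) \<noteq> 1"
    unfolding av_def em_mult by (rule em_neq_1[of _ i]) (simp_all add: lookup_simps)
  with assms ab have "emb (T_op n i (T_op n (Suc i) (T_op n i f))) = emb (T_op n (Suc i) (T_op n i (T_op n (Suc i) f)))"
    by (simp add: emb_T_op Tc_s tau_def, intro dl_braid3) (simp_all add: Xi_endo X av_nz)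
  then show ?thesis by simp
qed

lemma T_op_braid4_n:
  assumes "Suc i = n" "1 \<le> i"
  shows "T_op n i (T_op n n (T_op n i (T_op n n f))) = T_op n n (T_op n i (T_op n n (T_op n i f)))"
proof -
  have "xi n i (xi n n (xi n i (xi n n f))) = xi n n (xi n i (xi n n (xi n i f)))" for f
    using assms
  proof (induction f rule: laurent_induct)
    case (single \<nu> c)
    then show ?case using srefl_braid4[of i n n \<nu>] by (simp add: xi_simps qfac_def)
  qed (simp add: xi_simps)
  then have X: "Xi n i (Xi n n (Xi n i (Xi n n r))) = Xi n n (Xi n i (Xi n n (Xi n i r)))" for r
    by (cases r) (simp add: Xi_Fract)
  have ab: "Xi n i (av i) = 1 / av i" "Xi n n (yv n n) = 1 / yv n n"
    using assms by (auto simp: Xi_av Xi_yv)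
  have ab2: "Xi n i (yv n n) = yv n n / av i" "Xi n n (av i) = av i / (yv n n)\<^sup>2"
    using assms by (auto simp: av_def yv_def Xi_em qfac_def em_divide em_power lookup_simps intro!: em_eqI)
  have nz: "(yv n n)\<^sup>2 \<noteq> 1" "(yv n n)\<^sup>2 \<noteq> av i" "(yv n n)\<^sup>2 \<noteq> (av i)\<^sup>2"
  proof -
    show "(yv n n)\<^sup>2 \<noteq> 1" using assms by (simp add: yv_nz)
    show "(yv n n)\<^sup>2 \<noteq> av i" unfolding em_power av_def yv_def
      using assms by (simp add: em_power, intro em_neq[of _ i]) (simp_all add: lookup_simps)
    show "(yv n n)\<^sup>2 \<noteq> (av i)\<^sup>2" unfolding em_power av_def yv_def
      using assms by (simp add: em_power, intro em_neq[of _ i]) (simp_all add: lookup_simps)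
  qed
  have "emb (T_op n i (T_op n n (T_op n i (T_op n n f)))) = emb (T_op n n (T_op n i (T_op n n (T_op n i f))))"
    using assms dl_braid4[OF Xi_endo Xi_Xi Xi_kc Xi_kc Xi_kc Xi_endo Xi_Xi Xi_kc Xi_kc Xi_kc X ab(1) ab2(1) ab(2) ab2(2) _ _ _
      av_nz(1) yv_nz(1) av_nz(2) nz, of t_half tn_half un_half "emb f"]
    by (simp add: emb_T_op Tc_s Tc_n tau_def)
  then show ?thesis by simp
qed

text \<open>The double bond at node 0 is the same rank-two identity as at node n: under the
  reflections 1 and 0 the element q^{1/2}/x_1 behaves as x_n does under n-1 and n.\<close>

lemma T_op_braid4_0:
  assumes "2 \<le> n"
  shows "T_op n 1 (T_op n 0 (T_op n 1 (T_op n 0 f))) = T_op n 0 (T_op n 1 (T_op n 0 (T_op n 1 f)))"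
proof -
  have "xi n 1 (xi n 0 (xi n 1 (xi n 0 f))) = xi n 0 (xi n 1 (xi n 0 (xi n 1 f)))" for f
    using assms
  proof (induction f rule: laurent_induct)
    case (single \<nu> c)
    show ?case unfolding xi_simps
    proof (rule arg_cong2[where f = Poly_Mapping.single])
      show "srefl n 1 (srefl n 0 (srefl n 1 (srefl n 0 \<nu>))) = srefl n 0 (srefl n 1 (srefl n 0 (srefl n 1 \<nu>)))"
        by (rule srefl_braid4[symmetric]) (use assms in auto)
    qed (use assms in \<open>simp add: qfac_def lookup_srefl mult.left_commute\<close>)
  qed (simp add: xi_simps)
  then have X: "Xi n 1 (Xi n 0 (Xi n 1 (Xi n 0 r))) = Xi n 0 (Xi n 1 (Xi n 0 (Xi n 1 r)))" for r
    by (cases r) (simp add: Xi_Fract)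
  have ab: "Xi n 1 (av 1) = 1 / av 1" "Xi n 0 (yv n 0) = 1 / yv n 0"
    using assms by (auto simp: Xi_av Xi_yv)
  have ab2: "Xi n 1 (yv n 0) = yv n 0 / av 1" "Xi n 0 (av 1) = av 1 / (yv n 0)\<^sup>2"
  proof -
    show "Xi n 1 (yv n 0) = yv n 0 / av 1"
      unfolding yv_def av_def if_P[OF refl] Xi_em em_divide[OF one_neq_zero]
      by (rule em_eqI) (use assms in \<open>auto simp: qfac_def lookup_simps\<close>)
    have nz: "q_half\<^sup>2 \<noteq> 0" by simp
    show "Xi n 0 (av 1) = av 1 / (yv n 0)\<^sup>2"
      unfolding yv_def av_def if_P[OF refl] Xi_em em_power em_divide[OF nz]
      by (rule em_eqI) (use assms in \<open>auto simp: qfac_def lookup_simps power_int_minus inverse_eq_divide\<close>)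
  qed
  have nz: "(yv n 0)\<^sup>2 \<noteq> 1" "(yv n 0)\<^sup>2 \<noteq> av 1" "(yv n 0)\<^sup>2 \<noteq> (av 1)\<^sup>2"
  proof -
    show "(yv n 0)\<^sup>2 \<noteq> 1" using assms by (simp add: yv_nz)
    show "(yv n 0)\<^sup>2 \<noteq> av 1" unfolding em_power av_def yv_def
      using assms by (simp add: em_power, intro em_neq[of _ 2]) (simp_all add: lookup_simps)
    show "(yv n 0)\<^sup>2 \<noteq> (av 1)\<^sup>2" unfolding em_power av_def yv_def
      using assms by (simp add: em_power, intro em_neq[of _ 2]) (simp_all add: lookup_simps)
  qed
  have "emb (T_op n 1 (T_op n 0 (T_op n 1 (T_op n 0 f)))) = emb (T_op n 0 (T_op n 1 (T_op n 0 (T_op n 1 f))))"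
    using assms dl_braid4[OF Xi_endo Xi_Xi Xi_kc Xi_kc Xi_kc Xi_endo Xi_Xi Xi_kc Xi_kc Xi_kc X ab(1) ab2(1) ab(2) ab2(2) _ _ _
      av_nz(1) yv_nz(1) av_nz(2) nz, of t_half t0_half u0_half "emb f"]
    by (simp add: emb_T_op Tc_s Tc_0 tau_def)
  then show ?thesis by simp
qed

section \<open>Action on monomials modulo lower norm\<close>

abbreviation xm :: "vec \<Rightarrow> laurent" where "xm \<nu> \<equiv> Poly_Mapping.single \<nu> 1"

definition nrm :: "nat \<Rightarrow> vec \<Rightarrow> int" where
  "nrm n \<nu> = (\<Sum>k\<in>{1..n}. (Poly_Mapping.lookup \<nu> k)\<^sup>2)"

definition low :: "nat \<Rightarrow> vec \<Rightarrow> laurent set" where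
  "low n \<mu> = {f. \<forall>\<nu>\<in>Poly_Mapping.keys f. \<nu> \<in> lattice n \<and> nrm n \<nu> < nrm n \<mu>}"

lemma lattice_iff: "\<mu> \<in> lattice n \<longleftrightarrow> (\<forall>k. k \<notin> {1..n} \<longrightarrow> Poly_Mapping.lookup \<mu> k = 0)"
  unfolding lattice_def by (auto simp: in_keys_iff)

lemma lattice_add: "\<mu> \<in> lattice n \<Longrightarrow> \<nu> \<in> lattice n \<Longrightarrow> \<mu> + \<nu> \<in> lattice n"
  by (simp add: lattice_iff lookup_add)

lemma lattice_uminus: "- \<mu> \<in> lattice n \<longleftrightarrow> \<mu> \<in> lattice n"
  by (simp add: lattice_iff)

lemma lattice_single: "k \<in> {1..n} \<Longrightarrow> Poly_Mapping.single k a \<in> lattice n"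
  by (auto simp: lattice_iff lookup_single when_def)

lemma srefl_lattice: "i \<le> n \<Longrightarrow> 1 \<le> n \<Longrightarrow> \<mu> \<in> lattice n \<Longrightarrow> srefl n i \<mu> \<in> lattice n"
  by (auto simp: lattice_iff lookup_srefl)

lemma nrm_add_single:
  assumes "k \<in> {1..n}"
  shows "nrm n (\<mu> + Poly_Mapping.single k a) = nrm n \<mu> + 2 * a * Poly_Mapping.lookup \<mu> k + a\<^sup>2"
proof -
  have "nrm n (\<mu> + Poly_Mapping.single k a) = (\<Sum>j\<in>{1..n}. (Poly_Mapping.lookup \<mu> j)\<^sup>2 + (if k = j then 2 * a * Poly_Mapping.lookup \<mu> k + a\<^sup>2 else 0))"
    unfolding nrm_def by (intro sum.cong) (auto simp: lookup_add lookup_single when_def power2_sum)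
  then show ?thesis using assms by (simp add: sum.distrib nrm_def)
qed

lemma low_add: "f \<in> low n \<mu> \<Longrightarrow> g \<in> low n \<mu> \<Longrightarrow> f + g \<in> low n \<mu>"
  using keys_add[of f g] by (auto simp: low_def)

lemma low_0: "0 \<in> low n \<mu>"
  by (simp add: low_def)

lemma low_sum: "(\<And>k. k \<in> A \<Longrightarrow> f k \<in> low n \<mu>) \<Longrightarrow> (\<Sum>k\<in>A. f k) \<in> low n \<mu>"
  by (induction A rule: infinite_finite_induct) (auto intro: low_add low_0)

lemma keys_cst_mult: "Poly_Mapping.keys (cst c * f) \<subseteq> Poly_Mapping.keys f"
  by (auto simp: in_keys_iff lookup_cst_mult)

lemma low_cst: "f \<in> low n \<mu> \<Longrightarrow> cst c * f \<in> low n \<mu>"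
  using keys_cst_mult[of c f] by (auto simp: low_def)

lemma low_uminus: "f \<in> low n \<mu> \<Longrightarrow> - f \<in> low n \<mu>"
  using low_cst[of f n \<mu> "- 1"] by (simp add: cst_simps)

lemma low_single: "\<nu> \<in> lattice n \<Longrightarrow> nrm n \<nu> < nrm n \<mu> \<Longrightarrow> Poly_Mapping.single \<nu> c \<in> low n \<mu>"
  by (auto simp: low_def)

lemma low_mono: "nrm n \<mu> \<le> nrm n \<nu> \<Longrightarrow> f \<in> low n \<mu> \<Longrightarrow> f \<in> low n \<nu>"
  by (force simp: low_def)

text \<open>Clears the denominator, so that an asserted value of T_i is checked as an identity of
  Laurent polynomials.\<close>

lemma T_op_char:
  assumes "i \<le> n" "Tden n i * (cst ((tau n i)\<^sup>2) * f - cst (tau n i) * g) = Tnum n i * (f - xi n i f)"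
  shows "T_op n i f = g"
proof -
  obtain h where h: "h * Tden n i = f - xi n i f"
    "T_op n i f = cst (inverse (tau n i)) * (cst ((tau n i)\<^sup>2) * f - Tnum n i * h)"
    using T_op_obtain[OF assms(1)] by blast
  have "Tden n i * (cst ((tau n i)\<^sup>2) * f - cst (tau n i) * g) = Tden n i * (Tnum n i * h)"
    unfolding assms(2) h(1)[symmetric] by (simp add: mult_ac)
  then have "cst ((tau n i)\<^sup>2) * f - cst (tau n i) * g = Tnum n i * h"
    using Tden_nz[OF assms(1)] by (simp only: mult_cancel_left) blast
  then have "cst (tau n i) * g = cst ((tau n i)\<^sup>2) * f - Tnum n i * h"
    by (simp add: algebra_simps)
  then have "T_op n i f = (cst (inverse (tau n i)) * cst (tau n i)) * g"
    unfolding h(2) by (metis mult.assoc)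
  then show ?thesis by (simp flip: cst_simps(4) add: cst_simps(1))
qed

text \<open>The divided difference vanishes on invariants. This transfers the action of T_i from one
  monomial to its mirror image.\<close>

lemma T_op_invariant:
  assumes "i \<le> n"
  shows "T_op n i (f + xi n i f) = cst (tau n i) * (f + xi n i f)"
  by (rule T_op_char[OF assms]) (simp add: xi_simps cst_simps power2_eq_square add.commute mult.assoc)

lemma xm_power: "xm (Poly_Mapping.single k a) ^ m = xm (Poly_Mapping.single k (int m * a))"
  using single_single_power[of k a 1 m] by simp

text \<open>The sum runs over the interior of the string from X^d to Z^d; it supplies the lower
  terms of T_i on a monomial.\<close>

lemma geo2:
  fixes X Z :: "'a::idom"
  shows "1 \<le> d \<Longrightarrow> (Z - X) * (\<Sum>k\<in>{1..<d}. Z ^ k * X ^ (d - k)) = X * Z ^ d - Z * X ^ d"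
proof (induction d rule: nat_induct_at_least)
  case (Suc d)
  have "(\<Sum>k\<in>{1..<Suc d}. Z ^ k * X ^ (Suc d - k)) = (\<Sum>k\<in>{1..<d}. X * (Z ^ k * X ^ (d - k))) + Z ^ d * X"
    using Suc by (simp add: Suc_diff_le mult_ac)
  then have "(\<Sum>k\<in>{1..<Suc d}. Z ^ k * X ^ (Suc d - k)) = X * (\<Sum>k\<in>{1..<d}. Z ^ k * X ^ (d - k)) + Z ^ d * X"
    by (simp add: sum_distrib_left)
  then have "(Z - X) * (\<Sum>k\<in>{1..<Suc d}. Z ^ k * X ^ (Suc d - k)) = X * (X * Z ^ d - Z * X ^ d) + (Z - X) * Z ^ d * X"
    using Suc.IH by (simp add: distrib_left mult_ac)
  then show ?case by (simp add: algebra_simps)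
qed simp

text \<open>The pairing with the simple root \<open>sroot n i\<close>; for \<open>i = n\<close> this
  root is the unit vector itself and not its double.\<close>

definition dval :: "nat \<Rightarrow> nat \<Rightarrow> vec \<Rightarrow> int" where
  "dval n i \<mu> = (if i = n then Poly_Mapping.lookup \<mu> n else Poly_Mapping.lookup \<mu> i - Poly_Mapping.lookup \<mu> (Suc i))"

text \<open>All remaining monomials lie strictly between \<mu> and its reflection on the root
  string, where the norm is smaller.\<close>

lemma T_mono_pos_s:
  assumes "1 \<le> i" "i < n" "\<mu> \<in> lattice n" "0 < dval n i \<mu>"
  shows "\<exists>L\<in>low n \<mu>. T_op n i (xm \<mu>) = cst (inverse (tau n i)) * xm (srefl n i \<mu>) + L"
proof -
  obtain d where d: "dval n i \<mu> = int d" "1 \<le> d" using assms(4)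
    by (metis One_nat_def Suc_leI of_nat_0_less_iff zero_less_imp_eq_int)
  have d': "Poly_Mapping.lookup \<mu> i - Poly_Mapping.lookup \<mu> (Suc i) = int d" using d assms by (simp add: dval_def)
  define t where "t = tau n i"
  define M where "M = xm (\<mu> - Poly_Mapping.single i (int d))"
  define Q where "Q = (\<Sum>k\<in>{1..<d}. var (Suc i) ^ k * var i ^ (d - k))"
  define L where "L = cst (inverse t - t) * (M * Q)"
  have X: "xm \<mu> = M * var i ^ d" and Z: "xm (srefl n i \<mu>) = M * var (Suc i) ^ d"
    unfolding M_def var_def xm_power mult_single using assms d'
    by (auto intro!: arg_cong[where f = xm] poly_mapping_eqI simp: lookup_simps split: if_splits)
  have Q: "(var (Suc i) - var i) * Q = var i * var (Suc i) ^ d - var (Suc i) * var i ^ d"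
    unfolding Q_def by (rule geo2[OF d(2)])
  have t: "t \<noteq> 0" "tau n i = t" "t_half = t" using assms by (auto simp: t_def tau_def)
  define c c' where "c = cst t" and "c' = cst (inverse t)"
  have cc: "c * c' = 1" using t by (simp add: c_def c'_def cst_simps(1) flip: cst_simps(4))
  have "T_op n i (xm \<mu>) = cst (inverse t) * xm (srefl n i \<mu>) + L"
  proof (rule T_op_char)
    show "Tden n i * (cst ((tau n i)\<^sup>2) * xm \<mu> - cst (tau n i) * (cst (inverse t) * xm (srefl n i \<mu>) + L)) =
       Tnum n i * (xm \<mu> - xi n i (xm \<mu>))"
    proof -
      have "xi n i (xm \<mu>) = M * var (Suc i) ^ d" using assms by (simp add: xi_simps qfac_def flip: Z)
      moreover have TT: "Tden n i = var (Suc i) - var i" "Tnum n i = var (Suc i) - c\<^sup>2 * var i"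
        using assms t by (simp_all add: Tden_def Tnum_def c_def cst_simps)
      moreover define z x where "z = var (Suc i) ^ d" and "x = var i ^ d"
      ultimately show ?thesis
        using cc Q unfolding X Z L_def t cst_simps c_def[symmetric] c'_def[symmetric] TT z_def[symmetric] x_def[symmetric]
        by algebra
    qed
  qed (use assms in simp)
  moreover have "L \<in> low n \<mu>"
  proof -
    have "M * (var (Suc i) ^ k * var i ^ (d - k)) \<in> low n \<mu>" if k: "k \<in> {1..<d}" for k
    proof -
      have "M * (var (Suc i) ^ k * var i ^ (d - k)) = xm (\<mu> + Poly_Mapping.single i (- int k) + Poly_Mapping.single (Suc i) (int k))"
        unfolding M_def var_def xm_power mult_single using k
        by (auto intro!: arg_cong[where f = xm] poly_mapping_eqI simp: lookup_simps of_nat_diff split: if_splits)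
      \<comment> \<open>Convexity: the k-th interior point of a string of length d loses 2 k (d -
        k).\<close>
      moreover have "nrm n (\<mu> + Poly_Mapping.single i (- int k) + Poly_Mapping.single (Suc i) (int k))
         = nrm n \<mu> - 2 * (int k * (int d - int k))"
        using assms d' nrm_add_single[of "Suc i" n "\<mu> + Poly_Mapping.single i (- int k)" "int k"] nrm_add_single[of i n \<mu> "- int k"]
        by (simp add: lookup_simps power2_eq_square) (simp add: algebra_simps)
      moreover have "0 < int k * (int d - int k)" using k by simp
      moreover have "\<mu> + Poly_Mapping.single i (- int k) + Poly_Mapping.single (Suc i) (int k) \<in> lattice n"
        using assms by (intro lattice_add lattice_single) auto
      ultimately show ?thesis by (auto intro!: low_single)
    qed
    then show ?thesis unfolding L_def Q_def sum_distrib_left by (intro low_sum low_cst)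
  qed
  ultimately show ?thesis unfolding t_def by blast
qed

lemma geo:
  fixes w :: "'a::comm_ring_1"
  shows "(1 - w) * (\<Sum>k<d. w ^ k) = 1 - w ^ d"
  by (simp add: one_diff_power_eq)

lemma sum_lessThan_split: fixes d :: nat shows "1 \<le> d \<Longrightarrow> (\<Sum>k<d. f k) = f 0 + (\<Sum>k\<in>{1..<d}. f k :: 'a::comm_monoid_add)"
  using sum.atLeast_Suc_lessThan[of 0 d f] by (simp add: atLeast0LessThan)

lemma T_mono_pos_n:
  assumes "1 \<le> n" "\<mu> \<in> lattice n" "0 < Poly_Mapping.lookup \<mu> n"
  shows "\<exists>L\<in>low n \<mu>. T_op n n (xm \<mu>) = cst (inverse (tau n n)) * xm (srefl n n \<mu>) + L"
proof -
  obtain d where d: "Poly_Mapping.lookup \<mu> n = int d" "1 \<le> d" using assms(3)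
    by (metis One_nat_def Suc_leI of_nat_0_less_iff zero_less_imp_eq_int)
  define t where "t = tau n n"
  define M where "M = xm (srefl n n \<mu>)"
  define x where "x = var n"
  define P Q where "P = (\<Sum>k<d. (x\<^sup>2) ^ k)" and "Q = (\<Sum>k\<in>{1..<d}. (x\<^sup>2) ^ k)"
  have PQ: "P = 1 + Q" "(1 - x\<^sup>2) * P = 1 - (x\<^sup>2) ^ d"
    unfolding P_def Q_def using d(2) by (simp add: sum_lessThan_split) (rule geo)
  define A B where "A = tn_half * inverse un_half" and "B = tn_half * un_half"
  \<comment> \<open>From (1 + A x)(1 - B x) = 1 + (A - B) x - t^2 x^2, where A B = t^2: the even
    part produces \<open>Q\<close> and the odd part \<open>P\<close>.\<close>
  define L where "L = cst (inverse t) * (cst (1 - t\<^sup>2) * (M * Q) + cst (A - B) * (M * (x * P)))"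
  have X: "xm \<mu> = M * (x\<^sup>2) ^ d"
    unfolding M_def x_def var_def xm_power mult_single using assms d
    by (auto intro!: arg_cong[where f = xm] poly_mapping_eqI simp: lookup_simps split: if_splits)
  have t: "t \<noteq> 0" "tau n n = t" "A * B = t\<^sup>2" using assms by (auto simp: t_def tau_def A_def B_def power2_eq_square)
  define c c' a b where "c = cst t" and "c' = cst (inverse t)" and "a = cst A" and "b = cst B"
  have cc: "c * c' = 1" "a * b = c\<^sup>2" using t by (simp_all add: c_def c'_def a_def b_def cst_simps(1) flip: cst_simps(4,7))
  have "T_op n n (xm \<mu>) = cst (inverse t) * xm (srefl n n \<mu>) + L"
  proof (rule T_op_char)
    show "Tden n n * (cst ((tau n n)\<^sup>2) * xm \<mu> - cst (tau n n) * (cst (inverse t) * xm (srefl n n \<mu>) + L)) =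
       Tnum n n * (xm \<mu> - xi n n (xm \<mu>))"
    proof -
      have XM: "xi n n (xm \<mu>) = M" using assms by (simp add: xi_simps qfac_def M_def)
      have TT: "Tden n n = 1 - x\<^sup>2" "Tnum n n = (1 + a * x) * (1 - b * x)"
        using assms t by (simp_all add: Tden_def Tnum_def a_def b_def A_def B_def x_def)
      define z where "z = (x\<^sup>2) ^ d"
      show ?thesis
        using cc PQ unfolding XM
        unfolding X M_def[symmetric] L_def t cst_simps c_def[symmetric] c'_def[symmetric] a_def[symmetric] b_def[symmetric] TT z_def[symmetric]
        by algebra
    qed
  qed (use assms in simp)
  moreover have "L \<in> low n \<mu>"
  proof -
    have *: "xm (srefl n n \<mu> + Poly_Mapping.single n (int j)) \<in> low n \<mu>" if j: "0 < j" "j < 2 * d" for j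
    proof -
      have "nrm n (srefl n n \<mu>) = nrm n \<mu>"
        unfolding nrm_def by (intro sum.cong) (auto simp: lookup_srefl)
      then have "nrm n (srefl n n \<mu> + Poly_Mapping.single n (int j)) = nrm n \<mu> - int j * (2 * int d - int j)"
        using assms d nrm_add_single[of n n "srefl n n \<mu>" "int j"]
        by (simp add: lookup_simps power2_eq_square algebra_simps)
      moreover have "0 < int j * (2 * int d - int j)" using j by simp
      moreover have "srefl n n \<mu> + Poly_Mapping.single n (int j) \<in> lattice n"
        using assms by (intro lattice_add lattice_single srefl_lattice) auto
      ultimately show ?thesis by (auto intro!: low_single)
    qed
    have "M * (x\<^sup>2) ^ k \<in> low n \<mu>" if "k \<in> {1..<d}" for k
      using *[of "2 * k"] that by (simp add: M_def x_def var_def xm_power mult_single mult.commute)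
    moreover have "M * (x * (x\<^sup>2) ^ k) \<in> low n \<mu>" if "k < d" for k
      using *[of "2 * k + 1"] that
      by (simp add: M_def x_def var_def xm_power mult_single mult.commute add.commute flip: single_add)
    ultimately show ?thesis unfolding L_def Q_def P_def sum_distrib_left
      by (intro low_sum low_cst low_add) auto
  qed
  ultimately show ?thesis unfolding t_def by blast
qed

text \<open>The gradient of the affine simple root is the negative of the first unit vector, so for
  T_0 the roles of positive and negative entries are exchanged.\<close>

lemma T0_mono_neg:
  assumes "1 \<le> n" "\<mu> \<in> lattice n" "Poly_Mapping.lookup \<mu> 1 < 0"
  shows "\<exists>L\<in>low n \<mu>. T_op n 0 (xm \<mu>) = cst (inverse (tau n 0) * q_par powi Poly_Mapping.lookup \<mu> 1) * xm (srefl n 0 \<mu>) + L"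
proof -
  obtain d where d: "Poly_Mapping.lookup \<mu> 1 = - int d" "1 \<le> d" using assms(3)
    by (metis One_nat_def Suc_leI neg_int_cases of_nat_0_less_iff of_nat_1)
  define t where "t = tau n 0"
  define M where "M = xm \<mu>"
  define x where "x = var 1"
  define qi where "qi = cst (inverse q_par)"
  have qi: "cst q_par * qi = 1" by (simp add: qi_def cst_simps(1) flip: cst_simps(4))
  define w where "w = qi * x\<^sup>2"
  define P Q where "P = (\<Sum>k<d. w ^ k)" and "Q = (\<Sum>k\<in>{1..<d}. w ^ k)"
  have PQ: "P = 1 + Q" "(1 - w) * P = 1 - w ^ d"
    unfolding P_def Q_def using d(2) by (simp add: sum_lessThan_split) (rule geo)
  define A B where "A = q_half * t0_half * inverse u0_half" and "B = q_half * t0_half * u0_half"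
  define L where "L = cst (inverse t) * (cst (1 - t\<^sup>2) * (M * Q) + cst (inverse q_par * (A - B)) * (M * (x * P)))"
  have X: "xi n 0 (xm \<mu>) = M * w ^ d"
    unfolding M_def w_def qi_def cst_def x_def var_def xi_simps using assms d
    apply (simp add: xm_power power_mult_distrib single_single_power mult_single qfac_def)
    by (auto intro!: arg_cong2[where f = Poly_Mapping.single] poly_mapping_eqI simp: lookup_simps power_int_minus power_inverse split: if_splits simp flip: single_add)
  have X2: "cst (q_par powi Poly_Mapping.lookup \<mu> 1) * xm (srefl n 0 \<mu>) = M * w ^ d"
    unfolding X[symmetric] by (simp add: xi_simps qfac_def cst_single)
  have t: "t \<noteq> 0" "tau n 0 = t" "A * B = q_par * t\<^sup>2" by (auto simp: t_def tau_def A_def B_def power2_eq_square)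
  define c c' a b p where "c = cst t" and "c' = cst (inverse t)" and "a = cst A" and "b = cst B" and "p = cst q_par"
  have cc: "c * c' = 1" "a * b = p * c\<^sup>2" "p * qi = 1" "w = qi * x\<^sup>2" using t qi
    by (simp_all add: c_def c'_def a_def b_def p_def w_def cst_simps(1) flip: cst_simps(4,7))
  have "T_op n 0 (xm \<mu>) = cst (inverse t) * (M * w ^ d) + L"
  proof (rule T_op_char)
    show "Tden n 0 * (cst ((tau n 0)\<^sup>2) * xm \<mu> - cst (tau n 0) * (cst (inverse t) * (M * w ^ d) + L)) =
       Tnum n 0 * (xm \<mu> - xi n 0 (xm \<mu>))"
    proof -
      have TT: "Tden n 0 = x\<^sup>2 - p" "Tnum n 0 = (x + a) * (x - b)"
        by (simp_all add: Tden_def Tnum_def a_def b_def A_def B_def x_def p_def)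
      define z where "z = w ^ d"
      show ?thesis
        using cc PQ unfolding X unfolding M_def[symmetric] L_def t cst_simps c_def[symmetric] c'_def[symmetric] a_def[symmetric] b_def[symmetric]
         qi_def[symmetric] TT z_def[symmetric]
        by algebra
    qed
  qed simp
  moreover have "L \<in> low n \<mu>"
  proof -
    have *: "Poly_Mapping.single (\<mu> + Poly_Mapping.single 1 (int j)) c \<in> low n \<mu>" if j: "0 < j" "j < 2 * d" for j c
    proof -
      have "nrm n (\<mu> + Poly_Mapping.single 1 (int j)) = nrm n \<mu> - int j * (2 * int d - int j)"
        using assms d by (simp add: nrm_add_single lookup_simps power2_eq_square algebra_simps)
      moreover have "0 < int j * (2 * int d - int j)" using j by simp
      moreover have "\<mu> + Poly_Mapping.single 1 (int j) \<in> lattice n"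
        using assms by (intro lattice_add lattice_single) auto
      ultimately show ?thesis by (auto intro!: low_single)
    qed
    have "M * w ^ k \<in> low n \<mu>" if "k \<in> {1..<d}" for k
      using *[of "2 * k"] that by (simp add: M_def w_def qi_def cst_def x_def var_def power_mult_distrib single_single_power mult_single mult.commute)
    moreover have "M * (x * w ^ k) \<in> low n \<mu>" if "k < d" for k
      using *[of "2 * k + 1"] that
      by (simp add: M_def w_def qi_def cst_def x_def var_def power_mult_distrib single_single_power mult_single mult.commute add.commute flip: single_add)
    ultimately show ?thesis unfolding L_def Q_def P_def sum_distrib_left
      by (intro low_sum low_cst low_add) auto
  qed
  ultimately show ?thesis unfolding t_def cst_simps(4) mult.assoc X2 by blast
qed

lemma dval_srefl: "1 \<le> i \<Longrightarrow> i \<le> n \<Longrightarrow> dval n i (srefl n i \<mu>) = - dval n i \<mu>"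
  by (auto simp: dval_def lookup_srefl)

lemma nrm_srefl:
  assumes "i \<le> n" "1 \<le> n"
  shows "nrm n (srefl n i \<mu>) = nrm n \<mu>"
proof (cases "i = 0 \<or> i = n")
  case True
  then show ?thesis unfolding nrm_def by (intro sum.cong) (auto simp: lookup_srefl)
next
  case False
  then have i: "1 \<le> i" "i < n" using assms by auto
  define p where "p = (\<lambda>k. if k = i then Suc i else if k = Suc i then i else k)"
  have "nrm n (srefl n i \<mu>) = (\<Sum>k\<in>{1..n}. (Poly_Mapping.lookup \<mu> (p k))\<^sup>2)"
    unfolding nrm_def p_def using i by (intro sum.cong) (auto simp: lookup_srefl)
  also have "\<dots> = nrm n \<mu>" unfolding nrm_def
    by (rule sum.reindex_bij_witness[of _ p p]) (use i in \<open>auto simp: p_def\<close>)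
  finally show ?thesis .
qed

lemma T_mono_pos:
  assumes "1 \<le> i" "i \<le> n" "\<mu> \<in> lattice n" "0 < dval n i \<mu>"
  shows "\<exists>L\<in>low n \<mu>. T_op n i (xm \<mu>) = cst (inverse (tau n i)) * xm (srefl n i \<mu>) + L"
  using assms T_mono_pos_s[of i n \<mu>] T_mono_pos_n[of n \<mu>]
  by (cases "i = n") (auto simp: dval_def)

lemma T_mono_zero:
  assumes "1 \<le> i" "i \<le> n" "dval n i \<mu> = 0"
  shows "srefl n i \<mu> = \<mu>" "T_op n i (xm \<mu>) = cst (tau n i) * xm \<mu>"
proof -
  show s: "srefl n i \<mu> = \<mu>"
    by (rule poly_mapping_eqI) (use assms in \<open>auto simp: lookup_srefl dval_def split: if_splits\<close>)
  show "T_op n i (xm \<mu>) = cst (tau n i) * xm \<mu>"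
    using assms by (intro T_op_char) (simp_all add: xi_simps s qfac_def cst_simps power2_eq_square mult.assoc)
qed

lemma T_mono_neg:
  assumes "1 \<le> i" "i \<le> n" "\<mu> \<in> lattice n" "dval n i \<mu> < 0"
  shows "\<exists>L\<in>low n \<mu>. T_op n i (xm \<mu>) = cst (tau n i - inverse (tau n i)) * xm \<mu> + cst (tau n i) * xm (srefl n i \<mu>) + L"
proof -
  have "0 < dval n i (srefl n i \<mu>)" "srefl n i \<mu> \<in> lattice n"
    using assms by (auto simp: dval_srefl srefl_lattice)
  then obtain L where L: "L \<in> low n (srefl n i \<mu>)"
     "T_op n i (xm (srefl n i \<mu>)) = cst (inverse (tau n i)) * xm \<mu> + L"
    using T_mono_pos[of i n "srefl n i \<mu>"] assms by auto
  have "T_op n i (xm \<mu>) + T_op n i (xm (srefl n i \<mu>)) = cst (tau n i) * (xm \<mu> + xm (srefl n i \<mu>))"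
    using T_op_invariant[of i n "xm \<mu>"] assms by (simp add: T_op_linear xi_simps qfac_def)
  then have "T_op n i (xm \<mu>) = cst (tau n i - inverse (tau n i)) * xm \<mu> + cst (tau n i) * xm (srefl n i \<mu>) + (- L)"
    unfolding L(2) by (simp add: algebra_simps cst_simps)
  moreover have "- L \<in> low n \<mu>" using L(1) assms by (auto intro!: low_uminus elim!: low_mono[rotated] simp: nrm_srefl)
  ultimately show ?thesis by blast
qed

lemma T0_mono_zero:
  assumes "Poly_Mapping.lookup \<mu> 1 = 0"
  shows "srefl n 0 \<mu> = \<mu>" "T_op n 0 (xm \<mu>) = cst (tau n 0) * xm \<mu>"
proof -
  show s: "srefl n 0 \<mu> = \<mu>"
    by (rule poly_mapping_eqI) (use assms in \<open>auto simp: lookup_srefl\<close>)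
  show "T_op n 0 (xm \<mu>) = cst (tau n 0) * xm \<mu>"
    using assms by (intro T_op_char) (simp_all add: xi_simps s qfac_def cst_simps power2_eq_square mult.assoc)
qed

lemma T0_mono_pos:
  assumes "1 \<le> n" "\<mu> \<in> lattice n" "0 < Poly_Mapping.lookup \<mu> 1"
  shows "\<exists>L\<in>low n \<mu>. T_op n 0 (xm \<mu>) = cst (tau n 0 - inverse (tau n 0)) * xm \<mu>
    + cst (tau n 0 * q_par powi Poly_Mapping.lookup \<mu> 1) * xm (srefl n 0 \<mu>) + L"
proof -
  define m where "m = Poly_Mapping.lookup \<mu> 1"
  have m: "Poly_Mapping.lookup (srefl n 0 \<mu>) 1 = - m" by (simp add: lookup_srefl m_def)
  have "srefl n 0 \<mu> \<in> lattice n" using assms by (auto simp: srefl_lattice)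
  then obtain L where L: "L \<in> low n (srefl n 0 \<mu>)"
     "T_op n 0 (xm (srefl n 0 \<mu>)) = cst (inverse (tau n 0) * q_par powi (- m)) * xm \<mu> + L"
    using T0_mono_neg[of n "srefl n 0 \<mu>"] assms m unfolding srefl_srefl m by (auto simp: m_def)
  have x: "xi n 0 (xm \<mu>) = cst (q_par powi m) * xm (srefl n 0 \<mu>)"
    by (simp add: xi_simps qfac_def m_def cst_single)
  have "T_op n 0 (xm \<mu>) + cst (q_par powi m) * T_op n 0 (xm (srefl n 0 \<mu>))
     = cst (tau n 0) * (xm \<mu> + cst (q_par powi m) * xm (srefl n 0 \<mu>))"
    using T_op_invariant[of 0 n "xm \<mu>"] unfolding x by (simp add: T_op_linear)
  moreover have "cst (q_par powi m) * cst (inverse (tau n 0) * q_par powi (- m)) = cst (inverse (tau n 0))"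
    by (simp add: power_int_minus flip: cst_simps)
  ultimately have "T_op n 0 (xm \<mu>) = cst (tau n 0 - inverse (tau n 0)) * xm \<mu>
    + cst (tau n 0 * q_par powi m) * xm (srefl n 0 \<mu>) + cst (- (q_par powi m)) * L"
    unfolding L(2) cst_simps by algebra
  moreover have "cst (- (q_par powi m)) * L \<in> low n \<mu>" using L(1) assms
    by (intro low_cst, elim low_mono[rotated]) (simp add: nrm_srefl)
  ultimately show ?thesis unfolding m_def by blast
qed

section \<open>Positive roots and the lexicographic order\<close>

definition scal :: "int \<Rightarrow> vec \<Rightarrow> vec" where
  "scal a \<mu> = Poly_Mapping.map ((*) a) \<mu>"

lemma lookup_scal [simp]: "Poly_Mapping.lookup (scal a \<mu>) k = a * Poly_Mapping.lookup \<mu> k"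
  by (simp add: scal_def map.rep_eq when_def)

text \<open>The order on finitely supported functions is decided by the smallest index at which they
  differ. The roots e_i and e_i + e_j, e_i - e_j with i < j are positive in this order, so it can
  serve as the notion of a positive root.\<close>

lemma vec_pos_iff: "0 < (\<beta>::vec) \<longleftrightarrow> (\<exists>k. 0 < Poly_Mapping.lookup \<beta> k \<and> (\<forall>j<k. Poly_Mapping.lookup \<beta> j = 0))"
  by (auto simp: less_poly_mapping.rep_eq less_fun_def)

lemma scal_pos: "0 < a \<Longrightarrow> 0 < \<beta> \<Longrightarrow> 0 < scal a \<beta>"
  unfolding vec_pos_iff by (metis lookup_scal mult_pos_pos mult_zero_right)

definition pair :: "nat \<Rightarrow> vec \<Rightarrow> vec \<Rightarrow> int" where
  "pair n \<mu> \<beta> = (\<Sum>k\<in>{1..n}. Poly_Mapping.lookup \<mu> k * Poly_Mapping.lookup \<beta> k)"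

definition sroot :: "nat \<Rightarrow> nat \<Rightarrow> vec" where
  "sroot n i = (if i = n then Poly_Mapping.single n 1 else Poly_Mapping.single i 1 - Poly_Mapping.single (Suc i) 1)"

lemma srefl_simple [simp]: "i \<noteq> 0 \<Longrightarrow> srefl n i = simple_refl n i"
  by (simp add: srefl_def fun_eq_iff)

lemma pair_add: "pair n \<mu> (\<beta> + \<gamma>) = pair n \<mu> \<beta> + pair n \<mu> \<gamma>"
  and pair_minus: "pair n \<mu> (\<beta> - \<gamma>) = pair n \<mu> \<beta> - pair n \<mu> \<gamma>"
  and pair_uminus: "pair n \<mu> (- \<beta>) = - pair n \<mu> \<beta>"
  by (simp_all add: pair_def lookup_add lookup_minus algebra_simps sum.distrib sum_subtractf sum_negf)

lemma pair_single: "k \<in> {1..n} \<Longrightarrow> pair n \<mu> (Poly_Mapping.single k a) = a * Poly_Mapping.lookup \<mu> k"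
  by (simp add: pair_def lookup_single when_def if_distrib mult.commute cong: if_cong)

lemma pair_sroot: "1 \<le> i \<Longrightarrow> i \<le> n \<Longrightarrow> pair n \<mu> (sroot n i) = dval n i \<mu>"
  by (simp add: sroot_def dval_def pair_minus pair_single)

lemma sroot_lattice: "1 \<le> i \<Longrightarrow> i \<le> n \<Longrightarrow> sroot n i \<in> lattice n"
  by (auto simp: sroot_def lattice_iff lookup_simps)

lemma nrm_sroot:
  assumes "1 \<le> i" "i \<le> n" shows "nrm n (sroot n i) = (if i = n then 1 else 2)"
proof -
  have z: "nrm n 0 = 0" by (simp add: nrm_def)
  show ?thesis
  proof (cases "i = n")
    case True
    then show ?thesis using nrm_add_single[of n n 0 1] assms z by (simp add: sroot_def)
  next
    case False
    have "sroot n i = (0 + Poly_Mapping.single i 1) + Poly_Mapping.single (Suc i) (- 1)"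
      using False by (simp add: sroot_def single_uminus)
    then have "nrm n (sroot n i) = nrm n (0 + Poly_Mapping.single i 1) + 1"
      using nrm_add_single[of "Suc i" n "0 + Poly_Mapping.single i 1" "- 1"] assms False
      by (simp add: lookup_single)
    then show ?thesis using nrm_add_single[of i n 0 1] assms z False by simp
  qed
qed

lemma sroot_pos: "0 < sroot n i"
  by (auto simp: sroot_def vec_pos_iff lookup_simps intro!: exI[of _ i])

lemma simple_refl_sroot: "1 \<le> i \<Longrightarrow> i \<le> n \<Longrightarrow> simple_refl n i (sroot n i) = - sroot n i"
  by (rule poly_mapping_eqI) (auto simp: sroot_def lookup_simple_refl lookup_simps)

lemma simple_refl_eq: "1 \<le> i \<Longrightarrow> i \<le> n \<Longrightarrow>
    simple_refl n i \<mu> = \<mu> - scal ((if i = n then 2 else 1) * dval n i \<mu>) (sroot n i)"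
  by (rule poly_mapping_eqI) (auto simp: sroot_def lookup_simple_refl lookup_simps dval_def split: if_splits)

lemma sum_squares_1:
  fixes f :: "'a \<Rightarrow> int"
  assumes "finite A" "(\<Sum>k\<in>A. (f k)\<^sup>2) = 1"
  shows "\<exists>j\<in>A. \<bar>f j\<bar> = 1 \<and> (\<forall>k\<in>A - {j}. f k = 0)"
proof -
  have "\<exists>j\<in>A. f j \<noteq> 0" using assms(2) by (rule contrapos_pp) simp
  then obtain j where j: "j \<in> A" "f j \<noteq> 0" by blast
  then have s: "(\<Sum>k\<in>A. (f k)\<^sup>2) = (f j)\<^sup>2 + (\<Sum>k\<in>A - {j}. (f k)\<^sup>2)" using assms by (simp add: sum.remove)
  have "1 \<le> (f j)\<^sup>2" using j by (simp add: int_one_le_iff_zero_less)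
  moreover have "0 \<le> (\<Sum>k\<in>A - {j}. (f k)\<^sup>2)" by (simp add: sum_nonneg)
  ultimately have e: "(f j)\<^sup>2 = 1" "(\<Sum>k\<in>A - {j}. (f k)\<^sup>2) = 0" using s assms by linarith+
  have "\<forall>k\<in>A - {j}. f k = 0" using e(2) assms(1) by (simp add: sum_nonneg_eq_0_iff)
  moreover have "\<bar>f j\<bar> = 1" using e(1) by (auto simp: power2_eq_1_iff)
  ultimately show ?thesis using j by blast
qed

text \<open>By integrality, a positive leading entry whose square is at most 2 equals 1.\<close>

lemma pos_root_leading:
  assumes "\<beta> \<in> lattice n" "nrm n \<beta> \<le> 2" "0 < \<beta>"
  obtains k where "k \<in> {1..n}" "Poly_Mapping.lookup \<beta> k = 1" "\<forall>j<k. Poly_Mapping.lookup \<beta> j = 0"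
     "(\<Sum>j\<in>{1..n} - {k}. (Poly_Mapping.lookup \<beta> j)\<^sup>2) = nrm n \<beta> - 1"
proof -
  obtain k where k: "0 < Poly_Mapping.lookup \<beta> k" "\<forall>j<k. Poly_Mapping.lookup \<beta> j = 0"
    using assms(3) by (auto simp: vec_pos_iff)
  have kn: "k \<in> {1..n}" using k(1) assms(1) unfolding lattice_iff by (metis less_irrefl)
  have s: "nrm n \<beta> = (Poly_Mapping.lookup \<beta> k)\<^sup>2 + (\<Sum>j\<in>{1..n} - {k}. (Poly_Mapping.lookup \<beta> j)\<^sup>2)"
    unfolding nrm_def using kn by (simp add: sum.remove)
  have "0 \<le> (\<Sum>j\<in>{1..n} - {k}. (Poly_Mapping.lookup \<beta> j)\<^sup>2)" by (simp add: sum_nonneg)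
  then have "(Poly_Mapping.lookup \<beta> k)\<^sup>2 \<le> 2" using s assms(2) by linarith
  then have "Poly_Mapping.lookup \<beta> k < 2"
    using power_mono[of 2 "Poly_Mapping.lookup \<beta> k" 2] by (cases "Poly_Mapping.lookup \<beta> k < 2") auto
  then have "Poly_Mapping.lookup \<beta> k = 1" using k(1) by simp
  then show ?thesis using that[of k] kn k s by simp
qed

text \<open>Described by norm and sign, roots are easily followed under the Weyl group: it preserves
  the lattice and the norm, and only the sign remains to be decided.\<close>

lemma roots_d_eq: "roots_d n = {\<beta> \<in> lattice n. nrm n \<beta> = 1 \<and> 0 < \<beta>}"
proof safe
  have z: "nrm n 0 = 0" by (simp add: nrm_def)
  fix \<beta> assume "\<beta> \<in> roots_d n"
  then obtain i where i: "1 \<le> i" "i \<le> n" "\<beta> = Poly_Mapping.single i 1"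
    by (auto simp: roots_d_def eps_def)
  show "\<beta> \<in> lattice n" using i by (simp add: lattice_single)
  show "nrm n \<beta> = 1" using nrm_add_single[of i n 0 1] i z by simp
  show "0 < \<beta>" unfolding vec_pos_iff i(3) by (intro exI[of _ i]) (auto simp: lookup_single)
next
  fix \<beta> assume b: "\<beta> \<in> lattice n" "nrm n \<beta> = 1" "0 < \<beta>"
  then obtain k where k: "k \<in> {1..n}" "Poly_Mapping.lookup \<beta> k = 1"
     "(\<Sum>j\<in>{1..n} - {k}. (Poly_Mapping.lookup \<beta> j)\<^sup>2) = 0" by (elim pos_root_leading) auto
  then have z: "\<forall>j\<in>{1..n} - {k}. Poly_Mapping.lookup \<beta> j = 0" by (simp add: sum_nonneg_eq_0_iff)
  have "\<beta> = Poly_Mapping.single k 1"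
  proof (rule poly_mapping_eqI)
    fix j show "Poly_Mapping.lookup \<beta> j = Poly_Mapping.lookup (Poly_Mapping.single k 1) j"
      using z k b(1) by (cases "j = k"; cases "j \<in> {1..n}") (simp_all add: lookup_single lattice_iff)
  qed
  then show "\<beta> \<in> roots_d n" using k by (auto simp: roots_d_def eps_def)
qed

lemma roots_s_eq: "roots_s n = {\<beta> \<in> lattice n. nrm n \<beta> = 2 \<and> 0 < \<beta>}"
proof safe
  have z: "nrm n 0 = 0" by (simp add: nrm_def)
  fix \<beta> assume "\<beta> \<in> roots_s n"
  then obtain i j where ij: "1 \<le> i" "i < j" "j \<le> n" "\<beta> = eps (int i) + eps (int j) \<or> \<beta> = eps (int i) - eps (int j)"
    unfolding roots_s_def by blast
  then have "\<beta> = Poly_Mapping.single i 1 + Poly_Mapping.single j 1 \<or> \<beta> = Poly_Mapping.single i 1 + Poly_Mapping.single j (- 1)"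
    by (simp add: eps_def single_uminus)
  then obtain a where i: "1 \<le> i" "i < j" "j \<le> n" "\<beta> = Poly_Mapping.single i 1 + Poly_Mapping.single j a" "a = 1 \<or> a = - 1"
    using ij(1-3) by blast
  show "\<beta> \<in> lattice n" using i by (auto intro!: lattice_add lattice_single)
  show "nrm n \<beta> = 2" using nrm_add_single[of i n 0 1] nrm_add_single[of j n "Poly_Mapping.single i 1" a] i z
    by (auto simp: lookup_single)
  show "0 < \<beta>" unfolding vec_pos_iff i(4) using i by (intro exI[of _ i]) (auto simp: lookup_simps)
next
  fix \<beta> assume b: "\<beta> \<in> lattice n" "nrm n \<beta> = 2" "0 < \<beta>"
  then obtain k where k: "k \<in> {1..n}" "Poly_Mapping.lookup \<beta> k = 1" "\<forall>j<k. Poly_Mapping.lookup \<beta> j = 0"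
     "(\<Sum>j\<in>{1..n} - {k}. (Poly_Mapping.lookup \<beta> j)\<^sup>2) = 1" by (elim pos_root_leading) auto
  from sum_squares_1[OF _ k(4)]
  obtain j where j: "j \<in> {1..n} - {k}" "\<bar>Poly_Mapping.lookup \<beta> j\<bar> = 1" "\<forall>i\<in>{1..n} - {k} - {j}. Poly_Mapping.lookup \<beta> i = 0"
    by blast
  have kj: "k < j" using j k(3) by (metis DiffE abs_zero insert_iff linorder_neqE_nat zero_neq_one)
  have e: "\<beta> = Poly_Mapping.single k 1 + Poly_Mapping.single j (Poly_Mapping.lookup \<beta> j)"
  proof (rule poly_mapping_eqI)
    fix i show "Poly_Mapping.lookup \<beta> i = Poly_Mapping.lookup (Poly_Mapping.single k 1 + Poly_Mapping.single j (Poly_Mapping.lookup \<beta> j)) i"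
    proof -
      consider "i = k" | "i = j" | "i \<noteq> k" "i \<noteq> j" "i \<in> {1..n}" | "i \<notin> {1..n}" by blast
      then show ?thesis
      proof cases
        case 3
        then have "Poly_Mapping.lookup \<beta> i = 0" using j(3) by blast
        then show ?thesis using 3 by (simp add: lookup_add lookup_single)
      next
        case 4
        then have "Poly_Mapping.lookup \<beta> i = 0" "i \<noteq> k" "i \<noteq> j" using b(1) k(1) j(1) by (auto simp: lattice_iff)
        then show ?thesis by (simp add: lookup_add lookup_single)
      qed (use k(2) kj in \<open>simp_all add: lookup_add lookup_single\<close>)
    qed
  qed
  have "Poly_Mapping.lookup \<beta> j = 1 \<or> Poly_Mapping.lookup \<beta> j = - 1" using j(2) by linarith
  then show "\<beta> \<in> roots_s n"
  proof
    assume "Poly_Mapping.lookup \<beta> j = 1"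
    then have "\<beta> = eps (int k) + eps (int j)" using e k kj by (simp add: eps_def)
    then show ?thesis using k j kj unfolding roots_s_def by auto
  next
    assume "Poly_Mapping.lookup \<beta> j = - 1"
    then have "\<beta> = eps (int k) - eps (int j)" using e k kj by (simp add: eps_def single_uminus)
    then show ?thesis using k j kj unfolding roots_s_def by auto
  qed
qed

text \<open>Positivity is that of the lexicographic order on finitely supported functions.\<close>

definition posr :: "nat \<Rightarrow> vec set" where
  "posr n = {\<beta> \<in> lattice n. (nrm n \<beta> = 1 \<or> nrm n \<beta> = 2) \<and> 0 < \<beta>}"

lemma posr_eq: "roots_d n \<union> roots_s n = posr n"
  by (auto simp: posr_def roots_d_eq roots_s_eq)

lemma finite_posr [simp]: "finite (posr n)"
proof -
  have "roots_d n \<subseteq> (\<lambda>i. eps (int i)) ` {1..n}" by (auto simp: roots_d_def)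
  moreover have "roots_s n \<subseteq> (\<lambda>(i, j). eps (int i) + eps (int j)) ` ({1..n} \<times> {1..n}) \<union> (\<lambda>(i, j). eps (int i) - eps (int j)) ` ({1..n} \<times> {1..n})"
    by (auto simp: roots_s_def image_iff)
  ultimately show ?thesis unfolding posr_eq[symmetric] by (meson finite_UnI finite_SigmaI finite_atLeastAtMost finite_imageI finite_subset)
qed

text \<open>Only the first nonzero entry decides the sign, and the reflection makes it negative for
  its own simple root alone.\<close>

lemma simple_refl_pos:
  assumes "1 \<le> i" "i \<le> n" "\<beta> \<in> posr n" "\<beta> \<noteq> sroot n i"
  shows "0 < simple_refl n i \<beta>"
proof -
  have b: "\<beta> \<in> lattice n" "nrm n \<beta> \<le> 2" "0 < \<beta>" using assms(3) by (auto simp: posr_def)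
  from pos_root_leading[OF b] obtain k where k: "k \<in> {1..n}" "Poly_Mapping.lookup \<beta> k = 1" "\<forall>j<k. Poly_Mapping.lookup \<beta> j = 0"
     and s: "(\<Sum>j\<in>{1..n} - {k}. (Poly_Mapping.lookup \<beta> j)\<^sup>2) = nrm n \<beta> - 1" by blast
  show ?thesis
  proof (cases "i = n")
    case True
    show ?thesis
    proof (cases "k = n")
      case kn: True
      have "\<beta> = sroot n i"
      proof (rule poly_mapping_eqI)
        fix m show "Poly_Mapping.lookup \<beta> m = Poly_Mapping.lookup (sroot n i) m"
          using k(2,3) b(1) True kn by (cases "m < n"; cases "m = n") (simp_all add: sroot_def lookup_single lattice_iff)
      qed
      then show ?thesis using assms by simp
    next
      case False
      then show ?thesis unfolding vec_pos_iff using k True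
        by (intro exI[of _ k]) (auto simp: lookup_simple_refl)
    qed
  next
    case False
    then have i: "i < n" using assms by simp
    consider "k \<noteq> i" "k \<noteq> Suc i" | "k = Suc i" | "k = i" "0 < Poly_Mapping.lookup \<beta> (Suc i)"
      | "k = i" "0 = Poly_Mapping.lookup \<beta> (Suc i)" | "k = i" "Poly_Mapping.lookup \<beta> (Suc i) < 0" by linarith
    then show ?thesis
    proof cases
      case 1
      then show ?thesis unfolding vec_pos_iff using k i
        by (intro exI[of _ k]) (auto simp: lookup_simple_refl)
    next
      case 2
      then show ?thesis unfolding vec_pos_iff using k i
        by (intro exI[of _ i]) (auto simp: lookup_simple_refl)
    next
      case 3
      then show ?thesis unfolding vec_pos_iff using k i
        by (intro exI[of _ i]) (auto simp: lookup_simple_refl)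
    next
      case 4
      then show ?thesis unfolding vec_pos_iff using k i
        by (intro exI[of _ "Suc i"]) (auto simp: lookup_simple_refl less_Suc_eq)
    next
      case 5
      \<comment> \<open>The leading entry at i together with a negative entry next to it exhausts
        the norm 2, which leaves only the simple root.\<close>
      have "(Poly_Mapping.lookup \<beta> (Suc i))\<^sup>2 \<le> (\<Sum>j\<in>{1..n} - {k}. (Poly_Mapping.lookup \<beta> j)\<^sup>2)"
        using i 5 by (intro member_le_sum) auto
      moreover have "1 \<le> (Poly_Mapping.lookup \<beta> (Suc i))\<^sup>2" using 5 by (simp add: int_one_le_iff_zero_less)
      ultimately have s1: "(\<Sum>j\<in>{1..n} - {k}. (Poly_Mapping.lookup \<beta> j)\<^sup>2) = 1"
        using s assms(3) by (auto simp: posr_def)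
      from sum_squares_1[OF _ s1]
      obtain j where j: "j \<in> {1..n} - {k}" "\<bar>Poly_Mapping.lookup \<beta> j\<bar> = 1" "\<forall>i\<in>{1..n} - {k} - {j}. Poly_Mapping.lookup \<beta> i = 0"
        by blast
      have j2: "j = Suc i"
      proof (rule ccontr)
        assume "j \<noteq> Suc i"
        then have "Suc i \<in> {1..n} - {k} - {j}" using i 5 by simp
        then show False using j(3) 5 by fastforce
      qed
      have "\<beta> = sroot n i"
      proof (rule poly_mapping_eqI)
        fix m
        show "Poly_Mapping.lookup \<beta> m = Poly_Mapping.lookup (sroot n i) m"
        proof -
          consider "m = i" | "m = Suc i" | "m \<noteq> i" "m \<noteq> Suc i" "m \<in> {1..n}" | "m \<notin> {1..n}" by blast
          then show ?thesis
          proof cases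
            case 2
            then have "Poly_Mapping.lookup \<beta> m = - 1" using j(2) j2 5 by simp
            then show ?thesis using 2 i by (simp add: sroot_def lookup_minus lookup_single)
          next
            case 3
            then have "Poly_Mapping.lookup \<beta> m = 0" using j(3) 5 j2 by blast
            then show ?thesis using 3 i by (simp add: sroot_def lookup_minus lookup_single)
          next
            case 4
            then have "Poly_Mapping.lookup \<beta> m = 0" "m \<noteq> i" "m \<noteq> Suc i" using b(1) assms(1) i by (auto simp: lattice_iff)
            then show ?thesis using i by (simp add: sroot_def lookup_minus lookup_single)
          qed (use k(2) 5 i in \<open>simp_all add: sroot_def lookup_minus lookup_single\<close>)
        qed
      qed
      then show ?thesis using assms by simp
    qed
  qed
qed

section \<open>The Weyl group and its inversions\<close>

lemma word_prod_simps [simp]: "word_prod n [] = id" "word_prod n (i # is) = simple_refl n i \<circ> word_prod n is"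
  "word_prod n (is @ js) = word_prod n is \<circ> word_prod n js"
proof -
  show 1: "word_prod n [] = id" and 2: "word_prod n (i # is) = simple_refl n i \<circ> word_prod n is" for i "is"
    by (simp_all add: word_prod_def)
  show "word_prod n (is @ js) = word_prod n is \<circ> word_prod n js"
    by (induction "is") (simp_all add: 1 2 comp_assoc)
qed

lemma W_id: "id \<in> W_fin n"
  unfolding W_fin_def by (auto intro!: exI[of _ "[]"])

lemma W_comp: "u \<in> W_fin n \<Longrightarrow> v \<in> W_fin n \<Longrightarrow> u \<circ> v \<in> W_fin n"
  unfolding W_fin_def by auto (metis le_sup_iff set_append word_prod_simps(3))

lemma W_simple: "1 \<le> i \<Longrightarrow> i \<le> n \<Longrightarrow> simple_refl n i \<in> W_fin n"
  unfolding W_fin_def by (auto intro!: exI[of _ "[i]"])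

lemma W_word: "set is \<subseteq> {1..n} \<Longrightarrow> word_prod n is \<in> W_fin n"
  unfolding W_fin_def by auto

lemma W_induct [consumes 1, case_names id step]:
  assumes "w \<in> W_fin n" "P id" "\<And>i w. 1 \<le> i \<Longrightarrow> i \<le> n \<Longrightarrow> w \<in> W_fin n \<Longrightarrow> P w \<Longrightarrow> P (simple_refl n i \<circ> w)"
  shows "P w"
proof -
  obtain "is" where "is": "set is \<subseteq> {1..n}" "w = word_prod n is" using assms(1) by (auto simp: W_fin_def)
  have "P (word_prod n is)" using "is"(1)
    by (induction "is") (auto intro!: assms(2) assms(3) W_word simp del: comp_apply)
  then show ?thesis using "is" by simp
qed

lemma W_add: "w \<in> W_fin n \<Longrightarrow> w (\<mu> + \<nu>) = w \<mu> + w \<nu>"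
  by (induction w rule: W_induct) (simp_all add: simple_refl_add)

lemma simple_refl_scal: "simple_refl n i (scal a \<mu>) = scal a (simple_refl n i \<mu>)"
  by (rule poly_mapping_eqI) (simp add: lookup_simple_refl)

lemma W_scal: "w \<in> W_fin n \<Longrightarrow> w (scal a \<mu>) = scal a (w \<mu>)"
  by (induction w rule: W_induct) (simp_all add: simple_refl_scal)

lemma W_0: "w \<in> W_fin n \<Longrightarrow> w 0 = 0"
  using W_add[of w n 0 0] by simp

lemma W_uminus: "w \<in> W_fin n \<Longrightarrow> w (- \<mu>) = - w \<mu>"
  using W_add[of w n \<mu> "- \<mu>"] W_0[of w n] by (simp add: eq_neg_iff_add_eq_0 add.commute)

lemma W_minus: "w \<in> W_fin n \<Longrightarrow> w (\<mu> - \<nu>) = w \<mu> - w \<nu>"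
  using W_add[of w n \<mu> "- \<nu>"] by (simp add: W_uminus)

lemma simple_refl_lattice: "1 \<le> i \<Longrightarrow> i \<le> n \<Longrightarrow> \<mu> \<in> lattice n \<Longrightarrow> simple_refl n i \<mu> \<in> lattice n"
  using srefl_lattice[of i n \<mu>] by simp

lemma nrm_simple_refl: "1 \<le> i \<Longrightarrow> i \<le> n \<Longrightarrow> nrm n (simple_refl n i \<mu>) = nrm n \<mu>"
  using nrm_srefl[of i n \<mu>] by simp

lemma W_lattice: "w \<in> W_fin n \<Longrightarrow> \<mu> \<in> lattice n \<Longrightarrow> w \<mu> \<in> lattice n"
  by (induction w rule: W_induct) (simp_all add: simple_refl_lattice)

lemma W_nrm: "w \<in> W_fin n \<Longrightarrow> nrm n (w \<mu>) = nrm n \<mu>"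
  by (induction w rule: W_induct) (simp_all add: nrm_simple_refl)

lemma nrm_pair: "nrm n (\<mu> + \<nu>) = nrm n \<mu> + nrm n \<nu> + 2 * pair n \<mu> \<nu>"
  by (simp add: nrm_def pair_def lookup_add power2_sum sum.distrib sum_distrib_left mult.assoc)

text \<open>Polarization of the invariance of the norm.\<close>

lemma W_pair: "w \<in> W_fin n \<Longrightarrow> pair n (w \<mu>) (w \<nu>) = pair n \<mu> \<nu>"
  using nrm_pair[of n "w \<mu>" "w \<nu>"] nrm_pair[of n \<mu> \<nu>] W_nrm[of w n "\<mu> + \<nu>"] by (simp add: W_add W_nrm)

lemma W_inverse:
  assumes "w \<in> W_fin n"
  shows "\<exists>u\<in>W_fin n. u \<circ> w = id \<and> w \<circ> u = id"
  using assms
proof (induction w rule: W_induct)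
  case id
  then show ?case by (intro bexI[of _ id]) (simp_all add: W_id)
next
  case (step i w)
  then obtain u where u: "u \<in> W_fin n" "u \<circ> w = id" "w \<circ> u = id" by blast
  have "(u \<circ> simple_refl n i) \<circ> (simple_refl n i \<circ> w) = id" "(simple_refl n i \<circ> w) \<circ> (u \<circ> simple_refl n i) = id"
    using u(2,3) by (auto simp: fun_eq_iff)
  then show ?case using W_comp[OF u(1) W_simple[OF step(1,2)]] by blast
qed

lemma W_inv:
  assumes "w \<in> W_fin n"
  shows "inv w \<in> W_fin n" "inv w (w \<mu>) = \<mu>" "w (inv w \<mu>) = \<mu>" "bij w"
proof -
  obtain u where u: "u \<in> W_fin n" "u \<circ> w = id" "w \<circ> u = id" using W_inverse[OF assms] by blast
  then have i: "inv w = u" by (simp add: inv_unique_comp)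
  then show "inv w \<in> W_fin n" "inv w (w \<mu>) = \<mu>" "w (inv w \<mu>) = \<mu>" unfolding i using u by (simp_all add: fun_eq_iff)
  show "bij w" using u by (metis o_bij)
qed

lemma inv_simple_comp:
  assumes "w \<in> W_fin n" "1 \<le> i" "i \<le> n"
  shows "inv (simple_refl n i \<circ> w) = inv w \<circ> simple_refl n i"
  by (rule inv_unique_comp) (use W_inv[OF assms(1)] in \<open>auto simp: fun_eq_iff\<close>)

lemma W_posr:
  assumes "w \<in> W_fin n" "\<beta> \<in> posr n"
  shows "w \<beta> \<in> posr n \<and> 0 < w \<beta> \<or> - w \<beta> \<in> posr n \<and> w \<beta> < 0"
proof -
  have n: "nrm n (w \<beta>) = nrm n \<beta>" "w \<beta> \<in> lattice n" using assms by (auto simp: W_nrm W_lattice posr_def)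
  have "nrm n (- w \<beta>) = nrm n (w \<beta>)" by (simp add: nrm_def)
  moreover have "w \<beta> \<noteq> 0"
  proof
    assume "w \<beta> = 0"
    then have "nrm n \<beta> = 0" using n(1) by (simp add: nrm_def)
    then show False using assms(2) by (simp add: posr_def)
  qed
  ultimately show ?thesis using n assms(2) by (auto simp: posr_def lattice_uminus)
qed

lemma sroot_posr: "1 \<le> i \<Longrightarrow> i \<le> n \<Longrightarrow> sroot n i \<in> posr n"
  by (simp add: posr_def sroot_lattice sroot_pos nrm_sroot)

section \<open>Inversion sets under left multiplication by a simple reflection\<close>

lemma Inv_eq: "w \<in> W_fin n \<Longrightarrow> Inv n w = {\<beta> \<in> posr n. w \<beta> < 0}"
proof -
  assume w: "w \<in> W_fin n"
  have "- w \<beta> \<in> posr n \<longleftrightarrow> w \<beta> < 0" if "\<beta> \<in> posr n" for \<beta>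
  proof
    assume "- w \<beta> \<in> posr n"
    then show "w \<beta> < 0" by (simp add: posr_def)
  next
    assume "w \<beta> < 0"
    then show "- w \<beta> \<in> posr n" using W_posr[OF w that] by (meson less_asym)
  qed
  then show ?thesis unfolding Inv_def posr_eq by blast
qed

lemma finite_Inv [simp]: "finite (Inv n w)"
  unfolding Inv_def posr_eq by simp

lemma simple_refl_neg_iff:
  assumes "1 \<le> i" "i \<le> n" "\<beta> \<in> posr n \<or> - \<beta> \<in> posr n"
  shows "simple_refl n i \<beta> < 0 \<longleftrightarrow> (if \<beta> = sroot n i then True else if \<beta> = - sroot n i then False else \<beta> < 0)"
proof -
  have s: "simple_refl n i (- \<gamma>) = - simple_refl n i \<gamma>" for \<gamma> using W_uminus[OF W_simple[OF assms(1,2)]] .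
  show ?thesis
    using assms(3)
  proof
    assume b: "\<beta> \<in> posr n"
    then have "0 < \<beta>" by (simp add: posr_def)
    then have "\<beta> \<noteq> - sroot n i" using sroot_pos[of n i] by (metis less_asym neg_less_0_iff_less)
    then show ?thesis using simple_refl_pos[OF assms(1,2) b] simple_refl_sroot[OF assms(1,2)] sroot_pos[of n i] \<open>0 < \<beta>\<close> by auto
  next
    assume b: "- \<beta> \<in> posr n"
    then have "0 < - \<beta>" by (simp add: posr_def)
    then have "\<beta> \<noteq> sroot n i" using sroot_pos[of n i] by auto
    then show ?thesis using simple_refl_pos[OF assms(1,2) b] simple_refl_sroot[OF assms(1,2)] sroot_pos[of n i] \<open>0 < - \<beta>\<close> s
      by (auto simp: minus_equation_iff[of \<beta>])
  qed
qed

text \<open>Since s_i permutes the positive roots other than its own, the sign of w \<beta> changes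
  only where w \<beta> is the simple root up to sign.\<close>

lemma Inv_left_up:
  assumes w: "w \<in> W_fin n" and i: "1 \<le> i" "i \<le> n" and pos: "0 < inv w (sroot n i)"
  shows "Inv n (simple_refl n i \<circ> w) = insert (inv w (sroot n i)) (Inv n w)" "inv w (sroot n i) \<notin> Inv n w"
proof -
  note sw = W_comp[OF W_simple[OF i] w]
  have g: "inv w (sroot n i) \<in> posr n" using W_posr[OF W_inv(1)[OF w] sroot_posr[OF i]] pos by auto
  show "inv w (sroot n i) \<notin> Inv n w" using sroot_pos[of n i] by (auto simp: Inv_eq w W_inv[OF w])
  show "Inv n (simple_refl n i \<circ> w) = insert (inv w (sroot n i)) (Inv n w)"
  proof (intro set_eqI iffI)
    fix \<beta> assume "\<beta> \<in> Inv n (simple_refl n i \<circ> w)"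
    then have b: "\<beta> \<in> posr n" "simple_refl n i (w \<beta>) < 0" by (auto simp: Inv_eq sw)
    then show "\<beta> \<in> insert (inv w (sroot n i)) (Inv n w)"
      using simple_refl_neg_iff[OF i, of "w \<beta>"] W_posr[OF w b(1)] W_inv(2)[OF w, of \<beta>] by (auto simp: Inv_eq w split: if_splits)
  next
    fix \<beta> assume b: "\<beta> \<in> insert (inv w (sroot n i)) (Inv n w)"
    show "\<beta> \<in> Inv n (simple_refl n i \<circ> w)"
    proof (cases "\<beta> = inv w (sroot n i)")
      case True
      then show ?thesis using g sroot_pos[of n i] by (simp add: Inv_eq sw W_inv[OF w] simple_refl_sroot[OF i])
    next
      case False
      then have b: "\<beta> \<in> posr n" "w \<beta> < 0" using b by (auto simp: Inv_eq w)
      have "w \<beta> \<noteq> - sroot n i"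
      proof
        assume "w \<beta> = - sroot n i"
        then have "\<beta> = - inv w (sroot n i)" using W_inv[OF w] W_uminus[OF W_inv(1)[OF w]] by metis
        then show False using b(1) pos by (auto simp: posr_def dest: less_asym)
      qed
      then show ?thesis using simple_refl_neg_iff[OF i, of "w \<beta>"] W_posr[OF w b(1)] b by (auto simp: Inv_eq sw)
    qed
  qed
qed

lemma Inv_left_down:
  assumes w: "w \<in> W_fin n" and i: "1 \<le> i" "i \<le> n" and neg: "inv w (sroot n i) < 0"
  shows "Suc (card (Inv n (simple_refl n i \<circ> w))) = card (Inv n w)"
proof -
  define u where "u = simple_refl n i \<circ> w"
  have u: "u \<in> W_fin n" unfolding u_def by (rule W_comp[OF W_simple[OF i] w])
  have "inv u (sroot n i) = - inv w (sroot n i)"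
    unfolding u_def inv_simple_comp[OF w i] by (simp add: simple_refl_sroot[OF i] W_uminus[OF W_inv(1)[OF w]])
  then have "0 < inv u (sroot n i)" using neg by simp
  from Inv_left_up[OF u i this] have "card (Inv n (simple_refl n i \<circ> u)) = Suc (card (Inv n u))" by simp
  moreover have "simple_refl n i \<circ> u = w" by (simp add: u_def fun_eq_iff)
  ultimately show ?thesis by (simp add: u_def)
qed

lemma W_nonzero: "w \<in> W_fin n \<Longrightarrow> \<beta> \<in> posr n \<Longrightarrow> w \<beta> < 0 \<or> 0 < w \<beta>"
  using W_posr[of w n \<beta>] by auto

section \<open>Reduced words\<close>

text \<open>Agrees with \<open>len\<close> by \<open>reduced_word\<close>, but does not depend on a
  chosen word, so the inductions use it.\<close>

definition ilen :: "nat \<Rightarrow> (vec \<Rightarrow> vec) \<Rightarrow> nat" where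
  "ilen n w = card (Inv n w)"

lemma ilen_up: "w \<in> W_fin n \<Longrightarrow> 1 \<le> i \<Longrightarrow> i \<le> n \<Longrightarrow> 0 < inv w (sroot n i) \<Longrightarrow> ilen n (simple_refl n i \<circ> w) = Suc (ilen n w)"
  by (simp add: ilen_def Inv_left_up del: One_nat_def)

lemma ilen_down: "w \<in> W_fin n \<Longrightarrow> 1 \<le> i \<Longrightarrow> i \<le> n \<Longrightarrow> inv w (sroot n i) < 0 \<Longrightarrow> Suc (ilen n (simple_refl n i \<circ> w)) = ilen n w"
  unfolding ilen_def by (rule Inv_left_down)

lemma inv_sroot_cases:
  assumes "w \<in> W_fin n" "1 \<le> i" "i \<le> n"
  obtains "0 < inv w (sroot n i)" | "inv w (sroot n i) < 0"
  using W_nonzero[OF W_inv(1)[OF assms(1)] sroot_posr[OF assms(2,3)]] by blast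

lemma ilen_id [simp]: "ilen n id = 0"
proof -
  have "Inv n id = {}" by (auto simp: Inv_eq W_id posr_def)
  then show ?thesis by (simp add: ilen_def)
qed

lemma ilen_word_le:
  assumes "set is \<subseteq> {1..n}"
  shows "ilen n (word_prod n is) \<le> length is"
  using assms
proof (induction "is")
  case (Cons i "is")
  then have i: "1 \<le> i" "i \<le> n" and s: "set is \<subseteq> {1..n}" and IH: "ilen n (word_prod n is) \<le> length is"
    by auto
  note w = W_word[OF s]
  show ?case using IH
    by (cases rule: inv_sroot_cases[OF w i]) (use ilen_up[OF w i] ilen_down[OF w i] in \<open>simp_all del: comp_apply\<close>)
qed simp

lemma eps_less: "k < j \<Longrightarrow> Poly_Mapping.single j 1 < (Poly_Mapping.single k 1 :: vec)"
proof -
  assume "k < j"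
  then have "0 < Poly_Mapping.single k 1 - (Poly_Mapping.single j 1 :: vec)"
    unfolding vec_pos_iff by (intro exI[of _ k]) (auto simp: lookup_minus lookup_single)
  then show ?thesis by simp
qed

lemma W_single_outside: "w \<in> W_fin n \<Longrightarrow> k \<notin> {1..n} \<Longrightarrow> w (Poly_Mapping.single k a) = Poly_Mapping.single k a"
proof (induction w rule: W_induct)
  case (step i w)
  have "simple_refl n i (Poly_Mapping.single k a) = Poly_Mapping.single k a"
    using step by (intro poly_mapping_eqI) (auto simp: lookup_simple_refl lookup_single)
  then show ?case using step by simp
qed simp

lemma W_eqI:
  assumes u: "u \<in> W_fin n" and v: "v \<in> W_fin n"
    and eq: "\<And>k. k \<in> {1..n} \<Longrightarrow> u (Poly_Mapping.single k 1) = v (Poly_Mapping.single k 1)"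
  shows "u = v"
proof
  fix \<mu> show "u \<mu> = v \<mu>"
  proof (induction \<mu> rule: laurent_induct)
    case (single k a)
    have s: "Poly_Mapping.single k a = scal a (Poly_Mapping.single k 1)"
      by (rule poly_mapping_eqI) (simp add: lookup_single when_def)
    show ?case
    proof (cases "k \<in> {1..n}")
      case True
      then show ?thesis using eq[OF True] unfolding s W_scal[OF u] W_scal[OF v] by simp
    next
      case False
      then show ?thesis using W_single_outside[OF u False] W_single_outside[OF v False] by simp
    qed
  qed (simp add: W_add[OF u] W_add[OF v])
qed

lemma mono_self_map_id:
  fixes p :: "nat \<Rightarrow> nat"
  assumes "\<And>j. j \<in> {1..n} \<Longrightarrow> p j \<in> {1..n}" "\<And>j. j \<in> {1..n} \<Longrightarrow> j < n \<Longrightarrow> p j < p (Suc j)" "j \<in> {1..n}"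
  shows "p j = j"
proof (rule antisym)
  have 1: "1 \<le> j \<Longrightarrow> j \<le> n \<Longrightarrow> j \<le> p j" for j
  proof (induction j rule: nat_induct_at_least)
    case base
    then show ?case using assms(1)[of 1] by simp
  next
    case (Suc j)
    then show ?case using assms(2)[of j] by simp
  qed
  then show "j \<le> p j" using assms(3) by simp
  have "k \<le> n - 1 \<Longrightarrow> p (n - k) \<le> n - k" for k
  proof (induction k)
    case 0
    then show ?case using assms(1)[of n] assms(3) by (cases n) auto
  next
    case (Suc k)
    then have "p (n - Suc k) < p (Suc (n - Suc k))" by (intro assms(2)) auto
    moreover have "Suc (n - Suc k) = n - k" using Suc by simp
    ultimately show ?case using Suc by simp
  qed
  from this[of "n - j"] show "p j \<le> j" using assms(3) by auto
qed

text \<open>If all simple roots stay positive, the decreasing chain e_1 > ... > e_n > 0 goes to a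
  decreasing chain of positive unit vectors, and there is only one such chain.\<close>

lemma no_descent:
  assumes u: "u \<in> W_fin n" and pos: "\<And>i. 1 \<le> i \<Longrightarrow> i \<le> n \<Longrightarrow> 0 < u (sroot n i)"
  shows "u = id"
proof -
  define e where "e j = (Poly_Mapping.single j 1 :: vec)" for j :: nat
  have step: "u (e (Suc j)) < u (e j)" if "j \<in> {1..n}" "j < n" for j
  proof -
    have "e j = e (Suc j) + sroot n j" using that by (simp add: e_def sroot_def)
    then have "u (e j) = u (e (Suc j)) + u (sroot n j)" using W_add[OF u] by metis
    then show ?thesis using pos[of j] that by simp
  qed
  have nn: "k \<le> n - 1 \<Longrightarrow> 1 \<le> n \<Longrightarrow> 0 < u (e (n - k))" for k
  proof (induction k)
    case 0
    then show ?case using pos[of n] by (simp add: sroot_def e_def)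
  next
    case (Suc k)
    then have "u (e (Suc (n - Suc k))) < u (e (n - Suc k))" by (intro step) auto
    moreover have "Suc (n - Suc k) = n - k" using Suc by simp
    ultimately show ?case using Suc by (metis Suc_leD less_trans)
  qed
  have "\<exists>p. p \<in> {1..n} \<and> u (e j) = e p" if j: "j \<in> {1..n}" for j
  proof -
    have "0 < u (e j)" using nn[of "n - j"] j by auto
    moreover have "e j \<in> roots_d n" using j by (auto simp: e_def roots_d_def eps_def)
    ultimately have "u (e j) \<in> roots_d n" by (auto simp: roots_d_eq W_lattice[OF u] W_nrm[OF u])
    then show ?thesis by (auto simp: roots_d_def eps_def e_def)
  qed
  then obtain p where p: "\<And>j. j \<in> {1..n} \<Longrightarrow> p j \<in> {1..n}" "\<And>j. j \<in> {1..n} \<Longrightarrow> u (e j) = e (p j)" by metis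
  have "p j < p (Suc j)" if "j \<in> {1..n}" "j < n" for j
  proof (rule ccontr)
    assume "\<not> p j < p (Suc j)"
    then have "p (Suc j) < p j \<or> p (Suc j) = p j" by linarith
    then have "e (p j) \<le> e (p (Suc j))" using eps_less[of "p (Suc j)" "p j"] by (auto simp: e_def)
    then have "u (e j) \<le> u (e (Suc j))" using p(2)[of j] p(2)[of "Suc j"] that by auto
    then show False using step[OF that] by simp
  qed
  then have "p j = j" if "j \<in> {1..n}" for j using mono_self_map_id[of n p j] p that by blast
  then show ?thesis using p(2) by (intro W_eqI[OF u W_id]) (simp add: e_def)
qed

lemma inv_inv_W: "w \<in> W_fin n \<Longrightarrow> inv (inv w) = w"
  by (rule inv_inv_eq) (rule W_inv)

lemma ex_descent:
  assumes w: "w \<in> W_fin n" "w \<noteq> id"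
  shows "\<exists>i\<in>{1..n}. inv w (sroot n i) < 0"
proof (rule ccontr)
  assume "\<not> ?thesis"
  then have "0 < inv w (sroot n i)" if "1 \<le> i" "i \<le> n" for i
    using inv_sroot_cases[OF w(1) that] that by (metis atLeastAtMost_iff)
  then have "inv w = id" by (intro no_descent[OF W_inv(1)[OF w(1)]])
  then show False using w inv_inv_W[OF w(1)] by simp
qed

definition is_red :: "nat \<Rightarrow> nat list \<Rightarrow> bool" where
  "is_red n is \<longleftrightarrow> set is \<subseteq> {1..n} \<and> length is = ilen n (word_prod n is)"

lemma ex_red:
  assumes "w \<in> W_fin n"
  shows "\<exists>is. is_red n is \<and> word_prod n is = w"
  using assms
proof (induction "ilen n w" arbitrary: w rule: less_induct)
  case less
  show ?case
  proof (cases "w = id")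
    case True
    then show ?thesis by (intro exI[of _ "[]"]) (simp add: is_red_def)
  next
    case False
    then obtain i where i: "1 \<le> i" "i \<le> n" "inv w (sroot n i) < 0" using ex_descent[OF less(2)] by auto
    define u where "u = simple_refl n i \<circ> w"
    have u: "u \<in> W_fin n" unfolding u_def by (intro W_comp W_simple i less)
    have l: "Suc (ilen n u) = ilen n w" unfolding u_def by (rule ilen_down[OF less(2) i])
    have w: "w = simple_refl n i \<circ> u" by (simp add: u_def fun_eq_iff)
    obtain "is" where "is": "is_red n is" "word_prod n is = u" using less(1)[of u] u l by auto
    then have "is_red n (i # is)" "word_prod n (i # is) = w" using l i w by (auto simp: is_red_def)
    then show ?thesis by blast
  qed
qed

text \<open>A letter adds at most one inversion, so no word is shorter than the number of
  inversions; removing descents one by one attains this bound.\<close>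

lemma is_reduced_word_iff:
  assumes "w \<in> W_fin n"
  shows "is_reduced_word n w is \<longleftrightarrow> is_red n is \<and> word_prod n is = w"
proof
  assume r: "is_reduced_word n w is"
  obtain js where js: "is_red n js" "word_prod n js = w" using ex_red[OF assms] by blast
  then have "length is \<le> ilen n w" using r by (auto simp: is_reduced_word_def is_red_def)
  moreover have "ilen n w \<le> length is" using r ilen_word_le[of "is" n] by (auto simp: is_reduced_word_def)
  ultimately show "is_red n is \<and> word_prod n is = w" using r by (auto simp: is_reduced_word_def is_red_def)
next
  assume "is_red n is \<and> word_prod n is = w"
  then show "is_reduced_word n w is" using ilen_word_le[of _ n] unfolding is_reduced_word_def is_red_def by metis
qed

lemma reduced_word:
  assumes "w \<in> W_fin n"
  shows "is_red n (reduced_word n w)" "word_prod n (reduced_word n w) = w" "len n w = ilen n w"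
proof -
  have "is_reduced_word n w (reduced_word n w)" unfolding reduced_word_def
    by (rule someI_ex) (use ex_red[OF assms] is_reduced_word_iff[OF assms] in blast)
  then show "is_red n (reduced_word n w)" "word_prod n (reduced_word n w) = w" using is_reduced_word_iff[OF assms] by auto
  then show "len n w = ilen n w" by (simp add: len_def is_red_def)
qed

lemma red_Cons:
  assumes "is_red n (i # is)"
  shows "is_red n is" "0 < inv (word_prod n is) (sroot n i)" "1 \<le> i" "i \<le> n" "word_prod n is \<in> W_fin n"
proof -
  have i: "1 \<le> i" "i \<le> n" and s: "set is \<subseteq> {1..n}"
    and l: "ilen n (simple_refl n i \<circ> word_prod n is) = Suc (length is)"
    using assms by (auto simp: is_red_def simp del: comp_apply)
  note w = W_word[OF s]
  show "1 \<le> i" "i \<le> n" "word_prod n is \<in> W_fin n" by fact+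
  show "0 < inv (word_prod n is) (sroot n i)"
    using inv_sroot_cases[OF w i] ilen_down[OF w i] l ilen_word_le[OF s] by (metis Suc_n_not_le_n le_Suc_eq)
  from ilen_up[OF w i this] show "is_red n is" using l s by (simp add: is_red_def)
qed

lemma red_ConsI: "is_red n is \<Longrightarrow> 1 \<le> i \<Longrightarrow> i \<le> n \<Longrightarrow> 0 < inv (word_prod n is) (sroot n i) \<Longrightarrow> is_red n (i # is)"
  using ilen_up[of "word_prod n is" n i] W_word[of "is" n] by (auto simp: is_red_def)

lemma Inv_sd_disjoint: "Inv n w = Inv_s n w \<union> Inv_d n w" "Inv_s n w \<inter> Inv_d n w = {}"
  by (auto simp: Inv_def Inv_s_def Inv_d_def roots_d_eq roots_s_eq)

text \<open>Each letter of a reduced word adds one inversion of the same norm as its simple root, so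
  the number of letters of either kind does not depend on the word.\<close>

lemma red_count:
  assumes "is_red n is"
  shows "length (filter (\<lambda>i. i < n) is) = card (Inv_s n (word_prod n is)) \<and> length (filter (\<lambda>i. i = n) is) = card (Inv_d n (word_prod n is))"
  using assms
proof (induction "is")
  case Nil
  have "Inv n (word_prod n []) = {}" by (auto simp: Inv_eq[OF W_id] posr_def)
  then show ?case by (simp only: Inv_s_def Inv_d_def) simp
next
  case (Cons i "is")
  note r = red_Cons[OF Cons(2)]
  note up = Inv_left_up[OF r(5,3,4,2)]
  define \<gamma> where "\<gamma> = inv (word_prod n is) (sroot n i)"
  have g: "nrm n \<gamma> = (if i = n then 1 else 2)" "\<gamma> \<in> lattice n" "0 < \<gamma>"
    using r(2) unfolding \<gamma>_def by (simp_all add: W_nrm[OF W_inv(1)[OF r(5)]] nrm_sroot[OF r(3,4)] W_lattice[OF W_inv(1)[OF r(5)] sroot_lattice[OF r(3,4)]])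
  note up = up[folded \<gamma>_def]
  have IH: "length (filter (\<lambda>i. i < n) is) = card (Inv_s n (word_prod n is))" "length (filter (\<lambda>i. i = n) is) = card (Inv_d n (word_prod n is))"
    using Cons r by auto
  show ?case
  proof (cases "i = n")
    case True
    then have "\<gamma> \<in> roots_d n" "\<gamma> \<notin> roots_s n" using g by (auto simp: roots_d_eq roots_s_eq)
    then have "Inv_s n (word_prod n (i # is)) = Inv_s n (word_prod n is)" "Inv_d n (word_prod n (i # is)) = insert \<gamma> (Inv_d n (word_prod n is))"
      "\<gamma> \<notin> Inv_d n (word_prod n is)"
      using up by (auto simp: Inv_s_def Inv_d_def simp del: comp_apply)
    then show ?thesis using IH True by (simp add: Inv_d_def del: comp_apply word_prod_simps)
  next
    case False
    then have "\<gamma> \<notin> roots_d n" "\<gamma> \<in> roots_s n" using g by (auto simp: roots_d_eq roots_s_eq)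
    then have "Inv_d n (word_prod n (i # is)) = Inv_d n (word_prod n is)" "Inv_s n (word_prod n (i # is)) = insert \<gamma> (Inv_s n (word_prod n is))"
      "\<gamma> \<notin> Inv_s n (word_prod n is)"
      using up by (auto simp: Inv_s_def Inv_d_def simp del: comp_apply)
    then show ?thesis using IH False r by (simp add: Inv_s_def del: comp_apply word_prod_simps)
  qed
qed

lemma len_sd:
  assumes "w \<in> W_fin n"
  shows "len_s n w = card (Inv_s n w)" "len_d n w = card (Inv_d n w)"
  using red_count[OF reduced_word(1)[OF assms]] reduced_word(2)[OF assms] by (simp_all add: len_s_def len_d_def)

section \<open>Braid moves\<close>

lemma simple_refl_sroot_far:
  "1 \<le> i \<Longrightarrow> i \<le> n \<Longrightarrow> 1 \<le> j \<Longrightarrow> j \<le> n \<Longrightarrow> Suc i < j \<or> Suc j < i \<Longrightarrow> simple_refl n i (sroot n j) = sroot n j"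
  by (rule poly_mapping_eqI) (auto simp: lookup_simple_refl sroot_def lookup_minus lookup_single when_def)

lemma simple_refl_sroot_near:
  assumes "1 \<le> i" "Suc i < n"
  shows "simple_refl n i (sroot n (Suc i)) = sroot n i + sroot n (Suc i)"
    "simple_refl n (Suc i) (sroot n i) = sroot n i + sroot n (Suc i)"
  using assms by (intro poly_mapping_eqI, auto simp: lookup_simple_refl sroot_def lookup_minus lookup_add lookup_single when_def)+

lemma simple_refl_sroot_end:
  assumes "1 \<le> i" "Suc i = n"
  shows "simple_refl n i (sroot n n) = sroot n i + sroot n n"
    "simple_refl n n (sroot n i) = sroot n i + sroot n n + sroot n n"
  using assms by (intro poly_mapping_eqI, auto simp: lookup_simple_refl sroot_def lookup_minus lookup_add lookup_single when_def)+

locale braid_family =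
  fixes n :: nat and T :: "nat \<Rightarrow> 'a \<Rightarrow> 'a"
  assumes far: "1 \<le> i \<Longrightarrow> Suc i < j \<Longrightarrow> j \<le> n \<Longrightarrow> T i (T j x) = T j (T i x)"
    and braid3: "1 \<le> i \<Longrightarrow> Suc i < n \<Longrightarrow> T i (T (Suc i) (T i x)) = T (Suc i) (T i (T (Suc i) x))"
    and braid4: "1 \<le> i \<Longrightarrow> Suc i = n \<Longrightarrow> T i (T n (T i (T n x))) = T n (T i (T n (T i x)))"
begin

definition Tw :: "nat list \<Rightarrow> 'a \<Rightarrow> 'a" where
  "Tw is = foldr (\<lambda>i g. T i \<circ> g) is id"

lemma Tw_simps [simp]: "Tw [] = id" "Tw (i # is) = T i \<circ> Tw is"
  by (simp_all add: Tw_def)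

lemma red_simple_down:
  assumes "w \<in> W_fin n" "1 \<le> i" "i \<le> n" "inv w (sroot n i) < 0" "is_red n is" "word_prod n is = simple_refl n i \<circ> w"
  shows "is_red n (i # is)" "word_prod n (i # is) = w"
proof -
  show w: "word_prod n (i # is) = w" using assms(6) by (simp add: fun_eq_iff)
  have "Suc (length is) = ilen n w" using ilen_down[OF assms(1-4)] assms(5,6) by (simp add: is_red_def)
  then show "is_red n (i # is)" using w assms by (simp add: is_red_def)
qed

text \<open>Both i and j shorten w. Hence w has reduced words that begin with the two sides of the
  braid relation of i and j and share their tail; the induction hypothesis links each given word to
  one of these.\<close>

lemma matsumoto_step:
  assumes IH: "\<And>a b. length a < m \<Longrightarrow> is_red n a \<Longrightarrow> is_red n b \<Longrightarrow> word_prod n a = word_prod n b \<Longrightarrow> Tw a = Tw b"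
    and a: "is_red n (i # a)" and b: "is_red n (j # b)" and w: "word_prod n (i # a) = word_prod n (j # b)"
    and m: "length (i # a) = m" and ij: "i < j"
  shows "Tw (i # a) = Tw (j # b)"
proof -
  note ra = red_Cons[OF a] and rb = red_Cons[OF b]
  define w where "w = word_prod n (i # a)"
  have wW: "w \<in> W_fin n" unfolding w_def using a by (intro W_word) (simp add: is_red_def)
  have wa: "word_prod n a = simple_refl n i \<circ> w" by (simp add: w_def fun_eq_iff)
  have wb: "word_prod n b = simple_refl n j \<circ> w" unfolding w_def w by (simp add: fun_eq_iff)
  have lb: "length b < m" using a b w m by (simp add: is_red_def)
  have la: "length a < m" using m by simp
  note i = ra(3,4) and j = rb(3,4)
  have di: "inv w (sroot n i) < 0"
    using ra(2) unfolding wa inv_simple_comp[OF wW i] by (simp add: simple_refl_sroot[OF i] W_uminus[OF W_inv(1)[OF wW]])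
  have dj: "inv w (sroot n j) < 0"
    using rb(2) unfolding wb inv_simple_comp[OF wW j] by (simp add: simple_refl_sroot[OF j] W_uminus[OF W_inv(1)[OF wW]])
  note iadd = W_add[OF W_inv(1)[OF wW]]
  have W1: "simple_refl n k \<circ> u \<in> W_fin n" if "u \<in> W_fin n" "k = i \<or> k = j" for u k
    using that i j by (auto intro!: W_comp W_simple)
  note inv1 = inv_simple_comp
  consider "Suc i < j" | "j = Suc i" "j < n" | "j = n" "Suc i = n" using ij j by linarith
  then show ?thesis
  proof cases
    case 1
    note wi = W1[OF wW, of i] note wij = W1[OF wi, of j]
    obtain c where c: "is_red n c" "word_prod n c = simple_refl n j \<circ> (simple_refl n i \<circ> w)" using ex_red[OF wij] by auto
    have "inv (simple_refl n i \<circ> w) (sroot n j) < 0"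
      unfolding inv1[OF wW i] using dj 1 i j by (simp add: simple_refl_sroot_far)
    from red_simple_down[OF _ j this c] have c1: "is_red n (j # c)" "word_prod n (j # c) = word_prod n a" using wi wa by auto
    have comm: "simple_refl n j \<circ> (simple_refl n i \<circ> w) = simple_refl n i \<circ> (simple_refl n j \<circ> w)"
      using srefl_commute[OF 1 j(2)] i j by (simp add: fun_eq_iff)
    have "inv (simple_refl n j \<circ> w) (sroot n i) < 0"
      unfolding inv1[OF wW j] using di 1 i j by (simp add: simple_refl_sroot_far)
    from red_simple_down[OF _ i this c(1)] have c2: "is_red n (i # c)" "word_prod n (i # c) = word_prod n b"
      using W1[OF wW, of j] wb c(2) comm by auto
    have "Tw a = Tw (j # c)" "Tw b = Tw (i # c)" using IH la lb ra(1) rb(1) c1 c2 by metis+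
    then show ?thesis using far[OF i(1) 1 j(2)] by (simp add: fun_eq_iff)
  next
    case 2
    then have in': "Suc i < n" by simp
    note near = simple_refl_sroot_near[OF i(1) in']
    \<comment> \<open>Two chains below w, through i, j, i and through j, i, j; they end in the same
      element by the braid relation of the reflections.\<close>
    define u1 u2 u3 where "u1 = simple_refl n i \<circ> w" and "u2 = simple_refl n j \<circ> u1" and "u3 = simple_refl n i \<circ> u2"
    have u: "u1 \<in> W_fin n" "u2 \<in> W_fin n" "u3 \<in> W_fin n" unfolding u3_def u2_def u1_def using wW by (auto intro!: W1)
    define v1 v2 where "v1 = simple_refl n j \<circ> w" and "v2 = simple_refl n i \<circ> v1"
    have v: "v1 \<in> W_fin n" "v2 \<in> W_fin n" unfolding v2_def v1_def using wW by (auto intro!: W1)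
    have u3: "u3 = simple_refl n j \<circ> v2"
      using srefl_braid3[OF i(1) in'] 2 i by (simp add: fun_eq_iff u3_def u2_def u1_def v2_def v1_def)
    have d1: "inv u1 (sroot n j) < 0" unfolding u1_def inv1[OF wW i] using 2 near di dj by (simp add: iadd add_neg_neg)
    have d2: "inv u2 (sroot n i) < 0"
    proof -
      have "inv u2 (sroot n i) = inv w (simple_refl n i (simple_refl n j (sroot n i)))"
        unfolding u2_def inv1[OF u(1) j] unfolding u1_def inv1[OF wW i] by simp
      also have "simple_refl n i (simple_refl n j (sroot n i)) = sroot n j"
        using 2 near by (simp add: simple_refl_add simple_refl_sroot[OF i])
      finally show ?thesis using dj by simp
    qed
    have e1: "inv v1 (sroot n i) < 0" unfolding v1_def inv1[OF wW j] using 2 near di dj by (simp add: iadd add_neg_neg)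
    have e2: "inv v2 (sroot n j) < 0"
    proof -
      have "inv v2 (sroot n j) = inv w (simple_refl n j (simple_refl n i (sroot n j)))"
        unfolding v2_def inv1[OF v(1) i] unfolding v1_def inv1[OF wW j] by simp
      also have "simple_refl n j (simple_refl n i (sroot n j)) = sroot n i"
        using 2 near simple_refl_sroot[OF j] by (simp add: simple_refl_add)
      finally show ?thesis using di by simp
    qed
    obtain c where c: "is_red n c" "word_prod n c = u3" using ex_red[OF u(3)] by auto
    note a1 = red_simple_down[OF u(2) i d2 c(1) c(2)[unfolded u3_def]]
    note a2 = red_simple_down[OF u(1) j d1 a1(1) a1(2)[unfolded u2_def]]
    note b1 = red_simple_down[OF v(2) j e2 c(1) c(2)[unfolded u3]]
    note b2 = red_simple_down[OF v(1) i e1 b1(1) b1(2)[unfolded v2_def]]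
    have "Tw a = Tw (j # i # c)" "Tw b = Tw (i # j # c)"
      using IH[OF la ra(1) a2(1)] IH[OF lb rb(1) b2(1)] a2(2) b2(2) wa wb u1_def v1_def by auto
    then show ?thesis using braid3[OF i(1) in'] 2 by (simp add: fun_eq_iff)
  next
    case 3
    note nd = simple_refl_sroot_end[OF i(1) 3(2)]
    define u1 u2 u3 u4 where "u1 = simple_refl n i \<circ> w" and "u2 = simple_refl n j \<circ> u1" and "u3 = simple_refl n i \<circ> u2"
      and "u4 = simple_refl n j \<circ> u3"
    have u: "u1 \<in> W_fin n" "u2 \<in> W_fin n" "u3 \<in> W_fin n" "u4 \<in> W_fin n" unfolding u4_def u3_def u2_def u1_def using wW by (auto intro!: W1)
    define v1 v2 v3 where "v1 = simple_refl n j \<circ> w" and "v2 = simple_refl n i \<circ> v1" and "v3 = simple_refl n j \<circ> v2"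
    have v: "v1 \<in> W_fin n" "v2 \<in> W_fin n" "v3 \<in> W_fin n" unfolding v3_def v2_def v1_def using wW by (auto intro!: W1)
    have u4: "u4 = simple_refl n i \<circ> v3"
      using srefl_braid4[of i n n] 3 i by (simp add: fun_eq_iff u4_def u3_def u2_def u1_def v3_def v2_def v1_def)
    have inv_u: "inv u1 x = inv w (simple_refl n i x)" "inv u2 x = inv w (simple_refl n i (simple_refl n j x))"
       "inv u3 x = inv w (simple_refl n i (simple_refl n j (simple_refl n i x)))" for x
      unfolding u3_def inv1[OF u(2) i] unfolding u2_def inv1[OF u(1) j] unfolding u1_def inv1[OF wW i] by simp_all
    have inv_v: "inv v1 x = inv w (simple_refl n j x)" "inv v2 x = inv w (simple_refl n j (simple_refl n i x))"
       "inv v3 x = inv w (simple_refl n j (simple_refl n i (simple_refl n j x)))" for x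
      unfolding v3_def inv1[OF v(2) j] unfolding v2_def inv1[OF v(1) i] unfolding v1_def inv1[OF wW j] by simp_all
    have ss: "simple_refl n i (sroot n i) = - sroot n i" "simple_refl n n (sroot n n) = - sroot n n"
      using simple_refl_sroot[OF i] simple_refl_sroot[OF j] 3 by auto
    have dbl: "inv w (sroot n i + sroot n n + sroot n n) < 0" using di dj 3(1) by (simp only: iadd) (intro add_neg_neg, simp_all)
    have sgl: "inv w (sroot n i + sroot n n) < 0" using di dj 3(1) by (simp only: iadd) (intro add_neg_neg, simp_all)
    have r: "simple_refl n i (sroot n i + sroot n n + sroot n n) = sroot n i + sroot n n + sroot n n"
      "simple_refl n n (sroot n i + sroot n n) = sroot n i + sroot n n"
      unfolding simple_refl_add nd ss by simp_all
    have r2: "simple_refl n i (sroot n i + sroot n n) = sroot n n"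
      "simple_refl n n (sroot n i + sroot n n + sroot n n) = sroot n i"
      unfolding simple_refl_add nd ss by simp_all
    have d1: "inv u1 (sroot n j) < 0" and e1: "inv v1 (sroot n i) < 0"
      unfolding inv_u inv_v 3(1) nd by (rule sgl dbl)+
    have d2: "inv u2 (sroot n i) < 0" and e2: "inv v2 (sroot n j) < 0"
      unfolding inv_u inv_v 3(1) nd r by (rule sgl dbl)+
    have d3: "inv u3 (sroot n j) < 0" and e3: "inv v3 (sroot n i) < 0"
      unfolding inv_u inv_v 3(1) nd r r2 using di dj 3(1) by auto
    obtain c where c: "is_red n c" "word_prod n c = u4" using ex_red[OF u(4)] by auto
    note a1 = red_simple_down[OF u(3) j d3 c(1) c(2)[unfolded u4_def]]
    note a2 = red_simple_down[OF u(2) i d2 a1(1) a1(2)[unfolded u3_def]]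
    note a3 = red_simple_down[OF u(1) j d1 a2(1) a2(2)[unfolded u2_def]]
    note b1 = red_simple_down[OF v(3) i e3 c(1) c(2)[unfolded u4]]
    note b2 = red_simple_down[OF v(2) j e2 b1(1) b1(2)[unfolded v3_def]]
    note b3 = red_simple_down[OF v(1) i e1 b2(1) b2(2)[unfolded v2_def]]
    have "Tw a = Tw (j # i # j # c)" "Tw b = Tw (i # j # i # c)"
      using IH[OF la ra(1) a3(1)] IH[OF lb rb(1) b3(1)] a3(2) b3(2) wa wb u1_def v1_def by auto
    then show ?thesis using braid4[OF i(1) 3(2)] 3 by (simp add: fun_eq_iff)
  qed
qed

theorem matsumoto:
  assumes "is_red n a" "is_red n b" "word_prod n a = word_prod n b"
  shows "Tw a = Tw b"
  using assms
proof (induction "length a" arbitrary: a b rule: less_induct)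
  case less
  have l: "length a = length b" using less by (simp add: is_red_def)
  show ?case
  proof (cases a)
    case Nil
    then show ?thesis using l by simp
  next
    case (Cons i a')
    then obtain j b' where b: "b = j # b'" using l by (cases b) auto
    have IH: "Tw a0 = Tw b0" if "length a0 < length a" "is_red n a0" "is_red n b0" "word_prod n a0 = word_prod n b0" for a0 b0
      using less.hyps that by blast
    consider "i = j" | "i < j" | "j < i" by linarith
    then show ?thesis
    proof cases
      case 1
      have "word_prod n a' = simple_refl n i \<circ> word_prod n a" "word_prod n b' = simple_refl n i \<circ> word_prod n b"
        using Cons b 1 by (auto simp: fun_eq_iff)
      then have eq: "word_prod n a' = word_prod n b'" using less(4) by metis
      have "Tw a' = Tw b'"
        by (rule IH[OF _ red_Cons(1)[of n i a'] red_Cons(1)[of n j b'] eq]) (use less(2,3) Cons b in auto)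
      then show ?thesis using Cons b 1 by simp
    next
      case 2
      show ?thesis unfolding Cons b
        by (rule matsumoto_step[OF _ less(2)[unfolded Cons] less(3)[unfolded b] less(4)[unfolded Cons b] _ 2, of "length a"])
           (erule (3) IH, simp add: Cons)
    next
      case 3
      show ?thesis unfolding Cons b
        by (rule matsumoto_step[OF _ less(3)[unfolded b] less(2)[unfolded Cons] less(4)[unfolded Cons b, symmetric] _ 3, of "length a", symmetric])
           (erule (3) IH, use l b in simp)
    qed
  qed
qed

end

section \<open>The minimal elements and the longest element\<close>

definition pneg :: "nat \<Rightarrow> vec \<Rightarrow> vec set" where
  "pneg n \<mu> = {\<beta> \<in> posr n. 0 < pair n \<mu> \<beta>}"

lemma finite_pneg [simp]: "finite (pneg n \<mu>)"
  by (simp add: pneg_def)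

lemma posr_cases:
  assumes "\<beta> \<in> posr n"
  obtains i where "i \<in> {1..n}" "\<beta> = Poly_Mapping.single i 1"
  | i j where "1 \<le> i" "i < j" "j \<le> n" "\<beta> = Poly_Mapping.single i 1 + Poly_Mapping.single j 1"
  | i j where "1 \<le> i" "i < j" "j \<le> n" "\<beta> = Poly_Mapping.single i 1 - Poly_Mapping.single j 1"
proof -
  from assms consider i where "\<beta> = eps (int i)" "1 \<le> i" "i \<le> n"
    | i j where "\<beta> = eps (int i) + eps (int j)" "1 \<le> i" "i < j" "j \<le> n"
    | i j where "\<beta> = eps (int i) - eps (int j)" "1 \<le> i" "i < j" "j \<le> n"
    unfolding posr_eq[symmetric] roots_d_def roots_s_def by blast
  then show ?thesis
  proof cases
    case 1
    then show ?thesis using that(1)[of i] by (simp add: eps_def)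
  next
    case 2
    then show ?thesis using that(2)[of i j] by (simp add: eps_def)
  next
    case 3
    then show ?thesis using that(3)[of i j] by (simp add: eps_def)
  qed
qed

lemma antidominant_pair:
  assumes a: "antidominant n \<mu>" and "\<beta> \<in> posr n"
  shows "pair n \<mu> \<beta> \<le> 0"
  using assms(2)
proof (cases rule: posr_cases)
  case (1 i)
  then show ?thesis using a by (simp add: pair_single antidominant_def)
next
  case (2 i j)
  then have "Poly_Mapping.lookup \<mu> i \<le> 0" "Poly_Mapping.lookup \<mu> j \<le> 0" using a by (auto simp: antidominant_def)
  then show ?thesis using 2 by (simp add: pair_add pair_single)
next
  case (3 i j)
  then have "Poly_Mapping.lookup \<mu> i \<le> Poly_Mapping.lookup \<mu> j" using a by (auto simp: antidominant_def)
  then show ?thesis using 3 by (simp add: pair_minus pair_single)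
qed

lemma antidominantI:
  assumes d: "\<And>i. 1 \<le> i \<Longrightarrow> i \<le> n \<Longrightarrow> dval n i \<mu> \<le> 0"
  shows "antidominant n \<mu>"
proof -
  have s: "Poly_Mapping.lookup \<mu> i \<le> Poly_Mapping.lookup \<mu> (Suc i)" if "1 \<le> i" "i < n" for i
    using d[of i] that by (simp add: dval_def)
  have le: "i \<le> j \<Longrightarrow> 1 \<le> i \<Longrightarrow> j \<le> n \<Longrightarrow> Poly_Mapping.lookup \<mu> i \<le> Poly_Mapping.lookup \<mu> j" for i j
  proof (induction j rule: dec_induct)
    case (step j)
    then show ?case using s[of j] by simp
  qed simp
  have "Poly_Mapping.lookup \<mu> i \<le> 0" if "i \<in> {1..n}" for i
    using le[of i n] d[of n] that by (simp add: dval_def)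
  then show ?thesis using le by (auto simp: antidominant_def)
qed

text \<open>Away from the simple root s_i permutes the positive roots; the simple root itself turns
  from a non-inversion into an inversion.\<close>

lemma Inv_mult_simple:
  assumes v: "v \<in> W_fin n" and i: "1 \<le> i" "i \<le> n" and \<mu>: "0 < dval n i \<mu>"
    and Inv: "Inv n v = pneg n (simple_refl n i \<mu>)"
  shows "Inv n (v \<circ> simple_refl n i) = pneg n \<mu>"
proof -
  note S = W_simple[OF i]
  have vs: "v \<circ> simple_refl n i \<in> W_fin n" by (rule W_comp[OF v S])
  have "v (simple_refl n i \<beta>) < 0 \<longleftrightarrow> 0 < pair n \<mu> \<beta>" if b: "\<beta> \<in> posr n" for \<beta>
  proof (cases "\<beta> = sroot n i")
    case True
    have "pair n (simple_refl n i \<mu>) (sroot n i) < 0"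
      using \<mu> dval_srefl[OF i] i by (simp add: pair_sroot)
    then have "sroot n i \<notin> Inv n v" unfolding Inv by (simp add: pneg_def)
    then have "0 < v (sroot n i)" using W_nonzero[OF v sroot_posr[OF i]] sroot_posr[OF i] by (auto simp: Inv_eq[OF v])
    then show ?thesis using True \<mu> i by (simp add: simple_refl_sroot[OF i] W_uminus[OF v] pair_sroot)
  next
    case False
    then have p: "simple_refl n i \<beta> \<in> posr n" using simple_refl_pos[OF i b] b
      by (simp add: posr_def nrm_simple_refl[OF i] simple_refl_lattice[OF i])
    then have "v (simple_refl n i \<beta>) < 0 \<longleftrightarrow> simple_refl n i \<beta> \<in> Inv n v" by (simp add: Inv_eq[OF v])
    also have "\<dots> \<longleftrightarrow> 0 < pair n \<mu> \<beta>" unfolding Inv using p W_pair[OF S] by (simp add: pneg_def)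
    finally show ?thesis .
  qed
  then show ?thesis by (auto simp: Inv_eq[OF vs] pneg_def)
qed

text \<open>The measure for the inductions that lower a weight to the antidominant one. The
  reflection maps the smaller set into the larger one and misses the simple root.\<close>

lemma card_pneg_simple:
  assumes i: "1 \<le> i" "i \<le> n" and \<mu>: "0 < dval n i \<mu>"
  shows "card (pneg n (simple_refl n i \<mu>)) < card (pneg n \<mu>)"
proof -
  note S = W_simple[OF i]
  have ne: "\<beta> \<noteq> sroot n i" if "\<beta> \<in> pneg n (simple_refl n i \<mu>)" for \<beta>
    using that \<mu> dval_srefl[OF i, of \<mu>] i by (auto simp: pneg_def pair_sroot)
  have "simple_refl n i ` pneg n (simple_refl n i \<mu>) \<subseteq> pneg n \<mu> - {sroot n i}"
  proof safe
    fix \<beta> assume b: "\<beta> \<in> pneg n (simple_refl n i \<mu>)"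
    then have p: "simple_refl n i \<beta> \<in> posr n" using simple_refl_pos[OF i _ ne[OF b]]
      by (simp add: posr_def pneg_def nrm_simple_refl[OF i] simple_refl_lattice[OF i])
    show "simple_refl n i \<beta> \<in> pneg n \<mu>" using p b W_pair[OF S, of "simple_refl n i \<mu>" \<beta>] by (simp add: pneg_def)
    assume "simple_refl n i \<beta> = sroot n i"
    then have "\<beta> = - sroot n i" using simple_refl_sroot[OF i] by (metis simple_refl_simple_refl)
    then show False using b sroot_pos[of n i] by (auto simp: pneg_def posr_def dest: less_asym)
  qed
  then have "card (simple_refl n i ` pneg n (simple_refl n i \<mu>)) \<le> card (pneg n \<mu> - {sroot n i})"
    by (intro card_mono) auto
  also have "\<dots> < card (pneg n \<mu>)"
    using sroot_posr[OF i] \<mu> i by (intro card_Diff1_less) (auto simp: pneg_def pair_sroot)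
  also have "card (simple_refl n i ` pneg n (simple_refl n i \<mu>)) = card (pneg n (simple_refl n i \<mu>))"
    by (intro card_image inj_on_inverseI[of _ "simple_refl n i"]) simp
  finally show ?thesis .
qed

lemma ex_v: "\<exists>v\<in>W_fin n. Inv n v = pneg n \<mu>"
proof (induction "card (pneg n \<mu>)" arbitrary: \<mu> rule: less_induct)
  case less
  show ?case
  proof (cases "\<exists>i\<in>{1..n}. 0 < dval n i \<mu>")
    case True
    then obtain i where i: "1 \<le> i" "i \<le> n" "0 < dval n i \<mu>" by auto
    then obtain v where v: "v \<in> W_fin n" "Inv n v = pneg n (simple_refl n i \<mu>)"
      using less[OF card_pneg_simple[OF i]] by blast
    show ?thesis using Inv_mult_simple[OF v(1) i v(2)] W_comp[OF v(1) W_simple[OF i(1,2)]] by blast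
  next
    case False
    then have "antidominant n \<mu>" by (intro antidominantI) (simp add: not_less)
    then have "pneg n \<mu> = {}" using antidominant_pair by (force simp: pneg_def)
    moreover have "Inv n id = {}" by (auto simp: Inv_eq[OF W_id] posr_def)
    ultimately show ?thesis using W_id by metis
  qed
qed

text \<open>If the inversions agree, u composed with the inverse of v keeps all simple roots
  positive and is the identity.\<close>

lemma Inv_inj:
  assumes u: "u \<in> W_fin n" and v: "v \<in> W_fin n" and eq: "Inv n u = Inv n v"
  shows "u = v"
proof -
  have "0 < (u \<circ> inv v) (sroot n i)" if i: "1 \<le> i" "i \<le> n" for i
  proof -
    define \<gamma> where "\<gamma> = inv v (sroot n i)"
    have vg: "v \<gamma> = sroot n i" by (simp add: \<gamma>_def W_inv[OF v])
    consider "\<gamma> \<in> posr n" | "- \<gamma> \<in> posr n" unfolding \<gamma>_def using W_posr[OF W_inv(1)[OF v] sroot_posr[OF i]] by auto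
    then have "0 < u \<gamma>"
    proof cases
      case 1
      then have "\<gamma> \<notin> Inv n u" unfolding eq using vg sroot_pos[of n i] by (auto simp: Inv_eq[OF v])
      then show ?thesis using W_nonzero[OF u 1] 1 by (auto simp: Inv_eq[OF u])
    next
      case 2
      then have "- \<gamma> \<in> Inv n u" unfolding eq using vg sroot_pos[of n i] by (simp add: Inv_eq[OF v] W_uminus[OF v])
      then show ?thesis by (simp add: Inv_eq[OF u] W_uminus[OF u])
    qed
    then show ?thesis by (simp add: \<gamma>_def)
  qed
  then have "u \<circ> inv v = id" by (rule no_descent[OF W_comp[OF u W_inv(1)[OF v]]])
  then show "u = v" using W_inv(2)[OF v] by (metis comp_apply ext id_apply)
qed

lemma antidominant_v:
  assumes v: "v \<in> W_fin n" and Inv: "Inv n v = pneg n \<mu>"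
  shows "antidominant n (v \<mu>)"
proof (rule antidominantI)
  fix i assume i: "1 \<le> i" "i \<le> n"
  define \<gamma> where "\<gamma> = inv v (sroot n i)"
  have vg: "v \<gamma> = sroot n i" by (simp add: \<gamma>_def W_inv[OF v])
  have p: "dval n i (v \<mu>) = pair n \<mu> \<gamma>" using W_pair[OF v, of \<mu> \<gamma>] i by (simp add: vg pair_sroot)
  consider "\<gamma> \<in> posr n" | "- \<gamma> \<in> posr n" unfolding \<gamma>_def using W_posr[OF W_inv(1)[OF v] sroot_posr[OF i]] by auto
  then show "dval n i (v \<mu>) \<le> 0"
  proof cases
    case 1
    then have "\<gamma> \<notin> Inv n v" using vg sroot_pos[of n i] by (auto simp: Inv_eq[OF v])
    then show ?thesis using 1 unfolding p Inv by (simp add: pneg_def)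
  next
    case 2
    then have "- \<gamma> \<in> Inv n v" using vg sroot_pos[of n i] by (simp add: Inv_eq[OF v] W_uminus[OF v])
    then show ?thesis unfolding p Inv by (simp add: pneg_def pair_uminus)
  qed
qed

lemma pneg_subset_Inv:
  assumes u: "u \<in> W_fin n" and "antidominant n (u \<mu>)"
  shows "pneg n \<mu> \<subseteq> Inv n u"
proof
  fix \<beta> assume "\<beta> \<in> pneg n \<mu>"
  then have b: "\<beta> \<in> posr n" "0 < pair n (u \<mu>) (u \<beta>)" by (auto simp: pneg_def W_pair[OF u])
  then have "u \<beta> \<notin> posr n" using antidominant_pair[OF assms(2), of "u \<beta>"] by auto
  then show "\<beta> \<in> Inv n u" using W_posr[OF u b(1)] b(1) by (auto simp: Inv_eq[OF u])
qed

text \<open>Every u that makes \<mu> antidominant inverts all of \<open>pneg n \<mu>\<close>. An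
  element inverting exactly these roots is therefore shortest, and by \<open>Inv_inj\<close> it is
  the only one.\<close>

lemma v_min_eq:
  assumes v: "v \<in> W_fin n" and Inv: "Inv n v = pneg n \<mu>"
  shows "v_min n \<mu> = v"
  unfolding v_min_def
proof (rule the_equality)
  have m: "len n v \<le> len n u" if "u \<in> W_fin n" "antidominant n (u \<mu>)" for u
    using pneg_subset_Inv[OF that] by (simp add: reduced_word(3) that v ilen_def Inv card_mono)
  then show "v \<in> W_fin n \<and> antidominant n (v \<mu>) \<and> (\<forall>u\<in>W_fin n. antidominant n (u \<mu>) \<longrightarrow> len n v \<le> len n u)"
    using v antidominant_v[OF assms] by blast
  fix u assume u: "u \<in> W_fin n \<and> antidominant n (u \<mu>) \<and> (\<forall>w\<in>W_fin n. antidominant n (w \<mu>) \<longrightarrow> len n u \<le> len n w)"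
  then have "len n u \<le> len n v" using v antidominant_v[OF assms] by blast
  then have "card (Inv n u) \<le> card (pneg n \<mu>)" using u v by (simp add: reduced_word(3) ilen_def Inv)
  then have "pneg n \<mu> = Inv n u" using pneg_subset_Inv[of u n \<mu>] u by (intro card_seteq) auto
  then show "u = v" using Inv_inj[of u n v] u v Inv by simp
qed

lemma v_min_props: "v_min n \<mu> \<in> W_fin n" "Inv n (v_min n \<mu>) = pneg n \<mu>" "antidominant n (v_min n \<mu> \<mu>)"
  using ex_v[of n \<mu>] v_min_eq antidominant_v by metis+

lemma v_min_simple:
  assumes i: "1 \<le> i" "i \<le> n" and \<mu>: "0 < dval n i \<mu>"
  shows "v_min n \<mu> = v_min n (simple_refl n i \<mu>) \<circ> simple_refl n i"
  by (intro v_min_eq Inv_mult_simple v_min_props assms W_comp W_simple)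

lemma v_min_neg_iff:
  assumes "\<beta> \<in> posr n"
  shows "v_min n \<mu> \<beta> < 0 \<longleftrightarrow> 0 < pair n \<mu> \<beta>" "0 < v_min n \<mu> \<beta> \<longleftrightarrow> pair n \<mu> \<beta> \<le> 0"
proof -
  have "\<beta> \<in> Inv n (v_min n \<mu>) \<longleftrightarrow> \<beta> \<in> pneg n \<mu>" by (simp add: v_min_props)
  then show 1: "v_min n \<mu> \<beta> < 0 \<longleftrightarrow> 0 < pair n \<mu> \<beta>" using assms by (simp add: Inv_eq[OF v_min_props(1)] pneg_def)
  show "0 < v_min n \<mu> \<beta> \<longleftrightarrow> pair n \<mu> \<beta> \<le> 0" using 1 W_nonzero[OF v_min_props(1) assms, of \<mu>] by (meson less_asym not_less)
qed

section \<open>Finiteness of the group and the longest element\<close>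

lemma finite_W [simp]: "finite (W_fin n)"
proof (rule finite_imageD[of "Inv n"])
  show "finite (Inv n ` W_fin n)"
    by (rule finite_subset[of _ "Pow (posr n)"]) (auto simp: Inv_eq)
  show "inj_on (Inv n) (W_fin n)" by (auto intro: inj_onI Inv_inj)
qed

lemma lookup_rho: "k \<in> {1..n} \<Longrightarrow> Poly_Mapping.lookup (rho n) k = int n - int k + 1"
  by (simp add: rho_def lookup_sum lookup_single when_def)

lemma longest_props: "longest n \<in> W_fin n" "Inv n (longest n) = posr n"
proof -
  \<comment> \<open>The vector rho pairs positively with all positive roots, so the minimal element
    for rho inverts all of them and is the longest element.\<close>
  have "pneg n (rho n) = posr n"
  proof -
    have "0 < pair n (rho n) \<beta>" if "\<beta> \<in> posr n" for \<beta>
      using that by (cases rule: posr_cases) (simp_all add: pair_add pair_minus pair_single lookup_rho)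
    then show ?thesis by (auto simp: pneg_def)
  qed
  then obtain v where v: "v \<in> W_fin n" "Inv n v = posr n" using ex_v[of n "rho n"] by metis
  have m: "len n u \<le> len n v" if "u \<in> W_fin n" for u
    using that v by (auto simp: reduced_word(3) ilen_def Inv_eq intro!: card_mono)
  have "longest n = v" unfolding longest_def
  proof (rule the_equality)
    fix u assume u: "u \<in> W_fin n \<and> (\<forall>w\<in>W_fin n. len n w \<le> len n u)"
    then have "card (posr n) \<le> card (Inv n u)" using v by (auto simp: reduced_word(3) ilen_def)
    then have "Inv n u = posr n" using u by (intro card_seteq) (auto simp: Inv_eq)
    then show "u = v" using Inv_inj[of u n v] u v by simp
  qed (use v m in blast)
  then show "longest n \<in> W_fin n" "Inv n (longest n) = posr n" using v by auto
qed

section \<open>Spectral vectors\<close>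

lemma lookup_eps: "k \<noteq> 0 \<Longrightarrow> Poly_Mapping.lookup (eps k) m = (if m = nat \<bar>k\<bar> then sgn k else 0)"
  by (auto simp: eps_def lookup_single)

lemma eps_inj:
  assumes "k \<noteq> 0" "l \<noteq> 0" "eps k = eps l" shows "k = l"
proof -
  have "Poly_Mapping.lookup (eps l) (nat \<bar>k\<bar>) = sgn k" using assms lookup_eps[of k "nat \<bar>k\<bar>"] by simp
  then have "nat \<bar>k\<bar> = nat \<bar>l\<bar>" "sgn k = sgn l" using assms lookup_eps[of l "nat \<bar>k\<bar>"] by (auto simp: sgn_if split: if_splits)
  then show ?thesis using assms by (auto simp: sgn_if split: if_splits)
qed

lemma eps_uminus: "eps (- k) = - eps k"
  by (simp add: eps_def single_uminus sgn_minus)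

lemma W_eps:
  assumes w: "w \<in> W_fin n" and j: "j \<in> {1..n}"
  shows "\<exists>k. k \<noteq> 0 \<and> \<bar>k\<bar> \<le> int n \<and> w (eps (int j)) = eps k"
proof -
  have "eps (int j) \<in> roots_d n" using j by (auto simp: roots_d_def)
  then have "eps (int j) \<in> posr n" "nrm n (eps (int j)) = 1" by (auto simp: posr_eq[symmetric] roots_d_eq)
  then have "w (eps (int j)) \<in> roots_d n \<or> - w (eps (int j)) \<in> roots_d n"
    using W_posr[OF w, of "eps (int j)"] W_nrm[OF w] W_nrm[OF w, of "- eps (int j)"]
    by (auto simp: roots_d_eq posr_def nrm_def)
  then show ?thesis
  proof
    assume "w (eps (int j)) \<in> roots_d n"
    then obtain i where "1 \<le> i" "i \<le> n" "w (eps (int j)) = eps (int i)" by (auto simp: roots_d_def)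
    then show ?thesis by (intro exI[of _ "int i"]) auto
  next
    assume "- w (eps (int j)) \<in> roots_d n"
    then obtain i where i: "1 \<le> i" "i \<le> n" "- w (eps (int j)) = eps (int i)" by (auto simp: roots_d_def)
    then have "w (eps (int j)) = eps (- int i)" unfolding eps_uminus by (metis minus_minus)
    then show ?thesis using i by (intro exI[of _ "- int i"]) auto
  qed
qed

lemma signed_image:
  assumes w: "w \<in> W_fin n" and j: "j \<in> {1..n}"
  shows "signed_image n w j \<noteq> 0" "\<bar>signed_image n w j\<bar> \<le> int n" "w (eps (int j)) = eps (signed_image n w j)"
proof -
  have "\<exists>!k. k \<noteq> 0 \<and> \<bar>k\<bar> \<le> int n \<and> w (eps (int j)) = eps k"
    using W_eps[OF assms] eps_inj by metis
  from theI'[OF this] show "signed_image n w j \<noteq> 0" "\<bar>signed_image n w j\<bar> \<le> int n" "w (eps (int j)) = eps (signed_image n w j)"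
    unfolding signed_image_def by auto
qed

lemma signed_image_eq: "w \<in> W_fin n \<Longrightarrow> j \<in> {1..n} \<Longrightarrow> k \<noteq> 0 \<Longrightarrow> w (eps (int j)) = eps k \<Longrightarrow> signed_image n w j = k"
  using signed_image[of w n j] eps_inj by metis

definition vsg :: "vec \<Rightarrow> int" where
  "vsg \<beta> = (if 0 < \<beta> then 1 else - 1)"

lemma eps_add_pos: "a \<noteq> 0 \<Longrightarrow> \<bar>a\<bar> < \<bar>b\<bar> \<Longrightarrow> 0 < eps a + eps b \<longleftrightarrow> 0 < a"
proof -
  assume a: "a \<noteq> 0" "\<bar>a\<bar> < \<bar>b\<bar>"
  have pos: "0 < eps a + eps b" if "0 < a" "\<bar>a\<bar> < \<bar>b\<bar>" for a b
    using that unfolding vec_pos_iff by (intro exI[of _ "nat \<bar>a\<bar>"]) (auto simp: lookup_add lookup_eps)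
  show ?thesis
  proof
    assume p: "0 < eps a + eps b"
    show "0 < a"
    proof (rule ccontr)
      assume "\<not> 0 < a"
      then have "0 < eps (- a) + eps (- b)" using a by (intro pos) auto
      then have "0 < - (eps a + eps b)" by (simp add: eps_uminus)
      then show False using p by (metis less_asym neg_0_less_iff_less)
    qed
  qed (use a pos in auto)
qed

lemma vsg_eps: "a \<noteq> 0 \<Longrightarrow> vsg (eps a) = sgn a"
proof -
  assume a: "a \<noteq> 0"
  have pos: "0 < eps a" if "0 < a" for a
    using that unfolding vec_pos_iff by (intro exI[of _ "nat \<bar>a\<bar>"]) (auto simp: lookup_eps)
  show ?thesis
  proof (cases "0 < a")
    case False
    then have "0 < eps (- a)" using a by (intro pos) auto
    then have "\<not> 0 < eps a" unfolding eps_uminus by (metis less_asym neg_0_less_iff_less)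
    then show ?thesis using False a by (simp add: vsg_def)
  qed (simp add: vsg_def pos)
qed

lemma vsg_eps_sum:
  assumes "k \<noteq> 0" "l \<noteq> 0" "\<bar>k\<bar> \<noteq> \<bar>l\<bar>"
  shows "vsg (eps k + eps l) + vsg (eps k - eps l) = (if \<bar>k\<bar> < \<bar>l\<bar> then 2 * sgn k else 0)"
proof (cases "\<bar>k\<bar> < \<bar>l\<bar>")
  case True
  then show ?thesis using assms eps_add_pos[of k l] eps_add_pos[of k "- l"] by (auto simp: vsg_def eps_uminus sgn_if)
next
  case False
  then have "\<bar>l\<bar> < \<bar>k\<bar>" using assms by simp
  then have "0 < eps l + eps k \<longleftrightarrow> 0 < l" "0 < eps (- l) + eps k \<longleftrightarrow> 0 < - l"
    using assms eps_add_pos[of l k] eps_add_pos[of "- l" k] by auto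
  then show ?thesis using False assms by (auto simp: vsg_def eps_uminus add.commute)
qed

text \<open>The two terms for an index i cancel unless the absolute value of w(i) exceeds that of k.
  Absolute values permute the indices, so n - |k| of them remain, each contributing 2 sgn k.\<close>

lemma signed_image_sum:
  assumes w: "w \<in> W_fin n" and j: "j \<in> {1..n}"
  defines "k \<equiv> signed_image n w j"
  shows "(\<Sum>i\<in>{1..n} - {j}. vsg (w (eps (int j) + eps (int i))) + vsg (w (eps (int j) - eps (int i)))) = 2 * (int n * sgn k - k)"
proof -
  define l where "l i = signed_image n w i" for i
  define m where "m i = nat \<bar>l i\<bar>" for i
  have l: "l i \<noteq> 0" "\<bar>l i\<bar> \<le> int n" "w (eps (int i)) = eps (l i)" if "i \<in> {1..n}" for i
    using signed_image[OF w that] by (auto simp: l_def)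
  have lk: "l j = k" by (simp add: l_def k_def)
  have inj: "inj_on m {1..n}"
  proof (rule inj_onI)
    fix a b assume ab: "a \<in> {1..n}" "b \<in> {1..n}" "m a = m b"
    then have "l a = l b \<or> l a = - l b" by (auto simp: m_def)
    then have "w (eps (int a)) = w (eps (int b)) \<or> w (eps (int a)) = w (eps (- int b))"
      using l ab by (auto simp: eps_uminus W_uminus[OF w])
    then have "eps (int a) = eps (int b) \<or> eps (int a) = eps (- int b)" using W_inv(2)[OF w] by metis
    then show "a = b" using eps_inj[of "int a" "int b"] eps_inj[of "int a" "- int b"] ab by auto
  qed
  have "m ` {1..n} = {1..n}"
  proof (rule card_subset_eq)
    show "m ` {1..n} \<subseteq> {1..n}" using l by (force simp: m_def)
    show "card (m ` {1..n}) = card {1..n}" using inj by (rule card_image)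
  qed simp
  then have im: "m ` ({1..n} - {j}) = {1..n} - {m j}" using inj j by (simp add: inj_on_image_set_diff)
  have k: "k \<noteq> 0" "\<bar>k\<bar> \<le> int n" using l[OF j] lk by auto
  have "(\<Sum>i\<in>{1..n} - {j}. vsg (w (eps (int j) + eps (int i))) + vsg (w (eps (int j) - eps (int i)))) =
    (\<Sum>i\<in>{1..n} - {j}. if \<bar>k\<bar> < int (m i) then 2 * sgn k else 0)"
  proof (rule sum.cong[OF refl])
    fix i assume i: "i \<in> {1..n} - {j}"
    then have "m i \<noteq> m j" using inj j by (auto dest: inj_onD)
    then have "\<bar>k\<bar> \<noteq> \<bar>l i\<bar>" by (auto simp: m_def lk)
    then have "vsg (eps k + eps (l i)) + vsg (eps k - eps (l i)) = (if \<bar>k\<bar> < \<bar>l i\<bar> then 2 * sgn k else 0)"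
      using l i k by (intro vsg_eps_sum) auto
    then show "vsg (w (eps (int j) + eps (int i))) + vsg (w (eps (int j) - eps (int i))) = (if \<bar>k\<bar> < int (m i) then 2 * sgn k else 0)"
      using l i j lk by (simp add: W_add[OF w] W_minus[OF w] m_def)
  qed
  also have "\<dots> = (\<Sum>p\<in>m ` ({1..n} - {j}). if \<bar>k\<bar> < int p then 2 * sgn k else 0)"
    using inj by (subst sum.reindex) (auto intro: inj_on_subset)
  also have "\<dots> = (\<Sum>p\<in>{nat \<bar>k\<bar> <.. n}. 2 * sgn k)"
    unfolding im by (rule sum.mono_neutral_cong_right) (auto simp: m_def lk)
  also have "\<dots> = 2 * (int n * sgn k - k)" using k
    by (cases "0 < k") (auto simp: algebra_simps of_nat_diff)
  finally show ?thesis .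
qed

text \<open>A product over the roots that involve e_j. In this shape the eigenvalue arises from
  triangularity, one factor for each letter of Y_j.\<close>

lemma ev_Y_eq:
  assumes j: "j \<in> {1..n}"
  shows "ev_Y n \<mu> j = q_par powi (- Poly_Mapping.lookup \<mu> j) * (t0_half * tn_half) powi vsg (v_min n \<mu> (eps (int j))) *
    (\<Prod>i\<in>{1..n} - {j}. t_half powi vsg (v_min n \<mu> (eps (int j) + eps (int i))) * t_half powi vsg (v_min n \<mu> (eps (int j) - eps (int i))))"
proof -
  define k where "k = signed_image n (v_min n \<mu>) j"
  note k = signed_image[OF v_min_props(1)[of n \<mu>] j, folded k_def]
  have s: "vsg (v_min n \<mu> (eps (int j))) = sgn k" using k by (simp add: vsg_eps)
  have p: "(\<Prod>i\<in>A. t_half powi f i) = t_half powi (\<Sum>i\<in>A. f i)" for A and f :: "nat \<Rightarrow> int"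
    by (induction A rule: infinite_finite_induct) (auto simp: power_int_add)
  have "t_par powi (- k) * (t0_half * tn_half * t_par ^ n) powi sgn k = (t0_half * tn_half) powi sgn k * t_half powi (2 * (int n * sgn k - k))"
  proof -
    have "t_par = t_half powi 2" by simp
    then have "t_par powi (- k) = t_half powi (2 * (- k))" "(t_par ^ n) powi sgn k = t_half powi (2 * int n * sgn k)"
      by (simp_all only: power_int_mult power_int_of_nat)
    then show ?thesis by (simp add: power_int_mult_distrib algebra_simps power_int_diff power_int_minus power_int_add divide_inverse)
  qed
  then show ?thesis
    unfolding ev_Y_def k_def[symmetric] Let_def s p power_int_add[OF disjI1[OF par_nz(2)], symmetric]
      signed_image_sum[OF v_min_props(1) j, folded k_def] by (simp add: mult.assoc)
qed

section \<open>Commutation of the Y operators\<close>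

definition comm :: "('a \<Rightarrow> 'a) \<Rightarrow> ('a \<Rightarrow> 'a) \<Rightarrow> bool" where
  "comm A B \<longleftrightarrow> (\<forall>x. A (B x) = B (A x))"

lemma commI: "(\<And>x. A (B x) = B (A x)) \<Longrightarrow> comm A B" and commD: "comm A B \<Longrightarrow> A (B x) = B (A x)"
  by (auto simp: comm_def)

lemma comm_sym: "comm A B \<Longrightarrow> comm B A"
  by (simp add: comm_def)

lemma comm_comp: "comm A B \<Longrightarrow> comm A C \<Longrightarrow> comm A (B \<circ> C)"
  by (simp add: comm_def)

lemma comm_inv: "comm A B \<Longrightarrow> bij B \<Longrightarrow> comm A (inv B)"
  unfolding comm_def by (metis bij_inv_eq_iff)

locale affine_family = braid_family +
  assumes n1: "1 \<le> n"
    and far0: "2 \<le> j \<Longrightarrow> j \<le> n \<Longrightarrow> T 0 (T j x) = T j (T 0 x)"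
    and braid0: "2 \<le> n \<Longrightarrow> T 1 (T 0 (T 1 (T 0 x))) = T 0 (T 1 (T 0 (T 1 x)))"
    and bijT: "i \<le> n \<Longrightarrow> bij (T i)"
begin

lemma Tw_append: "Tw (as @ bs) = Tw as \<circ> Tw bs"
  by (induction as) (simp_all add: comp_assoc)

text \<open>The Jucys-Murphy elements of the finite Hecke algebra of type B. They describe the part
  of Y_j without T_0.\<close>

definition B :: "nat \<Rightarrow> 'a \<Rightarrow> 'a" where
  "B k = Tw ([k..<n] @ [n] @ rev [k..<n])"

lemma B_n: "B n = T n"
  by (simp add: B_def)

lemma B_step: "k < n \<Longrightarrow> B k = T k \<circ> B (Suc k) \<circ> T k"
  by (simp add: B_def upt_conv_Cons Tw_append comp_assoc)

lemma T_comm: "i \<le> n \<Longrightarrow> j \<le> n \<Longrightarrow> Suc i < j \<or> Suc j < i \<Longrightarrow> comm (T i) (T j)"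
  using far[of i j] far[of j i] far0[of i] far0[of j] unfolding comm_def
  by (metis One_nat_def Suc_leI less_2_cases_iff not_less gr_zeroI numeral_2_eq_2)

lemma B_far: "Suc k < m \<Longrightarrow> m \<le> n \<Longrightarrow> comm (T k) (B m)"
proof (induction "n - m" arbitrary: m)
  case 0
  then have mn: "m = n" by simp
  show ?case unfolding mn B_n by (rule T_comm) (use 0 in auto)
next
  case (Suc d)
  then have "comm (T k) (B (Suc m))" "comm (T k) (T m)" using T_comm[of k m] by auto
  moreover have "m < n" using Suc by simp
  ultimately show ?case unfolding B_step[OF \<open>m < n\<close>] by (intro comm_comp)
qed

text \<open>Only the layers next to i matter: for i = k + 1 the relation with T_k is the three-term
  braid relation if i < n and the four-term one if i = n.\<close>

lemma B_above: "1 \<le> k \<Longrightarrow> k < i \<Longrightarrow> i \<le> n \<Longrightarrow> comm (T i) (B k)"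
proof (induction "n - k" arbitrary: k)
  case (Suc d)
  have k: "k < n" using Suc by simp
  consider "Suc k < i" | "i = Suc k" "i < n" | "i = Suc k" "i = n" using Suc by linarith
  then show ?case
  proof cases
    case 1
    then have "comm (T i) (B (Suc k))" "comm (T i) (T k)" using Suc T_comm[of i k] by auto
    then show ?thesis unfolding B_step[OF k] by (intro comm_comp)
  next
    case 2
    have c: "T k (B (Suc i) x) = B (Suc i) (T k x)" for x using B_far[of k "Suc i"] 2 by (simp add: comm_def)
    have b: "T i (T k (T i x)) = T k (T i (T k x))" for x using braid3[of k x] 2 Suc by simp
    have e: "B k x = T k (T i (B (Suc i) (T i (T k x))))" for x using B_step[OF k] B_step[of i] 2 by simp
    show ?thesis by (rule commI) (simp add: e b c)
  next
    case 3
    have kn: "Suc k = n" using 3 by simp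
    have e: "B k x = T k (T n (T k x))" for x using B_step[OF k] unfolding kn B_n by simp
    show ?thesis unfolding 3(2) by (rule commI) (simp add: e braid4[OF Suc(3) kn])
  qed
qed simp

lemma B1_B: "2 \<le> m \<Longrightarrow> m \<le> n \<Longrightarrow> comm (B 1) (B m)"
proof (induction "n - m" arbitrary: m)
  case 0
  then have mn: "m = n" by simp
  show ?case unfolding mn B_n by (rule comm_sym[OF B_above]) (use 0 in auto)
next
  case (Suc d)
  then have "comm (B 1) (B (Suc m))" "comm (B 1) (T m)" using B_above[of 1 m] by (auto intro: comm_sym)
  moreover have "m < n" using Suc by simp
  ultimately show ?case unfolding B_step[OF \<open>m < n\<close>] by (intro comm_comp)
qed

definition Y :: "nat \<Rightarrow> 'a \<Rightarrow> 'a" where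
  "Y j = foldr (\<lambda>i g. inv (T i) \<circ> g) (rev [1..<j]) id \<circ> Tw ([0..<n] @ [n] @ rev [j..<n])"

lemma T_inv [simp]: "i \<le> n \<Longrightarrow> T i (inv (T i) x) = x" "i \<le> n \<Longrightarrow> inv (T i) (T i x) = x"
  using bijT[of i] by (simp_all add: bij_is_surj surj_f_inv_f bij_is_inj)

lemma Y_1: "Y 1 = T 0 \<circ> B 1"
proof -
  have "[0..<n] = 0 # [1..<n]" using n1 by (simp add: upt_conv_Cons)
  then show ?thesis by (simp add: Y_def B_def)
qed

lemma Y_Suc:
  assumes "1 \<le> j" "j < n" shows "Y (Suc j) = inv (T j) \<circ> Y j \<circ> inv (T j)"
proof -
  have "T j \<circ> inv (T j) = id" using assms by (auto simp: fun_eq_iff)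
  moreover have "rev [j..<n] = rev [Suc j..<n] @ [j]" using assms by (simp add: upt_conv_Cons)
  moreover have "rev [1..<Suc j] = j # rev [1..<j]" using assms by simp
  ultimately show ?thesis by (simp only: Y_def Tw_append Tw_simps foldr.simps comp_assoc comp_id o_apply)
qed

lemma Y_T: "1 \<le> j \<Longrightarrow> j < n \<Longrightarrow> T j (Y (Suc j) (T j x)) = Y j x"
  by (simp add: Y_Suc)

lemma Tw_bij: "set is \<subseteq> {..n} \<Longrightarrow> bij (Tw is)"
  by (induction "is") (auto intro: bij_comp bijT)

lemma foldr_inv: "set is \<subseteq> {..n} \<Longrightarrow> foldr (\<lambda>i g. inv (T i) \<circ> g) (rev is) g = inv (Tw is) \<circ> g"
proof (induction "is" arbitrary: g)
  case (Cons i "is")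
  then have e: "inv (T i \<circ> Tw is) = inv (Tw is) \<circ> inv (T i)" by (intro o_inv_distrib Tw_bij bijT) auto
  have "foldr (\<lambda>i g. inv (T i) \<circ> g) (rev (i # is)) g = foldr (\<lambda>i g. inv (T i) \<circ> g) (rev is) (inv (T i) \<circ> g)"
    by simp
  also have "\<dots> = inv (Tw is) \<circ> (inv (T i) \<circ> g)" by (rule Cons.IH) (use Cons.prems in auto)
  finally show ?case by (simp only: e Tw_simps comp_assoc)
qed simp

lemma Y_n: "Y n = inv (Tw [1..<n]) \<circ> T 0 \<circ> Tw [1..<n] \<circ> T n"
proof -
  have "[0..<n] = 0 # [1..<n]" using n1 by (simp add: upt_conv_Cons)
  moreover have "foldr (\<lambda>i g. inv (T i) \<circ> g) (rev [1..<n]) id = inv (Tw [1..<n])"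
    using foldr_inv[of "[1..<n]" id] by (simp add: subset_iff)
  ultimately show ?thesis by (simp add: Y_def Tw_append comp_assoc)
qed

lemma T_Y_1: "2 \<le> i \<Longrightarrow> i \<le> n \<Longrightarrow> comm (T i) (Y 1)"
  unfolding Y_1 using T_comm[of i 0] B_above[of 1 i] by (intro comm_comp) auto

lemma T_Y_comm: "1 \<le> i \<Longrightarrow> i \<le> n \<Longrightarrow> 1 \<le> j \<Longrightarrow> j \<le> n \<Longrightarrow> i \<noteq> j \<Longrightarrow> Suc i \<noteq> j \<Longrightarrow> comm (T i) (Y j)"
proof (induction j arbitrary: i rule: less_induct)
  case (less j)
  show ?case
  proof (cases "j = 1")
    case True
    then show ?thesis using T_Y_1[of i] less by auto
  next
    case False
    then obtain k where k: "j = Suc k" "1 \<le> k" "k < n" using less by (cases j) auto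
    note Yj = Y_Suc[OF k(2,3), folded k(1)]
    show ?thesis
    proof (cases "Suc i = k")
      case False
      then have "comm (T i) (T k)" using less k by (intro T_comm) auto
      then have "comm (T i) (inv (T k))" using k by (intro comm_inv bijT) auto
      moreover have "comm (T i) (Y k)" using less k False by (intro less.IH) auto
      ultimately show ?thesis unfolding Yj by (intro comm_comp)
    next
      case True
      then have ij: "1 \<le> i" "Suc i < n" "i < n" "k = Suc i" using less k by auto
      \<comment> \<open>Here j = i + 2. Passing T_i through the inverses of T_k and T_i turns it
        into T_k, which commutes with Y_i; the two inverses on the other side turn it back into
        T_i.\<close>
      have c: "T k (Y i x) = Y i (T k x)" for x
      proof -
        have "comm (T k) (Y i)" using less k ij by (intro less.IH) auto
        then show ?thesis by (rule commD)
      qed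
      have b: "T i (T k (T i x)) = T k (T i (T k x))" for x using braid3[of i x] ij by simp
      have b1: "T i (inv (T k) (inv (T i) y)) = inv (T k) (inv (T i) (T k y))" for y
      proof -
        define z where "z = inv (T k) (inv (T i) y)"
        have "T k y = T k (T i (T k z))" using ij k by (simp add: z_def)
        then have "T k y = T i (T k (T i z))" by (simp only: b)
        moreover have "T i (inv (T k) (inv (T i) y)) = T i z" by (simp add: z_def)
        ultimately show ?thesis using ij(3) k(3) by simp
      qed
      have b2: "T k (inv (T i) (inv (T k) y)) = inv (T i) (inv (T k) (T i y))" for y
      proof -
        define z where "z = inv (T i) (inv (T k) y)"
        have "T i y = T i (T k (T i z))" using ij k by (simp add: z_def)
        then have "T i y = T k (T i (T k z))" by (simp only: b)
        moreover have "T k (inv (T i) (inv (T k) y)) = T k z" by (simp add: z_def)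
        ultimately show ?thesis using ij(3) k(3) by simp
      qed
      have e: "Y j x = inv (T k) (inv (T i) (Y i (inv (T i) (inv (T k) x))))" for x
        unfolding Yj using Y_Suc[OF ij(1,3), folded ij(4)] by simp
      show ?thesis by (rule commI) (simp add: e b1 b2 c)
    qed
  qed
qed

text \<open>The case where the braid relation between T_0 and T_1 enters; all other pairs are
  reduced to it by \<open>Y_Suc\<close>.\<close>

lemma Y_1_2:
  assumes "2 \<le> n" shows "comm (Y 1) (Y 2)"
proof (rule commI)
  fix x
  have B1: "B 1 x = T 1 (B 2 (T 1 x))" for x using B_step[of 1] assms by (simp add: numeral_2_eq_2)
  have c0: "B 2 (T 0 x) = T 0 (B 2 x)" for x using B_far[of 0 2] assms by (simp add: comm_def)
  have c1: "B 2 (T 1 (B 2 (T 1 x))) = T 1 (B 2 (T 1 (B 2 x)))" for x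
  proof -
    have "B 1 (B 2 x) = B 2 (B 1 x)" using B1_B[of 2] assms by (auto intro: commD)
    then show ?thesis unfolding B1 by (rule sym)
  qed
  have Y1: "Y 1 x = T 0 (T 1 (B 2 (T 1 x)))" for x unfolding Y_1 by (simp only: o_apply B1)
  have Y2: "Y 2 x = inv (T 1) (T 0 (T 1 (B 2 x)))" for x
    using Y_Suc[of 1] assms Y1 by (simp add: numeral_2_eq_2)
  have "Y 2 (Y 1 x) = inv (T 1) (T 0 (T 1 (T 0 (B 2 (T 1 (B 2 (T 1 x)))))))"
    unfolding Y2 Y1 by (simp add: c0)
  also have "\<dots> = inv (T 1) (T 0 (T 1 (T 0 (T 1 (B 2 (T 1 (B 2 x)))))))" by (simp only: c1)
  also have "\<dots> = inv (T 1) (T 1 (T 0 (T 1 (T 0 (B 2 (T 1 (B 2 x)))))))" by (simp only: braid0[OF assms])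
  also have "\<dots> = T 0 (T 1 (T 0 (B 2 (T 1 (B 2 x)))))" using n1 by simp
  also have "\<dots> = Y 1 (Y 2 x)" unfolding Y1 Y2 using n1 by (simp add: c0)
  finally show "Y 1 (Y 2 x) = Y 2 (Y 1 x)" by simp
qed

lemma Y_1_j: "2 \<le> j \<Longrightarrow> j \<le> n \<Longrightarrow> comm (Y 1) (Y j)"
proof (induction j rule: nat_induct_at_least)
  case base
  then show ?case by (rule Y_1_2)
next
  case (Suc j)
  have "comm (Y 1) (inv (T j))" using Suc by (intro comm_inv bijT comm_sym[OF T_Y_1]) auto
  moreover have "comm (Y 1) (Y j)" "1 \<le> j" "j < n" using Suc by auto
  ultimately show ?case unfolding Y_Suc[OF \<open>1 \<le> j\<close> \<open>j < n\<close>] by (intro comm_comp)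
qed

lemma Y_less: "1 \<le> i \<Longrightarrow> i < j \<Longrightarrow> j \<le> n \<Longrightarrow> comm (Y i) (Y j)"
proof (induction i rule: nat_induct_at_least)
  case base
  then show ?case using Y_1_j by simp
next
  case (Suc i)
  have "comm (Y j) (inv (T i))" using Suc by (intro comm_inv bijT comm_sym[OF T_Y_comm]) auto
  moreover have "comm (Y j) (Y i)" "i < n" using Suc by (auto intro: comm_sym)
  ultimately show ?case unfolding Y_Suc[OF Suc(1) \<open>i < n\<close>] by (intro comm_sym[of "Y j"] comm_comp)
qed

theorem Y_comm: "i \<in> {1..n} \<Longrightarrow> j \<in> {1..n} \<Longrightarrow> comm (Y i) (Y j)"
proof -
  assume ij: "i \<in> {1..n}" "j \<in> {1..n}"
  consider "i < j" | "i = j" | "j < i" by linarith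
  then show ?thesis
  proof cases
    case 2 then show ?thesis by (simp add: comm_def)
  qed (use ij Y_less comm_sym in auto)
qed

end

text \<open>The quadratic relation provides the inverse explicitly.\<close>

lemma T_op_bij:
  assumes "i \<le> n" "1 \<le> n"
  shows "bij (T_op n i)" "inv (T_op n i) f = T_op n i f - cst (tau n i - inverse (tau n i)) * f"
proof -
  define S where "S f = T_op n i f - cst (tau n i - inverse (tau n i)) * f" for f
  note q = T_op_quadratic[OF assms] and l = T_op_linear[OF assms(1)]
  have lm: "T_op n i (f - g) = T_op n i f - T_op n i g" for f g
  proof -
    have "T_op n i (f - g) + T_op n i g = T_op n i (f - g + g)" by (simp only: l(1))
    then show ?thesis by (simp add: eq_diff_eq)
  qed
  have 1: "T_op n i \<circ> S = id" by (auto simp: fun_eq_iff S_def lm l(2) q)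
  have 2: "S \<circ> T_op n i = id" by (auto simp: fun_eq_iff S_def q)
  show "bij (T_op n i)" using 1 2 by (metis o_bij)
  have "inv (T_op n i) = S" by (rule inv_unique_comp[OF 1 2])
  then show "inv (T_op n i) f = T_op n i f - cst (tau n i - inverse (tau n i)) * f" by (simp add: S_def)
qed

lemma affine_family_T_op: "1 \<le> n \<Longrightarrow> affine_family n (T_op n)"
proof (unfold_locales)
  fix i j x
  assume n: "1 \<le> n"
  show "1 \<le> i \<Longrightarrow> Suc i < j \<Longrightarrow> j \<le> n \<Longrightarrow> T_op n i (T_op n j x) = T_op n j (T_op n i x)" by (rule T_op_commute)
  show "1 \<le> i \<Longrightarrow> Suc i < n \<Longrightarrow> T_op n i (T_op n (Suc i) (T_op n i x)) = T_op n (Suc i) (T_op n i (T_op n (Suc i) x))"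
    by (rule T_op_braid3)
  show "1 \<le> i \<Longrightarrow> Suc i = n \<Longrightarrow> T_op n i (T_op n n (T_op n i (T_op n n x))) = T_op n n (T_op n i (T_op n n (T_op n i x)))"
    by (rule T_op_braid4_n)
  show "1 \<le> n" by fact
  show "2 \<le> j \<Longrightarrow> j \<le> n \<Longrightarrow> T_op n 0 (T_op n j x) = T_op n j (T_op n 0 x)" by (rule T_op_commute) auto
  show "2 \<le> n \<Longrightarrow> T_op n 1 (T_op n 0 (T_op n 1 (T_op n 0 x))) = T_op n 0 (T_op n 1 (T_op n 0 (T_op n 1 x)))"
    by (rule T_op_braid4_0)
  show "i \<le> n \<Longrightarrow> bij (T_op n i)" by (rule T_op_bij(1)[OF _ n])
qed

section \<open>Triangularity\<close>

text \<open>By the sign, the lexicographically larger of two exponents of equal norm is the lower one.\<close>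

definition key :: "nat \<Rightarrow> (vec \<Rightarrow> vec) \<Rightarrow> vec \<Rightarrow> int \<times> vec" where
  "key n h \<nu> = (nrm n \<nu>, - h \<nu>)"

definition lw :: "nat \<Rightarrow> (vec \<Rightarrow> vec) \<Rightarrow> int \<times> vec \<Rightarrow> laurent set" where
  "lw n h k = {f. \<forall>\<nu>\<in>Poly_Mapping.keys f. \<nu> \<in> lattice n \<and> key n h \<nu> < k}"

definition lin :: "(laurent \<Rightarrow> laurent) \<Rightarrow> bool" where
  "lin F \<longleftrightarrow> (\<forall>f g. F (f + g) = F f + F g) \<and> (\<forall>c f. F (cst c * f) = cst c * F f)"

lemma linD: "lin F \<Longrightarrow> F (f + g) = F f + F g" "lin F \<Longrightarrow> F (cst c * f) = cst c * F f"
  by (auto simp: lin_def)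

lemma lin_0: "lin F \<Longrightarrow> F 0 = 0"
  using linD(2)[of F 0 0] by (simp add: cst_simps)

lemma lin_minus: "lin F \<Longrightarrow> F (f - g) = F f - F g"
  using linD(1)[of F "f - g" g] by (simp add: eq_diff_eq)

lemma lin_sum: "lin F \<Longrightarrow> F (\<Sum>i\<in>A. f i) = (\<Sum>i\<in>A. F (f i))"
  by (induction A rule: infinite_finite_induct) (simp_all add: lin_0 linD)

lemma lin_comp: "lin F \<Longrightarrow> lin G \<Longrightarrow> lin (F \<circ> G)"
  by (simp add: lin_def)

lemma lin_expand:
  assumes "lin F"
  shows "F f = (\<Sum>\<nu>\<in>Poly_Mapping.keys f. cst (Poly_Mapping.lookup f \<nu>) * F (xm \<nu>))"
proof -
  have "F f = F (\<Sum>\<nu>\<in>Poly_Mapping.keys f. cst (Poly_Mapping.lookup f \<nu>) * xm \<nu>)"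
    by (subst laurent_expand[of f]) (simp add: cst_single)
  then show ?thesis by (simp add: lin_sum linD assms)
qed

lemma lin_T: "i \<le> n \<Longrightarrow> lin (T_op n i)"
  by (simp add: lin_def T_op_linear)

lemma lin_inv_T: "i \<le> n \<Longrightarrow> 1 \<le> n \<Longrightarrow> lin (inv (T_op n i))"
  by (simp add: lin_def T_op_bij T_op_linear distrib_left right_diff_distrib mult.left_commute)

lemma lin_id: "lin id"
  by (simp add: lin_def)

lemma lw_add: "f \<in> lw n h k \<Longrightarrow> g \<in> lw n h k \<Longrightarrow> f + g \<in> lw n h k"
  using keys_add[of f g] by (auto simp: lw_def)

lemma lw_0: "0 \<in> lw n h k"
  by (simp add: lw_def)

lemma lw_sum: "(\<And>i. i \<in> A \<Longrightarrow> f i \<in> lw n h k) \<Longrightarrow> (\<Sum>i\<in>A. f i) \<in> lw n h k"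
  by (induction A rule: infinite_finite_induct) (auto intro: lw_add lw_0)

lemma lw_cst: "f \<in> lw n h k \<Longrightarrow> cst c * f \<in> lw n h k"
  using keys_cst_mult[of c f] by (auto simp: lw_def)

lemma lw_xm: "\<nu> \<in> lattice n \<Longrightarrow> key n h \<nu> < k \<Longrightarrow> xm \<nu> \<in> lw n h k"
  by (auto simp: lw_def)

lemma lw_mono: "k \<le> k' \<Longrightarrow> f \<in> lw n h k \<Longrightarrow> f \<in> lw n h k'"
  unfolding lw_def by (blast intro: less_le_trans)

lemma low_lw: "f \<in> low n \<mu> \<Longrightarrow> f \<in> lw n h (key n g \<mu>)"
  by (auto simp: low_def lw_def key_def less_prod_def)

text \<open>The source order is twisted by \<open>g\<close> and the target order by \<open>h\<close>, which makes
  triangularity compose along a word even though a single \<open>T\<^sub>i\<close> is triangular for no fixed order.\<close>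

definition triangular :: "nat \<Rightarrow> (laurent \<Rightarrow> laurent) \<Rightarrow> (vec \<Rightarrow> vec) \<Rightarrow> (vec \<Rightarrow> vec) \<Rightarrow> (vec \<Rightarrow> coeff) \<Rightarrow> bool" where
  "triangular n F g h c \<longleftrightarrow> lin F \<and> g \<in> W_fin n \<and> h \<in> W_fin n \<and>
     (\<forall>\<mu>\<in>lattice n. \<exists>L\<in>lw n h (key n g \<mu>). F (xm \<mu>) = cst (c \<mu>) * xm (inv h (g \<mu>)) + L)"

lemma triD:
  assumes "triangular n F g h c" "\<mu> \<in> lattice n"
  shows "\<exists>L\<in>lw n h (key n g \<mu>). F (xm \<mu>) = cst (c \<mu>) * xm (inv h (g \<mu>)) + L"
  using assms unfolding triangular_def by (elim conjE) (erule (1) bspec)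

lemma key_inv: "g \<in> W_fin n \<Longrightarrow> h \<in> W_fin n \<Longrightarrow> key n h (inv h (g \<mu>)) = key n g \<mu>"
  by (simp add: key_def W_inv W_nrm[OF W_inv(1)] W_nrm)

lemma tri_lw:
  assumes t: "triangular n F g h c" and f: "f \<in> lw n g k"
  shows "F f \<in> lw n h k"
proof -
  have l: "lin F" and W: "g \<in> W_fin n" "h \<in> W_fin n" using t by (auto simp: triangular_def)
  have "F (xm \<nu>) \<in> lw n h k" if "\<nu> \<in> Poly_Mapping.keys f" for \<nu>
  proof -
    have n: "\<nu> \<in> lattice n" "key n g \<nu> < k" using f that by (auto simp: lw_def)
    obtain L where L: "L \<in> lw n h (key n g \<nu>)" "F (xm \<nu>) = cst (c \<nu>) * xm (inv h (g \<nu>)) + L"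
      by (rule bexE[OF triD[OF t n(1)]], rule that)
    have "xm (inv h (g \<nu>)) \<in> lw n h k"
      by (rule lw_xm[OF W_lattice[OF W_inv(1)[OF W(2)] W_lattice[OF W(1) n(1)]]]) (simp add: key_inv W n(2))
    moreover have "L \<in> lw n h k" by (rule lw_mono[OF less_imp_le[OF n(2)] L(1)])
    ultimately show ?thesis unfolding L(2) by (intro lw_add lw_cst)
  qed
  then show ?thesis unfolding lin_expand[OF l, of f] by (intro lw_sum lw_cst)
qed

text \<open>The target twist of F is the source twist of F', so the leading term of F is again
  leading for F', and the lower part stays lower by \<open>tri_lw\<close>.\<close>

lemma tri_comp:
  assumes t: "triangular n F g h c" and t': "triangular n F' h k c'"
  shows "triangular n (F' \<circ> F) g k (\<lambda>\<mu>. c \<mu> * c' (inv h (g \<mu>)))"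
proof -
  have l: "lin F" "lin F'" and W: "g \<in> W_fin n" "h \<in> W_fin n" "k \<in> W_fin n" using t t' by (auto simp: triangular_def)
  show ?thesis
    unfolding triangular_def
  proof (intro conjI ballI)
    fix \<mu> assume m: "\<mu> \<in> lattice n"
    obtain L where L: "L \<in> lw n h (key n g \<mu>)" "F (xm \<mu>) = cst (c \<mu>) * xm (inv h (g \<mu>)) + L"
      by (rule bexE[OF triD[OF t m]], rule that)
    define \<nu> where "\<nu> = inv h (g \<mu>)"
    have nu: "\<nu> \<in> lattice n" "h \<nu> = g \<mu>" "key n h \<nu> = key n g \<mu>" unfolding \<nu>_def
      using W_lattice[OF W_inv(1)[OF W(2)] W_lattice[OF W(1) m]] by (simp_all add: W_inv[OF W(2)] key_inv W)
    obtain L' where L': "L' \<in> lw n k (key n g \<mu>)" "F' (xm \<nu>) = cst (c' \<nu>) * xm (inv k (g \<mu>)) + L'"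
      by (rule bexE[OF triD[OF t' nu(1), unfolded nu(2,3)]], rule that)
    have "(F' \<circ> F) (xm \<mu>) = cst (c \<mu> * c' \<nu>) * xm (inv k (g \<mu>)) + (cst (c \<mu>) * L' + F' L)"
      by (simp add: L(2) linD[OF l(2)] L'(2) cst_simps algebra_simps flip: \<nu>_def)
    moreover have "cst (c \<mu>) * L' + F' L \<in> lw n k (key n g \<mu>)"
      by (intro lw_add lw_cst L'(1) tri_lw[OF t'] L(1))
    ultimately show "\<exists>L\<in>lw n k (key n g \<mu>). (F' \<circ> F) (xm \<mu>) = cst (c \<mu> * c' (inv h (g \<mu>))) * xm (inv k (g \<mu>)) + L"
      unfolding \<nu>_def by blast
  qed (use l W in \<open>auto intro: lin_comp\<close>)
qed

lemma tri_id: "triangular n id id id (\<lambda>_. 1)"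
  by (auto simp: triangular_def lin_id W_id cst_simps intro!: bexI[of _ 0] lw_0)

section \<open>Triangularity of the generators and their inverses\<close>

lemma key_mono: "nrm n \<nu> = nrm n \<mu> \<Longrightarrow> g \<mu> < h \<nu> \<Longrightarrow> key n h \<nu> < key n g \<mu>"
  by (simp add: key_def less_prod_def)

text \<open>Decides when the extra term x^\<mu> in T_i x^\<mu> is lower: passing from g to g s_i
  changes the value at \<mu> by a multiple of the image of the simple root, and in
  \<open>key\<close> the larger vector is the lower one.\<close>

lemma W_simple_refl_shift:
  assumes g: "g \<in> W_fin n" and i: "1 \<le> i" "i \<le> n" and neg: "dval n i \<mu> < 0 \<and> 0 < g (sroot n i) \<or> 0 < dval n i \<mu> \<and> g (sroot n i) < 0"
  shows "g \<mu> < g (simple_refl n i \<mu>)"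
proof -
  define a where "a = (if i = n then 2 else 1) * dval n i \<mu>"
  have e: "g (simple_refl n i \<mu>) = g \<mu> - scal a (g (sroot n i))"
    unfolding simple_refl_eq[OF i] a_def by (simp add: W_minus[OF g] W_scal[OF g])
  have "0 < - scal a (g (sroot n i))"
    using neg
  proof
    assume "dval n i \<mu> < 0 \<and> 0 < g (sroot n i)"
    then have "0 < scal (- a) (g (sroot n i))" by (intro scal_pos) (auto simp: a_def)
    moreover have "scal (- a) (g (sroot n i)) = - scal a (g (sroot n i))" by (rule poly_mapping_eqI) simp
    ultimately show ?thesis by simp
  next
    assume "0 < dval n i \<mu> \<and> g (sroot n i) < 0"
    then have "0 < scal a (- g (sroot n i))" by (intro scal_pos) (auto simp: a_def)
    moreover have "scal a (- g (sroot n i)) = - scal a (g (sroot n i))" by (rule poly_mapping_eqI) simp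
    ultimately show ?thesis by simp
  qed
  then show ?thesis unfolding e by simp
qed

lemma inv_comp_simple: "g \<in> W_fin n \<Longrightarrow> 1 \<le> i \<Longrightarrow> i \<le> n \<Longrightarrow> inv (g \<circ> simple_refl n i) (g \<mu>) = simple_refl n i \<mu>"
  using W_inv(2)[OF W_comp[OF _ W_simple], of g n i "simple_refl n i \<mu>"] by simp

lemma tri_T:
  assumes g: "g \<in> W_fin n" and i: "1 \<le> i" "i \<le> n" and pos: "0 < g (sroot n i)"
  shows "triangular n (T_op n i) g (g \<circ> simple_refl n i) (\<lambda>\<mu>. if 0 < dval n i \<mu> then inverse (tau n i) else tau n i)"
  unfolding triangular_def
proof (intro conjI ballI)
  fix \<mu> assume m: "\<mu> \<in> lattice n"
  let ?h = "g \<circ> simple_refl n i"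
  have sr: "srefl n i = simple_refl n i" using i by simp
  consider "0 < dval n i \<mu>" | "dval n i \<mu> = 0" | "dval n i \<mu> < 0" by linarith
  then show "\<exists>L\<in>lw n ?h (key n g \<mu>). T_op n i (xm \<mu>) =
      cst (if 0 < dval n i \<mu> then inverse (tau n i) else tau n i) * xm (inv ?h (g \<mu>)) + L"
    unfolding inv_comp_simple[OF g i]
  proof cases
    case 1
    then show "\<exists>L\<in>lw n ?h (key n g \<mu>). T_op n i (xm \<mu>) = cst (if 0 < dval n i \<mu> then inverse (tau n i) else tau n i) * xm (simple_refl n i \<mu>) + L"
      using T_mono_pos[OF i m 1] unfolding sr by (auto intro: low_lw)
  next
    case 2
    then show "\<exists>L\<in>lw n ?h (key n g \<mu>). T_op n i (xm \<mu>) = cst (if 0 < dval n i \<mu> then inverse (tau n i) else tau n i) * xm (simple_refl n i \<mu>) + L"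
      using T_mono_zero[OF i 2] unfolding sr by (intro bexI[OF _ lw_0]) simp
  next
    case 3
    obtain L where L: "L \<in> low n \<mu>" "T_op n i (xm \<mu>) = cst (tau n i - inverse (tau n i)) * xm \<mu> + cst (tau n i) * xm (simple_refl n i \<mu>) + L"
      using T_mono_neg[OF i m 3] unfolding sr by blast
    have "xm \<mu> \<in> lw n ?h (key n g \<mu>)"
      using W_simple_refl_shift[OF g i] 3 pos m by (intro lw_xm key_mono) auto
    then have "cst (tau n i - inverse (tau n i)) * xm \<mu> + L \<in> lw n ?h (key n g \<mu>)"
      by (rule lw_add[OF lw_cst low_lw[OF L(1)]])
    then show "\<exists>L\<in>lw n ?h (key n g \<mu>). T_op n i (xm \<mu>) = cst (if 0 < dval n i \<mu> then inverse (tau n i) else tau n i) * xm (simple_refl n i \<mu>) + L"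
      unfolding L(2) using 3 by (auto simp: algebra_simps intro!: bexI)
  qed
qed (simp_all add: lin_T[OF i(2)] g W_comp[OF g W_simple[OF i]])

text \<open>The inverse leaves its extra term x^\<mu> at positive pairings, whereas T_i leaves it at
  negative ones; hence the opposite sign condition on g.\<close>

lemma tri_inv_T:
  assumes g: "g \<in> W_fin n" and i: "1 \<le> i" "i \<le> n" and neg: "g (sroot n i) < 0"
  shows "triangular n (inv (T_op n i)) g (g \<circ> simple_refl n i) (\<lambda>\<mu>. if dval n i \<mu> < 0 then tau n i else inverse (tau n i))"
  unfolding triangular_def
proof (intro conjI ballI)
  have n1: "1 \<le> n" using i by simp
  show "lin (inv (T_op n i))" by (rule lin_inv_T[OF i(2) n1])
  fix \<mu> assume m: "\<mu> \<in> lattice n"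
  let ?h = "g \<circ> simple_refl n i"
  have sr: "srefl n i = simple_refl n i" using i by simp
  have iT: "inv (T_op n i) f = T_op n i f - cst (tau n i - inverse (tau n i)) * f" for f by (rule T_op_bij(2)[OF i(2) n1])
  consider "0 < dval n i \<mu>" | "dval n i \<mu> = 0" | "dval n i \<mu> < 0" by linarith
  then show "\<exists>L\<in>lw n ?h (key n g \<mu>). inv (T_op n i) (xm \<mu>) =
      cst (if dval n i \<mu> < 0 then tau n i else inverse (tau n i)) * xm (inv ?h (g \<mu>)) + L"
    unfolding inv_comp_simple[OF g i] iT
  proof cases
    case 1
    obtain L where L: "L \<in> low n \<mu>" "T_op n i (xm \<mu>) = cst (inverse (tau n i)) * xm (simple_refl n i \<mu>) + L"
      using T_mono_pos[OF i m 1] unfolding sr by blast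
    have "xm \<mu> \<in> lw n ?h (key n g \<mu>)"
      using W_simple_refl_shift[OF g i] 1 neg m by (intro lw_xm key_mono) auto
    then have "cst (- (tau n i - inverse (tau n i))) * xm \<mu> + L \<in> lw n ?h (key n g \<mu>)"
      by (rule lw_add[OF lw_cst low_lw[OF L(1)]])
    then show "\<exists>L\<in>lw n ?h (key n g \<mu>). T_op n i (xm \<mu>) - cst (tau n i - inverse (tau n i)) * xm \<mu> =
       cst (if dval n i \<mu> < 0 then tau n i else inverse (tau n i)) * xm (simple_refl n i \<mu>) + L"
      unfolding L(2) using 1 by (auto simp: algebra_simps cst_simps intro!: bexI)
  next
    case 2
    then show "\<exists>L\<in>lw n ?h (key n g \<mu>). T_op n i (xm \<mu>) - cst (tau n i - inverse (tau n i)) * xm \<mu> =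
       cst (if dval n i \<mu> < 0 then tau n i else inverse (tau n i)) * xm (simple_refl n i \<mu>) + L"
      using T_mono_zero[OF i 2] unfolding sr by (intro bexI[OF _ lw_0]) (simp add: cst_simps algebra_simps)
  next
    case 3
    obtain L where L: "L \<in> low n \<mu>" "T_op n i (xm \<mu>) = cst (tau n i - inverse (tau n i)) * xm \<mu> + cst (tau n i) * xm (simple_refl n i \<mu>) + L"
      using T_mono_neg[OF i m 3] unfolding sr by blast
    then show "\<exists>L\<in>lw n ?h (key n g \<mu>). T_op n i (xm \<mu>) - cst (tau n i - inverse (tau n i)) * xm \<mu> =
       cst (if dval n i \<mu> < 0 then tau n i else inverse (tau n i)) * xm (simple_refl n i \<mu>) + L"
      using 3 by (intro bexI[OF _ low_lw[OF L(1)]]) simp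
  qed
qed (simp_all add: g W_comp[OF g W_simple[OF i]])

lemma W_srefl0:
  assumes "1 \<le> n" shows "srefl n 0 \<in> W_fin n"
proof -
  define neg where "neg j \<mu> = Poly_Mapping.update j (- Poly_Mapping.lookup \<mu> j) \<mu>" for j :: nat and \<mu> :: vec
  have "k \<le> n - 1 \<Longrightarrow> neg (n - k) \<in> W_fin n" for k
  proof (induction k)
    case 0
    have "neg n = simple_refl n n" by (simp add: neg_def simple_refl_def fun_eq_iff)
    then show ?case using W_simple[of n n] assms by simp
  next
    case (Suc k)
    define j where "j = n - Suc k"
    have j: "1 \<le> j" "j < n" "n - k = Suc j" using Suc by (auto simp: j_def)
    have e: "neg j = simple_refl n j \<circ> neg (Suc j) \<circ> simple_refl n j"
      using j by (intro ext poly_mapping_eqI) (auto simp: neg_def lookup_simple_refl lookup_update)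
    have "neg (Suc j) \<in> W_fin n" "simple_refl n j \<in> W_fin n" using Suc j by (auto intro: W_simple)
    then show ?case unfolding j_def[symmetric] e by (intro W_comp)
  qed
  from this[of "n - 1"] have "neg 1 \<in> W_fin n" using assms by simp
  moreover have "neg 1 = srefl n 0" by (simp add: neg_def srefl_def fun_eq_iff)
  ultimately show ?thesis by simp
qed

lemma srefl0_eq: "srefl n 0 \<mu> = \<mu> - scal (2 * Poly_Mapping.lookup \<mu> 1) (eps 1)"
  by (rule poly_mapping_eqI) (auto simp: lookup_srefl lookup_minus lookup_eps)

text \<open>The gradient of the affine simple root is - \<open>eps 1\<close>, so the sign condition
  again says that its image under g is positive.\<close>

lemma tri_T0:
  assumes g: "g \<in> W_fin n" and n: "1 \<le> n" and neg: "g (eps 1) < 0"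
  shows "triangular n (T_op n 0) g (g \<circ> srefl n 0) (\<lambda>\<mu>. (if Poly_Mapping.lookup \<mu> 1 < 0 then inverse t0_half else t0_half) * q_par powi Poly_Mapping.lookup \<mu> 1)"
  unfolding triangular_def
proof (intro conjI ballI)
  fix \<mu> assume m: "\<mu> \<in> lattice n"
  let ?h = "g \<circ> srefl n 0"
  have t: "tau n 0 = t0_half" by (simp add: tau_def)
  define m1 where "m1 = Poly_Mapping.lookup \<mu> 1"
  have inv: "inv ?h (g \<mu>) = srefl n 0 \<mu>"
    using W_inv(2)[OF W_comp[OF g W_srefl0[OF n]], of "srefl n 0 \<mu>"] by simp
  consider "m1 < 0" | "m1 = 0" | "0 < m1" by linarith
  then show "\<exists>L\<in>lw n ?h (key n g \<mu>). T_op n 0 (xm \<mu>) =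
      cst ((if Poly_Mapping.lookup \<mu> 1 < 0 then inverse t0_half else t0_half) * q_par powi Poly_Mapping.lookup \<mu> 1) * xm (inv ?h (g \<mu>)) + L"
    unfolding inv m1_def[symmetric]
  proof cases
    case 1
    then show "\<exists>L\<in>lw n ?h (key n g \<mu>). T_op n 0 (xm \<mu>) = cst ((if m1 < 0 then inverse t0_half else t0_half) * q_par powi m1) * xm (srefl n 0 \<mu>) + L"
      using T0_mono_neg[OF n m] unfolding t m1_def[symmetric] by (auto intro: low_lw)
  next
    case 2
    then show "\<exists>L\<in>lw n ?h (key n g \<mu>). T_op n 0 (xm \<mu>) = cst ((if m1 < 0 then inverse t0_half else t0_half) * q_par powi m1) * xm (srefl n 0 \<mu>) + L"
      using T0_mono_zero[of \<mu> n] unfolding t m1_def[symmetric] by (intro bexI[OF _ lw_0]) simp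
  next
    case 3
    obtain L where L: "L \<in> low n \<mu>" "T_op n 0 (xm \<mu>) = cst (t0_half - inverse t0_half) * xm \<mu> + cst (t0_half * q_par powi m1) * xm (srefl n 0 \<mu>) + L"
      using T0_mono_pos[OF n m] 3 unfolding t m1_def[symmetric] by blast
    have "g \<mu> < g (srefl n 0 \<mu>)"
    proof -
      have "0 < scal (2 * m1) (- g (eps 1))" using 3 neg by (intro scal_pos) auto
      moreover have "scal (2 * m1) (- g (eps 1)) = - scal (2 * m1) (g (eps 1))" by (rule poly_mapping_eqI) simp
      moreover have "g (srefl n 0 \<mu>) = g \<mu> - scal (2 * m1) (g (eps 1))"
        unfolding srefl0_eq m1_def by (simp add: W_minus[OF g] W_scal[OF g])
      ultimately show ?thesis by simp
    qed
    then have "xm \<mu> \<in> lw n ?h (key n g \<mu>)"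
      using m by (intro lw_xm key_mono) auto
    then have "cst (t0_half - inverse t0_half) * xm \<mu> + L \<in> lw n ?h (key n g \<mu>)"
      by (rule lw_add[OF lw_cst low_lw[OF L(1)]])
    then show "\<exists>L\<in>lw n ?h (key n g \<mu>). T_op n 0 (xm \<mu>) = cst ((if m1 < 0 then inverse t0_half else t0_half) * q_par powi m1) * xm (srefl n 0 \<mu>) + L"
      unfolding L(2) using 3 by (auto simp: algebra_simps intro!: bexI)
  qed
qed (simp_all add: lin_T g W_comp[OF g W_srefl0[OF n]])

text \<open>By invariance of the pairing, the exponent of tau is the sign of
  \<open>v_min n \<mu>\<close> on the image root, as in the factors of
  \<open>ev_Y_eq\<close>.\<close>

lemma tri_step_T:
  assumes t: "triangular n F id h c" and i: "1 \<le> i" "i \<le> n" and pos: "0 < h (sroot n i)"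
  shows "triangular n (T_op n i \<circ> F) id (h \<circ> simple_refl n i) (\<lambda>\<mu>. c \<mu> * tau n i powi vsg (v_min n \<mu> (h (sroot n i))))"
proof -
  have h: "h \<in> W_fin n" using t by (simp add: triangular_def)
  have b: "h (sroot n i) \<in> posr n" using W_posr[OF h sroot_posr[OF i]] pos by (auto dest: less_asym)
  have "(if 0 < dval n i (inv h \<mu>) then inverse (tau n i) else tau n i) = tau n i powi vsg (v_min n \<mu> (h (sroot n i)))" for \<mu>
  proof -
    have "dval n i (inv h \<mu>) = pair n \<mu> (h (sroot n i))"
      using W_pair[OF h, of "inv h \<mu>" "sroot n i"] i by (simp add: W_inv[OF h] pair_sroot)
    then show ?thesis using v_min_neg_iff[OF b, of \<mu>] by (auto simp: vsg_def power_int_minus)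
  qed
  then show ?thesis using tri_comp[OF t tri_T[OF h i pos]] by simp
qed

lemma tri_step_inv_T:
  assumes t: "triangular n F id h c" and i: "1 \<le> i" "i \<le> n" and neg: "h (sroot n i) < 0"
  shows "triangular n (inv (T_op n i) \<circ> F) id (h \<circ> simple_refl n i) (\<lambda>\<mu>. c \<mu> * tau n i powi vsg (v_min n \<mu> (h (sroot n i))))"
proof -
  have h: "h \<in> W_fin n" using t by (simp add: triangular_def)
  have b: "- h (sroot n i) \<in> posr n" using W_posr[OF h sroot_posr[OF i]] neg by (auto dest: less_asym)
  have "(if dval n i (inv h \<mu>) < 0 then tau n i else inverse (tau n i)) = tau n i powi vsg (v_min n \<mu> (h (sroot n i)))" for \<mu>
  proof -
    have "dval n i (inv h \<mu>) = pair n \<mu> (h (sroot n i))"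
      using W_pair[OF h, of "inv h \<mu>" "sroot n i"] i by (simp add: W_inv[OF h] pair_sroot)
    then show ?thesis using v_min_neg_iff[OF b, of \<mu>] by (auto simp: vsg_def power_int_minus pair_uminus W_uminus[OF v_min_props(1)])
  qed
  then show ?thesis using tri_comp[OF t tri_inv_T[OF h i neg]] by simp
qed

lemma eps_posr: "i \<in> {1..n} \<Longrightarrow> eps (int i) \<in> posr n"
  by (auto simp: posr_eq[symmetric] roots_d_def)

lemma tri_step_T0:
  assumes t: "triangular n F id h c" and n: "1 \<le> n" and j: "j \<in> {1..n}" and hj: "h (eps 1) = - eps (int j)"
  shows "triangular n (T_op n 0 \<circ> F) id (h \<circ> srefl n 0) (\<lambda>\<mu>. c \<mu> * (t0_half powi vsg (v_min n \<mu> (eps (int j))) * q_par powi (- Poly_Mapping.lookup \<mu> j)))"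
proof -
  have h: "h \<in> W_fin n" using t by (simp add: triangular_def)
  have b: "eps (int j) \<in> posr n" by (rule eps_posr[OF j])
  then have neg: "h (eps 1) < 0" by (simp add: hj posr_def)
  have "(if Poly_Mapping.lookup (inv h \<mu>) 1 < 0 then inverse t0_half else t0_half) * q_par powi Poly_Mapping.lookup (inv h \<mu>) 1 =
    t0_half powi vsg (v_min n \<mu> (eps (int j))) * q_par powi (- Poly_Mapping.lookup \<mu> j)" for \<mu>
  proof -
    have p: "pair n \<mu> (eps (int k)) = Poly_Mapping.lookup \<mu> k" if "k \<in> {1..n}" for \<mu> k
      using that by (simp add: eps_def pair_single)
    have "Poly_Mapping.lookup (inv h \<mu>) 1 = - Poly_Mapping.lookup \<mu> j"
      using W_pair[OF h, of "inv h \<mu>" "eps 1"] n j p[of 1 "inv h \<mu>"] p[of j \<mu>] by (simp add: W_inv[OF h] hj pair_uminus)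
    then show ?thesis using v_min_neg_iff[OF b, of \<mu>] j p[of j \<mu>] by (auto simp: vsg_def power_int_minus)
  qed
  then show ?thesis using tri_comp[OF t tri_T0[OF h n neg]] by simp
qed

section \<open>The spectrum of the Y operators\<close>

lemma eps_nat: "1 \<le> k \<Longrightarrow> eps (int k) = Poly_Mapping.single k 1"
  by (simp add: eps_def)

lemma sroot_eps: "1 \<le> i \<Longrightarrow> i \<le> n \<Longrightarrow> sroot n i = (if i = n then eps (int n) else eps (int i) - eps (int (Suc i)))"
  using eps_nat[of i] eps_nat[of "Suc i"] eps_nat[of n] by (simp add: sroot_def del: of_nat_Suc)

lemma simple_refl_eps:
  assumes "1 \<le> i" "i \<le> n" "1 \<le> k"
  shows "simple_refl n i (eps (int k)) = (if i = n then (if k = n then - eps (int n) else eps (int k))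
     else eps (int (if k = i then Suc i else if k = Suc i then i else k)))"
  using assms by (intro poly_mapping_eqI) (auto simp: lookup_simple_refl eps_nat lookup_single when_def)

lemma srefl0_eps: "1 \<le> k \<Longrightarrow> srefl n 0 (eps (int k)) = (if k = 1 then - eps 1 else eps (int k))"
  by (intro poly_mapping_eqI) (auto simp: lookup_srefl lookup_eps)

lemma eps_diff_pos: "1 \<le> i \<Longrightarrow> i < j \<Longrightarrow> 0 < eps (int i) - eps (int j)"
  using eps_add_pos[of "int i" "- int j"] by (simp add: eps_uminus)

lemma eps_sum_pos: "1 \<le> i \<Longrightarrow> 1 \<le> j \<Longrightarrow> i \<noteq> j \<Longrightarrow> 0 < eps (int i) + eps (int j)"
  using eps_add_pos[of "int i" "int j"] eps_add_pos[of "int j" "int i"] by (cases "i < j") (auto simp: add.commute)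

lemma eps_pos: "1 \<le> i \<Longrightarrow> 0 < eps (int i)"
  unfolding vec_pos_iff by (intro exI[of _ i]) (auto simp: lookup_eps)

lemma T_word_simps: "T_word n [] = id" "T_word n (i # is) = T_op n i \<circ> T_word n is"
  by (simp_all add: T_word_def)

context
  fixes n j :: nat
  assumes n: "1 \<le> n" and j: "j \<in> {1..n}"
begin

text \<open>Enumerates the indices other than \<open>j\<close>.\<close>

definition skip :: "nat \<Rightarrow> nat" where
  "skip k = (if k < j then k else Suc k)"

definition c_diff :: "nat \<Rightarrow> vec \<Rightarrow> coeff" where
  "c_diff k \<mu> = t_half powi vsg (v_min n \<mu> (eps (int j) - eps (int k)))"

definition c_sum :: "nat \<Rightarrow> vec \<Rightarrow> coeff" where
  "c_sum k \<mu> = t_half powi vsg (v_min n \<mu> (eps (int j) + eps (int k)))"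

text \<open>The word of Y_j is read from the right, and h is the accumulated twist. The letters T_j,
  ..., T_{n-1} contribute the roots e_j - e_k with k > j.\<close>

lemma phase1:
  "j \<le> i \<Longrightarrow> i \<le> n \<Longrightarrow> \<exists>h. triangular n (T_word n (rev [j..<i])) id h (\<lambda>\<mu>. \<Prod>k\<in>{j<..i}. c_diff k \<mu>) \<and> h (eps (int i)) = eps (int j) \<and>
     (\<forall>k\<in>{1..n}. k < j \<or> i < k \<longrightarrow> h (eps (int k)) = eps (int k)) \<and> (\<forall>k. j \<le> k \<and> k < i \<longrightarrow> h (eps (int k)) = eps (int (Suc k)))"
proof (induction i rule: nat_induct_at_least)
  case base
  have "triangular n (T_word n (rev [j..<j])) id id (\<lambda>\<mu>. \<Prod>k\<in>{j<..j}. c_diff k \<mu>)"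
    using tri_id[of n] by (simp add: T_word_simps)
  then show ?case by (intro exI[of _ id] conjI) (assumption, auto)
next
  case (Suc i)
  obtain h where h: "triangular n (T_word n (rev [j..<i])) id h (\<lambda>\<mu>. \<Prod>k\<in>{j<..i}. c_diff k \<mu>)" "h (eps (int i)) = eps (int j)"
     "\<forall>k\<in>{1..n}. k < j \<or> i < k \<longrightarrow> h (eps (int k)) = eps (int k)" "\<forall>k. j \<le> k \<and> k < i \<longrightarrow> h (eps (int k)) = eps (int (Suc k))"
    using Suc.IH[OF Suc_leD[OF Suc.prems]] by (elim exE conjE) (rule that)
  have hW: "h \<in> W_fin n" using h(1) by (simp add: triangular_def)
  have i: "1 \<le> i" "i \<le> n" "i < n" "i \<noteq> n" using Suc j by auto
  have r: "h (sroot n i) = eps (int j) - eps (int (Suc i))"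
    using h(2) bspec[OF h(3), of "Suc i"] i by (simp add: sroot_eps W_minus[OF hW] del: of_nat_Suc)
  have pos: "0 < h (sroot n i)" unfolding r by (rule eps_diff_pos) (use j Suc in auto)
  note t = tri_step_T[OF h(1) i(1,2) pos]
  have c: "(\<lambda>\<mu>. (\<Prod>k\<in>{j<..i}. c_diff k \<mu>) * tau n i powi vsg (v_min n \<mu> (h (sroot n i)))) = (\<lambda>\<mu>. \<Prod>k\<in>{j<..Suc i}. c_diff k \<mu>)"
  proof
    fix \<mu>
    have "{j<..Suc i} = insert (Suc i) {j<..i}" using Suc by auto
    then show "(\<Prod>k\<in>{j<..i}. c_diff k \<mu>) * tau n i powi vsg (v_min n \<mu> (h (sroot n i))) = (\<Prod>k\<in>{j<..Suc i}. c_diff k \<mu>)"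
      using i by (simp add: r c_diff_def tau_def mult.commute)
  qed
  have w: "T_word n (rev [j..<Suc i]) = T_op n i \<circ> T_word n (rev [j..<i])" using Suc by (simp add: T_word_simps)
  show ?case
  proof (intro exI conjI)
    show "triangular n (T_word n (rev [j..<Suc i])) id (h \<circ> simple_refl n i) (\<lambda>\<mu>. \<Prod>k\<in>{j<..Suc i}. c_diff k \<mu>)" using t unfolding c w .
    have i1: "Suc i \<noteq> 0" by simp
    show "(h \<circ> simple_refl n i) (eps (int (Suc i))) = eps (int j)" using i h(2) by (simp add: simple_refl_eps del: of_nat_Suc)
    show "\<forall>k\<in>{1..n}. k < j \<or> Suc i < k \<longrightarrow> (h \<circ> simple_refl n i) (eps (int k)) = eps (int k)"
      using i h(3) Suc by (auto simp: simple_refl_eps simp del: of_nat_Suc)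
    show "\<forall>k. j \<le> k \<and> k < Suc i \<longrightarrow> (h \<circ> simple_refl n i) (eps (int k)) = eps (int (Suc k))"
    proof (intro allI impI)
      fix k assume k: "j \<le> k \<and> k < Suc i"
      have ki: "1 \<le> k" using k j by auto
      show "(h \<circ> simple_refl n i) (eps (int k)) = eps (int (Suc k))"
      proof (cases "k = i")
        case True
        then show ?thesis using i h(3) Suc by (simp add: simple_refl_eps del: of_nat_Suc)
      next
        case False
        then show ?thesis using i h(4) k ki by (simp add: simple_refl_eps del: of_nat_Suc)
      qed
    qed
  qed
qed

definition c2 :: "nat \<Rightarrow> vec \<Rightarrow> coeff" where
  "c2 m \<mu> = (\<Prod>k\<in>{j<..n}. c_diff k \<mu>) * tn_half powi vsg (v_min n \<mu> (eps (int j))) * (\<Prod>k\<in>{m..<n}. c_sum (skip k) \<mu>)"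

text \<open>T_n contributes e_j, and the letters T_{n-1}, ..., T_1 contribute e_j + e_k for all k
  other than j, in the order given by \<open>skip\<close>. The twist then carries e_m to -
  e_j.\<close>

lemma phase2:
  "1 \<le> m \<Longrightarrow> m \<le> n \<Longrightarrow> \<exists>h. triangular n (T_word n ([m..<n] @ [n] @ rev [j..<n])) id h (c2 m) \<and> h (eps (int m)) = - eps (int j) \<and>
     (\<forall>k\<in>{1..<m}. h (eps (int k)) = eps (int (skip k))) \<and> (\<forall>k\<in>{m<..n}. h (eps (int k)) = eps (int (skip (k - 1))))"
proof (rotate_tac 1, induction m rule: inc_induct)
  case base
  from phase1[of n] j obtain h where h: "triangular n (T_word n (rev [j..<n])) id h (\<lambda>\<mu>. \<Prod>k\<in>{j<..n}. c_diff k \<mu>)" "h (eps (int n)) = eps (int j)"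
     "\<forall>k\<in>{1..n}. k < j \<or> n < k \<longrightarrow> h (eps (int k)) = eps (int k)" "\<forall>k. j \<le> k \<and> k < n \<longrightarrow> h (eps (int k)) = eps (int (Suc k))"
    by auto
  have hW: "h \<in> W_fin n" using h(1) by (simp add: triangular_def)
  have r: "h (sroot n n) = eps (int j)" using h(2) n by (simp add: sroot_eps)
  have pos: "0 < h (sroot n n)" unfolding r by (rule eps_pos) (use j in auto)
  note t = tri_step_T[OF h(1) n le_refl pos]
  have c: "(\<lambda>\<mu>. (\<Prod>k\<in>{j<..n}. c_diff k \<mu>) * tau n n powi vsg (v_min n \<mu> (h (sroot n n)))) = c2 n"
    using n by (simp add: fun_eq_iff c2_def tau_def r)
  have w: "T_word n ([n..<n] @ [n] @ rev [j..<n]) = T_op n n \<circ> T_word n (rev [j..<n])" by (simp add: T_word_simps)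
  show ?case
  proof (intro exI conjI)
    show "triangular n (T_word n ([n..<n] @ [n] @ rev [j..<n])) id (h \<circ> simple_refl n n) (c2 n)" using t unfolding c w .
    show "(h \<circ> simple_refl n n) (eps (int n)) = - eps (int j)" using h(2) n by (simp add: simple_refl_eps W_uminus[OF hW])
    show "\<forall>k\<in>{1..<n}. (h \<circ> simple_refl n n) (eps (int k)) = eps (int (skip k))"
      using h(3,4) n by (auto simp: simple_refl_eps skip_def simp del: of_nat_Suc)
  qed simp
next
  case (step m)
  obtain h where h: "triangular n (T_word n ([Suc m..<n] @ [n] @ rev [j..<n])) id h (c2 (Suc m))" "h (eps (int (Suc m))) = - eps (int j)"
     "\<forall>k\<in>{1..<Suc m}. h (eps (int k)) = eps (int (skip k))" "\<forall>k\<in>{Suc m<..n}. h (eps (int k)) = eps (int (skip (k - 1)))"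
    using step.IH[OF le_SucI[OF step.prems]] by (elim exE conjE) (rule that)
  have hW: "h \<in> W_fin n" using h(1) by (simp add: triangular_def)
  have m: "1 \<le> m" "m \<le> n" "m < n" "m \<noteq> n" using step by auto
  have r: "h (sroot n m) = eps (int j) + eps (int (skip m))"
    using h(2,3) m by (simp add: sroot_eps W_minus[OF hW] add.commute del: of_nat_Suc)
  have pos: "0 < h (sroot n m)" unfolding r by (rule eps_sum_pos) (use j m in \<open>auto simp: skip_def\<close>)
  note t = tri_step_T[OF h(1) m(1,2) pos]
  have c: "(\<lambda>\<mu>. c2 (Suc m) \<mu> * tau n m powi vsg (v_min n \<mu> (h (sroot n m)))) = c2 m"
  proof
    fix \<mu>
    have "{m..<n} = insert m {Suc m..<n}" using m by auto
    then show "c2 (Suc m) \<mu> * tau n m powi vsg (v_min n \<mu> (h (sroot n m))) = c2 m \<mu>"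
      using m by (simp add: c2_def r c_sum_def tau_def mult_ac)
  qed
  have w: "T_word n ([m..<n] @ [n] @ rev [j..<n]) = T_op n m \<circ> T_word n ([Suc m..<n] @ [n] @ rev [j..<n])"
    using m by (simp add: upt_conv_Cons T_word_simps)
  show ?case
  proof (intro exI conjI ballI)
    show "triangular n (T_word n ([m..<n] @ [n] @ rev [j..<n])) id (h \<circ> simple_refl n m) (c2 m)" using t unfolding c w .
    show "(h \<circ> simple_refl n m) (eps (int m)) = - eps (int j)" using h(2) m by (simp add: simple_refl_eps del: of_nat_Suc)
    fix k
    {
      assume "k \<in> {1..<m}"
      then show "(h \<circ> simple_refl n m) (eps (int k)) = eps (int (skip k))"
        using h(3) m by (simp add: simple_refl_eps del: of_nat_Suc)
    next
      assume k: "k \<in> {m<..n}"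
      show "(h \<circ> simple_refl n m) (eps (int k)) = eps (int (skip (k - 1)))"
      proof (cases "k = Suc m")
        case True
        then show ?thesis using h(3) m k by (simp add: simple_refl_eps del: of_nat_Suc)
      next
        case False
        then show ?thesis using h(4) m k by (simp add: simple_refl_eps del: of_nat_Suc)
      qed
    }
  qed
qed

definition c3 :: "vec \<Rightarrow> coeff" where
  "c3 \<mu> = c2 1 \<mu> * (t0_half powi vsg (v_min n \<mu> (eps (int j))) * q_par powi (- Poly_Mapping.lookup \<mu> j))"

text \<open>T_0 contributes the power of q and the factor in t_0. The remaining letters meet the
  negative roots e_j - e_i with i < j, where the inverses are the triangular operators.\<close>

lemma phase4:
  "1 \<le> i \<Longrightarrow> i \<le> j \<Longrightarrow> \<exists>h. triangular n (foldr (\<lambda>i g. inv (T_op n i) \<circ> g) (rev [1..<i]) id \<circ> T_word n ([0..<n] @ [n] @ rev [j..<n])) id h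
     (\<lambda>\<mu>. c3 \<mu> * (\<Prod>k\<in>{1..<i}. c_diff k \<mu>)) \<and> h (eps (int i)) = eps (int j) \<and>
     (\<forall>k\<in>{1..<i}. h (eps (int k)) = eps (int k)) \<and> (\<forall>k\<in>{i<..n}. h (eps (int k)) = eps (int (skip (k - 1))))"
proof (induction i rule: nat_induct_at_least)
  case base
  from phase2[of 1] n obtain h where h: "triangular n (T_word n ([1..<n] @ [n] @ rev [j..<n])) id h (c2 1)" "h (eps (int 1)) = - eps (int j)"
     "\<forall>k\<in>{1<..n}. h (eps (int k)) = eps (int (skip (k - 1)))"
    by auto
  have hW: "h \<in> W_fin n" using h(1) by (simp add: triangular_def)
  have h1: "h (eps 1) = - eps (int j)" using h(2) by simp
  note t = tri_step_T0[OF h(1) n j h1]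
  have w: "foldr (\<lambda>i g. inv (T_op n i) \<circ> g) (rev [1..<1]) id \<circ> T_word n ([0..<n] @ [n] @ rev [j..<n]) = T_op n 0 \<circ> T_word n ([1..<n] @ [n] @ rev [j..<n])"
    using n by (simp add: upt_conv_Cons T_word_simps)
  show ?case
  proof (intro exI conjI ballI)
    show "triangular n (foldr (\<lambda>i g. inv (T_op n i) \<circ> g) (rev [1..<1]) id \<circ> T_word n ([0..<n] @ [n] @ rev [j..<n])) id (h \<circ> srefl n 0)
       (\<lambda>\<mu>. c3 \<mu> * (\<Prod>k\<in>{1..<1}. c_diff k \<mu>))" using t unfolding w by (simp add: c3_def)
    show "(h \<circ> srefl n 0) (eps (int 1)) = eps (int j)" using h1 srefl0_eps[of 1 n] by (simp add: W_uminus[OF hW])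
    fix k assume "k \<in> {1<..n}"
    then show "(h \<circ> srefl n 0) (eps (int k)) = eps (int (skip (k - 1)))" using h(3) by (simp add: srefl0_eps)
  qed simp
next
  case (Suc i)
  obtain h where h: "triangular n (foldr (\<lambda>i g. inv (T_op n i) \<circ> g) (rev [1..<i]) id \<circ> T_word n ([0..<n] @ [n] @ rev [j..<n])) id h
     (\<lambda>\<mu>. c3 \<mu> * (\<Prod>k\<in>{1..<i}. c_diff k \<mu>))" "h (eps (int i)) = eps (int j)" "\<forall>k\<in>{1..<i}. h (eps (int k)) = eps (int k)"
    "\<forall>k\<in>{i<..n}. h (eps (int k)) = eps (int (skip (k - 1)))"
    using Suc.IH[OF Suc_leD[OF Suc.prems]] by (elim exE conjE) (rule that)
  have hW: "h \<in> W_fin n" using h(1) by (simp add: triangular_def)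
  have i: "1 \<le> i" "i \<le> n" "i < n" "i \<noteq> n" "i < j" using Suc j by auto
  have hi: "h (eps (int (Suc i))) = eps (int i)" using h(4) i by (simp add: skip_def del: of_nat_Suc)
  have r: "h (sroot n i) = eps (int j) - eps (int i)"
    using h(2) hi i by (simp add: sroot_eps W_minus[OF hW] del: of_nat_Suc)
  have neg: "h (sroot n i) < 0" unfolding r using eps_diff_pos[OF i(1,5)] by simp
  note t = tri_step_inv_T[OF h(1) i(1,2) neg]
  have c: "(\<lambda>\<mu>. c3 \<mu> * (\<Prod>k\<in>{1..<i}. c_diff k \<mu>) * tau n i powi vsg (v_min n \<mu> (h (sroot n i)))) = (\<lambda>\<mu>. c3 \<mu> * (\<Prod>k\<in>{1..<Suc i}. c_diff k \<mu>))"
    using i by (simp add: fun_eq_iff c_diff_def tau_def r mult_ac)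
  have w: "foldr (\<lambda>i g. inv (T_op n i) \<circ> g) (rev [1..<Suc i]) id \<circ> T_word n ([0..<n] @ [n] @ rev [j..<n]) =
     inv (T_op n i) \<circ> (foldr (\<lambda>i g. inv (T_op n i) \<circ> g) (rev [1..<i]) id \<circ> T_word n ([0..<n] @ [n] @ rev [j..<n]))"
    using i by (simp add: comp_assoc)
  show ?case
  proof (intro exI conjI ballI)
    show "triangular n (foldr (\<lambda>i g. inv (T_op n i) \<circ> g) (rev [1..<Suc i]) id \<circ> T_word n ([0..<n] @ [n] @ rev [j..<n])) id (h \<circ> simple_refl n i)
       (\<lambda>\<mu>. c3 \<mu> * (\<Prod>k\<in>{1..<Suc i}. c_diff k \<mu>))" using t unfolding w c .
    show "(h \<circ> simple_refl n i) (eps (int (Suc i))) = eps (int j)" using h(2) i by (simp add: simple_refl_eps del: of_nat_Suc)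
    fix k
    {
      assume k: "k \<in> {1..<Suc i}"
      show "(h \<circ> simple_refl n i) (eps (int k)) = eps (int k)"
      proof (cases "k = i")
        case True
        then show ?thesis using hi i by (simp add: simple_refl_eps del: of_nat_Suc)
      next
        case False
        then show ?thesis using k h(3) i by (simp add: simple_refl_eps del: of_nat_Suc)
      qed
    next
      assume k: "k \<in> {Suc i<..n}"
      then show "(h \<circ> simple_refl n i) (eps (int k)) = eps (int (skip (k - 1)))"
        using h(4) i by (simp add: simple_refl_eps del: of_nat_Suc)
    }
  qed
qed

text \<open>The twists along the word compose to the identity, so Y_j is triangular for one fixed
  order, and the collected factors form the product in \<open>ev_Y_eq\<close>.\<close>

theorem tri_Y: "triangular n (Y_op n j) id id (\<lambda>\<mu>. ev_Y n \<mu> j)"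
proof -
  from phase4[of j] j obtain h where h: "triangular n (Y_op n j) id h (\<lambda>\<mu>. c3 \<mu> * (\<Prod>k\<in>{1..<j}. c_diff k \<mu>))" "h (eps (int j)) = eps (int j)"
    "\<forall>k\<in>{1..<j}. h (eps (int k)) = eps (int k)"  "\<forall>k\<in>{j<..n}. h (eps (int k)) = eps (int (skip (k - 1)))"
    by (auto simp: Y_op_def)
  have hW: "h \<in> W_fin n" using h(1) by (simp add: triangular_def)
  have "h = id"
  proof (rule W_eqI[OF hW W_id])
    fix k assume k: "k \<in> {1..n}"
    consider "k < j" | "k = j" | "j < k" by linarith
    then have "h (eps (int k)) = eps (int k)" using h k by cases (auto simp: skip_def)
    then show "h (Poly_Mapping.single k 1) = id (Poly_Mapping.single k 1)" using k by (simp add: eps_nat)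
  qed
  moreover have "c3 \<mu> * (\<Prod>k\<in>{1..<j}. c_diff k \<mu>) = ev_Y n \<mu> j" for \<mu>
  proof -
    have "(\<Prod>k\<in>{1..<n}. c_sum (skip k) \<mu>) = (\<Prod>i\<in>{1..n} - {j}. c_sum i \<mu>)"
      by (rule prod.reindex_bij_witness[of _ "\<lambda>i. if i < j then i else i - 1" skip]) (use j in \<open>auto simp: skip_def\<close>)
    moreover have "(\<Prod>k\<in>{j<..n}. c_diff k \<mu>) * (\<Prod>k\<in>{1..<j}. c_diff k \<mu>) = (\<Prod>i\<in>{1..n} - {j}. c_diff i \<mu>)"
    proof -
      have "{1..n} - {j} = {j<..n} \<union> {1..<j}" "{j<..n} \<inter> {1..<j} = {}" using j by auto
      then show ?thesis by (simp add: prod.union_disjoint)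
    qed
    moreover have "ev_Y n \<mu> j = q_par powi (- Poly_Mapping.lookup \<mu> j) * (t0_half powi vsg (v_min n \<mu> (eps (int j))) * tn_half powi vsg (v_min n \<mu> (eps (int j)))) *
       ((\<Prod>i\<in>{1..n} - {j}. c_sum i \<mu>) * (\<Prod>i\<in>{1..n} - {j}. c_diff i \<mu>))"
      unfolding ev_Y_eq[OF j] by (simp add: c_sum_def c_diff_def prod.distrib power_int_mult_distrib)
    ultimately show ?thesis by (simp add: c3_def c2_def mult_ac)
  qed
  ultimately show ?thesis using h(1) by simp
qed

end

section \<open>Degrees of monomials in the parameters\<close>

text \<open>The degree in a single parameter, for quotients of monomials only.\<close>

definition gdeg :: "6 \<Rightarrow> coeff \<Rightarrow> int \<Rightarrow> bool" where
  "gdeg p x a \<longleftrightarrow> (\<exists>\<nu> \<nu>'. x = Fract (Poly_Mapping.single \<nu> 1) (Poly_Mapping.single \<nu>' 1) \<and>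
     int (Poly_Mapping.lookup \<nu> p) - int (Poly_Mapping.lookup \<nu>' p) = a)"

lemma gdeg_mult:
  assumes "gdeg p x a" "gdeg p y b" shows "gdeg p (x * y) (a + b)"
proof -
  obtain \<nu> \<nu>' where 1: "x = Fract (Poly_Mapping.single \<nu> 1) (Poly_Mapping.single \<nu>' 1)" "int (Poly_Mapping.lookup \<nu> p) - int (Poly_Mapping.lookup \<nu>' p) = a"
    using assms(1) by (auto simp: gdeg_def)
  obtain \<mu> \<mu>' where 2: "y = Fract (Poly_Mapping.single \<mu> 1) (Poly_Mapping.single \<mu>' 1)" "int (Poly_Mapping.lookup \<mu> p) - int (Poly_Mapping.lookup \<mu>' p) = b"
    using assms(2) by (auto simp: gdeg_def)
  show ?thesis unfolding gdeg_def
    by (intro exI[of _ "\<nu> + \<mu>"] exI[of _ "\<nu>' + \<mu>'"]) (use 1 2 in \<open>auto simp: mult_single lookup_add\<close>)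
qed

lemma gdeg_inverse: "gdeg p x a \<Longrightarrow> gdeg p (inverse x) (- a)"
  unfolding gdeg_def by fastforce

lemma gdeg_1: "gdeg p 1 0"
  unfolding gdeg_def One_fract_def by (intro exI[of _ 0]) simp

lemma gdeg_generator: "gdeg p (generator r) (if r = p then 1 else 0)"
  unfolding gdeg_def generator_def by (intro exI[of _ "Poly_Mapping.single r 1"] exI[of _ 0]) (auto simp: lookup_single)

lemma gdeg_power: "gdeg p x a \<Longrightarrow> gdeg p (x ^ k) (int k * a)"
proof (induction k)
  case (Suc k)
  then show ?case using gdeg_mult[of p x a "x ^ k" "int k * a"] by (simp add: algebra_simps)
qed (simp add: gdeg_1)

lemma gdeg_powi: "gdeg p x a \<Longrightarrow> gdeg p (x powi k) (k * a)"
proof -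
  assume x: "gdeg p x a"
  show ?thesis
  proof (cases k rule: int_cases2)
    case (nonneg m)
    then show ?thesis using gdeg_power[OF x, of m] by simp
  next
    case (nonpos m)
    then show ?thesis using gdeg_inverse[OF gdeg_power[OF x, of m]] by (simp add: power_int_minus)
  qed
qed

lemma gdeg_prod0: "(\<And>i. i \<in> A \<Longrightarrow> gdeg p (f i) 0) \<Longrightarrow> gdeg p (\<Prod>i\<in>A. f i) 0"
proof (induction A rule: infinite_finite_induct)
  case (insert x A)
  then show ?case using gdeg_mult[of p "f x" 0 "\<Prod>i\<in>A. f i" 0] by simp
qed (simp_all add: gdeg_1)

lemma gdeg_unique: "gdeg p x a \<Longrightarrow> gdeg p x b \<Longrightarrow> a = b"
proof -
  assume ga: "gdeg p x a" and gb: "gdeg p x b"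
  obtain \<nu> \<nu>' where 1: "x = Fract (Poly_Mapping.single \<nu> 1) (Poly_Mapping.single \<nu>' 1)" "int (Poly_Mapping.lookup \<nu> p) - int (Poly_Mapping.lookup \<nu>' p) = a"
    using ga by (auto simp: gdeg_def)
  obtain \<mu> \<mu>' where 2: "x = Fract (Poly_Mapping.single \<mu> 1) (Poly_Mapping.single \<mu>' 1)" "int (Poly_Mapping.lookup \<mu> p) - int (Poly_Mapping.lookup \<mu>' p) = b"
    using gb by (auto simp: gdeg_def)
  from 1 2 have "(Poly_Mapping.single (\<nu> + \<mu>') 1 :: (6 \<Rightarrow>\<^sub>0 nat) \<Rightarrow>\<^sub>0 complex) = Poly_Mapping.single (\<mu> + \<nu>') 1"
    by (simp add: eq_fract mult_single)
  then have "\<nu> + \<mu>' = \<mu> + \<nu>'" by (metis lookup_single_eq lookup_single_not_eq one_neq_zero)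
  then have "Poly_Mapping.lookup \<nu> p + Poly_Mapping.lookup \<mu>' p = Poly_Mapping.lookup \<mu> p + Poly_Mapping.lookup \<nu>' p"
    by (metis lookup_add)
  then show "a = b" using 1 2 by linarith
qed

lemma type6_neq: "(0::6) \<noteq> 1" "(0::6) \<noteq> 2" "(0::6) \<noteq> 4" "(2::6) \<noteq> 4"
  by simp_all

lemma gdeg_q: "gdeg 0 q_half 1" "gdeg 0 t_half 0" "gdeg 0 t0_half 0" "gdeg 0 tn_half 0"
  using gdeg_generator[of 0 0] gdeg_generator[of 0 1] gdeg_generator[of 0 2] gdeg_generator[of 0 4] type6_neq
  unfolding q_half_def t_half_def t0_half_def tn_half_def by (simp_all split: if_splits)

text \<open>Measured in \<open>q_half\<close>, hence twice the exponent of q; the other factors of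
  \<open>ev_Y_eq\<close> contain no q.\<close>

lemma gdeg_ev_Y:
  assumes "j \<in> {1..n}"
  shows "gdeg 0 (ev_Y n \<mu> j) (- 2 * Poly_Mapping.lookup \<mu> j)"
proof -
  have q: "gdeg 0 q_par 2" using gdeg_power[OF gdeg_q(1), of 2] by simp
  have 1: "gdeg 0 (q_par powi (- Poly_Mapping.lookup \<mu> j)) (- 2 * Poly_Mapping.lookup \<mu> j)"
    using gdeg_powi[OF q, of "- Poly_Mapping.lookup \<mu> j"] by (simp add: mult.commute)
  have 2: "gdeg 0 ((t0_half * tn_half) powi k) 0" for k
    using gdeg_powi[OF gdeg_mult[OF gdeg_q(3,4)], of k] by simp
  have 3: "gdeg 0 (t_half powi k * t_half powi l) 0" for k l
    using gdeg_mult[OF gdeg_powi[OF gdeg_q(2), of k] gdeg_powi[OF gdeg_q(2), of l]] by simp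
  show ?thesis unfolding ev_Y_eq[OF assms]
    using gdeg_mult[OF gdeg_mult[OF 1 2] gdeg_prod0[OF 3]] by simp
qed

lemma ev_Y_inj:
  assumes "\<mu> \<in> lattice n" "\<nu> \<in> lattice n" "\<And>j. j \<in> {1..n} \<Longrightarrow> ev_Y n \<mu> j = ev_Y n \<nu> j"
  shows "\<mu> = \<nu>"
proof (rule poly_mapping_eqI)
  fix k
  show "Poly_Mapping.lookup \<mu> k = Poly_Mapping.lookup \<nu> k"
  proof (cases "k \<in> {1..n}")
    case True
    then show ?thesis using gdeg_unique[OF gdeg_ev_Y[OF True, of \<mu>] gdeg_ev_Y[OF True, of \<nu>, folded assms(3)[OF True]]] by simp
  next
    case False
    then show ?thesis using assms by (simp add: lattice_iff)
  qed
qed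

section \<open>Existence and uniqueness of the electronic polynomials\<close>

lemma Y_op_comm:
  assumes "1 \<le> n" "i \<in> {1..n}" "j \<in> {1..n}"
  shows "Y_op n i (Y_op n j f) = Y_op n j (Y_op n i f)"
proof -
  interpret A: affine_family n "T_op n" by (rule affine_family_T_op[OF assms(1)])
  have e: "A.Y k = Y_op n k" for k
    by (simp add: A.Y_def Y_op_def A.Tw_def T_word_def)
  show ?thesis using A.Y_comm[OF assms(2,3)] unfolding e by (rule commD)
qed

lemma lin_Y: "1 \<le> n \<Longrightarrow> j \<in> {1..n} \<Longrightarrow> lin (Y_op n j)"
  using tri_Y[of n j] by (simp add: triangular_def)

lemma Y_op_xm:
  assumes "1 \<le> n" "j \<in> {1..n}" "\<mu> \<in> lattice n"
  shows "\<exists>L\<in>lw n id (key n id \<mu>). Y_op n j (xm \<mu>) = cst (ev_Y n \<mu> j) * xm \<mu> + L"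
proof -
  have "inv id \<mu> = \<mu>" by (metis W_id W_inv(3) id_apply)
  then show ?thesis using triD[OF tri_Y[OF assms(1,2)] assms(3)] by simp
qed

lemma Y_op_lw: "1 \<le> n \<Longrightarrow> j \<in> {1..n} \<Longrightarrow> f \<in> lw n id k \<Longrightarrow> Y_op n j f \<in> lw n id k"
  by (rule tri_lw[OF tri_Y])

text \<open>Makes the down-sets of \<open>key n id\<close> finite, so that lower exponents can be
  removed one by one.\<close>

lemma finite_lattice_nrm: "finite {\<nu> \<in> lattice n. nrm n \<nu> \<le> N}"
proof (rule finite_imageD)
  let ?r = "(\<lambda>\<nu>. restrict (Poly_Mapping.lookup \<nu>) {1..n}) :: vec \<Rightarrow> nat \<Rightarrow> int"
  show "finite (?r ` {\<nu> \<in> lattice n. nrm n \<nu> \<le> N})"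
  proof (rule finite_subset)
    show "?r ` {\<nu> \<in> lattice n. nrm n \<nu> \<le> N} \<subseteq> (PiE {1..n} (\<lambda>_. {- N..N}))"
    proof safe
      fix \<nu> k assume n: "nrm n \<nu> \<le> N" and k: "k \<in> {1..n}"
      have "(Poly_Mapping.lookup \<nu> k)\<^sup>2 \<le> nrm n \<nu>" unfolding nrm_def using k by (intro member_le_sum) auto
      then have "(Poly_Mapping.lookup \<nu> k)\<^sup>2 \<le> N" using n by simp
      moreover have "\<bar>Poly_Mapping.lookup \<nu> k\<bar> \<le> (Poly_Mapping.lookup \<nu> k)\<^sup>2"
        using self_le_power[of "\<bar>Poly_Mapping.lookup \<nu> k\<bar>" 2] by (cases "Poly_Mapping.lookup \<nu> k = 0") auto
      ultimately show "?r \<nu> k \<in> {- N..N}" using k by (auto simp: abs_le_iff)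
    qed auto
    show "finite (PiE {1..n} (\<lambda>_. {- N..N}))" by (intro finite_PiE) auto
  qed
  show "inj_on ?r {\<nu> \<in> lattice n. nrm n \<nu> \<le> N}"
  proof (rule inj_onI)
    fix \<mu> \<nu> assume a: "\<mu> \<in> {\<nu> \<in> lattice n. nrm n \<nu> \<le> N}" "\<nu> \<in> {\<nu> \<in> lattice n. nrm n \<nu> \<le> N}" "?r \<mu> = ?r \<nu>"
    show "\<mu> = \<nu>"
    proof (rule poly_mapping_eqI)
      fix k show "Poly_Mapping.lookup \<mu> k = Poly_Mapping.lookup \<nu> k"
      proof (cases "k \<in> {1..n}")
        case True
        then show ?thesis using fun_cong[OF a(3), of k] by (simp only: restrict_apply')
      next
        case False
        then show ?thesis using a(1,2) by (simp add: lattice_iff)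
      qed
    qed
  qed
qed

lemma key_inj: "key n id \<mu> = key n id \<nu> \<Longrightarrow> \<mu> = \<nu>"
  by (simp add: key_def)

text \<open>F is a product of operators Y_j - \<open>ev_Y n x j\<close>, one for each x in S, with j
  chosen to separate x from \<mu>. By triangularity each factor removes the top exponent of the
  down-set, while it acts on the leading term at \<mu> by a nonzero scalar.\<close>

lemma annihilator:
  assumes n: "1 \<le> n" and \<mu>: "\<mu> \<in> lattice n" and "finite S"
    and "S \<subseteq> lattice n" "\<mu> \<notin> S" "\<forall>\<nu>\<in>S. \<forall>\<nu>'\<in>lattice n. key n id \<nu>' < key n id \<nu> \<longrightarrow> \<nu>' \<in> S"
  shows "\<exists>F. lin F \<and> (\<forall>j\<in>{1..n}. \<forall>f. F (Y_op n j f) = Y_op n j (F f)) \<and> (\<forall>k f. f \<in> lw n id k \<longrightarrow> F f \<in> lw n id k) \<and>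
    (\<forall>f. Poly_Mapping.keys f \<subseteq> S \<longrightarrow> F f = 0) \<and> (\<exists>c L. c \<noteq> 0 \<and> L \<in> lw n id (key n id \<mu>) \<and> F (xm \<mu>) = cst c * xm \<mu> + L)"
  using assms(3-)
proof (induction S rule: finite_ranking_induct[where f = "key n id"])
  case empty
  have "\<exists>c L. c \<noteq> 0 \<and> L \<in> lw n id (key n id \<mu>) \<and> id (xm \<mu>) = cst c * xm \<mu> + L"
    by (intro exI[of _ 1] exI[of _ 0]) (simp add: lw_0 cst_simps)
  then show ?case using lin_id by (intro exI[of _ id] conjI) (assumption | simp)+
next
  case (insert x S)
  show ?case
  proof (cases "x \<in> S")
    case True
    then show ?thesis using insert by (simp add: insert_absorb)
  next
    case False
    have xS: "S \<subseteq> lattice n" "\<mu> \<notin> S" "x \<in> lattice n" "x \<noteq> \<mu>" using insert by auto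
    have less: "key n id y < key n id x" if "y \<in> S" for y
      using insert(2)[OF that] False that key_inj[of n y x] by (auto simp: le_less)
    have down: "\<nu>' \<in> S" if "\<nu> \<in> insert x S" "\<nu>' \<in> lattice n" "key n id \<nu>' < key n id \<nu>" for \<nu> \<nu>'
    proof -
      have "\<nu>' \<in> insert x S" using insert.prems(3) that by blast
      moreover have "\<nu>' \<noteq> x" using that less by (auto dest: less_asym)
      ultimately show ?thesis by simp
    qed
    have "\<forall>\<nu>\<in>S. \<forall>\<nu>'\<in>lattice n. key n id \<nu>' < key n id \<nu> \<longrightarrow> \<nu>' \<in> S" using down by blast
    from insert.IH[OF xS(1,2) this] obtain F c L where F: "lin F" "\<And>j f. j \<in> {1..n} \<Longrightarrow> F (Y_op n j f) = Y_op n j (F f)"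
      "\<And>k f. f \<in> lw n id k \<Longrightarrow> F f \<in> lw n id k" "\<And>f. Poly_Mapping.keys f \<subseteq> S \<Longrightarrow> F f = 0"
      and c: "c \<noteq> 0" "L \<in> lw n id (key n id \<mu>)" "F (xm \<mu>) = cst c * xm \<mu> + L"
      by (elim exE conjE) blast
    obtain j where j: "j \<in> {1..n}" "ev_Y n \<mu> j \<noteq> ev_Y n x j" using ev_Y_inj[OF \<mu> xS(3)] xS(4) by blast
    define e where "e = ev_Y n x j"
    define A where "A f = Y_op n j f - cst e * f" for f
    note lY = lin_Y[OF n j(1)]
    have lA: "lin A" unfolding A_def lin_def by (simp add: linD[OF lY] distrib_left right_diff_distrib mult.left_commute)
    have Am: "f - g \<in> lw n id k" if "f \<in> lw n id k" "g \<in> lw n id k" for f g k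
      using lw_add[OF that(1) lw_cst[OF that(2), of "- 1"]] by (simp add: cst_simps)
    have Alw: "A f \<in> lw n id k" if "f \<in> lw n id k" for f k
      unfolding A_def by (intro Am Y_op_lw[OF n j(1)] lw_cst that)
    have Ax: "\<exists>L\<in>lw n id (key n id \<nu>). A (xm \<nu>) = cst (ev_Y n \<nu> j - e) * xm \<nu> + L" if nu: "\<nu> \<in> lattice n" for \<nu>
    proof -
      from Y_op_xm[OF n j(1) nu] obtain L where "L \<in> lw n id (key n id \<nu>)" "Y_op n j (xm \<nu>) = cst (ev_Y n \<nu> j) * xm \<nu> + L" by blast
      then show ?thesis by (intro bexI[of _ L]) (simp_all add: A_def cst_simps algebra_simps)
    qed
    have Asupp: "Poly_Mapping.keys (A f) \<subseteq> S" if f: "Poly_Mapping.keys f \<subseteq> insert x S" for f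
    proof -
      have "Poly_Mapping.keys (cst (Poly_Mapping.lookup f \<nu>) * A (xm \<nu>)) \<subseteq> S" if nu: "\<nu> \<in> Poly_Mapping.keys f" for \<nu>
      proof -
        have nl: "\<nu> \<in> insert x S" "\<nu> \<in> lattice n" using nu f xS by auto
        from Ax[OF nl(2)] obtain L where L: "L \<in> lw n id (key n id \<nu>)" "A (xm \<nu>) = cst (ev_Y n \<nu> j - e) * xm \<nu> + L" by blast
        have "Poly_Mapping.keys L \<subseteq> S" using L(1) down[OF nl(1)] by (auto simp: lw_def)
        moreover have "Poly_Mapping.keys (cst (ev_Y n \<nu> j - e) * xm \<nu>) \<subseteq> S"
          using nl by (cases "\<nu> = x") (auto simp: e_def cst_single)
        ultimately have "Poly_Mapping.keys (A (xm \<nu>)) \<subseteq> S"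
          unfolding L(2) using keys_add[of "cst (ev_Y n \<nu> j - e) * xm \<nu>" L] by blast
        then show ?thesis using keys_cst_mult by blast
      qed
      then show ?thesis unfolding lin_expand[OF lA, of f] by (rule order_trans[OF keys_sum UN_least])
    qed
    show ?thesis
    proof (intro exI[of _ "F \<circ> A"] conjI ballI allI impI)
      show "lin (F \<circ> A)" by (rule lin_comp[OF F(1) lA])
      fix i and f :: laurent assume i: "i \<in> {1..n}"
      have "A (Y_op n i f) = Y_op n i (A f)"
        unfolding A_def lin_minus[OF lin_Y[OF n i]] linD(2)[OF lin_Y[OF n i]] Y_op_comm[OF n i j(1)] ..
      then show "(F \<circ> A) (Y_op n i f) = Y_op n i ((F \<circ> A) f)" by (simp add: F(2)[OF i])
    next
      fix k and f :: laurent assume "f \<in> lw n id k"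
      then show "(F \<circ> A) f \<in> lw n id k" by (simp add: F(3) Alw)
    next
      fix f :: laurent assume "Poly_Mapping.keys f \<subseteq> insert x S"
      then show "(F \<circ> A) f = 0" using F(4)[OF Asupp] by simp
    next
      from Ax[OF \<mu>] obtain L' where L': "L' \<in> lw n id (key n id \<mu>)" "A (xm \<mu>) = cst (ev_Y n \<mu> j - e) * xm \<mu> + L'" by blast
      define d where "d = ev_Y n \<mu> j - e"
      have "d * c \<noteq> 0" using c j by (simp add: d_def e_def)
      moreover have "(F \<circ> A) (xm \<mu>) = cst (d * c) * xm \<mu> + (cst d * L + F L')"
        by (simp add: L'(2) linD[OF F(1)] c(3) d_def[symmetric] cst_simps algebra_simps)
      moreover have "cst d * L + F L' \<in> lw n id (key n id \<mu>)" by (intro lw_add lw_cst c(2) F(3) L'(1))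
      ultimately show "\<exists>c L. c \<noteq> 0 \<and> L \<in> lw n id (key n id \<mu>) \<and> (F \<circ> A) (xm \<mu>) = cst c * xm \<mu> + L" by blast
    qed
  qed
qed

lemma lw_coeff: "L \<in> lw n id (key n id \<mu>) \<Longrightarrow> Poly_Mapping.lookup L \<mu> = 0"
  by (auto simp: lw_def in_keys_iff)

lemma lw_laurent_ring: "L \<in> lw n id k \<Longrightarrow> L \<in> laurent_ring n"
  by (auto simp: lw_def laurent_ring_def)

text \<open>Annihilating everything below \<mu> turns x^\<mu> into a joint eigenvector: F commutes
  with the Y_j and kills the lower part of Y_j x^\<mu>.\<close>

lemma E_exists:
  assumes n: "1 \<le> n" and \<mu>: "\<mu> \<in> lattice n"
  shows "\<exists>L\<in>lw n id (key n id \<mu>). \<forall>j\<in>{1..n}. Y_op n j (xm \<mu> + L) = cst (ev_Y n \<mu> j) * (xm \<mu> + L)"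
proof -
  define S where "S = {\<nu> \<in> lattice n. key n id \<nu> < key n id \<mu>}"
  have fin: "finite S" unfolding S_def
    by (rule finite_subset[OF _ finite_lattice_nrm[of n "nrm n \<mu>"]]) (auto simp: key_def less_prod_def)
  have S: "S \<subseteq> lattice n" "\<mu> \<notin> S" by (auto simp: S_def)
  have S2: "\<forall>\<nu>\<in>S. \<forall>\<nu>'\<in>lattice n. key n id \<nu>' < key n id \<nu> \<longrightarrow> \<nu>' \<in> S"
    unfolding S_def by (blast intro: less_trans)
  from annihilator[OF n \<mu> fin S S2] obtain F c L where F: "lin F" "\<And>j f. j \<in> {1..n} \<Longrightarrow> F (Y_op n j f) = Y_op n j (F f)"
      "\<And>f. Poly_Mapping.keys f \<subseteq> S \<Longrightarrow> F f = 0"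
      and c: "c \<noteq> 0" "L \<in> lw n id (key n id \<mu>)" "F (xm \<mu>) = cst c * xm \<mu> + L"
    by (elim exE conjE) blast
  have lwS: "F M = 0" if "M \<in> lw n id (key n id \<mu>)" for M using that by (intro F(3)) (auto simp: lw_def S_def)
  define E where "E = cst (inverse c) * F (xm \<mu>)"
  have E: "E = xm \<mu> + cst (inverse c) * L"
    using c(1) by (simp add: E_def c(3) distrib_left cst_simps(1) flip: mult.assoc cst_simps(4))
  have "Y_op n j E = cst (ev_Y n \<mu> j) * E" if j: "j \<in> {1..n}" for j
  proof -
    from Y_op_xm[OF n j \<mu>] obtain M where M: "M \<in> lw n id (key n id \<mu>)" "Y_op n j (xm \<mu>) = cst (ev_Y n \<mu> j) * xm \<mu> + M" by blast
    have "Y_op n j (F (xm \<mu>)) = cst (ev_Y n \<mu> j) * F (xm \<mu>)"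
      unfolding F(2)[OF j, symmetric] M(2) by (simp add: linD[OF F(1)] lwS[OF M(1)])
    then show ?thesis unfolding E_def by (simp add: linD[OF lin_Y[OF n j]] mult.left_commute)
  qed
  moreover have "cst (inverse c) * L \<in> lw n id (key n id \<mu>)" by (intro lw_cst c(2))
  ultimately show ?thesis unfolding E by blast
qed

text \<open>At the highest exponent of f only the diagonal entry of the triangular Y_j
  contributes.\<close>

lemma eigen_leading:
  assumes n: "1 \<le> n" and f: "f \<in> laurent_ring n" "f \<noteq> 0" and e: "\<And>j. j \<in> {1..n} \<Longrightarrow> Y_op n j f = cst (e j) * f"
  shows "\<exists>\<nu>\<in>Poly_Mapping.keys f. \<nu> \<in> lattice n \<and> (\<forall>j\<in>{1..n}. e j = ev_Y n \<nu> j)"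
proof -
  have "Poly_Mapping.keys f \<noteq> {}" using f(2) by simp
  then have "Max (key n id ` Poly_Mapping.keys f) \<in> key n id ` Poly_Mapping.keys f" by (intro Max_in) auto
  then obtain \<nu> where nu: "\<nu> \<in> Poly_Mapping.keys f" "key n id \<nu> = Max (key n id ` Poly_Mapping.keys f)" by auto
  have max: "key n id \<nu>' \<le> key n id \<nu>" if "\<nu>' \<in> Poly_Mapping.keys f" for \<nu>'
    unfolding nu(2) using that by (intro Max_ge) auto
  have nl: "\<nu> \<in> lattice n" using nu f by (auto simp: laurent_ring_def)
  define c where "c = Poly_Mapping.lookup f \<nu>"
  define L where "L = f - cst c * xm \<nu>"
  have c: "c \<noteq> 0" using nu by (simp add: c_def in_keys_iff)
  have L: "L \<in> lw n id (key n id \<nu>)" unfolding lw_def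
  proof safe
    fix \<nu>' assume k: "\<nu>' \<in> Poly_Mapping.keys L"
    have "Poly_Mapping.lookup L \<nu> = 0" by (simp add: L_def c_def cst_single lookup_minus)
    then have ne: "\<nu>' \<noteq> \<nu>" using k by auto
    then have kf: "\<nu>' \<in> Poly_Mapping.keys f" using k by (simp add: L_def cst_single lookup_minus in_keys_iff lookup_single)
    show "\<nu>' \<in> lattice n" using kf f by (auto simp: laurent_ring_def)
    show "key n id \<nu>' < key n id \<nu>" using max[OF kf] ne key_inj[of n \<nu>' \<nu>] by (auto simp: le_less)
  qed
  have "e j = ev_Y n \<nu> j" if j: "j \<in> {1..n}" for j
  proof -
    from Y_op_xm[OF n j nl] obtain M where M: "M \<in> lw n id (key n id \<nu>)" "Y_op n j (xm \<nu>) = cst (ev_Y n \<nu> j) * xm \<nu> + M" by blast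
    have "f = cst c * xm \<nu> + L" by (simp add: L_def)
    then have "Y_op n j f = cst c * (cst (ev_Y n \<nu> j) * xm \<nu> + M) + Y_op n j L"
      by (metis linD[OF lin_Y[OF n j]] M(2))
    then have "Poly_Mapping.lookup (cst (e j) * f) \<nu> = Poly_Mapping.lookup (cst c * (cst (ev_Y n \<nu> j) * xm \<nu> + M) + Y_op n j L) \<nu>"
      using e[OF j] by metis
    then have "e j * c = c * ev_Y n \<nu> j"
      by (simp add: lookup_cst_mult lookup_add lw_coeff[OF M(1)] lw_coeff[OF Y_op_lw[OF n j L]] c_def)
    then show ?thesis using c by simp
  qed
  then show ?thesis using nu(1) nl by blast
qed

lemma E_poly:
  assumes n: "1 \<le> n" and \<mu>: "\<mu> \<in> lattice n"
  shows "\<exists>L\<in>lw n id (key n id \<mu>). E_poly n \<mu> = xm \<mu> + L" "j \<in> {1..n} \<Longrightarrow> Y_op n j (E_poly n \<mu>) = cst (ev_Y n \<mu> j) * E_poly n \<mu>"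
    "E_poly n \<mu> \<in> laurent_ring n" "Poly_Mapping.lookup (E_poly n \<mu>) \<mu> = 1"
    "f \<in> laurent_ring n \<Longrightarrow> (\<And>j. j \<in> {1..n} \<Longrightarrow> Y_op n j f = cst (ev_Y n \<mu> j) * f) \<Longrightarrow> f = cst (Poly_Mapping.lookup f \<mu>) * E_poly n \<mu>"
proof -
  from E_exists[OF assms] obtain L where L: "L \<in> lw n id (key n id \<mu>)" "\<And>j. j \<in> {1..n} \<Longrightarrow> Y_op n j (xm \<mu> + L) = cst (ev_Y n \<mu> j) * (xm \<mu> + L)" by blast
  have ring: "xm \<mu> + L \<in> laurent_ring n" using lw_laurent_ring[OF L(1)] \<mu> keys_add[of "xm \<mu>" L] by (auto simp: laurent_ring_def)
  have co: "Poly_Mapping.lookup (xm \<mu> + L) \<mu> = 1" by (simp add: lookup_add lw_coeff[OF L(1)])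
  have uniq: "f = cst (Poly_Mapping.lookup f \<mu>) * (xm \<mu> + L)"
    if f: "f \<in> laurent_ring n" "\<And>j. j \<in> {1..n} \<Longrightarrow> Y_op n j f = cst (ev_Y n \<mu> j) * f" for f
  proof (rule ccontr)
    \<comment> \<open>The difference has no coefficient at \<mu>, but its eigenvalues force \<mu> to
      occur in it.\<close>
    define g where "g = f - cst (Poly_Mapping.lookup f \<mu>) * (xm \<mu> + L)"
    assume "f \<noteq> cst (Poly_Mapping.lookup f \<mu>) * (xm \<mu> + L)"
    then have g0: "g \<noteq> 0" by (simp add: g_def)
    have gr: "g \<in> laurent_ring n" unfolding g_def laurent_ring_def
      using f(1) ring keys_diff[of f "cst (Poly_Mapping.lookup f \<mu>) * (xm \<mu> + L)"] keys_cst_mult[of "Poly_Mapping.lookup f \<mu>" "xm \<mu> + L"]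
      by (auto simp: laurent_ring_def)
    have ge: "Y_op n j g = cst (ev_Y n \<mu> j) * g" if j: "j \<in> {1..n}" for j
      unfolding g_def lin_minus[OF lin_Y[OF n j]] linD(2)[OF lin_Y[OF n j]] f(2)[OF j] L(2)[OF j] right_diff_distrib
      by (simp only: mult.left_commute)
    from eigen_leading[OF n gr g0 ge] obtain \<nu> where nu: "\<nu> \<in> Poly_Mapping.keys g" "\<nu> \<in> lattice n" "\<And>j. j \<in> {1..n} \<Longrightarrow> ev_Y n \<mu> j = ev_Y n \<nu> j" by blast
    then have "\<nu> = \<mu>" using ev_Y_inj[OF \<mu> nu(2,3)] by simp
    then show False using nu(1) by (simp add: g_def in_keys_iff lookup_minus lookup_cst_mult co)
  qed
  have "E_poly n \<mu> = xm \<mu> + L" unfolding E_poly_def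
  proof (rule the_equality)
    show "xm \<mu> + L \<in> laurent_ring n \<and> Poly_Mapping.lookup (xm \<mu> + L) \<mu> = 1 \<and> (\<forall>j\<in>{1..n}. Y_op n j (xm \<mu> + L) = cst (ev_Y n \<mu> j) * (xm \<mu> + L))"
      using ring co L(2) by blast
    fix f assume "f \<in> laurent_ring n \<and> Poly_Mapping.lookup f \<mu> = 1 \<and> (\<forall>j\<in>{1..n}. Y_op n j f = cst (ev_Y n \<mu> j) * f)"
    then show "f = xm \<mu> + L" using uniq[of f] by (simp add: cst_simps)
  qed
  then show "\<exists>L\<in>lw n id (key n id \<mu>). E_poly n \<mu> = xm \<mu> + L" "j \<in> {1..n} \<Longrightarrow> Y_op n j (E_poly n \<mu>) = cst (ev_Y n \<mu> j) * E_poly n \<mu>"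
    "E_poly n \<mu> \<in> laurent_ring n" "Poly_Mapping.lookup (E_poly n \<mu>) \<mu> = 1"
    "f \<in> laurent_ring n \<Longrightarrow> (\<And>j. j \<in> {1..n} \<Longrightarrow> Y_op n j f = cst (ev_Y n \<mu> j) * f) \<Longrightarrow> f = cst (Poly_Mapping.lookup f \<mu>) * E_poly n \<mu>"
    using L ring co uniq by auto
qed

section \<open>The electronic polynomials as a basis\<close>

text \<open>The leading monomial of the highest E with a nonzero coefficient occurs in no other
  summand.\<close>

lemma E_independent:
  assumes n: "1 \<le> n" and A: "finite A" "A \<subseteq> lattice n" and z: "(\<Sum>\<nu>\<in>A. cst (c \<nu>) * E_poly n \<nu>) = 0" and \<mu>: "\<mu> \<in> A"
  shows "c \<mu> = 0"
proof (rule ccontr)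
  assume "c \<mu> \<noteq> 0"
  define B where "B = {\<nu> \<in> A. c \<nu> \<noteq> 0}"
  have B: "finite B" "B \<noteq> {}" using A \<mu> \<open>c \<mu> \<noteq> 0\<close> by (auto simp: B_def)
  then have "Max (key n id ` B) \<in> key n id ` B" by (intro Max_in) auto
  then obtain m where m: "m \<in> B" "key n id m = Max (key n id ` B)" by auto
  have z0: "Poly_Mapping.lookup (E_poly n \<nu>) m = 0" if "\<nu> \<in> B" "\<nu> \<noteq> m" for \<nu>
  proof -
    have "key n id \<nu> \<le> key n id m" unfolding m(2) using B that by (intro Max_ge) auto
    then have k: "key n id \<nu> \<le> key n id m" .
    have "\<nu> \<in> lattice n" using that A by (auto simp: B_def)
    from E_poly(1)[OF n this] obtain L where L: "L \<in> lw n id (key n id \<nu>)" "E_poly n \<nu> = xm \<nu> + L" by blast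
    show ?thesis unfolding L(2) using lw_coeff[OF lw_mono[OF k L(1)]] that by (simp add: lookup_add lookup_single)
  qed
  have "(\<Sum>\<nu>\<in>A. cst (c \<nu>) * E_poly n \<nu>) = (\<Sum>\<nu>\<in>B. cst (c \<nu>) * E_poly n \<nu>)"
    by (rule sum.mono_neutral_right) (use A in \<open>auto simp: B_def cst_simps\<close>)
  then have "Poly_Mapping.lookup (\<Sum>\<nu>\<in>B. cst (c \<nu>) * E_poly n \<nu>) m = 0" using z by simp
  then have "(\<Sum>\<nu>\<in>B. c \<nu> * Poly_Mapping.lookup (E_poly n \<nu>) m) = 0" by (simp add: lookup_sum lookup_cst_mult)
  also have "(\<Sum>\<nu>\<in>B. c \<nu> * Poly_Mapping.lookup (E_poly n \<nu>) m) = (\<Sum>\<nu>\<in>{m}. c \<nu> * Poly_Mapping.lookup (E_poly n \<nu>) m)"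
    by (rule sum.mono_neutral_right) (use B m z0 in auto)
  also have "\<dots> = c m" using E_poly(4)[OF n, of m] m(1) A by (auto simp: B_def)
  finally show False using m by (simp add: B_def)
qed

text \<open>Subtracting a multiple of the E at the top exponent leaves a support inside the smaller
  down-set.\<close>

lemma E_span:
  assumes n: "1 \<le> n" and "finite S" "S \<subseteq> lattice n"
    "\<forall>\<nu>\<in>S. \<forall>\<nu>'\<in>lattice n. key n id \<nu>' < key n id \<nu> \<longrightarrow> \<nu>' \<in> S" "Poly_Mapping.keys f \<subseteq> S"
  shows "\<exists>c. f = (\<Sum>\<nu>\<in>S. cst (c \<nu>) * E_poly n \<nu>)"
  using assms(2-)
proof (induction S arbitrary: f rule: finite_ranking_induct[where f = "key n id"])
  case empty
  then show ?case by simp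
next
  case (insert x S)
  show ?case
  proof (cases "x \<in> S")
    case True
    then show ?thesis using insert by (simp add: insert_absorb)
  next
    case False
    have xS: "S \<subseteq> lattice n" "x \<in> lattice n" using insert by auto
    have less: "key n id y < key n id x" if "y \<in> S" for y
      using insert(2)[OF that] False that key_inj[of n y x] by (auto simp: le_less)
    have down: "\<nu>' \<in> S" if "\<nu> \<in> insert x S" "\<nu>' \<in> lattice n" "key n id \<nu>' < key n id \<nu>" for \<nu> \<nu>'
    proof -
      have "\<nu>' \<in> insert x S" using insert.prems(2) that by blast
      moreover have "\<nu>' \<noteq> x" using that less by (auto dest: less_asym)
      ultimately show ?thesis by simp
    qed
    then have dS: "\<forall>\<nu>\<in>S. \<forall>\<nu>'\<in>lattice n. key n id \<nu>' < key n id \<nu> \<longrightarrow> \<nu>' \<in> S" by blast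
    define a where "a = Poly_Mapping.lookup f x"
    define g where "g = f - cst a * E_poly n x"
    from E_poly(1)[OF n xS(2)] obtain L where L: "L \<in> lw n id (key n id x)" "E_poly n x = xm x + L" by blast
    have LS: "Poly_Mapping.keys L \<subseteq> S" using L(1) down[of x] by (auto simp: lw_def)
    have "Poly_Mapping.keys g \<subseteq> S"
    proof
      fix \<nu> assume k: "\<nu> \<in> Poly_Mapping.keys g"
      have "Poly_Mapping.lookup g x = 0" using E_poly(4)[OF n xS(2)] by (simp add: g_def a_def lookup_minus lookup_cst_mult)
      then have "\<nu> \<noteq> x" using k by auto
      then have "\<nu> \<in> Poly_Mapping.keys f \<or> \<nu> \<in> Poly_Mapping.keys L"
        using k by (auto simp: g_def L(2) in_keys_iff lookup_minus lookup_cst_mult lookup_add lookup_single)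
      then show "\<nu> \<in> S" using LS insert.prems(3) \<open>\<nu> \<noteq> x\<close> by auto
    qed
    from insert.IH[OF xS(1) dS this] obtain c where c: "g = (\<Sum>\<nu>\<in>S. cst (c \<nu>) * E_poly n \<nu>)" by blast
    have "f = cst a * E_poly n x + g" by (simp add: g_def)
    also have "\<dots> = (\<Sum>\<nu>\<in>insert x S. cst ((c(x := a)) \<nu>) * E_poly n \<nu>)"
      unfolding c using insert(1) False by (simp add: sum.insert) (intro sum.cong, auto)
    finally show ?thesis by blast
  qed
qed

text \<open>In the basis of the E, applying Y_j - \<open>ev_Y n \<mu> j\<close> clears the
  coefficient at \<mu>, so there are no Jordan blocks. \<open>T_E_zero\<close> uses this to separate
  eigenvalues of equal degree in q.\<close>

lemma Y_semisimple:
  assumes n: "1 \<le> n" and \<mu>: "\<mu> \<in> lattice n" and j: "j \<in> {1..n}" and G: "G \<in> laurent_ring n"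
    and e: "Y_op n j G - cst (ev_Y n \<mu> j) * G = cst d * E_poly n \<mu>"
  shows "d = 0"
proof -
  define N where "N = Max (insert (nrm n \<mu>) (nrm n ` Poly_Mapping.keys G))"
  define S where "S = {\<nu> \<in> lattice n. nrm n \<nu> \<le> N}"
  have fin: "finite S" unfolding S_def by (rule finite_lattice_nrm)
  have S: "S \<subseteq> lattice n" by (auto simp: S_def)
  have \<mu>S: "\<mu> \<in> S" unfolding S_def N_def using \<mu> by simp
  have down: "\<forall>\<nu>\<in>S. \<forall>\<nu>'\<in>lattice n. key n id \<nu>' < key n id \<nu> \<longrightarrow> \<nu>' \<in> S"
    by (auto simp: S_def key_def less_prod_def)
  have "Poly_Mapping.keys G \<subseteq> S"
  proof
    fix \<nu> assume k: "\<nu> \<in> Poly_Mapping.keys G"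
    then have "nrm n \<nu> \<le> N" unfolding N_def by (intro Max_ge) auto
    then show "\<nu> \<in> S" using k G by (auto simp: S_def laurent_ring_def)
  qed
  from E_span[OF n fin S down this] obtain c where c: "G = (\<Sum>\<nu>\<in>S. cst (c \<nu>) * E_poly n \<nu>)" by blast
  have "Y_op n j G = (\<Sum>\<nu>\<in>S. cst (c \<nu>) * (cst (ev_Y n \<nu> j) * E_poly n \<nu>))"
    unfolding c lin_sum[OF lin_Y[OF n j]] linD(2)[OF lin_Y[OF n j]]
    by (intro sum.cong refl arg_cong2[where f = "(*)"] E_poly(2) n j) (use S in auto)
  then have "(\<Sum>\<nu>\<in>S. cst (c \<nu> * (ev_Y n \<nu> j - ev_Y n \<mu> j)) * E_poly n \<nu>) = Y_op n j G - cst (ev_Y n \<mu> j) * G"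
    unfolding c by (simp add: sum_distrib_left cst_simps algebra_simps sum_subtractf)
  also have "\<dots> = (\<Sum>\<nu>\<in>S. cst (if \<nu> = \<mu> then d else 0) * E_poly n \<nu>)"
    unfolding e using fin \<mu>S by (subst sum.remove[of S \<mu>]) (auto simp: cst_simps intro!: sum.neutral)
  finally have "(\<Sum>\<nu>\<in>S. cst (c \<nu> * (ev_Y n \<nu> j - ev_Y n \<mu> j) - (if \<nu> = \<mu> then d else 0)) * E_poly n \<nu>) = 0"
    by (simp add: cst_simps(6) left_diff_distrib sum_subtractf)
  from E_independent[OF n fin S this \<mu>S] show "d = 0" by simp
qed

section \<open>Action of the finite Hecke algebra on the electronic polynomials\<close>

text \<open>In the third part X is T_0 conjugated by T_1 ... T_{n-1}; it inherits the quadratic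
  relation with parameter t_0, which takes the place of an exchange relation at the end n.\<close>

lemma T_Y_relations:
  assumes n: "1 \<le> n"
  shows "1 \<le> i \<Longrightarrow> i < n \<Longrightarrow> T_op n i (Y_op n (Suc i) (T_op n i f)) = Y_op n i f"
    "i \<in> {1..n} \<Longrightarrow> j \<in> {1..n} \<Longrightarrow> i \<noteq> j \<Longrightarrow> Suc i \<noteq> j \<Longrightarrow> T_op n i (Y_op n j f) = Y_op n j (T_op n i f)"
    "\<exists>X. lin X \<and> (\<forall>f. Y_op n n f = X (T_op n n f)) \<and> (\<forall>f. X (X f) = cst (t0_half - inverse t0_half) * X f + f)"
proof -
  interpret A: affine_family n "T_op n" by (rule affine_family_T_op[OF n])
  have e: "A.Y k = Y_op n k" for k
    by (simp add: A.Y_def Y_op_def A.Tw_def T_word_def)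
  show "1 \<le> i \<Longrightarrow> i < n \<Longrightarrow> T_op n i (Y_op n (Suc i) (T_op n i f)) = Y_op n i f"
    using A.Y_T unfolding e by blast
  show "i \<in> {1..n} \<Longrightarrow> j \<in> {1..n} \<Longrightarrow> i \<noteq> j \<Longrightarrow> Suc i \<noteq> j \<Longrightarrow> T_op n i (Y_op n j f) = Y_op n j (T_op n i f)"
    using A.T_Y_comm[of i j] unfolding e by (auto intro: commD)
  define U where "U = A.Tw [1..<n]"
  define X where "X = inv U \<circ> T_op n 0 \<circ> U"
  have linU: "set is \<subseteq> {..n} \<Longrightarrow> lin (A.Tw is)" for "is"
    by (induction "is") (auto intro!: lin_comp lin_T lin_id)
  have lU: "lin U" and bU: "bij U" unfolding U_def by (auto intro!: linU A.Tw_bij)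
  have Ui: "U (inv U f) = f" "inv U (U f) = f" for f using bU by (simp_all add: bij_is_surj surj_f_inv_f bij_is_inj)
  have liU: "lin (inv U)" unfolding lin_def
  proof (intro conjI allI)
    fix f g c
    show "inv U (f + g) = inv U f + inv U g"
      by (rule inv_f_eq[OF bij_is_inj[OF bU]]) (simp add: linD[OF lU] Ui)
    show "inv U (cst c * f) = cst c * inv U f"
      by (rule inv_f_eq[OF bij_is_inj[OF bU]]) (simp add: linD[OF lU] Ui)
  qed
  have lX: "lin X" unfolding X_def by (intro lin_comp liU lU lin_T) simp
  have "Y_op n n f = X (T_op n n f)" for f unfolding e[symmetric] A.Y_n X_def U_def by simp
  moreover have "X (X f) = cst (t0_half - inverse t0_half) * X f + f" for f
    using T_op_quadratic[of 0 n "U f"] n by (simp add: X_def Ui linD[OF liU] tau_def)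
  ultimately show "\<exists>X. lin X \<and> (\<forall>f. Y_op n n f = X (T_op n n f)) \<and> (\<forall>f. X (X f) = cst (t0_half - inverse t0_half) * X f + f)"
    using lX by blast
qed

lemma T_op_laurent_ring:
  assumes i: "1 \<le> i" "i \<le> n" and f: "f \<in> laurent_ring n"
  shows "T_op n i f \<in> laurent_ring n"
proof -
  have add: "g + h \<in> laurent_ring n" if "g \<in> laurent_ring n" "h \<in> laurent_ring n" for g h
    using that keys_add[of g h] by (auto simp: laurent_ring_def)
  have cm: "cst c * g \<in> laurent_ring n" if "g \<in> laurent_ring n" for c g
    using that keys_cst_mult[of c g] by (auto simp: laurent_ring_def)
  have x: "T_op n i (xm \<nu>) \<in> laurent_ring n" if nu: "\<nu> \<in> lattice n" for \<nu>
  proof -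
    have pos: "0 < id (sroot n i)" using sroot_pos[of n i] by simp
    note t = tri_T[OF W_id i pos]
    from triD[OF t nu] obtain c L where L: "L \<in> lw n (id \<circ> simple_refl n i) (key n id \<nu>)"
      "T_op n i (xm \<nu>) = cst c * xm (inv (id \<circ> simple_refl n i) (id \<nu>)) + L" by blast
    have "inv (id \<circ> simple_refl n i) (id \<nu>) \<in> lattice n"
      unfolding inv_comp_simple[OF W_id i] using simple_refl_lattice[OF i nu] .
    then show ?thesis unfolding L(2) using L(1) by (intro add cm) (auto simp: laurent_ring_def lw_def)
  qed
  have fin: "finite A \<Longrightarrow> (\<And>\<nu>. \<nu> \<in> A \<Longrightarrow> g \<nu> \<in> laurent_ring n) \<Longrightarrow> (\<Sum>\<nu>\<in>A. g \<nu>) \<in> laurent_ring n" for A g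
  proof (induction A rule: finite_induct)
    case empty
    show ?case by (simp add: laurent_ring_def)
  qed (simp add: add)
  show ?thesis unfolding lin_expand[OF lin_T[OF i(2)], of f]
    by (intro fin cm x) (use f in \<open>auto simp: laurent_ring_def\<close>)
qed

lemma linear_combination_laurent_ring: "f \<in> laurent_ring n \<Longrightarrow> g \<in> laurent_ring n \<Longrightarrow> cst c * f + cst d * g \<in> laurent_ring n"
  using keys_add[of "cst c * f" "cst d * g"] keys_cst_mult[of c f] keys_cst_mult[of d g]
  unfolding laurent_ring_def by blast

text \<open>Twisting the target order by s_i makes s_i \<mu> the leading exponent of T_i E, so only
  the leading term of E contributes.\<close>

lemma T_E_coeff:
  assumes n: "1 \<le> n" and i: "1 \<le> i" "i \<le> n" and \<mu>: "\<mu> \<in> lattice n" and d: "0 \<le> dval n i \<mu>"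
  shows "Poly_Mapping.lookup (T_op n i (E_poly n \<mu>)) (simple_refl n i \<mu>) = (if 0 < dval n i \<mu> then inverse (tau n i) else tau n i)"
proof -
  have pos: "0 < id (sroot n i)" using sroot_pos[of n i] by simp
  note t = tri_T[OF W_id i pos, unfolded id_comp]
  from E_poly(1)[OF n \<mu>] obtain L where L: "L \<in> lw n id (key n id \<mu>)" "E_poly n \<mu> = xm \<mu> + L" by blast
  have inv: "inv (simple_refl n i) (id \<mu>) = simple_refl n i \<mu>" using inv_comp_simple[OF W_id i, of \<mu>] by simp
  from triD[OF t \<mu>, unfolded inv] obtain L' where L': "L' \<in> lw n (simple_refl n i) (key n id \<mu>)"
      "T_op n i (xm \<mu>) = cst (if 0 < dval n i \<mu> then inverse (tau n i) else tau n i) * xm (simple_refl n i \<mu>) + L'" by blast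
  have k: "key n (simple_refl n i) (simple_refl n i \<mu>) = key n id \<mu>" by (simp add: key_def nrm_simple_refl[OF i])
  have z: "Poly_Mapping.lookup M (simple_refl n i \<mu>) = 0" if "M \<in> lw n (simple_refl n i) (key n id \<mu>)" for M
  proof (rule ccontr)
    assume "Poly_Mapping.lookup M (simple_refl n i \<mu>) \<noteq> 0"
    then have "simple_refl n i \<mu> \<in> Poly_Mapping.keys M" by (simp add: in_keys_iff)
    then have "key n (simple_refl n i) (simple_refl n i \<mu>) < key n id \<mu>" using that unfolding lw_def by blast
    then show False unfolding k by simp
  qed
  show ?thesis
    unfolding L(2) linD(1)[OF lin_T[OF i(2)]] L'(2)
    by (simp add: lookup_add lookup_cst_mult z[OF L'(1)] z[OF tri_lw[OF t L(1)]])
qed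

section \<open>Intertwiners and the two-term formula\<close>

lemma Y_T_s:
  assumes n: "1 \<le> n" and i: "1 \<le> i" "i < n"
    and e: "\<And>j. j \<in> {1..n} \<Longrightarrow> Y_op n j f = cst (y j) * f"
  shows "Y_op n i (T_op n i f) = cst ((tau n i - inverse (tau n i)) * y i) * f + cst (y (Suc i)) * T_op n i f"
    "Y_op n (Suc i) (T_op n i f) = cst (y i) * (T_op n i f - cst (tau n i - inverse (tau n i)) * f)"
proof -
  define g where "g = T_op n i f"
  define \<theta> where "\<theta> = tau n i - inverse (tau n i)"
  note lY = lin_Y[OF n]
  have in': "i \<le> n" "i \<in> {1..n}" "Suc i \<in> {1..n}" using i by auto
  have TT: "T_op n i g = cst \<theta> * g + f" unfolding g_def \<theta>_def by (rule T_op_quadratic[OF in'(1) n])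
  have YT: "T_op n i (Y_op n (Suc i) g) = cst (y i) * f" using T_Y_relations(1)[OF n i, of f] e[OF in'(2)] by (simp add: g_def)
  have "Y_op n i g = T_op n i (Y_op n (Suc i) (cst \<theta> * g + f))"
    using T_Y_relations(1)[OF n i, of g] TT by simp
  also have "\<dots> = cst \<theta> * T_op n i (Y_op n (Suc i) g) + cst (y (Suc i)) * g"
    by (simp add: linD[OF lY[OF in'(3)]] linD[OF lin_T[OF in'(1)]] e[OF in'(3)] g_def)
  finally show "Y_op n i (T_op n i f) = cst ((tau n i - inverse (tau n i)) * y i) * f + cst (y (Suc i)) * T_op n i f"
    unfolding YT by (simp only: g_def \<theta>_def cst_simps(4) mult.assoc)
  have "T_op n i (cst (y i) * (g - cst \<theta> * f)) = cst (y i) * f"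
    by (simp add: linD[OF lin_T[OF in'(1)]] lin_minus[OF lin_T[OF in'(1)]] TT flip: g_def)
  then have "Y_op n (Suc i) g = cst (y i) * (g - cst \<theta> * f)" using YT T_op_bij(1)[OF in'(1) n] by (metis bij_is_inj injD)
  then show "Y_op n (Suc i) (T_op n i f) = cst (y i) * (T_op n i f - cst (tau n i - inverse (tau n i)) * f)"
    by (simp only: g_def \<theta>_def)
qed

text \<open>T_i + \<kappa> is an intertwiner: the condition on \<kappa> cancels the multiple of f by
  which, according to \<open>Y_T_s\<close>, the vector T_i f fails to be an eigenvector.\<close>

lemma swap_eigen_s:
  assumes n: "1 \<le> n" and i: "1 \<le> i" "i < n"
    and e: "\<And>j. j \<in> {1..n} \<Longrightarrow> Y_op n j f = cst (y j) * f"
    and \<kappa>: "(tau n i - inverse (tau n i) + \<kappa>) * y i = \<kappa> * y (Suc i)" and j: "j \<in> {1..n}"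
  shows "Y_op n j (T_op n i f + cst \<kappa> * f) = cst (y (if j = i then Suc i else if j = Suc i then i else j)) * (T_op n i f + cst \<kappa> * f)"
proof -
  define g where "g = T_op n i f"
  define \<theta> where "\<theta> = tau n i - inverse (tau n i)"
  note lY = lin_Y[OF n]
  have in': "i \<le> n" "i \<in> {1..n}" "Suc i \<in> {1..n}" using i by auto
  have K: "cst \<kappa> * cst (y (Suc i)) = cst (\<theta> + \<kappa>) * cst (y i)" using \<kappa> by (simp add: \<theta>_def flip: cst_simps(4))
  have Yi: "Y_op n i g = cst \<theta> * cst (y i) * f + cst (y (Suc i)) * g" "Y_op n (Suc i) g = cst (y i) * (g - cst \<theta> * f)"
    unfolding g_def \<theta>_def cst_simps(4)[symmetric] by (rule Y_T_s[OF n i e], assumption)+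
  consider "j = i" | "j = Suc i" | "j \<noteq> i" "j \<noteq> Suc i" by blast
  then show ?thesis
  proof cases
    case 1
    have "Y_op n i (g + cst \<kappa> * f) = cst (y (Suc i)) * g + (cst (\<theta> + \<kappa>) * cst (y i)) * f"
      by (simp add: linD[OF lY[OF in'(2)]] Yi e[OF in'(2)]) (simp add: cst_simps algebra_simps)
    then show ?thesis using 1 unfolding K[symmetric] by (simp add: g_def algebra_simps)
  next
    case 2
    have "Y_op n (Suc i) (g + cst \<kappa> * f) = cst (y i) * g + (cst \<kappa> * cst (y (Suc i)) - cst \<theta> * cst (y i)) * f"
      by (simp add: linD[OF lY[OF in'(3)]] Yi e[OF in'(3)]) (simp add: cst_simps algebra_simps)
    then show ?thesis using 2 unfolding K by (simp add: g_def algebra_simps cst_simps)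
  next
    case 3
    have "Y_op n j (T_op n i f) = T_op n i (Y_op n j f)" using T_Y_relations(2)[OF n in'(2) j] 3 by simp
    then show ?thesis using 3 by (simp add: linD[OF lY[OF j]] linD[OF lin_T[OF in'(1)]] e[OF j]) (simp add: algebra_simps)
  qed
qed

lemma Y_T_n:
  assumes n: "1 \<le> n" and e: "Y_op n n f = cst y * f" and y: "y \<noteq> 0"
  shows "Y_op n n (T_op n n f) = cst ((tn_half - inverse tn_half) * y + (t0_half - inverse t0_half)) * f + cst (inverse y) * T_op n n f"
proof -
  define g where "g = T_op n n f"
  define \<theta> where "\<theta> = tn_half - inverse tn_half"
  define \<theta>0 where "\<theta>0 = t0_half - inverse t0_half"
  obtain X where X: "lin X" "\<And>f. Y_op n n f = X (T_op n n f)" "\<And>f. X (X f) = cst \<theta>0 * X f + f"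
    using T_Y_relations(3)[OF n] unfolding \<theta>0_def by blast
  have TT: "T_op n n g = cst \<theta> * g + f" unfolding g_def \<theta>_def using T_op_quadratic[OF le_refl n, of f] n by (simp add: tau_def)
  have Xg: "X g = cst y * f" using X(2)[of f] e by (simp add: g_def)
  have "cst y * X f = cst \<theta>0 * cst y * f + g"
    using X(3)[of g] unfolding Xg by (simp add: linD[OF X(1)] mult.assoc)
  moreover have "cst (inverse y) * cst y = 1" using y by (simp add: cst_simps(1) flip: cst_simps(4))
  ultimately have Xf: "X f = cst \<theta>0 * f + cst (inverse y) * g" by algebra
  have "Y_op n n g = cst \<theta> * X g + X f" unfolding X(2) TT by (simp add: linD[OF X(1)])
  then have Yg: "Y_op n n g = cst (\<theta> * y + \<theta>0) * f + cst (inverse y) * g"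
    unfolding Xg Xf by (simp add: cst_simps algebra_simps)
  then show ?thesis by (simp add: g_def \<theta>_def \<theta>0_def)
qed

text \<open>At the end n the reflection inverts one eigenvalue instead of exchanging two; the
  t_0-term in the condition stems from X in \<open>T_Y_relations\<close>.\<close>

lemma swap_eigen_n:
  assumes n: "1 \<le> n"
    and e: "\<And>j. j \<in> {1..n} \<Longrightarrow> Y_op n j f = cst (y j) * f" and y: "y n \<noteq> 0"
    and \<kappa>: "(tn_half - inverse tn_half) * y n + (t0_half - inverse t0_half) + \<kappa> * y n = \<kappa> * inverse (y n)" and j: "j \<in> {1..n}"
  shows "Y_op n j (T_op n n f + cst \<kappa> * f) = cst (if j = n then inverse (y n) else y j) * (T_op n n f + cst \<kappa> * f)"
proof -
  have nn: "n \<in> {1..n}" using n by simp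
  show ?thesis
  proof (cases "j = n")
    case True
    have "Y_op n n (T_op n n f + cst \<kappa> * f) = cst ((tn_half - inverse tn_half) * y n + (t0_half - inverse t0_half) + \<kappa> * y n) * f + cst (inverse (y n)) * T_op n n f"
      by (simp add: linD[OF lin_Y[OF n nn]] Y_T_n[OF n e[OF nn] y] e[OF nn]) (simp add: cst_simps algebra_simps)
    also note \<kappa>
    finally show ?thesis using True by (simp add: cst_simps algebra_simps)
  next
    case False
    have "Y_op n j (T_op n n f) = T_op n n (Y_op n j f)" using T_Y_relations(2)[OF n nn j] False j by simp
    then show ?thesis using False by (simp add: linD[OF lin_Y[OF n j]] linD[OF lin_T[OF le_refl]] e[OF j]) (simp add: algebra_simps)
  qed
qed

text \<open>Rests on the factorization \<open>v_min_simple\<close>, hence on a positive pairing. At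
  a weight fixed by s_i the spectral vector is not permuted, as the proof of \<open>T_E_zero\<close>
  shows.\<close>

lemma ev_Y_simple:
  assumes i: "1 \<le> i" "i \<le> n" and d: "0 < dval n i \<mu>" and j: "j \<in> {1..n}"
  shows "i < n \<Longrightarrow> ev_Y n (simple_refl n i \<mu>) j = ev_Y n \<mu> (if j = i then Suc i else if j = Suc i then i else j)"
    "i = n \<Longrightarrow> ev_Y n (simple_refl n i \<mu>) j = (if j = n then inverse (ev_Y n \<mu> n) else ev_Y n \<mu> j)"
proof -
  define v where "v = v_min n (simple_refl n i \<mu>)"
  have vW: "v \<in> W_fin n" unfolding v_def by (rule v_min_props)
  have vm: "v_min n \<mu> = v \<circ> simple_refl n i" unfolding v_def by (rule v_min_simple[OF i d])
  have vmW: "v \<circ> simple_refl n i \<in> W_fin n" using v_min_props(1)[of n \<mu>] unfolding vm .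
  show "ev_Y n (simple_refl n i \<mu>) j = ev_Y n \<mu> (if j = i then Suc i else if j = Suc i then i else j)" if "i < n"
  proof -
    define p where "p = (if j = i then Suc i else if j = Suc i then i else j)"
    have p: "p \<in> {1..n}" using i j that by (auto simp: p_def)
    have "signed_image n (v \<circ> simple_refl n i) p = signed_image n v j"
    proof (rule signed_image_eq[OF vmW p signed_image(1)[OF vW j]])
      have "simple_refl n i (eps (int p)) = eps (int j)" using i p that by (auto simp: simple_refl_eps p_def simp del: of_nat_Suc)
      then show "(v \<circ> simple_refl n i) (eps (int p)) = eps (signed_image n v j)" using signed_image(3)[OF vW j] by simp
    qed
    moreover have "Poly_Mapping.lookup (simple_refl n i \<mu>) j = Poly_Mapping.lookup \<mu> p"
      using that by (auto simp: lookup_simple_refl p_def)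
    ultimately show ?thesis unfolding p_def[symmetric] by (simp add: ev_Y_def vm v_def[symmetric])
  qed
  show "ev_Y n (simple_refl n i \<mu>) j = (if j = n then inverse (ev_Y n \<mu> n) else ev_Y n \<mu> j)" if "i = n"
  proof (cases "j = n")
    case True
    have nn: "n \<in> {1..n}" using i by auto
    have "signed_image n (v \<circ> simple_refl n i) n = - signed_image n v n"
    proof (rule signed_image_eq[OF vmW nn])
      have "simple_refl n i (eps (int n)) = - eps (int n)" using i that by (simp add: simple_refl_eps)
      then show "(v \<circ> simple_refl n i) (eps (int n)) = eps (- signed_image n v n)"
        using signed_image(3)[OF vW nn] by (simp add: W_uminus[OF vW] eps_uminus)
      show "- signed_image n v n \<noteq> 0" using signed_image(1)[OF vW nn] by simp
    qed
    moreover define k where "k = signed_image n v n"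
    ultimately have si: "signed_image n (v_min n \<mu>) n = - k" unfolding vm by simp
    define m where "m = Poly_Mapping.lookup \<mu> n"
    define c where "c = t0_half * tn_half * t_par ^ n"
    have "ev_Y n (simple_refl n i \<mu>) n = q_par powi m * t_par powi (- k) * c powi sgn k"
      unfolding ev_Y_def v_def[symmetric] k_def[symmetric] Let_def c_def using that by (simp add: lookup_simple_refl m_def)
    moreover have "ev_Y n \<mu> n = q_par powi (- m) * t_par powi k * c powi (- sgn k)"
    proof -
      have "sgn (- k) = - sgn k" by (simp add: sgn_if)
      then show ?thesis unfolding ev_Y_def si Let_def c_def m_def by (simp only: minus_minus)
    qed
    ultimately have "ev_Y n (simple_refl n i \<mu>) n = inverse (ev_Y n \<mu> n)"
      by (simp only: power_int_minus inverse_mult_distrib inverse_inverse_eq)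
    then show ?thesis using True by simp
  next
    case False
    have "signed_image n (v \<circ> simple_refl n i) j = signed_image n v j"
    proof (rule signed_image_eq[OF vmW j signed_image(1)[OF vW j]])
      have "simple_refl n i (eps (int j)) = eps (int j)" using i j that False by (simp add: simple_refl_eps)
      then show "(v \<circ> simple_refl n i) (eps (int j)) = eps (signed_image n v j)" using signed_image(3)[OF vW j] by simp
    qed
    then have "signed_image n (v_min n \<mu>) j = signed_image n (v_min n (simple_refl n i \<mu>)) j"
      unfolding vm v_def .
    moreover have "Poly_Mapping.lookup (simple_refl n i \<mu>) j = Poly_Mapping.lookup \<mu> j"
      using that False by (simp add: lookup_simple_refl)
    ultimately show ?thesis using False by (simp only: ev_Y_def if_False)
  qed
qed

lemma ev_Y_nz [simp]: "ev_Y n \<mu> j \<noteq> 0"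
  by (simp add: ev_Y_def Let_def power_int_not_zero)

text \<open>The solution \<kappa> of the condition in \<open>swap_eigen_n\<close> or
  \<open>swap_eigen_s\<close> at the spectral vector of \<mu>.\<close>

definition kapT :: "nat \<Rightarrow> nat \<Rightarrow> vec \<Rightarrow> coeff" where
  "kapT n i \<mu> = (if i = n then ((tn_half - inverse tn_half) * ev_Y n \<mu> n + (t0_half - inverse t0_half)) / (inverse (ev_Y n \<mu> n) - ev_Y n \<mu> n)
     else (t_half - inverse t_half) * ev_Y n \<mu> i / (ev_Y n \<mu> (Suc i) - ev_Y n \<mu> i))"

lemma ev_Y_sep:
  assumes "1 \<le> i" "i \<le> n" "dval n i \<mu> \<noteq> 0"
  shows "i < n \<Longrightarrow> ev_Y n \<mu> i \<noteq> ev_Y n \<mu> (Suc i)" "i = n \<Longrightarrow> ev_Y n \<mu> n \<noteq> inverse (ev_Y n \<mu> n)"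
proof -
  show "ev_Y n \<mu> i \<noteq> ev_Y n \<mu> (Suc i)" if "i < n"
  proof
    assume e: "ev_Y n \<mu> i = ev_Y n \<mu> (Suc i)"
    have "gdeg 0 (ev_Y n \<mu> i) (- 2 * Poly_Mapping.lookup \<mu> i)" "gdeg 0 (ev_Y n \<mu> i) (- 2 * Poly_Mapping.lookup \<mu> (Suc i))"
      using gdeg_ev_Y[of i n \<mu>] gdeg_ev_Y[of "Suc i" n \<mu>] assms that unfolding e by auto
    then show False using gdeg_unique assms that by (fastforce simp: dval_def)
  qed
  show "ev_Y n \<mu> n \<noteq> inverse (ev_Y n \<mu> n)" if "i = n"
  proof
    assume e: "ev_Y n \<mu> n = inverse (ev_Y n \<mu> n)"
    have 1: "gdeg 0 (ev_Y n \<mu> n) (- 2 * Poly_Mapping.lookup \<mu> n)" using gdeg_ev_Y[of n n \<mu>] assms that by auto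
    then have "gdeg 0 (ev_Y n \<mu> n) (- (- 2 * Poly_Mapping.lookup \<mu> n))" using gdeg_inverse[OF 1] e by simp
    then show False using gdeg_unique[OF 1] assms that by (fastforce simp: dval_def)
  qed
qed

text \<open>The intertwined vector has the spectral vector of s_i \<mu>, hence is a multiple of that
  E; the multiple is its coefficient at s_i \<mu>.\<close>

lemma T_E_pos:
  assumes n: "1 \<le> n" and i: "1 \<le> i" "i \<le> n" and \<mu>: "\<mu> \<in> lattice n" and d: "0 < dval n i \<mu>"
  shows "T_op n i (E_poly n \<mu>) = cst (inverse (tau n i)) * E_poly n (simple_refl n i \<mu>) - cst (kapT n i \<mu>) * E_poly n \<mu>"
proof -
  define \<kappa> where "\<kappa> = kapT n i \<mu>"
  define F where "F = T_op n i (E_poly n \<mu>) + cst \<kappa> * E_poly n \<mu>"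
  have dn: "dval n i \<mu> \<noteq> 0" using d by simp
  have F: "F \<in> laurent_ring n"
    unfolding F_def using linear_combination_laurent_ring[OF T_op_laurent_ring[OF i E_poly(3)[OF n \<mu>]] E_poly(3)[OF n \<mu>], of 1 \<kappa>] by (simp add: cst_simps)
  have eig: "Y_op n j F = cst (ev_Y n (simple_refl n i \<mu>) j) * F" if j: "j \<in> {1..n}" for j
  proof (cases "i = n")
    case True
    have s: "inverse (ev_Y n \<mu> n) - ev_Y n \<mu> n \<noteq> 0" using ev_Y_sep(2)[OF i dn True] by simp
    have "\<kappa> * (inverse (ev_Y n \<mu> n) - ev_Y n \<mu> n) = (tn_half - inverse tn_half) * ev_Y n \<mu> n + (t0_half - inverse t0_half)"
      unfolding \<kappa>_def kapT_def if_P[OF True] by (rule nonzero_eq_divide_eq[THEN iffD1, OF s refl])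
    then have k: "(tn_half - inverse tn_half) * ev_Y n \<mu> n + (t0_half - inverse t0_half) + \<kappa> * ev_Y n \<mu> n = \<kappa> * inverse (ev_Y n \<mu> n)"
      by (simp add: algebra_simps)
    show ?thesis unfolding F_def True using swap_eigen_n[of n "E_poly n \<mu>" "ev_Y n \<mu>", OF n E_poly(2)[OF n \<mu>] ev_Y_nz k j]
        ev_Y_simple(2)[OF i d j True] True by simp
  next
    case False
    then have in': "i < n" using i by simp
    have s: "ev_Y n \<mu> (Suc i) - ev_Y n \<mu> i \<noteq> 0" using ev_Y_sep(1)[OF i dn in'] by simp
    have t: "tau n i = t_half" using in' i by (simp add: tau_def)
    have "\<kappa> * (ev_Y n \<mu> (Suc i) - ev_Y n \<mu> i) = (t_half - inverse t_half) * ev_Y n \<mu> i"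
      unfolding \<kappa>_def kapT_def if_not_P[OF False] by (rule nonzero_eq_divide_eq[THEN iffD1, OF s refl])
    then have k: "(tau n i - inverse (tau n i) + \<kappa>) * ev_Y n \<mu> i = \<kappa> * ev_Y n \<mu> (Suc i)" unfolding t
      by (simp add: algebra_simps)
    show ?thesis unfolding F_def using swap_eigen_s[of n i "E_poly n \<mu>" "ev_Y n \<mu>", OF n i(1) in' E_poly(2)[OF n \<mu>] k j]
        ev_Y_simple(1)[OF i d j in'] by simp
  qed
  have sl: "simple_refl n i \<mu> \<in> lattice n" by (rule simple_refl_lattice[OF i \<mu>])
  \<comment> \<open>s_i \<mu> is lexicographically smaller than \<mu>, hence higher in
    \<open>key\<close>, and does not occur in the E of \<mu>.\<close>
  have E0: "Poly_Mapping.lookup (E_poly n \<mu>) (simple_refl n i \<mu>) = 0"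
  proof -
    have "dval n i (simple_refl n i \<mu>) < 0" using dval_srefl[OF i, of \<mu>] d i by simp
    then have "id (simple_refl n i \<mu>) < id (simple_refl n i (simple_refl n i \<mu>))"
      using sroot_pos[of n i] by (intro W_simple_refl_shift[OF W_id i]) simp
    then have k: "key n id \<mu> < key n id (simple_refl n i \<mu>)"
      by (intro key_mono) (simp_all add: nrm_simple_refl[OF i])
    from E_poly(1)[OF n \<mu>] obtain L where L: "L \<in> lw n id (key n id \<mu>)" "E_poly n \<mu> = xm \<mu> + L" by blast
    have "simple_refl n i \<mu> \<noteq> \<mu>" using k by auto
    moreover have "Poly_Mapping.lookup L (simple_refl n i \<mu>) = 0" using lw_coeff[OF lw_mono[OF less_imp_le[OF k] L(1)]] .
    ultimately show ?thesis unfolding L(2) by (simp add: lookup_add lookup_single)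
  qed
  have "Poly_Mapping.lookup F (simple_refl n i \<mu>) = inverse (tau n i)"
    using T_E_coeff[OF n i \<mu>] d by (simp add: F_def lookup_add lookup_cst_mult E0)
  then have "F = cst (inverse (tau n i)) * E_poly n (simple_refl n i \<mu>)"
    using E_poly(5)[OF n sl F eig] by simp
  then show ?thesis unfolding F_def \<kappa>_def by (simp add: eq_diff_eq)
qed

lemma gdeg_par: "gdeg 2 t0_half 1" "gdeg 2 tn_half 0"
  using gdeg_generator[of 2 2] gdeg_generator[of 2 4] type6_neq
  unfolding t0_half_def tn_half_def by (auto split: if_splits)

lemma t_half_sep: "t_half - inverse t_half \<noteq> 0"
proof
  assume "t_half - inverse t_half = 0"
  then have e: "t_half = inverse t_half" by simp
  have g: "gdeg 1 t_half 1" using gdeg_generator[of 1 1] by (simp add: t_half_def)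
  have "gdeg 1 t_half (- 1)" using gdeg_inverse[OF g] e by simp
  then show False using gdeg_unique[OF g] by fastforce
qed

text \<open>The intertwined vector has swapped or inverted eigenvalues of the same degrees in q as
  those of \<mu>. A nonzero vector with these degrees must have the spectral vector of \<mu> itself;
  as the swapped one differs from it, the intertwined vector vanishes, and T_i E is a multiple of
  E.\<close>

lemma T_E_zero:
  assumes n: "1 \<le> n" and i: "1 \<le> i" "i \<le> n" and \<mu>: "\<mu> \<in> lattice n" and d: "dval n i \<mu> = 0"
  shows "T_op n i (E_poly n \<mu>) = cst (tau n i) * E_poly n \<mu>"
proof -
  have s: "simple_refl n i \<mu> = \<mu>" using T_mono_zero(1)[OF i d] i by simp
  define G where "G = T_op n i (E_poly n \<mu>)"
  have G1: "Poly_Mapping.lookup G \<mu> = tau n i" using T_E_coeff[OF n i \<mu>] d by (simp add: s G_def)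
  have Gr: "G \<in> laurent_ring n" unfolding G_def by (rule T_op_laurent_ring[OF i E_poly(3)[OF n \<mu>]])
  note E1 = E_poly(4)[OF n \<mu>]
  define y where "y = ev_Y n \<mu>"
  have main: "T_op n i (E_poly n \<mu>) = cst (tau n i) * E_poly n \<mu>"
    if e': "\<And>j. j \<in> {1..n} \<Longrightarrow> Y_op n j (G + cst \<kappa> * E_poly n \<mu>) = cst (y' j) * (G + cst \<kappa> * E_poly n \<mu>)"
      and deg: "\<And>j. j \<in> {1..n} \<Longrightarrow> gdeg 0 (y' j) (- 2 * Poly_Mapping.lookup \<mu> j)" and ne: "k \<in> {1..n}" "y' k \<noteq> y k" for y' \<kappa> k
  proof -
    define F where "F = G + cst \<kappa> * E_poly n \<mu>"
    have Fr: "F \<in> laurent_ring n"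
      unfolding F_def using linear_combination_laurent_ring[OF Gr E_poly(3)[OF n \<mu>], of 1 \<kappa>] by (simp add: cst_simps)
    have "F = 0"
    proof (rule ccontr)
      assume F0: "F \<noteq> 0"
      from eigen_leading[OF n Fr F0 e'[folded F_def]] obtain \<nu> where nu: "\<nu> \<in> lattice n" "\<And>j. j \<in> {1..n} \<Longrightarrow> y' j = ev_Y n \<nu> j" by blast
      have "\<nu> = \<mu>"
      proof (rule poly_mapping_eqI)
        fix j
        show "Poly_Mapping.lookup \<nu> j = Poly_Mapping.lookup \<mu> j"
        proof (cases "j \<in> {1..n}")
          case True
          then show ?thesis using gdeg_unique[OF deg[OF True] gdeg_ev_Y[OF True, of \<nu>, folded nu(2)[OF True]]] by simp
        next
          case False
          then show ?thesis using nu(1) \<mu> by (simp add: lattice_iff)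
        qed
      qed
      then show False using nu(2)[OF ne(1)] ne(2) by (simp add: y_def)
    qed
    then have "G = cst (- \<kappa>) * E_poly n \<mu>" by (simp add: F_def cst_simps eq_neg_iff_add_eq_0)
    moreover from this have "tau n i = - \<kappa>" using G1 E1 by (simp add: lookup_cst_mult)
    ultimately show ?thesis by (simp add: G_def)
  qed
  show ?thesis
  proof (cases "i = n")
    case False
    then have in': "i < n" using i by simp
    have ii: "i \<in> {1..n}" "Suc i \<in> {1..n}" using i in' by auto
    \<comment> \<open>Degrees in q cannot separate these two values. If they agreed, T_i E would be
      a proper generalized eigenvector.\<close>
    have ne: "y i \<noteq> y (Suc i)"
    proof
      assume eq: "y i = y (Suc i)"
      define \<theta> where "\<theta> = tau n i - inverse (tau n i)"
      have "Y_op n i G - cst (ev_Y n \<mu> i) * G = cst (\<theta> * y i) * E_poly n \<mu>"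
        unfolding G_def \<theta>_def using Y_T_s(1)[OF n i(1) in' E_poly(2)[OF n \<mu>]] eq by (simp add: y_def)
      from Y_semisimple[OF n \<mu> ii(1) Gr this] have "\<theta> = 0" by (simp add: y_def)
      then show False using t_half_sep in' i by (simp add: \<theta>_def tau_def)
    qed
    define \<kappa> where "\<kappa> = (tau n i - inverse (tau n i)) * y i / (y (Suc i) - y i)"
    have "\<kappa> * (y (Suc i) - y i) = (tau n i - inverse (tau n i)) * y i" using ne by (simp add: \<kappa>_def)
    then have k: "(tau n i - inverse (tau n i) + \<kappa>) * y i = \<kappa> * y (Suc i)" by (simp add: algebra_simps)
    show ?thesis
    proof (rule main[where y' = "\<lambda>j. y (if j = i then Suc i else if j = Suc i then i else j)" and \<kappa> = \<kappa> and k = i])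
      show "i \<in> {1..n}" by (rule ii)
      show "y (if i = i then Suc i else if i = Suc i then i else i) \<noteq> y i" using ne by simp
      fix j assume j: "j \<in> {1..n}"
      show "Y_op n j (G + cst \<kappa> * E_poly n \<mu>) = cst (y (if j = i then Suc i else if j = Suc i then i else j)) * (G + cst \<kappa> * E_poly n \<mu>)"
        unfolding G_def by (rule swap_eigen_s[OF n i(1) in' _ k j]) (simp add: y_def E_poly(2)[OF n \<mu>])
      show "gdeg 0 (y (if j = i then Suc i else if j = Suc i then i else j)) (- 2 * Poly_Mapping.lookup \<mu> j)"
        using gdeg_ev_Y[of "if j = i then Suc i else if j = Suc i then i else j" n \<mu>] ii j d in' by (auto simp: y_def dval_def split: if_splits)
    qed
  next
    case True
    have nn: "n \<in> {1..n}" using n by simp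
    have y0: "y n \<noteq> 0" by (simp add: y_def)
    have ne: "y n \<noteq> inverse (y n)"
    proof
      assume eq: "y n = inverse (y n)"
      define \<theta> \<theta>0 where "\<theta> = tn_half - inverse tn_half" and "\<theta>0 = t0_half - inverse t0_half"
      have "Y_op n n G - cst (ev_Y n \<mu> n) * G = cst (\<theta> * y n + \<theta>0) * E_poly n \<mu>"
        unfolding G_def \<theta>_def \<theta>0_def True using Y_T_n[OF n E_poly(2)[OF n \<mu> nn]] eq by (simp add: y_def)
      from Y_semisimple[OF n \<mu> nn Gr this] have z: "\<theta> * y n + \<theta>0 = 0" .
      have yy: "y n * y n = 1" using eq y0 by (metis left_inverse)
      have 1: "tn_half * inverse tn_half = 1" "t0_half * inverse t0_half = 1" by simp_all
      \<comment> \<open>Since y n squares to 1, the relation z forces \<open>tn_half\<close> to be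
        \<open>t0_half\<close> or its inverse up to sign; the degree in \<open>t0_half\<close> rules
        this out.\<close>
      have "(tn_half * t0_half + 1) * (tn_half * t0_half - 1) * (tn_half + t0_half) * (tn_half - t0_half) = 0"
        using z yy 1 unfolding \<theta>_def \<theta>0_def by algebra
      then have "(tn_half * t0_half)\<^sup>2 = 1 \<or> tn_half\<^sup>2 = t0_half\<^sup>2" by (auto simp: power2_eq_1_iff power2_eq_iff eq_neg_iff_add_eq_0)
      then show False
      proof
        assume "(tn_half * t0_half)\<^sup>2 = 1"
        moreover have "gdeg 2 ((tn_half * t0_half)\<^sup>2) 2" using gdeg_power[OF gdeg_mult[OF gdeg_par(2,1)], of 2] by simp
        ultimately show False using gdeg_unique[OF gdeg_1, of 2 2] by simp
      next
        assume "tn_half\<^sup>2 = t0_half\<^sup>2"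
        moreover have "gdeg 2 (tn_half\<^sup>2) 0" "gdeg 2 (t0_half\<^sup>2) 2" using gdeg_power[OF gdeg_par(2), of 2] gdeg_power[OF gdeg_par(1), of 2] by simp_all
        ultimately show False using gdeg_unique[of 2 "t0_half\<^sup>2" 0 2] by simp
      qed
    qed
    define \<kappa> where "\<kappa> = ((tn_half - inverse tn_half) * y n + (t0_half - inverse t0_half)) / (inverse (y n) - y n)"
    have "\<kappa> * (inverse (y n) - y n) = (tn_half - inverse tn_half) * y n + (t0_half - inverse t0_half)"
      using ne by (simp only: \<kappa>_def) simp
    then have k: "(tn_half - inverse tn_half) * y n + (t0_half - inverse t0_half) + \<kappa> * y n = \<kappa> * inverse (y n)" by (simp add: algebra_simps)
    show ?thesis
    proof (rule main[where y' = "\<lambda>j. if j = n then inverse (y n) else y j" and \<kappa> = \<kappa> and k = n])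
      show "n \<in> {1..n}" by (rule nn)
      show "(if n = n then inverse (y n) else y n) \<noteq> y n" using ne by simp
      fix j assume j: "j \<in> {1..n}"
      show "Y_op n j (G + cst \<kappa> * E_poly n \<mu>) = cst (if j = n then inverse (y n) else y j) * (G + cst \<kappa> * E_poly n \<mu>)"
        unfolding G_def True by (rule swap_eigen_n[of n "E_poly n \<mu>" y \<kappa> j, OF n _ y0 k j]) (simp add: y_def E_poly(2)[OF n \<mu>])
      show "gdeg 0 (if j = n then inverse (y n) else y j) (- 2 * Poly_Mapping.lookup \<mu> j)"
        using gdeg_ev_Y[OF j, of \<mu>] gdeg_inverse[OF gdeg_ev_Y[OF nn, of \<mu>]] d True by (auto simp: y_def dval_def)
    qed
  qed
qed

definition aT :: "nat \<Rightarrow> nat \<Rightarrow> vec \<Rightarrow> coeff" where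
  "aT n i \<nu> = (if 0 < dval n i \<nu> then - kapT n i \<nu> else if dval n i \<nu> = 0 then tau n i
     else tau n i - inverse (tau n i) + kapT n i (simple_refl n i \<nu>))"

definition bT :: "nat \<Rightarrow> nat \<Rightarrow> vec \<Rightarrow> coeff" where
  "bT n i \<nu> = (if 0 < dval n i \<nu> then inverse (tau n i) else if dval n i \<nu> = 0 then 0
     else tau n i * (1 - kapT n i (simple_refl n i \<nu>) * (tau n i - inverse (tau n i) + kapT n i (simple_refl n i \<nu>))))"

text \<open>For a negative pairing the formula at the reflected weight is solved for the E in
  question, and the quadratic relation gives T_i on it.\<close>

lemma T_E:
  assumes n: "1 \<le> n" and i: "1 \<le> i" "i \<le> n" and \<nu>: "\<nu> \<in> lattice n"
  shows "T_op n i (E_poly n \<nu>) = cst (aT n i \<nu>) * E_poly n \<nu> + cst (bT n i \<nu>) * E_poly n (simple_refl n i \<nu>)"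
proof -
  consider "0 < dval n i \<nu>" | "dval n i \<nu> = 0" | "dval n i \<nu> < 0" by linarith
  then show ?thesis
  proof cases
    case 1
    then show ?thesis using T_E_pos[OF n i \<nu> 1] by (simp add: aT_def bT_def cst_simps)
  next
    case 2
    then show ?thesis using T_E_zero[OF n i \<nu> 2] by (simp add: aT_def bT_def cst_simps)
  next
    case 3
    define \<mu> where "\<mu> = simple_refl n i \<nu>"
    have m: "\<mu> \<in> lattice n" "0 < dval n i \<mu>" "simple_refl n i \<mu> = \<nu>"
      unfolding \<mu>_def using simple_refl_lattice[OF i \<nu>] dval_srefl[OF i, of \<nu>] 3 i by auto
    define \<tau> \<kappa> where "\<tau> = tau n i" and "\<kappa> = kapT n i \<mu>"
    define t t' k where "t = cst \<tau>" and "t' = cst (inverse \<tau>)" and "k = cst \<kappa>"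
    have tt: "t * t' = 1" unfolding t_def t'_def \<tau>_def by (simp add: cst_simps(1) flip: cst_simps(4))
    have p: "T_op n i (E_poly n \<mu>) = t' * E_poly n \<nu> - k * E_poly n \<mu>"
      using T_E_pos[OF n i m(1,2)] unfolding m(3) by (simp add: t'_def k_def \<tau>_def \<kappa>_def)
    then have e: "E_poly n \<nu> = t * (T_op n i (E_poly n \<mu>) + k * E_poly n \<mu>)" using tt by algebra
    have "T_op n i (E_poly n \<nu>) = t * ((t - t') * T_op n i (E_poly n \<mu>) + E_poly n \<mu> + k * T_op n i (E_poly n \<mu>))"
      using T_op_quadratic[OF i(2) n, of "E_poly n \<mu>"]
      by (subst e) (simp add: t_def k_def t'_def \<tau>_def linD[OF lin_T[OF i(2)]] cst_simps)
    also have "\<dots> = (t - t' + k) * E_poly n \<nu> + t * (1 - k * (t - t' + k)) * E_poly n \<mu>"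
      unfolding p using tt by algebra
    finally show ?thesis using 3 unfolding \<mu>_def[symmetric]
      by (simp add: aT_def bT_def \<mu>_def[symmetric] cst_simps t_def t'_def k_def \<tau>_def \<kappa>_def)
  qed
qed

section \<open>Combinations of electronic polynomials along an orbit\<close>

lemma orbit_self: "\<mu> \<in> orbit n \<mu>"
  unfolding orbit_def by (rule image_eqI[OF _ W_id]) simp

lemma orbit_simple:
  assumes "1 \<le> i" "i \<le> n" shows "simple_refl n i \<nu> \<in> orbit n \<mu> \<longleftrightarrow> \<nu> \<in> orbit n \<mu>"
proof -
  have *: "simple_refl n i \<nu> \<in> orbit n \<mu>" if "\<nu> \<in> orbit n \<mu>" for \<nu>
  proof -
    from that obtain w where "w \<in> W_fin n" "\<nu> = w \<mu>" by (auto simp: orbit_def)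
    then show ?thesis unfolding orbit_def using W_comp[OF W_simple[OF assms], of w] by (intro image_eqI[of _ _ "simple_refl n i \<circ> w"]) auto
  qed
  show ?thesis using *[of \<nu>] *[of "simple_refl n i \<nu>"] by auto
qed

lemma finite_orbit [simp]: "finite (orbit n \<mu>)"
  by (simp add: orbit_def)

lemma orbit_lattice: "\<mu> \<in> lattice n \<Longrightarrow> orbit n \<mu> \<subseteq> lattice n"
  by (auto simp: orbit_def W_lattice)

lemma T_orbit_sum:
  assumes n: "1 \<le> n" and i: "1 \<le> i" "i \<le> n" and \<mu>: "\<mu> \<in> lattice n"
  shows "T_op n i (\<Sum>\<nu>\<in>orbit n \<mu>. cst (c \<nu>) * E_poly n \<nu>) =
    (\<Sum>\<nu>\<in>orbit n \<mu>. cst (c \<nu> * aT n i \<nu> + c (simple_refl n i \<nu>) * bT n i (simple_refl n i \<nu>)) * E_poly n \<nu>)"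
proof -
  have "T_op n i (\<Sum>\<nu>\<in>orbit n \<mu>. cst (c \<nu>) * E_poly n \<nu>) =
    (\<Sum>\<nu>\<in>orbit n \<mu>. cst (c \<nu> * aT n i \<nu>) * E_poly n \<nu>) + (\<Sum>\<nu>\<in>orbit n \<mu>. cst (c \<nu> * bT n i \<nu>) * E_poly n (simple_refl n i \<nu>))"
    unfolding lin_sum[OF lin_T[OF i(2)]] linD(2)[OF lin_T[OF i(2)]] sum.distrib[symmetric]
    by (rule sum.cong[OF refl], subst T_E[OF n i]) (use orbit_lattice[OF \<mu>] in \<open>auto simp: cst_simps algebra_simps\<close>)
  also have "(\<Sum>\<nu>\<in>orbit n \<mu>. cst (c \<nu> * bT n i \<nu>) * E_poly n (simple_refl n i \<nu>)) =
     (\<Sum>\<nu>\<in>orbit n \<mu>. cst (c (simple_refl n i \<nu>) * bT n i (simple_refl n i \<nu>)) * E_poly n \<nu>)"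
    by (rule sum.reindex_bij_witness[of _ "simple_refl n i" "simple_refl n i"]) (auto simp: orbit_simple[OF i])
  finally show ?thesis by (simp add: sum.distrib[symmetric] cst_simps distrib_right)
qed

section \<open>Symmetrization\<close>

text \<open>By Matsumoto's theorem the word chosen in \<open>T_w\<close> may be replaced by any
  other reduced word.\<close>

lemma T_w_eq:
  assumes n: "1 \<le> n" and "is_red n is"
  shows "T_w n (word_prod n is) = T_word n is"
proof -
  interpret A: affine_family n "T_op n" by (rule affine_family_T_op[OF n])
  have "word_prod n is \<in> W_fin n" using assms(2) by (intro W_word) (simp add: is_red_def)
  from A.matsumoto[OF reduced_word(1)[OF this] assms(2) reduced_word(2)[OF this]]
  show ?thesis by (simp add: T_w_def T_word_def A.Tw_def)
qed

lemma T_w_simple: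
  assumes n: "1 \<le> n" and w: "w \<in> W_fin n" and i: "1 \<le> i" "i \<le> n" and pos: "0 < inv w (sroot n i)"
  shows "T_w n (simple_refl n i \<circ> w) f = T_op n i (T_w n w f)"
proof -
  note r = reduced_word(1,2)[OF w]
  have "is_red n (i # reduced_word n w)" by (rule red_ConsI[OF r(1) i]) (simp add: r(2) pos)
  from T_w_eq[OF n this] show ?thesis using T_w_eq[OF n r(1)] r(2) by (simp add: T_word_simps)
qed

definition tau_root :: "nat \<Rightarrow> vec \<Rightarrow> coeff" where
  "tau_root n \<beta> = (if nrm n \<beta> = 1 then tn_half else t_half)"

definition chi_root :: "symm_type \<Rightarrow> nat \<Rightarrow> vec \<Rightarrow> coeff" where
  "chi_root X n \<beta> = (if nrm n \<beta> = 1 then chi_d X else chi_s X)"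

lemma Inv_nrm: "Inv_d n w = {\<beta> \<in> Inv n w. nrm n \<beta> = 1}" "Inv_s n w = {\<beta> \<in> Inv n w. nrm n \<beta> \<noteq> 1}"
  by (auto simp: Inv_d_def Inv_s_def Inv_def roots_d_eq roots_s_eq)

lemma prod_Inv_split: "(\<Prod>\<beta>\<in>Inv n w. f \<beta>) = (\<Prod>\<beta>\<in>Inv_s n w. f \<beta>) * (\<Prod>\<beta>\<in>Inv_d n w. f \<beta>)"
  by (subst Inv_sd_disjoint(1)) (intro prod.union_disjoint, auto simp: Inv_nrm)

text \<open>A product over inversions, like the leading coefficients in
  \<open>T_word_dominant\<close>, so that the two can be compared root by root.\<close>

lemma chi_eq:
  assumes w: "w \<in> W_fin n" shows "chi X n w = (\<Prod>\<beta>\<in>Inv n w. chi_root X n \<beta>)"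
proof -
  have l: "set is \<subseteq> {1..n} \<Longrightarrow> prod_list (map (\<lambda>i. if i < n then chi_s X else chi_d X) is) =
    chi_s X ^ length (filter (\<lambda>i. i < n) is) * chi_d X ^ length (filter (\<lambda>i. i = n) is)" for "is"
    by (induction "is") (auto simp: mult_ac)
  have s: "set (reduced_word n w) \<subseteq> {1..n}" using reduced_word(1)[OF w] by (simp add: is_red_def)
  have "(\<Prod>\<beta>\<in>Inv n w. chi_root X n \<beta>) = (\<Prod>\<beta>\<in>Inv_s n w. chi_s X) * (\<Prod>\<beta>\<in>Inv_d n w. chi_d X)"
    unfolding prod_Inv_split by (intro arg_cong2[where f = "(*)"] prod.cong) (auto simp: chi_root_def Inv_nrm)
  then show ?thesis using l[OF s] len_sd[OF w] by (simp add: chi_def len_s_def len_d_def)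
qed

definition chiT :: "symm_type \<Rightarrow> nat \<Rightarrow> nat \<Rightarrow> coeff" where
  "chiT X n i = (if i < n then chi_s X else chi_d X)"

lemma chi_simple:
  assumes w: "w \<in> W_fin n" and i: "1 \<le> i" "i \<le> n" and pos: "0 < inv w (sroot n i)"
  shows "chi X n (simple_refl n i \<circ> w) = chiT X n i * chi X n w"
proof -
  have sw: "simple_refl n i \<circ> w \<in> W_fin n" by (rule W_comp[OF W_simple[OF i] w])
  have "chi_root X n (inv w (sroot n i)) = chiT X n i"
    using i by (auto simp: chi_root_def chiT_def W_nrm[OF W_inv(1)[OF w]] nrm_sroot)
  then show ?thesis unfolding chi_eq[OF w] chi_eq[OF sw] Inv_left_up(1)[OF w i pos]
    using Inv_left_up(2)[OF w i pos] by simp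
qed

lemma chiT_quadratic: "1 \<le> i \<Longrightarrow> i \<le> n \<Longrightarrow> chiT X n i * chiT X n i = (tau n i - inverse (tau n i)) * chiT X n i + 1"
  by (cases X) (auto simp: chiT_def tau_def field_simps)

definition symsum :: "symm_type \<Rightarrow> nat \<Rightarrow> laurent \<Rightarrow> laurent" where
  "symsum X n f = (\<Sum>w\<in>W_fin n. cst (chi X n w) * T_w n w f)"

text \<open>Pairing w with s_i w writes the sum through terms g + c T_i g, and T_i multiplies such a
  term by c because c satisfies the quadratic relation.\<close>

lemma T_symsum:
  assumes n: "1 \<le> n" and i: "1 \<le> i" "i \<le> n"
  shows "T_op n i (symsum X n f) = cst (chiT X n i) * symsum X n f"
proof -
  define U where "U = {w \<in> W_fin n. 0 < inv w (sroot n i)}"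
  define D where "D = {w \<in> W_fin n. inv w (sroot n i) < 0}"
  define c where "c = cst (chiT X n i)"
  define \<theta> where "\<theta> = cst (tau n i - inverse (tau n i))"
  have cc: "c * c = \<theta> * c + 1" unfolding c_def \<theta>_def using chiT_quadratic[OF i, of X] by (metis cst_simps(1,3,4))
  have UD: "W_fin n = U \<union> D" "U \<inter> D = {}"
    unfolding U_def D_def using inv_sroot_cases[OF _ i] by (auto dest: less_asym)
  have fin: "finite U" "finite D" unfolding U_def D_def by simp_all
  have UW: "w \<in> W_fin n" "0 < inv w (sroot n i)" if "w \<in> U" for w using that by (auto simp: U_def)
  define s :: "(vec \<Rightarrow> vec) \<Rightarrow> vec \<Rightarrow> vec" where "s = (\<lambda>w. simple_refl n i \<circ> w)"
  have ss: "s (s w) = w" for w by (simp add: s_def fun_eq_iff)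
  have inv_s: "inv (s w) (sroot n i) = - inv w (sroot n i)" if "w \<in> W_fin n" for w
    unfolding s_def inv_simple_comp[OF that i] by (simp add: simple_refl_sroot[OF i] W_uminus[OF W_inv(1)[OF that]])
  have sW: "s w \<in> W_fin n" if "w \<in> W_fin n" for w unfolding s_def by (rule W_comp[OF W_simple[OF i] that])
  have sum_D: "(\<Sum>w\<in>D. cst (chi X n w) * T_w n w f) = (\<Sum>w\<in>U. cst (chi X n (s w)) * T_w n (s w) f)"
    by (rule sum.reindex_bij_witness[of _ s s]) (auto simp: ss U_def D_def inv_s sW)
  have S: "symsum X n f = (\<Sum>w\<in>U. cst (chi X n w) * T_w n w f + cst (chi X n (s w)) * T_w n (s w) f)"
    unfolding symsum_def UD(1) sum.union_disjoint[OF fin UD(2)] sum_D sum.distrib ..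
  also have "\<dots> = (\<Sum>w\<in>U. cst (chi X n w) * (T_w n w f + c * T_op n i (T_w n w f)))"
    by (rule sum.cong[OF refl])
       (simp add: s_def chi_simple[OF UW(1) i UW(2)] T_w_simple[OF n UW(1) i UW(2)] cst_simps c_def algebra_simps del: comp_apply)
  finally have S: "symsum X n f = (\<Sum>w\<in>U. cst (chi X n w) * (T_w n w f + c * T_op n i (T_w n w f)))" .
  have "T_op n i (g + c * T_op n i g) = c * (g + c * T_op n i g)" for g
  proof -
    have "T_op n i (g + c * T_op n i g) = T_op n i g + c * (\<theta> * T_op n i g + g)"
      unfolding c_def \<theta>_def by (simp add: linD[OF lin_T[OF i(2)]] T_op_quadratic[OF i(2) n])
    then show ?thesis using cc by algebra
  qed
  then show ?thesis
    unfolding S lin_sum[OF lin_T[OF i(2)]] linD(2)[OF lin_T[OF i(2)]] sum_distrib_left c_def[symmetric]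
    by (simp add: mult.left_commute)
qed

lemma T_w_orbit_sum:
  assumes n: "1 \<le> n" and \<mu>: "\<mu> \<in> lattice n" and "is": "set is \<subseteq> {1..n}"
  shows "\<exists>c. T_word n is (E_poly n \<mu>) = (\<Sum>\<nu>\<in>orbit n \<mu>. cst (c \<nu>) * E_poly n \<nu>)"
  using "is"
proof (induction "is")
  case Nil
  have "(\<Sum>\<nu>\<in>orbit n \<mu>. cst (if \<nu> = \<mu> then 1 else 0) * E_poly n \<nu>) = E_poly n \<mu>"
    using orbit_self[of \<mu> n] by (subst sum.remove[of _ \<mu>]) (auto simp: cst_simps intro!: sum.neutral)
  then show ?case by (intro exI[of _ "\<lambda>\<nu>. if \<nu> = \<mu> then 1 else 0"]) (simp add: T_word_simps)
next
  case (Cons i "is")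
  then obtain c where c: "T_word n is (E_poly n \<mu>) = (\<Sum>\<nu>\<in>orbit n \<mu>. cst (c \<nu>) * E_poly n \<nu>)" by auto
  have i: "1 \<le> i" "i \<le> n" using Cons by auto
  show ?case unfolding T_word_simps o_apply c T_orbit_sum[OF n i \<mu>] by (rule exI, rule refl)
qed

lemma symsum_orbit_sum:
  assumes n: "1 \<le> n" and \<mu>: "\<mu> \<in> lattice n"
  shows "\<exists>c. symsum X n (E_poly n \<mu>) = (\<Sum>\<nu>\<in>orbit n \<mu>. cst (c \<nu>) * E_poly n \<nu>)"
proof -
  have "\<exists>c. T_w n w (E_poly n \<mu>) = (\<Sum>\<nu>\<in>orbit n \<mu>. cst (c \<nu>) * E_poly n \<nu>)" if "w \<in> W_fin n" for w
    unfolding T_w_def using reduced_word(1)[OF that] by (intro T_w_orbit_sum[OF n \<mu>]) (simp add: is_red_def)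
  then have "\<forall>w\<in>W_fin n. \<exists>c. T_w n w (E_poly n \<mu>) = (\<Sum>\<nu>\<in>orbit n \<mu>. cst (c \<nu>) * E_poly n \<nu>)" by blast
  from bchoice[OF this] obtain c where c: "\<forall>w\<in>W_fin n. T_w n w (E_poly n \<mu>) = (\<Sum>\<nu>\<in>orbit n \<mu>. cst (c w \<nu>) * E_poly n \<nu>)" by (elim exE) (rule that)
  have "symsum X n (E_poly n \<mu>) = (\<Sum>w\<in>W_fin n. \<Sum>\<nu>\<in>orbit n \<mu>. cst (chi X n w * c w \<nu>) * E_poly n \<nu>)"
    unfolding symsum_def by (rule sum.cong[OF refl]) (simp add: c sum_distrib_left cst_simps mult.assoc)
  also have "\<dots> = (\<Sum>\<nu>\<in>orbit n \<mu>. cst (\<Sum>w\<in>W_fin n. chi X n w * c w \<nu>) * E_poly n \<nu>)"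
  proof -
    have cs: "cst (\<Sum>w\<in>A. g w) = (\<Sum>w\<in>A. cst (g w))" for A :: "(vec \<Rightarrow> vec) set" and g
      by (induction A rule: infinite_finite_induct) (simp_all add: cst_simps)
    show ?thesis by (subst sum.swap) (simp add: cs sum_distrib_right)
  qed
  finally show ?thesis by (rule exI[of _ "\<lambda>\<nu>. \<Sum>w\<in>W_fin n. chi X n w * c w \<nu>"])
qed

section \<open>The leading coefficient\<close>

text \<open>Peeling letters off a reduced word, the pairing with the simple root is nonpositive both
  before and after the reflection. It is therefore zero, and no letter moves the weight.\<close>

lemma antidominant_unique:
  assumes a: "antidominant n \<alpha>" and u: "u \<in> W_fin n" and ua: "antidominant n (u \<alpha>)"
  shows "u \<alpha> = \<alpha>"
proof -
  have "is_red n is \<Longrightarrow> antidominant n (word_prod n is \<alpha>) \<Longrightarrow> word_prod n is \<alpha> = \<alpha>" for "is"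
  proof (induction "is")
    case (Cons i "is")
    note r = red_Cons[OF Cons(2)]
    define w where "w = word_prod n is"
    have wW: "w \<in> W_fin n" unfolding w_def by (rule r(5))
    have g: "inv w (sroot n i) \<in> posr n" using W_posr[OF W_inv(1)[OF wW] sroot_posr[OF r(3,4)]] r(2) by (auto simp: w_def dest: less_asym)
    have "dval n i (w \<alpha>) = pair n \<alpha> (inv w (sroot n i))"
      using W_pair[OF wW, of \<alpha> "inv w (sroot n i)"] by (simp add: W_inv[OF wW] pair_sroot[OF r(3,4)])
    then have 1: "dval n i (w \<alpha>) \<le> 0" using antidominant_pair[OF a g] by simp
    have "dval n i (simple_refl n i (w \<alpha>)) \<le> 0"
      using antidominant_pair[OF Cons(3) sroot_posr[OF r(3,4)]] by (simp add: w_def pair_sroot[OF r(3,4)])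
    then have d: "dval n i (w \<alpha>) = 0" using 1 dval_srefl[OF r(3,4), of "w \<alpha>"] r(3) by simp
    have s: "simple_refl n i (w \<alpha>) = w \<alpha>" using T_mono_zero(1)[OF r(3,4) d] r(3) by simp
    then show ?case using Cons r(1) by (simp add: w_def)
  qed simp
  from this[OF reduced_word(1)[OF u]] show ?thesis using ua by (simp add: reduced_word(2)[OF u])
qed

lemma antidominant_orbit:
  assumes "\<nu> \<in> orbit n \<mu>" "antidominant n \<nu>"
  shows "\<nu> = v_min n \<mu> \<mu>"
proof -
  obtain w where w: "w \<in> W_fin n" "\<nu> = w \<mu>" using assms(1) by (auto simp: orbit_def)
  note v = v_min_props[of n \<mu>]
  have "(w \<circ> inv (v_min n \<mu>)) (v_min n \<mu> \<mu>) = \<nu>" using w W_inv(2)[OF v(1)] by simp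
  then show ?thesis using antidominant_unique[OF v(3) W_comp[OF w(1) W_inv(1)[OF v(1)]]] assms(2) by simp
qed

lemma v_min_in_orbit: "v_min n \<mu> \<mu> \<in> orbit n \<mu>"
  unfolding orbit_def using v_min_props(1) by auto

lemma simple_refl_less:
  assumes "1 \<le> i" "i \<le> n" "0 < dval n i \<nu>" shows "simple_refl n i \<nu> < \<nu>"
proof -
  have "dval n i (simple_refl n i \<nu>) < 0" using dval_srefl[OF assms(1,2), of \<nu>] assms by simp
  then have "id (simple_refl n i \<nu>) < id (simple_refl n i (simple_refl n i \<nu>))"
    using sroot_pos[of n i] by (intro W_simple_refl_shift[OF W_id assms(1,2)]) simp
  then show ?thesis by simp
qed

text \<open>A reflection at a positive pairing lowers the weight lexicographically, and only the
  antidominant weight admits none.\<close>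

lemma antidominant_least: "\<nu> \<in> orbit n \<mu> \<Longrightarrow> v_min n \<mu> \<mu> \<le> \<nu>"
proof (induction "card (pneg n \<nu>)" arbitrary: \<nu> rule: less_induct)
  case less
  show ?case
  proof (cases "\<exists>i\<in>{1..n}. 0 < dval n i \<nu>")
    case True
    then obtain i where i: "1 \<le> i" "i \<le> n" "0 < dval n i \<nu>" by auto
    have "v_min n \<mu> \<mu> \<le> simple_refl n i \<nu>" using less card_pneg_simple[OF i] orbit_simple[OF i(1,2)] by blast
    then show ?thesis using simple_refl_less[OF i] by simp
  next
    case False
    then have "antidominant n \<nu>" by (intro antidominantI) (simp add: not_less)
    then show ?thesis using antidominant_orbit less by simp
  qed
qed

text \<open>Being lexicographically least, the antidominant weight is the highest of its orbit in
  \<open>key\<close>, so its monomial occurs in no other E of the orbit.\<close>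

lemma coeff_at_antidominant:
  assumes n: "1 \<le> n" and \<mu>: "\<mu> \<in> lattice n"
  shows "Poly_Mapping.lookup (\<Sum>\<nu>\<in>orbit n \<mu>. cst (c \<nu>) * E_poly n \<nu>) (v_min n \<mu> \<mu>) = c (v_min n \<mu> \<mu>)"
proof -
  define a where "a = v_min n \<mu> \<mu>"
  have a: "a \<in> orbit n \<mu>" "a \<in> lattice n" unfolding a_def using v_min_in_orbit orbit_lattice[OF \<mu>] by auto
  have z: "Poly_Mapping.lookup (E_poly n \<nu>) a = 0" if nu: "\<nu> \<in> orbit n \<mu>" "\<nu> \<noteq> a" for \<nu>
  proof -
    have nl: "\<nu> \<in> lattice n" using nu orbit_lattice[OF \<mu>] by auto
    have "nrm n \<nu> = nrm n a" using nu(1) a(1) by (auto simp: orbit_def W_nrm)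
    moreover have "a < \<nu>" using antidominant_least[OF nu(1)] nu(2) by (simp add: a_def)
    ultimately have k: "key n id \<nu> \<le> key n id a"
      by (simp add: key_def less_eq_prod_def)
    from E_poly(1)[OF n nl] obtain L where L: "L \<in> lw n id (key n id \<nu>)" "E_poly n \<nu> = xm \<nu> + L" by blast
    show ?thesis unfolding L(2) using lw_coeff[OF lw_mono[OF k L(1)]] nu by (simp add: lookup_add lookup_single)
  qed
  have "Poly_Mapping.lookup (\<Sum>\<nu>\<in>orbit n \<mu>. cst (c \<nu>) * E_poly n \<nu>) a = (\<Sum>\<nu>\<in>orbit n \<mu>. c \<nu> * Poly_Mapping.lookup (E_poly n \<nu>) a)"
    by (simp add: lookup_sum lookup_cst_mult)
  also have "\<dots> = (\<Sum>\<nu>\<in>{a}. c \<nu> * Poly_Mapping.lookup (E_poly n \<nu>) a)"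
    by (rule sum.mono_neutral_right[OF finite_orbit]) (use a(1) in \<open>simp_all add: z\<close>)
  finally show ?thesis using E_poly(4)[OF n a(2)] by (simp add: a_def)
qed

text \<open>A space that is stable under the \<open>T\<^sub>i\<close> and invisible to the coefficients on the orbit.\<close>

definition off_orbit :: "nat \<Rightarrow> vec \<Rightarrow> laurent set" where
  "off_orbit n \<mu> = {f. \<forall>\<nu>\<in>Poly_Mapping.keys f. \<nu> \<in> lattice n \<and> nrm n \<nu> \<le> nrm n \<mu> \<and> \<nu> \<notin> orbit n \<mu>}"

lemma off_add: "f \<in> off_orbit n \<mu> \<Longrightarrow> g \<in> off_orbit n \<mu> \<Longrightarrow> f + g \<in> off_orbit n \<mu>"
  using keys_add[of f g] by (auto simp: off_orbit_def)

lemma off_cst: "f \<in> off_orbit n \<mu> \<Longrightarrow> cst c * f \<in> off_orbit n \<mu>"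
  using keys_cst_mult[of c f] by (auto simp: off_orbit_def)

lemma off_sum: "(\<And>i. i \<in> A \<Longrightarrow> f i \<in> off_orbit n \<mu>) \<Longrightarrow> (\<Sum>i\<in>A. f i) \<in> off_orbit n \<mu>"
proof (induction A rule: infinite_finite_induct)
  case (insert x A)
  then show ?case by (simp add: off_add)
qed (simp_all add: off_orbit_def)

lemma low_off: "nrm n \<nu> \<le> nrm n \<mu> \<Longrightarrow> f \<in> low n \<nu> \<Longrightarrow> f \<in> off_orbit n \<mu>"
  by (fastforce simp: off_orbit_def low_def orbit_def W_nrm)

lemma T_xm_span:
  assumes i: "1 \<le> i" "i \<le> n" and nu: "\<nu> \<in> lattice n"
  shows "\<exists>a b L. L \<in> low n \<nu> \<and> T_op n i (xm \<nu>) = cst a * xm \<nu> + cst b * xm (simple_refl n i \<nu>) + L"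
proof -
  have sr: "srefl n i = simple_refl n i" using i by simp
  consider "0 < dval n i \<nu>" | "dval n i \<nu> = 0" | "dval n i \<nu> < 0" by linarith
  then show ?thesis
  proof cases
    case 1
    from T_mono_pos[OF i nu 1, unfolded sr] obtain L where "L \<in> low n \<nu>" "T_op n i (xm \<nu>) = cst (inverse (tau n i)) * xm (simple_refl n i \<nu>) + L" by blast
    then show ?thesis by (intro exI[of _ 0] exI[of _ "inverse (tau n i)"] exI[of _ L]) (simp add: cst_simps)
  next
    case 2
    show ?thesis using T_mono_zero(2)[OF i 2] by (intro exI[of _ "tau n i"] exI[of _ 0] exI[of _ 0]) (simp add: cst_simps low_0)
  next
    case 3
    from T_mono_neg[OF i nu 3, unfolded sr] show ?thesis by blast
  qed
qed

lemma T_off: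
  assumes i: "1 \<le> i" "i \<le> n" and f: "f \<in> off_orbit n \<mu>"
  shows "T_op n i f \<in> off_orbit n \<mu>"
proof -
  have "T_op n i (xm \<nu>) \<in> off_orbit n \<mu>" if "\<nu> \<in> Poly_Mapping.keys f" for \<nu>
  proof -
    have nu: "\<nu> \<in> lattice n" "nrm n \<nu> \<le> nrm n \<mu>" "\<nu> \<notin> orbit n \<mu>" using f that by (auto simp: off_orbit_def)
    from T_xm_span[OF i nu(1)] obtain a b L where L: "L \<in> low n \<nu>" "T_op n i (xm \<nu>) = cst a * xm \<nu> + cst b * xm (simple_refl n i \<nu>) + L" by blast
    have "xm \<nu> \<in> off_orbit n \<mu>" "xm (simple_refl n i \<nu>) \<in> off_orbit n \<mu>"
      using nu simple_refl_lattice[OF i nu(1)] by (auto simp: off_orbit_def nrm_simple_refl[OF i] orbit_simple[OF i])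
    then show ?thesis unfolding L(2) by (intro off_add off_cst low_off[OF nu(2) L(1)])
  qed
  then show ?thesis unfolding lin_expand[OF lin_T[OF i(2)], of f] by (intro off_sum off_cst)
qed

section \<open>Leading terms starting from a dominant weight\<close>

lemma dominant_pair:
  assumes d: "dominant n \<mu>" and "\<beta> \<in> posr n"
  shows "0 \<le> pair n \<mu> \<beta>"
  using assms(2)
proof (cases rule: posr_cases)
  case (1 i)
  then show ?thesis using d by (simp add: pair_single dominant_def)
next
  case (2 i j)
  then have "0 \<le> Poly_Mapping.lookup \<mu> i" "0 \<le> Poly_Mapping.lookup \<mu> j" using d by (auto simp: dominant_def)
  then show ?thesis using 2 by (simp add: pair_add pair_single)
next
  case (3 i j)
  then have "Poly_Mapping.lookup \<mu> j \<le> Poly_Mapping.lookup \<mu> i" using d by (auto simp: dominant_def)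
  then show ?thesis using 3 by (simp add: pair_minus pair_single)
qed

text \<open>The factor that T_i contributes when its letter adds the inversion \<beta>. A root
  orthogonal to \<mu> gives tau, because T_i then acts on a fixed monomial.\<close>

definition lead_factor :: "nat \<Rightarrow> vec \<Rightarrow> vec \<Rightarrow> coeff" where
  "lead_factor n \<mu> \<beta> = (if 0 < pair n \<mu> \<beta> then inverse (tau_root n \<beta>) else tau_root n \<beta>)"

lemma red_dval:
  assumes d: "dominant n \<mu>" and r: "is_red n (i # is)"
  shows "0 \<le> dval n i (word_prod n is \<mu>)" "dval n i (word_prod n is \<mu>) = pair n \<mu> (inv (word_prod n is) (sroot n i))"
proof -
  note r = red_Cons[OF r]
  define w where "w = word_prod n is"
  have wW: "w \<in> W_fin n" unfolding w_def by (rule r(5))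
  have g: "inv w (sroot n i) \<in> posr n" using W_posr[OF W_inv(1)[OF wW] sroot_posr[OF r(3,4)]] r(2) by (auto simp: w_def dest: less_asym)
  show e: "dval n i (word_prod n is \<mu>) = pair n \<mu> (inv (word_prod n is) (sroot n i))"
    using W_pair[OF wW, of \<mu> "inv w (sroot n i)"] by (simp add: W_inv[OF wW] pair_sroot[OF r(3,4)] flip: w_def)
  show "0 \<le> dval n i (word_prod n is \<mu>)" unfolding e using dominant_pair[OF d g] by (simp add: w_def)
qed

text \<open>In \<open>key\<close> the dominant weight is thus the lowest of its orbit, so its E
  contains no other monomial of the orbit.\<close>

lemma dominant_greatest:
  assumes d: "dominant n \<mu>" and "\<nu> \<in> orbit n \<mu>"
  shows "\<nu> \<le> \<mu>"
proof -
  have "is_red n is \<Longrightarrow> word_prod n is \<mu> \<le> \<mu>" for "is"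
  proof (induction "is")
    case (Cons i "is")
    note r = red_Cons[OF Cons(2)]
    have "simple_refl n i (word_prod n is \<mu>) \<le> word_prod n is \<mu>"
    proof (cases "dval n i (word_prod n is \<mu>) = 0")
      case True
      then show ?thesis using T_mono_zero(1)[OF r(3,4) True] r(3) by simp
    next
      case False
      then show ?thesis using simple_refl_less[OF r(3,4)] red_dval(1)[OF d Cons(2)] by (simp add: less_imp_le)
    qed
    then show ?case using Cons r(1) by auto
  qed simp
  moreover obtain w where w: "w \<in> W_fin n" "\<nu> = w \<mu>" using assms(2) by (auto simp: orbit_def)
  ultimately show ?thesis using reduced_word[OF w(1)] by metis
qed

text \<open>From a dominant weight a reduced word meets only nonnegative pairings, so each T_i moves
  the leading monomial and leaves no further term of the orbit behind.\<close>

lemma T_word_dominant: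
  assumes n: "1 \<le> n" and \<mu>: "\<mu> \<in> lattice n" and d: "dominant n \<mu>" and "is_red n is"
  shows "\<exists>L\<in>off_orbit n \<mu>. T_word n is (E_poly n \<mu>) = cst (\<Prod>\<beta>\<in>Inv n (word_prod n is). lead_factor n \<mu> \<beta>) * xm (word_prod n is \<mu>) + L"
  using assms(4)
proof (induction "is")
  case Nil
  from E_poly(1)[OF n \<mu>] obtain L where L: "L \<in> lw n id (key n id \<mu>)" "E_poly n \<mu> = xm \<mu> + L" by blast
  have "L \<in> off_orbit n \<mu>" unfolding off_orbit_def
  proof safe
    fix \<nu> assume k: "\<nu> \<in> Poly_Mapping.keys L"
    then have l: "\<nu> \<in> lattice n" "key n id \<nu> < key n id \<mu>" using L(1) by (auto simp: lw_def)
    show "\<nu> \<in> lattice n" "nrm n \<nu> \<le> nrm n \<mu>" using l by (auto simp: key_def less_prod_def)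
    assume o: "\<nu> \<in> orbit n \<mu>"
    then have "nrm n \<nu> = nrm n \<mu>" by (auto simp: orbit_def W_nrm)
    then show False using l(2) dominant_greatest[OF d o] by (simp add: key_def less_prod_def)
  qed
  moreover have "Inv n id = {}" by (auto simp: Inv_eq[OF W_id] posr_def)
  ultimately show ?case using L(2) by (intro bexI[of _ L]) (simp add: T_word_simps cst_simps flip: id_def, assumption)
next
  case (Cons i "is")
  note r = red_Cons[OF Cons(2)]
  define w where "w = word_prod n is"
  have wW: "w \<in> W_fin n" unfolding w_def by (rule r(5))
  define K where "K = (\<Prod>\<beta>\<in>Inv n w. lead_factor n \<mu> \<beta>)"
  define \<gamma> where "\<gamma> = inv w (sroot n i)"
  from Cons.IH[OF r(1)] obtain L where L: "L \<in> off_orbit n \<mu>" "T_word n is (E_poly n \<mu>) = cst K * xm (w \<mu>) + L" unfolding K_def w_def by blast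
  have wl: "w \<mu> \<in> lattice n" by (rule W_lattice[OF wW \<mu>])
  have nw: "nrm n (w \<mu>) \<le> nrm n \<mu>" by (simp add: W_nrm[OF wW])
  have tau_root: "tau_root n \<gamma> = tau n i" unfolding \<gamma>_def using r(3,4) by (simp add: tau_root_def tau_def W_nrm[OF W_inv(1)[OF wW]] nrm_sroot)
  have p: "dval n i (w \<mu>) = pair n \<mu> \<gamma>" using red_dval(2)[OF d Cons(2)] by (simp add: w_def \<gamma>_def)
  have sr: "srefl n i = simple_refl n i" using r(3) by simp
  have "\<exists>L'\<in>off_orbit n \<mu>. T_op n i (xm (w \<mu>)) = cst (lead_factor n \<mu> \<gamma>) * xm (simple_refl n i (w \<mu>)) + L'"
  proof (cases "0 < dval n i (w \<mu>)")
    case True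
    from T_mono_pos[OF r(3,4) wl True, unfolded sr] show ?thesis using True low_off[OF nw] by (auto simp: lead_factor_def p[symmetric] tau_root)
  next
    case False
    then have z: "dval n i (w \<mu>) = 0" using red_dval(1)[OF d Cons(2)] by (simp add: w_def)
    show ?thesis using T_mono_zero[OF r(3,4) z, unfolded sr] z
      by (intro bexI[of _ 0]) (simp_all add: lead_factor_def p[symmetric] tau_root off_orbit_def)
  qed
  then obtain L' where L': "L' \<in> off_orbit n \<mu>" "T_op n i (xm (w \<mu>)) = cst (lead_factor n \<mu> \<gamma>) * xm (simple_refl n i (w \<mu>)) + L'" by blast
  have I: "(\<Prod>\<beta>\<in>Inv n (simple_refl n i \<circ> w). lead_factor n \<mu> \<beta>) = lead_factor n \<mu> \<gamma> * K"
    unfolding Inv_left_up(1)[OF wW r(3,4) r(2)[folded w_def]] \<gamma>_def K_def using Inv_left_up(2)[OF wW r(3,4) r(2)[folded w_def]] by simp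
  have "T_word n (i # is) (E_poly n \<mu>) = cst (lead_factor n \<mu> \<gamma> * K) * xm (simple_refl n i (w \<mu>)) + (cst K * L' + T_op n i L)"
    unfolding T_word_simps o_apply L(2) linD[OF lin_T[OF r(4)]] L'(2) by (simp add: cst_simps algebra_simps)
  moreover have "cst K * L' + T_op n i L \<in> off_orbit n \<mu>" by (intro off_add off_cst L'(1) T_off[OF r(3,4) L(1)])
  ultimately show ?case unfolding word_prod_simps w_def[symmetric] I by (intro bexI[of _ "cst K * L' + T_op n i L"]) simp_all
qed

lemma off_coeff: "L \<in> off_orbit n \<mu> \<Longrightarrow> \<nu> \<in> orbit n \<mu> \<Longrightarrow> Poly_Mapping.lookup L \<nu> = 0"
  by (auto simp: off_orbit_def in_keys_iff)

lemma tau_root_nz [simp]: "tau_root n \<beta> \<noteq> 0" and chi_root_nz [simp]: "chi_root X n \<beta> \<noteq> 0"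
  by (cases X; simp add: tau_root_def chi_root_def)+

text \<open>Only the coset of v = \<open>v_min n \<mu>\<close> by the stabilizer reaches the
  antidominant monomial. For u in the stabilizer the inversions of v u are those of v together with
  those of u: the first give a constant and the second, by \<open>C\<close>, the Poincare
  polynomial.\<close>

lemma symsum_leading:
  assumes n: "1 \<le> n" and \<mu>: "\<mu> \<in> lattice n" and d: "dominant n \<mu>"
    and C: "\<And>\<beta>. \<beta> \<in> posr n \<Longrightarrow> pair n \<mu> \<beta> = 0 \<Longrightarrow> chi_root X n \<beta> = tau_root n \<beta>"
  shows "chi Plus n (longest n) / chi X n (longest n) * Poly_Mapping.lookup (symsum X n (E_poly n \<mu>)) (v_min n \<mu> \<mu>) = poincare n \<mu>"
proof -
  define v where "v = v_min n \<mu>"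
  have v: "v \<in> W_fin n" "Inv n v = pneg n \<mu>" unfolding v_def by (rule v_min_props)+
  have vi: "v \<circ> (inv v \<circ> a) = a" "inv v \<circ> (v \<circ> a) = a" for a :: "vec \<Rightarrow> vec" by (simp_all add: fun_eq_iff W_inv[OF v(1)])
  define St where "St = stabilizer n \<mu>"
  have fin: "finite St" unfolding St_def stabilizer_def by simp
  have co: "Poly_Mapping.lookup (T_w n w (E_poly n \<mu>)) (v \<mu>) = (if w \<mu> = v \<mu> then (\<Prod>\<beta>\<in>Inv n w. lead_factor n \<mu> \<beta>) else 0)" if w: "w \<in> W_fin n" for w
  proof -
    note r = reduced_word(1,2)[OF w]
    from T_word_dominant[OF n \<mu> d r(1)] obtain L where L: "L \<in> off_orbit n \<mu>" "T_w n w (E_poly n \<mu>) = cst (\<Prod>\<beta>\<in>Inv n w. lead_factor n \<mu> \<beta>) * xm (w \<mu>) + L"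
      unfolding T_w_def r(2) by blast
    have "Poly_Mapping.lookup L (v \<mu>) = 0" by (rule off_coeff[OF L(1)]) (use v in \<open>auto simp: orbit_def\<close>)
    then show ?thesis unfolding L(2) by (simp add: lookup_add lookup_cst_mult lookup_single)
  qed
  have "Poly_Mapping.lookup (symsum X n (E_poly n \<mu>)) (v \<mu>) = (\<Sum>w\<in>W_fin n. chi X n w * (if w \<mu> = v \<mu> then (\<Prod>\<beta>\<in>Inv n w. lead_factor n \<mu> \<beta>) else 0))"
    by (simp add: symsum_def lookup_sum lookup_cst_mult co)
  also have "\<dots> = (\<Sum>w\<in>{w \<in> W_fin n. w \<mu> = v \<mu>}. chi X n w * (\<Prod>\<beta>\<in>Inv n w. lead_factor n \<mu> \<beta>))"
    by (rule sum.mono_neutral_cong_right) auto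
  also have "\<dots> = (\<Sum>u\<in>St. chi X n (v \<circ> u) * (\<Prod>\<beta>\<in>Inv n (v \<circ> u). lead_factor n \<mu> \<beta>))"
    by (rule sum.reindex_bij_witness[of _ "\<lambda>u. v \<circ> u" "\<lambda>w. inv v \<circ> w"])
       (simp_all only: vi, auto simp: St_def stabilizer_def W_inv[OF v(1)] intro: W_comp[OF v(1)] W_comp[OF W_inv(1)[OF v(1)]])
  also have "\<dots> = (\<Sum>u\<in>St. (\<Prod>\<beta>\<in>pneg n \<mu>. chi_root X n \<beta> / tau_root n \<beta>) * (\<Prod>\<beta>\<in>Inv n u. (tau_root n \<beta>)\<^sup>2))"
  proof (rule sum.cong[OF refl])
    fix u assume "u \<in> St"
    then have u: "u \<in> W_fin n" "u \<mu> = \<mu>" by (auto simp: St_def stabilizer_def)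
    have vu: "v \<circ> u \<in> W_fin n" by (rule W_comp[OF v(1) u(1)])
    have pu: "pair n \<mu> (u \<beta>) = pair n \<mu> \<beta>" for \<beta> using W_pair[OF u(1), of \<mu> \<beta>] u(2) by simp
    have zero: "pair n \<mu> \<beta> = 0" if b: "\<beta> \<in> Inv n u" for \<beta>
    proof -
      have b: "\<beta> \<in> posr n" "u \<beta> < 0" using b by (auto simp: Inv_eq[OF u(1)])
      then have "- u \<beta> \<in> posr n" using W_posr[OF u(1) b(1)] by (auto dest: less_asym)
      then have "0 \<le> pair n \<mu> (- u \<beta>)" by (rule dominant_pair[OF d])
      then show ?thesis using dominant_pair[OF d b(1)] by (simp add: pair_uminus pu)
    qed
    \<comment> \<open>Positive roots orthogonal to \<mu> stay positive under v. Hence every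
      inversion of u survives in v u, and for the other roots the pairing with \<mu>
      decides.\<close>
    have I: "Inv n (v \<circ> u) = pneg n \<mu> \<union> Inv n u"
    proof (intro set_eqI)
      fix \<beta>
      show "\<beta> \<in> Inv n (v \<circ> u) \<longleftrightarrow> \<beta> \<in> pneg n \<mu> \<union> Inv n u"
      proof (cases "\<beta> \<in> posr n")
        case True
        note b = True
        have iff: "v \<gamma> < 0 \<longleftrightarrow> 0 < pair n \<mu> \<gamma>" if "\<gamma> \<in> posr n" for \<gamma>
          unfolding v_def by (rule v_min_neg_iff(1)[OF that])
        consider "u \<beta> \<in> posr n" "0 < u \<beta>" | "- u \<beta> \<in> posr n" "u \<beta> < 0" using W_posr[OF u(1) b] by blast
        then show ?thesis
        proof cases
          case 1
          then show ?thesis using b iff[OF 1(1)] by (auto simp: Inv_eq[OF vu] Inv_eq[OF u(1)] pneg_def pu dest: less_asym)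
        next
          case 2
          then have bi: "\<beta> \<in> Inv n u" using b by (simp add: Inv_eq[OF u(1)])
          have "\<not> v (- u \<beta>) < 0" using iff[OF 2(1)] zero[OF bi] by (simp add: pair_uminus pu)
          then have "v (u \<beta>) < 0" using W_nonzero[OF v(1) 2(1)] by (simp add: W_uminus[OF v(1)])
          then show ?thesis using b bi by (simp add: Inv_eq[OF vu])
        qed
      qed (auto simp: Inv_eq[OF vu] Inv_eq[OF u(1)] pneg_def)
    qed
    have dis: "pneg n \<mu> \<inter> Inv n u = {}" using zero by (fastforce simp: pneg_def)
    have split: "(\<Prod>\<beta>\<in>Inv n (v \<circ> u). f \<beta>) = (\<Prod>\<beta>\<in>pneg n \<mu>. f \<beta>) * (\<Prod>\<beta>\<in>Inv n u. f \<beta> :: coeff)" for f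
      unfolding I by (rule prod.union_disjoint) (auto simp: dis)
    have "chi X n (v \<circ> u) * (\<Prod>\<beta>\<in>Inv n (v \<circ> u). lead_factor n \<mu> \<beta>) = (\<Prod>\<beta>\<in>Inv n (v \<circ> u). chi_root X n \<beta> * lead_factor n \<mu> \<beta>)"
      unfolding chi_eq[OF vu] prod.distrib ..
    also have "\<dots> = (\<Prod>\<beta>\<in>pneg n \<mu>. chi_root X n \<beta> / tau_root n \<beta>) * (\<Prod>\<beta>\<in>Inv n u. (tau_root n \<beta>)\<^sup>2)"
      unfolding split
    proof (intro arg_cong2[where f = "(*)"] prod.cong refl)
      fix \<beta> assume "\<beta> \<in> Inv n u"
      then show "chi_root X n \<beta> * lead_factor n \<mu> \<beta> = (tau_root n \<beta>)\<^sup>2" using zero[of \<beta>] C[of \<beta>] by (simp add: lead_factor_def Inv_eq[OF u(1)] power2_eq_square)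
    qed (simp add: lead_factor_def pneg_def divide_inverse)
    finally show "chi X n (v \<circ> u) * (\<Prod>\<beta>\<in>Inv n (v \<circ> u). lead_factor n \<mu> \<beta>) = (\<Prod>\<beta>\<in>pneg n \<mu>. chi_root X n \<beta> / tau_root n \<beta>) * (\<Prod>\<beta>\<in>Inv n u. (tau_root n \<beta>)\<^sup>2)" .
  qed
  also have "\<dots> = (\<Prod>\<beta>\<in>pneg n \<mu>. chi_root X n \<beta> / tau_root n \<beta>) * poincare n \<mu>"
  proof -
    have "(\<Prod>\<beta>\<in>Inv n u. (tau_root n \<beta>)\<^sup>2) = t_par ^ len_s n u * tn_par ^ len_d n u" if "u \<in> St" for u
    proof -
      have u: "u \<in> W_fin n" using that by (auto simp: St_def stabilizer_def)
      have "(\<Prod>\<beta>\<in>Inv n u. (tau_root n \<beta>)\<^sup>2) = (\<Prod>\<beta>\<in>Inv_s n u. t_par) * (\<Prod>\<beta>\<in>Inv_d n u. tn_par)"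
        unfolding prod_Inv_split by (intro arg_cong2[where f = "(*)"] prod.cong) (auto simp: tau_root_def Inv_nrm)
      then show ?thesis by (simp add: len_sd[OF u])
    qed
    then show ?thesis by (simp add: poincare_def St_def sum_distrib_left)
  qed
  finally have lead: "Poly_Mapping.lookup (symsum X n (E_poly n \<mu>)) (v \<mu>) = (\<Prod>\<beta>\<in>pneg n \<mu>. chi_root X n \<beta> / tau_root n \<beta>) * poincare n \<mu>" .
  \<comment> \<open>By \<open>C\<close> the characters differ only on \<open>pneg n \<mu>\<close>,
    so their quotient at the longest element cancels the constant found above.\<close>
  have "chi Plus n (longest n) / chi X n (longest n) = (\<Prod>\<beta>\<in>posr n. tau_root n \<beta> / chi_root X n \<beta>)"
    unfolding chi_eq[OF longest_props(1)] longest_props(2) prod_dividef[symmetric] by (intro prod.cong) (auto simp: chi_root_def tau_root_def)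
  also have "\<dots> = (\<Prod>\<beta>\<in>pneg n \<mu>. tau_root n \<beta> / chi_root X n \<beta>)"
  proof (rule prod.mono_neutral_right)
    show "\<forall>\<beta>\<in>posr n - pneg n \<mu>. tau_root n \<beta> / chi_root X n \<beta> = 1"
    proof
      fix \<beta> assume b: "\<beta> \<in> posr n - pneg n \<mu>"
      then have "pair n \<mu> \<beta> = 0" using dominant_pair[OF d, of \<beta>] by (auto simp: pneg_def)
      then show "tau_root n \<beta> / chi_root X n \<beta> = 1" using C b by simp
    qed
  qed (auto simp: pneg_def)
  finally have "chi Plus n (longest n) / chi X n (longest n) * (\<Prod>\<beta>\<in>pneg n \<mu>. chi_root X n \<beta> / tau_root n \<beta>) = 1"
    by (simp add: prod.distrib[symmetric])
  then show ?thesis unfolding v_def[symmetric] lead by (simp flip: mult.assoc)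
qed

section \<open>Evaluation of rational functions\<close>

definition evm :: "nat \<Rightarrow> vec \<Rightarrow> vec \<Rightarrow> coeff" where
  "evm n \<mu> \<beta> = (\<Prod>j\<in>{1..n}. ev_Y n \<mu> j powi Poly_Mapping.lookup \<beta> j)"

lemma evm_nz [simp]: "evm n \<mu> \<beta> \<noteq> 0"
  by (simp add: evm_def power_int_not_zero)

lemma evm_add: "evm n \<mu> (\<beta> + \<gamma>) = evm n \<mu> \<beta> * evm n \<mu> \<gamma>"
  by (simp add: evm_def lookup_add power_int_add prod.distrib)

lemma evm_0: "evm n \<mu> 0 = 1"
  by (simp add: evm_def)

lemma evm_uminus: "evm n \<mu> (- \<beta>) = inverse (evm n \<mu> \<beta>)"
  by (simp add: evm_def power_int_minus prod_inversef[symmetric] o_def)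

lemma evm_single: "j \<in> {1..n} \<Longrightarrow> evm n \<mu> (Poly_Mapping.single j 1) = ev_Y n \<mu> j"
  unfolding evm_def by (subst prod.remove[of _ j]) (auto simp: lookup_single when_def intro!: prod.neutral)

lemma evm_sroot: "1 \<le> i \<Longrightarrow> i \<le> n \<Longrightarrow> evm n \<mu> (sroot n i) = (if i = n then ev_Y n \<mu> n else ev_Y n \<mu> i / ev_Y n \<mu> (Suc i))"
  using evm_add[of n \<mu> "Poly_Mapping.single i 1" "- Poly_Mapping.single (Suc i) 1"]
  by (simp add: sroot_def evm_single evm_uminus divide_inverse)

lemma gdeg_evm: "gdeg 0 (evm n \<mu> \<beta>) (- 2 * pair n \<mu> \<beta>)"
proof -
  have "gdeg 0 (\<Prod>j\<in>A. ev_Y n \<mu> j powi Poly_Mapping.lookup \<beta> j) (\<Sum>j\<in>A. Poly_Mapping.lookup \<beta> j * (- 2 * Poly_Mapping.lookup \<mu> j))"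
    if "A \<subseteq> {1..n}" for A
    using finite_subset[OF that finite_atLeastAtMost] that
  proof (induction A rule: finite_induct)
    case (insert x A)
    then show ?case using gdeg_mult[OF gdeg_powi[OF gdeg_ev_Y[of x n \<mu>], of "Poly_Mapping.lookup \<beta> x"]] by simp
  qed (simp add: gdeg_1)
  from this[OF order_refl] show ?thesis by (simp add: evm_def pair_def sum_distrib_left algebra_simps sum_negf)
qed

text \<open>A nonzero pairing means a nonzero degree in q, so the denominators of the kappa
  functions do not vanish under evaluation.\<close>

lemma evm_sep:
  assumes "pair n \<mu> \<beta> \<noteq> 0"
  shows "evm n \<mu> \<beta> \<noteq> 1" "(evm n \<mu> \<beta>)\<^sup>2 \<noteq> 1"
proof -
  show "(evm n \<mu> \<beta>)\<^sup>2 \<noteq> 1"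
    using gdeg_power[OF gdeg_evm[of n \<mu> \<beta>], of 2] gdeg_unique[OF gdeg_1] assms by force
  then show "evm n \<mu> \<beta> \<noteq> 1" by auto
qed

lemma evm_simple:
  assumes i: "1 \<le> i" "i \<le> n" and d: "0 < dval n i \<mu>"
  shows "evm n (simple_refl n i \<mu>) \<beta> = evm n \<mu> (simple_refl n i \<beta>)"
proof (cases "i < n")
  case True
  define p where "p j = (if j = i then Suc i else if j = Suc i then i else j)" for j
  have pp: "p (p j) = j" for j by (simp add: p_def)
  have p: "p j \<in> {1..n}" if "j \<in> {1..n}" for j using that i True by (auto simp: p_def)
  have "evm n (simple_refl n i \<mu>) \<beta> = (\<Prod>j\<in>{1..n}. ev_Y n \<mu> (p j) powi Poly_Mapping.lookup \<beta> j)"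
    unfolding evm_def p_def by (rule prod.cong[OF refl]) (simp only: ev_Y_simple(1)[OF i d _ True])
  also have "\<dots> = (\<Prod>j\<in>{1..n}. ev_Y n \<mu> j powi Poly_Mapping.lookup \<beta> (p j))"
    by (rule prod.reindex_bij_witness[of _ p p]) (use p in \<open>simp_all only: pp\<close>)
  also have "\<dots> = evm n \<mu> (simple_refl n i \<beta>)"
    unfolding evm_def lookup_simple_refl p_def using True by simp
  finally show ?thesis .
next
  case False
  then have i': "i = n" using i by simp
  show ?thesis unfolding evm_def
    by (rule prod.cong[OF refl])
       (simp only: ev_Y_simple(2)[OF i d _ i'], simp add: i' lookup_simple_refl power_int_minus power_int_inverse)
qed

lemma ev_laurent_superset:
  assumes "finite A" "Poly_Mapping.keys p \<subseteq> A"
  shows "ev_laurent n \<mu> p = (\<Sum>\<nu>\<in>A. Poly_Mapping.lookup p \<nu> * evm n \<mu> \<nu>)"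
  unfolding ev_laurent_def evm_def
  by (rule sum.mono_neutral_left) (use assms in \<open>auto simp: in_keys_iff\<close>)

lemma ev_laurent_single: "ev_laurent n \<mu> (Poly_Mapping.single \<nu> c) = c * evm n \<mu> \<nu>"
  by (subst ev_laurent_superset[of "{\<nu>}"]) auto

lemma ev_laurent_0: "ev_laurent n \<mu> 0 = 0"
  by (simp add: ev_laurent_def)

lemma ev_laurent_1: "ev_laurent n \<mu> 1 = 1"
  using ev_laurent_single[of n \<mu> 0 1] by (simp add: evm_0)

lemma ev_laurent_add: "ev_laurent n \<mu> (f + g) = ev_laurent n \<mu> f + ev_laurent n \<mu> g"
proof -
  define A where "A = Poly_Mapping.keys f \<union> Poly_Mapping.keys g"
  have "finite A" "Poly_Mapping.keys (f + g) \<subseteq> A" "Poly_Mapping.keys f \<subseteq> A" "Poly_Mapping.keys g \<subseteq> A"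
    using keys_add[of f g] by (auto simp: A_def)
  then show ?thesis by (simp add: ev_laurent_superset[of A] lookup_add sum.distrib distrib_right)
qed

lemma ev_laurent_mult: "ev_laurent n \<mu> (f * g) = ev_laurent n \<mu> f * ev_laurent n \<mu> g"
proof (induction f rule: laurent_induct)
  case (single \<nu> c)
  show ?case
    by (induction g rule: laurent_induct)
       (simp_all add: mult_single ev_laurent_single evm_add distrib_left ev_laurent_add)
qed (simp add: distrib_right ev_laurent_add)

lemma ev_laurent_uminus: "ev_laurent n \<mu> (- f) = - ev_laurent n \<mu> f"
  using ev_laurent_add[of n \<mu> f "- f"] by (simp add: ev_laurent_0 eq_neg_iff_add_eq_0 add.commute)

text \<open>A relational form of \<open>ev\<close>, whose closure under the field operations can be
  proved before the description is known to have a value.\<close>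

definition evaluates :: "nat \<Rightarrow> vec \<Rightarrow> laurent fract \<Rightarrow> coeff \<Rightarrow> bool" where
  "evaluates n \<mu> r c \<longleftrightarrow> (\<exists>a b. r = Fract a b \<and> ev_laurent n \<mu> b \<noteq> 0 \<and> c = ev_laurent n \<mu> a / ev_laurent n \<mu> b)"

lemma ev_eqI:
  assumes "evaluates n \<mu> r c" shows "ev n \<mu> r = c"
  unfolding ev_def
proof (rule the_equality)
  show "\<exists>a b. r = Fract a b \<and> ev_laurent n \<mu> b \<noteq> 0 \<and> c = ev_laurent n \<mu> a / ev_laurent n \<mu> b"
    using assms by (simp add: evaluates_def)
  fix c' assume "\<exists>a b. r = Fract a b \<and> ev_laurent n \<mu> b \<noteq> 0 \<and> c' = ev_laurent n \<mu> a / ev_laurent n \<mu> b"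
  then obtain a' b' where 1: "r = Fract a' b'" "ev_laurent n \<mu> b' \<noteq> 0" "c' = ev_laurent n \<mu> a' / ev_laurent n \<mu> b'" by blast
  obtain a b where 2: "r = Fract a b" "ev_laurent n \<mu> b \<noteq> 0" "c = ev_laurent n \<mu> a / ev_laurent n \<mu> b"
    using assms by (auto simp: evaluates_def)
  have "b \<noteq> 0" "b' \<noteq> 0" using 1 2 by (auto simp: ev_laurent_0)
  then have "a * b' = a' * b" using 1(1) 2(1) by (simp add: eq_fract)
  then have "ev_laurent n \<mu> a * ev_laurent n \<mu> b' = ev_laurent n \<mu> a' * ev_laurent n \<mu> b" by (metis ev_laurent_mult)
  then show "c' = c" using 1 2 by (simp add: frac_eq_eq)
qed

lemma evaluatesE:
  assumes "evaluates n \<mu> r c"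
  obtains a b where "r = Fract a b" "b \<noteq> 0" "ev_laurent n \<mu> b \<noteq> 0" "c = ev_laurent n \<mu> a / ev_laurent n \<mu> b"
  using assms unfolding evaluates_def by (metis ev_laurent_0)

lemma evaluates_add: "evaluates n \<mu> r c \<Longrightarrow> evaluates n \<mu> s d \<Longrightarrow> evaluates n \<mu> (r + s) (c + d)"
proof (elim evaluatesE)
  fix a b a' b'
  assume "r = Fract a b" "b \<noteq> 0" "ev_laurent n \<mu> b \<noteq> 0" "c = ev_laurent n \<mu> a / ev_laurent n \<mu> b"
    "s = Fract a' b'" "b' \<noteq> 0" "ev_laurent n \<mu> b' \<noteq> 0" "d = ev_laurent n \<mu> a' / ev_laurent n \<mu> b'"
  then show "evaluates n \<mu> (r + s) (c + d)" unfolding evaluates_def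
    by (intro exI[of _ "a * b' + a' * b"] exI[of _ "b * b'"]) (simp add: ev_laurent_add ev_laurent_mult add_frac_eq)
qed

lemma evaluates_mult: "evaluates n \<mu> r c \<Longrightarrow> evaluates n \<mu> s d \<Longrightarrow> evaluates n \<mu> (r * s) (c * d)"
  by (elim evaluatesE) (auto simp: evaluates_def ev_laurent_mult intro!: exI[of _ "_ * _"])

lemma evaluates_uminus: "evaluates n \<mu> r c \<Longrightarrow> evaluates n \<mu> (- r) (- c)"
  by (elim evaluatesE) (auto simp: evaluates_def ev_laurent_uminus intro!: exI[of _ "- _"])

lemma evaluates_diff: "evaluates n \<mu> r c \<Longrightarrow> evaluates n \<mu> s d \<Longrightarrow> evaluates n \<mu> (r - s) (c - d)"
  using evaluates_add[OF _ evaluates_uminus] by fastforce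

lemma evaluates_inverse: "evaluates n \<mu> r c \<Longrightarrow> c \<noteq> 0 \<Longrightarrow> evaluates n \<mu> (inverse r) (inverse c)"
  by (elim evaluatesE) (auto simp: evaluates_def)

lemma evaluates_divide: "evaluates n \<mu> r c \<Longrightarrow> evaluates n \<mu> s d \<Longrightarrow> d \<noteq> 0 \<Longrightarrow> evaluates n \<mu> (r / s) (c / d)"
  unfolding divide_inverse by (intro evaluates_mult evaluates_inverse)

lemma evaluates_1: "evaluates n \<mu> 1 1"
proof -
  have "1 = Fract 1 (1 :: laurent)" by (rule One_fract_def)
  then show ?thesis unfolding evaluates_def by (intro exI[of _ 1]) (simp add: ev_laurent_1)
qed

lemma evaluates_cst_Y: "evaluates n \<mu> (cst_Y c) c"
  unfolding evaluates_def cst_Y_def cst_def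
  by (intro exI[of _ "Poly_Mapping.single 0 c"] exI[of _ 1]) (simp add: ev_laurent_1 ev_laurent_single evm_0)

lemma evaluates_Y_mon: "evaluates n \<mu> (Y_mon \<beta>) (evm n \<mu> \<beta>)"
  unfolding evaluates_def Y_mon_def
  by (intro exI[of _ "Poly_Mapping.single \<beta> 1"] exI[of _ 1]) (simp add: ev_laurent_1 ev_laurent_single)

lemma evaluates_prod: "(\<And>i. i \<in> A \<Longrightarrow> evaluates n \<mu> (f i) (c i)) \<Longrightarrow> evaluates n \<mu> (\<Prod>i\<in>A. f i) (\<Prod>i\<in>A. c i)"
  by (induction A rule: infinite_finite_induct) (simp_all add: evaluates_1 evaluates_mult)

section \<open>The kappa functions at a spectral vector\<close>

definition kap_s :: "coeff \<Rightarrow> coeff" where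
  "kap_s y = (1 - t_par * y) / (1 - y)"

definition kap_d :: "coeff \<Rightarrow> coeff" where
  "kap_d y = (1 - tn_half * t0_half * y) * (1 + tn_half * inverse t0_half * y) / (1 - y\<^sup>2)"

lemma evaluates_kap_s: "evaluates n \<mu> r y \<Longrightarrow> y \<noteq> 1 \<Longrightarrow> evaluates n \<mu> (kappa_root_s r) (kap_s y)"
  unfolding kappa_root_s_def kap_s_def
  by (intro evaluates_divide evaluates_diff evaluates_mult evaluates_1 evaluates_cst_Y) auto

lemma evaluates_kap_d: "evaluates n \<mu> r y \<Longrightarrow> y\<^sup>2 \<noteq> 1 \<Longrightarrow> evaluates n \<mu> (kappa_root_d r) (kap_d y)"
  unfolding kappa_root_d_def kap_d_def power2_eq_square
  by (intro evaluates_divide evaluates_diff evaluates_add evaluates_mult evaluates_1 evaluates_cst_Y) auto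

definition flip_s :: "symm_type \<Rightarrow> bool" where "flip_s X \<longleftrightarrow> X = MinusPlus \<or> X = Minus"
definition flip_d :: "symm_type \<Rightarrow> bool" where "flip_d X \<longleftrightarrow> X = PlusMinus \<or> X = Minus"

text \<open>The sign of the expansion formula is distributed over the roots: each root whose kappa
  function is taken at the inverse carries one factor -1.\<close>

definition kap :: "symm_type \<Rightarrow> nat \<Rightarrow> vec \<Rightarrow> coeff \<Rightarrow> coeff" where
  "kap X n \<beta> y = (if nrm n \<beta> = 1 then (if flip_d X then - kap_d (inverse y) else kap_d y)
     else (if flip_s X then - kap_s (inverse y) else kap_s y))"

definition sign_X :: "symm_type \<Rightarrow> nat \<Rightarrow> (vec \<Rightarrow> vec) \<Rightarrow> coeff" where
  "sign_X X n w = (if flip_s X then (-1) ^ len_s n w else 1) * (if flip_d X then (-1) ^ len_d n w else 1)"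

text \<open>The evaluation exists because every inversion of \<open>v_min n \<mu>\<close> pairs
  positively with \<mu>.\<close>

lemma ev_kappa: "sign_X X n (v_min n \<mu>) * ev n \<mu> (kappa X n (v_min n \<mu>)) = (\<Prod>\<beta>\<in>pneg n \<mu>. kap X n \<beta> (evm n \<mu> \<beta>))"
proof -
  define v where "v = v_min n \<mu>"
  have v: "v \<in> W_fin n" "Inv n v = pneg n \<mu>" unfolding v_def by (rule v_min_props)+
  define ks where "ks \<beta> = (if flip_s X then kap_s (inverse (evm n \<mu> \<beta>)) else kap_s (evm n \<mu> \<beta>))" for \<beta>
  define kd where "kd \<beta> = (if flip_d X then kap_d (inverse (evm n \<mu> \<beta>)) else kap_d (evm n \<mu> \<beta>))" for \<beta>
  have nz: "pair n \<mu> \<beta> \<noteq> 0" if "\<beta> \<in> Inv_s n v \<or> \<beta> \<in> Inv_d n v" for \<beta>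
    using that unfolding Inv_nrm v(2) by (auto simp: pneg_def)
  have n1: "evm n \<mu> \<beta> \<noteq> 1" "inverse (evm n \<mu> \<beta>) \<noteq> 1" if "\<beta> \<in> Inv_s n v" for \<beta>
    using evm_sep(1)[of n \<mu> \<beta>] nz[of \<beta>] that by (auto simp: inverse_eq_1_iff)
  have n2: "(evm n \<mu> \<beta>)\<^sup>2 \<noteq> 1" "(inverse (evm n \<mu> \<beta>))\<^sup>2 \<noteq> 1" if "\<beta> \<in> Inv_d n v" for \<beta>
    using evm_sep(2)[of n \<mu> \<beta>] nz[of \<beta>] that by (auto simp: power_inverse inverse_eq_1_iff)
  have yi: "evaluates n \<mu> (inverse (Y_mon \<beta>)) (inverse (evm n \<mu> \<beta>))" for \<beta>
    by (rule evaluates_inverse[OF evaluates_Y_mon]) simp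
  have "evaluates n \<mu> (kappa X n v) ((\<Prod>\<beta>\<in>Inv_s n v. ks \<beta>) * (\<Prod>\<beta>\<in>Inv_d n v. kd \<beta>))"
    by (cases X; simp only: kappa.simps ks_def kd_def flip_s_def flip_d_def symm_type.distinct simp_thms if_True if_False;
        intro evaluates_mult evaluates_prod evaluates_kap_s evaluates_kap_d yi evaluates_Y_mon n1 n2)
  then have "ev n \<mu> (kappa X n v) = (\<Prod>\<beta>\<in>Inv_s n v. ks \<beta>) * (\<Prod>\<beta>\<in>Inv_d n v. kd \<beta>)" by (rule ev_eqI)
  moreover have "(\<Prod>\<beta>\<in>Inv_s n v. kap X n \<beta> (evm n \<mu> \<beta>)) = (if flip_s X then (-1) ^ len_s n v else 1) * (\<Prod>\<beta>\<in>Inv_s n v. ks \<beta>)"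
  proof -
    have "(\<Prod>\<beta>\<in>Inv_s n v. kap X n \<beta> (evm n \<mu> \<beta>)) = (\<Prod>\<beta>\<in>Inv_s n v. (if flip_s X then - 1 else 1) * ks \<beta>)"
      by (rule prod.cong) (auto simp: kap_def ks_def Inv_nrm)
    then show ?thesis by (simp add: prod.distrib len_sd(1)[OF v(1)])
  qed
  moreover have "(\<Prod>\<beta>\<in>Inv_d n v. kap X n \<beta> (evm n \<mu> \<beta>)) = (if flip_d X then (-1) ^ len_d n v else 1) * (\<Prod>\<beta>\<in>Inv_d n v. kd \<beta>)"
  proof -
    have "(\<Prod>\<beta>\<in>Inv_d n v. kap X n \<beta> (evm n \<mu> \<beta>)) = (\<Prod>\<beta>\<in>Inv_d n v. (if flip_d X then - 1 else 1) * kd \<beta>)"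
      by (rule prod.cong) (auto simp: kap_def kd_def Inv_nrm)
    then show ?thesis by (simp add: prod.distrib len_sd(2)[OF v(1)])
  qed
  ultimately show ?thesis unfolding v_def[symmetric] v(2)[symmetric] prod_Inv_split sign_X_def by (simp add: mult_ac)
qed

section \<open>The recursion along the orbit\<close>

lemma pneg_simple:
  assumes i: "1 \<le> i" "i \<le> n" and \<mu>: "0 < dval n i \<mu>"
  shows "pneg n \<mu> = insert (sroot n i) (simple_refl n i ` pneg n (simple_refl n i \<mu>))"
    "sroot n i \<notin> simple_refl n i ` pneg n (simple_refl n i \<mu>)"
proof -
  note S = W_simple[OF i]
  have pos: "simple_refl n i \<beta> \<in> posr n" if "\<beta> \<in> posr n" "\<beta> \<noteq> sroot n i" for \<beta>
    using that simple_refl_pos[OF i that] by (simp add: posr_def nrm_simple_refl[OF i] simple_refl_lattice[OF i])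
  have pr: "pair n \<mu> (simple_refl n i \<beta>) = pair n (simple_refl n i \<mu>) \<beta>" for \<beta>
    using W_pair[OF S, of "simple_refl n i \<mu>" \<beta>] by simp
  have a: "sroot n i \<notin> pneg n (simple_refl n i \<mu>)"
    using \<mu> dval_srefl[OF i, of \<mu>] i by (auto simp: pneg_def pair_sroot)
  show "pneg n \<mu> = insert (sroot n i) (simple_refl n i ` pneg n (simple_refl n i \<mu>))"
  proof (intro set_eqI iffI)
    fix \<beta> assume b: "\<beta> \<in> pneg n \<mu>"
    show "\<beta> \<in> insert (sroot n i) (simple_refl n i ` pneg n (simple_refl n i \<mu>))"
    proof (cases "\<beta> = sroot n i")
      case False
      then have "simple_refl n i \<beta> \<in> pneg n (simple_refl n i \<mu>)"
        using b pos[of \<beta>] W_pair[OF S, of \<mu> \<beta>] by (simp add: pneg_def)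
      then show ?thesis by (metis image_eqI insertI2 simple_refl_simple_refl)
    qed simp
  next
    fix \<beta> assume "\<beta> \<in> insert (sroot n i) (simple_refl n i ` pneg n (simple_refl n i \<mu>))"
    then consider "\<beta> = sroot n i" | \<gamma> where "\<beta> = simple_refl n i \<gamma>" "\<gamma> \<in> pneg n (simple_refl n i \<mu>)" by blast
    then show "\<beta> \<in> pneg n \<mu>"
    proof cases
      case 1
      then show ?thesis using \<mu> sroot_posr[OF i] by (simp add: pneg_def pair_sroot[OF i])
    next
      case 2
      then have "\<gamma> \<noteq> sroot n i" using a by blast
      then show ?thesis using 2 pos[of \<gamma>] by (simp add: pneg_def pr)
    qed
  qed
  show "sroot n i \<notin> simple_refl n i ` pneg n (simple_refl n i \<mu>)"
  proof
    assume "sroot n i \<in> simple_refl n i ` pneg n (simple_refl n i \<mu>)"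
    then obtain \<gamma> where g: "sroot n i = simple_refl n i \<gamma>" "\<gamma> \<in> posr n" by (auto simp: pneg_def)
    then have "\<gamma> = - sroot n i" using simple_refl_sroot[OF i] by (metis simple_refl_simple_refl)
    then show False using g(2) sroot_pos[of n i] by (auto simp: posr_def dest: less_asym)
  qed
qed

text \<open>The left side is the ratio of the coefficients at \<mu> and at s_i \<mu>. For the
  character value tau it is kappa(y), for -1/tau it is -kappa(1/y).\<close>

lemma kap_recursion:
  assumes i: "1 \<le> i" "i \<le> n" and d: "0 < dval n i \<mu>"
  shows "tau n i * (chiT X n i - tau n i + inverse (tau n i) - kapT n i \<mu>) = kap X n (sroot n i) (evm n \<mu> (sroot n i))"
proof (cases "i = n")
  case False
  then have i': "i < n" using i by simp
  define y where "y = evm n \<mu> (sroot n i)"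
  have y: "y = ev_Y n \<mu> i / ev_Y n \<mu> (Suc i)" using evm_sroot[OF i] False by (simp add: y_def)
  have y0: "y \<noteq> 0" by (simp add: y_def)
  have y1: "y \<noteq> 1" unfolding y_def by (rule evm_sep) (use d in \<open>simp add: pair_sroot[OF i]\<close>)
  have i0: "i \<noteq> 0" using i by simp
  have n1: "ev_Y n \<mu> (Suc i) - ev_Y n \<mu> i \<noteq> 0" "1 - y \<noteq> 0" "y - 1 \<noteq> 0" using y1 by (auto simp: y)
  have "ev_Y n \<mu> i = y * ev_Y n \<mu> (Suc i)" by (simp add: y)
  then have k: "kapT n i \<mu> = (t_half - inverse t_half) * y / (1 - y)"
    using False n1 y0 unfolding kapT_def by (simp add: divide_simps) (simp add: algebra_simps)
  have f: "1 - inverse y = (y - 1) / y" using y0 by (simp add: field_simps)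
  show ?thesis unfolding y_def[symmetric] k
    using i' i0 n1 y0 y1 by (cases X) (simp_all add: kap_def nrm_sroot[OF i] flip_s_def kap_s_def tau_def chiT_def f divide_simps, simp_all add: power2_eq_square algebra_simps)
next
  case True
  define y where "y = evm n \<mu> (sroot n i)"
  have y: "y = ev_Y n \<mu> n" using evm_sroot[OF i] True by (simp add: y_def)
  have y0: "y \<noteq> 0" by (simp add: y_def)
  have y1: "y\<^sup>2 \<noteq> 1" unfolding y_def by (rule evm_sep) (use d in \<open>simp add: pair_sroot[OF i]\<close>)
  have n1: "1 - y * y \<noteq> 0" "y * y - 1 \<noteq> 0" using y1 by (auto simp: power2_eq_square)
  have f: "inverse y - y = (1 - y * y) / y" "1 - inverse y * inverse y = (y * y - 1) / (y * y)" using y0 by (simp_all add: field_simps)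
  have nr: "nrm n (sroot n n) = 1" using nrm_sroot[OF i] True by simp
  define a where "a = t0_half"
  define \<tau> where "\<tau> = tn_half"
  have nz: "a \<noteq> 0" "\<tau> \<noteq> 0" by (simp_all add: a_def \<tau>_def)
  have k: "kapT n i \<mu> = ((\<tau> - inverse \<tau>) * y + (a - inverse a)) / (inverse y - y)"
    using True unfolding kapT_def by (simp add: y a_def \<tau>_def)
  show ?thesis unfolding y_def[symmetric] k f
    using True i n1 y0 nz nr by (cases X) (simp_all add: kap_def flip_d_def kap_d_def tau_def chiT_def power2_eq_square f divide_simps
      flip: a_def \<tau>_def, simp_all add: algebra_simps)
qed

text \<open>Each reflection towards the antidominant weight splits off the factor of one simple
  root. At the antidominant weight \<open>pneg\<close> is empty, and \<open>c1\<close> starts the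
  recursion.\<close>

lemma orbit_coefficients:
  assumes n: "1 \<le> n" and \<mu>0: "\<mu>0 \<in> lattice n"
    and T: "\<And>i. 1 \<le> i \<Longrightarrow> i \<le> n \<Longrightarrow> T_op n i (\<Sum>\<nu>\<in>orbit n \<mu>0. cst (c \<nu>) * E_poly n \<nu>) = cst (chiT X n i) * (\<Sum>\<nu>\<in>orbit n \<mu>0. cst (c \<nu>) * E_poly n \<nu>)"
    and c1: "c (v_min n \<mu>0 \<mu>0) = 1"
  shows "\<mu> \<in> orbit n \<mu>0 \<Longrightarrow> c \<mu> = (\<Prod>\<beta>\<in>pneg n \<mu>. kap X n \<beta> (evm n \<mu> \<beta>))"
proof (induction "card (pneg n \<mu>)" arbitrary: \<mu> rule: less_induct)
  case less
  show ?case
  proof (cases "\<exists>i\<in>{1..n}. 0 < dval n i \<mu>")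
    case True
    then obtain i where i: "1 \<le> i" "i \<le> n" "0 < dval n i \<mu>" by auto
    define \<nu> where "\<nu> = simple_refl n i \<mu>"
    have \<nu>: "\<nu> \<in> orbit n \<mu>0" "simple_refl n i \<nu> = \<mu>" "dval n i \<nu> < 0"
      using less(2) orbit_simple[OF i(1,2)] dval_srefl[OF i(1,2), of \<mu>] i by (auto simp: \<nu>_def)
    \<comment> \<open>Coefficients are compared at \<nu> and not at \<mu>, since there c \<mu>
      enters with the plain factor 1/tau.\<close>
    have "(\<Sum>\<nu>\<in>orbit n \<mu>0. cst (c \<nu> * aT n i \<nu> + c (simple_refl n i \<nu>) * bT n i (simple_refl n i \<nu>) - chiT X n i * c \<nu>) * E_poly n \<nu>) = 0"
      using T[OF i(1,2)] unfolding T_orbit_sum[OF n i(1,2) \<mu>0] sum_distrib_left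
      by (simp add: sum_subtractf cst_simps left_diff_distrib mult.assoc)
    from E_independent[OF n finite_orbit orbit_lattice[OF \<mu>0] this \<nu>(1)]
    have r: "c \<nu> * (tau n i - inverse (tau n i) + kapT n i \<mu>) + c \<mu> * inverse (tau n i) = chiT X n i * c \<nu>"
      using i(3) \<nu>(3) by (simp add: \<nu>(2) aT_def bT_def)
    have "c \<mu> = tau n i * (inverse (tau n i) * c \<mu>)" by simp
    also have "inverse (tau n i) * c \<mu> = c \<nu> * (chiT X n i - tau n i + inverse (tau n i) - kapT n i \<mu>)"
      using r by algebra
    finally have "c \<mu> = kap X n (sroot n i) (evm n \<mu> (sroot n i)) * c \<nu>"
      unfolding kap_recursion[OF i, symmetric] by (simp add: mult_ac)
    moreover have "c \<nu> = (\<Prod>\<beta>\<in>pneg n \<nu>. kap X n \<beta> (evm n \<nu> \<beta>))"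
      using less(1)[of \<nu>] card_pneg_simple[OF i] \<nu>(1) by (simp add: \<nu>_def)
    \<comment> \<open>Reflecting the weight reflects the evaluated root, so these are the factors of
      \<open>pneg n \<mu>\<close> except for the simple root.\<close>
    moreover have "\<dots> = (\<Prod>\<beta>\<in>simple_refl n i ` pneg n \<nu>. kap X n \<beta> (evm n \<mu> \<beta>))"
      by (subst prod.reindex) (auto simp: \<nu>_def evm_simple[OF i] kap_def nrm_simple_refl[OF i(1,2)] intro!: inj_on_inverseI[of _ "simple_refl n i"])
    ultimately show ?thesis unfolding pneg_simple(1)[OF i] using pneg_simple(2)[OF i] by (simp add: \<nu>_def)
  next
    case False
    then have a: "antidominant n \<mu>" by (intro antidominantI) (simp add: not_less)
    then have "c \<mu> = 1" using antidominant_orbit[OF less(2)] c1 by simp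
    moreover have "pneg n \<mu> = {}" using antidominant_pair[OF a] by (force simp: pneg_def)
    ultimately show ?thesis by simp
  qed
qed

text \<open>Positive integer coefficients cannot cancel in characteristic zero.\<close>

lemma sum_monomials_nonzero:
  assumes "finite A" "a \<in> A"
  shows "(\<Sum>u\<in>A. Fract (Poly_Mapping.single (m u) 1) 1 :: coeff) \<noteq> 0"
proof -
  have s: "(\<Sum>u\<in>A. Fract (f u) 1 :: coeff) = Fract (\<Sum>u\<in>A. f u) 1" for f
    by (induction A rule: infinite_finite_induct) (simp_all add: Zero_fract_def)
  have "Poly_Mapping.lookup (\<Sum>u\<in>A. Poly_Mapping.single (m u) (1::complex)) (m a) = of_nat (card {u \<in> A. m u = m a})"
    using assms(1) by (simp add: lookup_sum lookup_single when_def sum.If_cases Int_def)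
  moreover have "card {u \<in> A. m u = m a} \<noteq> 0" using assms by auto
  ultimately have "(\<Sum>u\<in>A. Poly_Mapping.single (m u) (1::complex)) \<noteq> 0" by (metis lookup_zero of_nat_eq_0_iff)
  then show ?thesis by (simp add: s Zero_fract_def eq_fract)
qed

lemma poincare_nz: "poincare n \<mu> \<noteq> 0"
proof -
  have g: "generator p ^ k = Fract (Poly_Mapping.single (Poly_Mapping.single p k) 1) 1" for p k
    by (induction k) (simp_all add: generator_def One_fract_def mult_single single_add[symmetric])
  have "t_par ^ a * tn_par ^ b = Fract (Poly_Mapping.single (Poly_Mapping.single 1 (2 * a) + Poly_Mapping.single 4 (2 * b)) 1) 1" for a b
  proof -
    have "t_par ^ a * tn_par ^ b = generator 1 ^ (2 * a) * generator 4 ^ (2 * b)"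
      unfolding t_half_def tn_half_def power_mult ..
    then show ?thesis unfolding g by (simp add: mult_single)
  qed
  then have "poincare n \<mu> = (\<Sum>u\<in>stabilizer n \<mu>. Fract (Poly_Mapping.single (Poly_Mapping.single 1 (2 * len_s n u) + Poly_Mapping.single 4 (2 * len_d n u)) 1) 1)"
    by (simp add: poincare_def)
  moreover have "finite (stabilizer n \<mu>)" "id \<in> stabilizer n \<mu>" by (simp_all add: stabilizer_def W_id)
  ultimately show ?thesis by (simp only: sum_monomials_nonzero not_False_eq_True)
qed

lemma chi_nz: "w \<in> W_fin n \<Longrightarrow> chi X n w \<noteq> 0"
  by (simp add: chi_eq)

lemma symm_E_expansion:
  assumes n: "1 \<le> n" and \<mu>: "\<mu> \<in> lattice n" and d: "dominant n \<mu>"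
    and C: "\<And>\<beta>. \<beta> \<in> posr n \<Longrightarrow> pair n \<mu> \<beta> = 0 \<Longrightarrow> chi_root X n \<beta> = tau_root n \<beta>"
  shows "symm_E X n \<mu> = (\<Sum>\<nu>\<in>orbit n \<mu>. cst (sign_X X n (v_min n \<nu>) * ev n \<nu> (kappa X n (v_min n \<nu>))) * E_poly n \<nu>)"
proof -
  define K where "K = chi Plus n (longest n) / chi X n (longest n) / poincare n \<mu>"
  from symsum_orbit_sum[OF n \<mu>, of X] obtain c where c: "symsum X n (E_poly n \<mu>) = (\<Sum>\<nu>\<in>orbit n \<mu>. cst (c \<nu>) * E_poly n \<nu>)"
    by (elim exE) (rule that)
  have s: "symm_E X n \<mu> = cst K * symsum X n (E_poly n \<mu>)"
    unfolding symm_E_def symmetrizer_def symsum_def[symmetric] K_def mult.assoc[symmetric] cst_simps(4)[symmetric] by simp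
  have e: "symm_E X n \<mu> = (\<Sum>\<nu>\<in>orbit n \<mu>. cst (K * c \<nu>) * E_poly n \<nu>)"
    unfolding s c sum_distrib_left by (simp add: cst_simps mult.assoc)
  \<comment> \<open>The normalization in \<open>symm_E\<close> makes the coefficient at the
    antidominant weight equal to 1, as the recursion requires.\<close>
  have "K * c (v_min n \<mu> \<mu>) = 1"
    using symsum_leading[OF n \<mu> d C] coeff_at_antidominant[OF n \<mu>, of c] poincare_nz[of n \<mu>] chi_nz[OF longest_props(1), of X n] unfolding c K_def by (simp add: field_simps)
  moreover have "T_op n i (symm_E X n \<mu>) = cst (chiT X n i) * symm_E X n \<mu>" if "1 \<le> i" "i \<le> n" for i
    unfolding s linD(2)[OF lin_T[OF that(2)]] T_symsum[OF n that] by (simp add: mult_ac)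
  ultimately have "K * c \<nu> = (\<Prod>\<beta>\<in>pneg n \<nu>. kap X n \<beta> (evm n \<nu> \<beta>))" if "\<nu> \<in> orbit n \<mu>" for \<nu>
    using orbit_coefficients[OF n \<mu>, of "\<lambda>\<nu>. K * c \<nu>" X \<nu>] that unfolding e by blast
  then show ?thesis unfolding e ev_kappa by (intro sum.cong) simp_all
qed

lemma len_split:
  assumes "w \<in> W_fin n" shows "len n w = len_s n w + len_d n w"
proof -
  have "card (Inv_s n w \<union> Inv_d n w) = card (Inv_s n w) + card (Inv_d n w)"
    by (rule card_Un_disjoint) (auto simp: Inv_nrm)
  then show ?thesis by (simp only: reduced_word(3)[OF assms] len_sd[OF assms] ilen_def Inv_sd_disjoint(1)[of n w])
qed

section \<open>The three shifts and the roots orthogonal to a shifted weight\<close>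

lemma lookup_omega: "k \<in> {1..n} \<Longrightarrow> Poly_Mapping.lookup (omega n) k = 1"
  and lookup_pi_vec: "k \<in> {1..n} \<Longrightarrow> Poly_Mapping.lookup (pi_vec n) k = int n - int k"
  by (simp_all add: omega_def pi_vec_def lookup_sum lookup_single when_def)

lemma shifts_lattice: "omega n \<in> lattice n" "rho n \<in> lattice n" "pi_vec n \<in> lattice n"
  by (auto simp: lattice_def in_keys_iff omega_def rho_def pi_vec_def lookup_sum lookup_single when_def split: if_splits)

lemma dominant_add: "dominant n \<mu> \<Longrightarrow> dominant n \<nu> \<Longrightarrow> dominant n (\<mu> + \<nu>)"
  by (auto simp: dominant_def lookup_add intro!: add_mono)

lemma shifts_dominant: "dominant n (omega n)" "dominant n (rho n)" "dominant n (pi_vec n)"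
  by (auto simp: dominant_def lookup_omega lookup_rho lookup_pi_vec)

lemma pair_add_left: "pair n (\<mu> + \<nu>) \<beta> = pair n \<mu> \<beta> + pair n \<nu> \<beta>"
  by (simp add: pair_def lookup_add algebra_simps sum.distrib)

lemma nrm_posr:
  "i \<in> {1..n} \<Longrightarrow> nrm n (Poly_Mapping.single i 1) = 1"
  "1 \<le> i \<Longrightarrow> i < j \<Longrightarrow> j \<le> n \<Longrightarrow> nrm n (Poly_Mapping.single i 1 + Poly_Mapping.single j 1) = 2"
  "1 \<le> i \<Longrightarrow> i < j \<Longrightarrow> j \<le> n \<Longrightarrow> nrm n (Poly_Mapping.single i 1 - Poly_Mapping.single j 1) = 2"
proof -
  have z: "nrm n 0 = 0" by (simp add: nrm_def)
  show 1: "nrm n (Poly_Mapping.single i 1) = 1" if "i \<in> {1..n}" for i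
    using nrm_add_single[OF that, of 0 1] by (simp add: z)
  show "nrm n (Poly_Mapping.single i 1 + Poly_Mapping.single j 1) = 2" if "1 \<le> i" "i < j" "j \<le> n"
    using nrm_add_single[of j n "Poly_Mapping.single i 1" 1] 1[of i] that by (simp add: lookup_single)
  show "nrm n (Poly_Mapping.single i 1 - Poly_Mapping.single j 1) = 2" if "1 \<le> i" "i < j" "j \<le> n"
    using nrm_add_single[of j n "Poly_Mapping.single i 1" "-1"] 1[of i] that by (simp add: lookup_single single_uminus)
qed

text \<open>Verifies hypothesis \<open>C\<close> of \<open>symm_E_expansion\<close>: each shift
  pairs positively with all roots on which its character takes a nontrivial value, namely those of
  norm 1 for omega, all for rho, and those of norm 2 for pi.\<close>

lemma shift_pair_pos:
  assumes "\<beta> \<in> posr n"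
  shows "nrm n \<beta> = 1 \<Longrightarrow> 0 < pair n (omega n) \<beta>" "0 < pair n (rho n) \<beta>" "nrm n \<beta> \<noteq> 1 \<Longrightarrow> 0 < pair n (pi_vec n) \<beta>"
  using assms by (cases rule: posr_cases; simp add: nrm_posr pair_add pair_minus pair_single lookup_omega lookup_rho lookup_pi_vec)+

theorem proposition4p4:
  fixes n :: nat and lam :: vec
  assumes "n \<ge> 1" and "lam \<in> lattice n" and "dominant n lam"
  shows "P_poly n lam =
           (\<Sum>\<mu>\<in>orbit n lam. cst (ev n \<mu> (kappa Plus n (v_min n \<mu>))) * E_poly n \<mu>)
       \<and> A_pm_poly n (lam + omega n) =
           (\<Sum>\<mu>\<in>orbit n (lam + omega n).
              cst ((-1) ^ len_d n (v_min n \<mu>) * ev n \<mu> (kappa PlusMinus n (v_min n \<mu>))) * E_poly n \<mu>)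
       \<and> A_poly n (lam + rho n) =
           (\<Sum>\<mu>\<in>orbit n (lam + rho n).
              cst ((-1) ^ len n (v_min n \<mu>) * ev n \<mu> (kappa Minus n (v_min n \<mu>))) * E_poly n \<mu>)
       \<and> A_mp_poly n (lam + pi_vec n) =
           (\<Sum>\<mu>\<in>orbit n (lam + pi_vec n).
              cst ((-1) ^ len_s n (v_min n \<mu>) * ev n \<mu> (kappa MinusPlus n (v_min n \<mu>))) * E_poly n \<mu>)"
proof -
  note n = assms(1)
  have L: "lam + omega n \<in> lattice n" "lam + rho n \<in> lattice n" "lam + pi_vec n \<in> lattice n"
    by (intro lattice_add assms(2) shifts_lattice)+
  have D: "dominant n (lam + omega n)" "dominant n (lam + rho n)" "dominant n (lam + pi_vec n)"
    by (intro dominant_add assms(3) shifts_dominant)+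
  have pos: "0 < pair n (lam + \<nu>) \<beta>" if "\<beta> \<in> posr n" "0 < pair n \<nu> \<beta>" for \<nu> \<beta>
    using dominant_pair[OF assms(3) that(1)] that(2) by (simp add: pair_add_left)
  have "symm_E Plus n lam = (\<Sum>\<nu>\<in>orbit n lam. cst (sign_X Plus n (v_min n \<nu>) * ev n \<nu> (kappa Plus n (v_min n \<nu>))) * E_poly n \<nu>)"
    by (rule symm_E_expansion[OF n assms(2,3)]) (simp add: chi_root_def tau_root_def)
  moreover have "symm_E PlusMinus n (lam + omega n) = (\<Sum>\<nu>\<in>orbit n (lam + omega n). cst (sign_X PlusMinus n (v_min n \<nu>) * ev n \<nu> (kappa PlusMinus n (v_min n \<nu>))) * E_poly n \<nu>)"
    by (rule symm_E_expansion[OF n L(1) D(1)]) (use pos shift_pair_pos(1) in \<open>force simp: chi_root_def tau_root_def\<close>)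
  moreover have "symm_E Minus n (lam + rho n) = (\<Sum>\<nu>\<in>orbit n (lam + rho n). cst (sign_X Minus n (v_min n \<nu>) * ev n \<nu> (kappa Minus n (v_min n \<nu>))) * E_poly n \<nu>)"
    by (rule symm_E_expansion[OF n L(2) D(2)]) (use pos shift_pair_pos(2) in \<open>force simp: chi_root_def tau_root_def\<close>)
  moreover have "symm_E MinusPlus n (lam + pi_vec n) = (\<Sum>\<nu>\<in>orbit n (lam + pi_vec n). cst (sign_X MinusPlus n (v_min n \<nu>) * ev n \<nu> (kappa MinusPlus n (v_min n \<nu>))) * E_poly n \<nu>)"
    by (rule symm_E_expansion[OF n L(3) D(3)]) (use pos shift_pair_pos(3) in \<open>force simp: chi_root_def tau_root_def\<close>)
  ultimately show ?thesis
    by (simp only: P_poly_def A_poly_def A_pm_poly_def A_mp_poly_def sign_X_def flip_s_def flip_d_def symm_type.distinct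
      simp_thms if_True if_False mult_1_left mult_1_right len_split[OF v_min_props(1)] power_add)
qed

end
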